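(* Let $n\ge2$ and let $F:\mathcal S_n\to\mathbb R$ be uniformly elliptic and positively homogeneous of degree one (as in the context), with upward-pointing fundamental solution $\Phi$, and let $\tilde\Phi$ be the upward-pointing fundamental solution of the dual operator $\tilde F(M):=-F(-M)$. Suppose that $u\in C(\mathbb R^n\setminus\{0\})$ is a solution of $$F(D^2u)=0\quad\text{in }\mathbb R^n\setminus\{0\}.$$ Suppose further that $u$ is bounded from above or bounded from below in $B_1\setminus\{0\}$, and that $u$ is bounded from above or bounded from below in $\mathbb R^n\setminus B_1$. Then either $u\equiv b$, or $u\equiv a\Phi+b$, or $u\equiv -a\tilde\Phi+b$, for some $a>0$ and $b\in\mathbb R$.
   Context: $\mathcal S_n$ is the set of real symmetric $n\times n$ matrices and $B_r=\{x\in\mathbb R^n:|x|<r\}$. The map $F:\mathcal S_n\to\mathbb R$ satisfies, for some constants $0<\lambda\le\Lambda$: (uniform ellipticity) $\lambda\,\mathrm{trace}(N)\le F(M-N)-F(M)\le\Lambda\,\mathrm{trace}(N)$ for all $M,N\in\mathcal S_n$ with $N$ nonnegative definite; (positive homogeneity) $F(tM)=tF(M)$ for all $t\ge0$ and $M\in\mathcal S_n$. All equations and inequalities are understood in the viscosity sense (sign convention of $-\Delta$: subsolution means $F(D^2u)\le0$, supersolution means $F(D^2u)\ge 0$). The dual operator $\tilde F(M):=-F(-M)$ satisfies the same hypotheses. Spaces of homogeneous functions: for $\alpha\in[-1,\infty)\setminus\{0\}$, $H_\alpha^+$ is the set of $v\in C(\mathbb R^n\setminus\{0\})$ with $\alpha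 v>0$ and $\sigma^\alpha v(\sigma x)=v(x)$ for all $\sigma>0$, $x\ne0$; $H_0^+$ is the set of $v\in C(\mathbb R^n\setminus\{0\})$ with $v(\sigma x)+\log\sigma=v(x)$ for all $\sigma>0$, $x\neq0$. Scaling exponent: $\alpha^*(F):=\sup\{\alpha\in(-1,\infty)\setminus\{0\}:\text{there exists }v\in H_\alpha^+\text{ with }F(D^2v)\ge0\text{ in }\mathbb R^n\setminus\{0\}\}$, which is a finite number $>-1$. Fundamental solution: it is known that there is a unique $\Phi\in H^+_{\alpha^*(F)}$ solving $F(D^2\Phi)=0$ in $\mathbb R^n\setminus\{0\}$ with the normalization $\min_{\partial B_1}(\mathrm{sign}(\alpha^* )\Phi)=1$ if $\alpha^*=\alpha^*(F)\ne0$, and $\int_{\partial B_1}\Phi=0$ if $\alpha^*(F)=0$. This $\Phi$ is called the upward-pointing fundamental solution of $F$. *)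

theory Defs
  imports "HOL-Analysis.Analysis"
begin

definition symmetric_mat :: "real^'n^'n \<Rightarrow> bool" where
  "symmetric_mat M \<longleftrightarrow> transpose M = M"

definition nonneg_definite :: "real^'n^'n \<Rightarrow> bool" where
  "nonneg_definite N \<longleftrightarrow> symmetric_mat N \<and> (\<forall>x. 0 \<le> x \<bullet> (N *v x))"

text \<open>
  Operators are total functions on square matrices, but only their values on symmetric
  matrices matter: all hypotheses are restricted to those, and the Hessians of
  \<open>C\<^sup>2\<close> functions, to which operators are applied below, are symmetric by Schwarz's theorem.
\<close>

definition uniformly_elliptic :: "real \<Rightarrow> real \<Rightarrow> (real^'n^'n \<Rightarrow> real) \<Rightarrow> bool" where
  "uniformly_elliptic lam Lam F \<longleftrightarrow> 0 < lam \<and> lam \<le> Lam \<and>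
     (\<forall>M N. symmetric_mat M \<longrightarrow> nonneg_definite N \<longrightarrow>
        lam * trace N \<le> F (M - N) - F M \<and> F (M - N) - F M \<le> Lam * trace N)"

definition positively_homogeneous :: "(real^'n^'n \<Rightarrow> real) \<Rightarrow> bool" where
  "positively_homogeneous F \<longleftrightarrow>
     (\<forall>t\<ge>0. \<forall>M. symmetric_mat M \<longrightarrow> F (t *\<^sub>R M) = t * F M)"

definition dual_operator :: "(real^'n^'n \<Rightarrow> real) \<Rightarrow> real^'n^'n \<Rightarrow> real" where
  "dual_operator F M = - F (- M)"

text \<open>
  \<open>C2_on \<Omega> \<phi> g H\<close>: on the open set \<open>\<Omega>\<close>, \<open>\<phi>\<close> is twice continuously differentiable with
  gradient \<open>g\<close> and Hessian \<open>H\<close>.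
\<close>

definition C2_on ::
  "(real^'n) set \<Rightarrow> (real^'n \<Rightarrow> real) \<Rightarrow> (real^'n \<Rightarrow> real^'n) \<Rightarrow> (real^'n \<Rightarrow> real^'n^'n) \<Rightarrow> bool"
where
  "C2_on \<Omega> \<phi> g H \<longleftrightarrow>
     (\<forall>x\<in>\<Omega>. GDERIV \<phi> x :> g x) \<and>
     (\<forall>x\<in>\<Omega>. (g has_derivative (\<lambda>h. H x *v h)) (at x)) \<and>
     continuous_on \<Omega> H"

text \<open>
  Viscosity inequalities for \<open>F(D\<^sup>2u)\<close> in an open set \<open>\<Omega>\<close>. Since \<open>F\<close> is decreasing in the
  matrix (the sign convention of \<open>-\<Delta>\<close>), subsolutions are tested at local maxima of \<open>u - \<phi>\<close>
  and supersolutions at local minima. These predicates do not include continuity of \<open>u\<close>.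
\<close>

definition viscosity_subsolution ::
  "(real^'n^'n \<Rightarrow> real) \<Rightarrow> (real^'n) set \<Rightarrow> (real^'n \<Rightarrow> real) \<Rightarrow> bool"
where
  "viscosity_subsolution F \<Omega> u \<longleftrightarrow>
     (\<forall>\<phi> g H. C2_on \<Omega> \<phi> g H \<longrightarrow>
        (\<forall>x\<in>\<Omega>. (\<forall>\<^sub>F y in nhds x. u y - \<phi> y \<le> u x - \<phi> x) \<longrightarrow> F (H x) \<le> 0))"

definition viscosity_supersolution ::
  "(real^'n^'n \<Rightarrow> real) \<Rightarrow> (real^'n) set \<Rightarrow> (real^'n \<Rightarrow> real) \<Rightarrow> bool"
where
  "viscosity_supersolution F \<Omega> u \<longleftrightarrow>
     (\<forall>\<phi> g H. C2_on \<Omega> \<phi> g H \<longrightarrow>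
        (\<forall>x\<in>\<Omega>. (\<forall>\<^sub>F y in nhds x. u y - \<phi> y \<ge> u x - \<phi> x) \<longrightarrow> F (H x) \<ge> 0))"

definition viscosity_solution ::
  "(real^'n^'n \<Rightarrow> real) \<Rightarrow> (real^'n) set \<Rightarrow> (real^'n \<Rightarrow> real) \<Rightarrow> bool"
where
  "viscosity_solution F \<Omega> u \<longleftrightarrow>
     viscosity_subsolution F \<Omega> u \<and> viscosity_supersolution F \<Omega> u"

text \<open>
  The spaces \<open>H\<^sub>\<alpha>\<^sup>+\<close>, of interest for \<open>\<alpha> \<ge> -1\<close>. Functions on \<open>\<real>\<^sup>n \<setminus> {0}\<close> are total functions
  whose value at the origin is irrelevant.
\<close>

definition homogeneous_class :: "real \<Rightarrow> (real^'n \<Rightarrow> real) set" where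
  "homogeneous_class \<alpha> =
     (if \<alpha> = 0
      then {v. continuous_on (- {0}) v \<and>
               (\<forall>\<sigma>>0. \<forall>x. x \<noteq> 0 \<longrightarrow> v (\<sigma> *\<^sub>R x) + ln \<sigma> = v x)}
      else {v. continuous_on (- {0}) v \<and>
               (\<forall>x. x \<noteq> 0 \<longrightarrow> \<alpha> * v x > 0) \<and>
               (\<forall>\<sigma>>0. \<forall>x. x \<noteq> 0 \<longrightarrow> \<sigma> powr \<alpha> * v (\<sigma> *\<^sub>R x) = v x)})"

text \<open>
  For uniformly elliptic, positively homogeneous \<open>F\<close> in dimension at least two, the set below is
  nonempty and bounded above, so the supremum is a genuine one.
\<close>

definition scaling_exponent :: "(real^'n^'n \<Rightarrow> real) \<Rightarrow> real" where
  "scaling_exponent F =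
     Sup {\<alpha>. \<alpha> > -1 \<and> \<alpha> \<noteq> 0 \<and>
             (\<exists>v\<in>homogeneous_class \<alpha>. viscosity_supersolution F (- {0}) v)}"

text \<open>
  Surface measure on the unit sphere, defined by polar coordinates: the area of \<open>A\<close> is \<open>n\<close>
  times the Lebesgue measure of the cone \<open>{t a | 0 < t < 1, a \<in> A}\<close> over \<open>A\<close>.
\<close>

definition sphere_measure :: "(real^'n) measure" where
  "sphere_measure =
     distr (scale_measure (of_nat CARD('n)) (restrict_space lborel (ball 0 1 - {0})))
       borel (\<lambda>x. x /\<^sub>R norm x)"

lemma emeasure_sphere_measure:
  fixes A :: "(real^'n) set"
  assumes "A \<in> sets borel"
  shows "emeasure sphere_measure A =
    of_nat CARD('n) * emeasure lborel {x \<in> ball 0 1 - {0}. x /\<^sub>R norm x \<in> A}"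
proof -
  let ?B = "ball (0::real^'n) 1 - {0}"
  let ?R = "restrict_space lborel ?B"
  have B: "?B \<in> sets lborel" by simp
  have "(\<lambda>x::real^'n. x /\<^sub>R norm x) \<in> borel_measurable ?R"
    by (intro measurable_restrict_space1) simp
  then have m: "(\<lambda>x::real^'n. x /\<^sub>R norm x)
      \<in> measurable (scale_measure (of_nat CARD('n)) ?R) borel"
    by (simp add: measurable_def space_scale_measure)
  have eq: "(\<lambda>x. x /\<^sub>R norm x) -` A \<inter> space (scale_measure (of_nat CARD('n)) ?R) =
      {x \<in> ?B. x /\<^sub>R norm x \<in> A}"
    by (auto simp: space_scale_measure space_restrict_space)
  have "emeasure ?R {x \<in> ?B. x /\<^sub>R norm x \<in> A} =
      emeasure lborel {x \<in> ?B. x /\<^sub>R norm x \<in> A}"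
    using B by (intro emeasure_restrict_space) auto
  then show ?thesis
    unfolding sphere_measure_def emeasure_distr[OF m assms] eq by simp
qed

text \<open>
  The upward-pointing fundamental solution. If the exponent is nonzero, the normalization says
  that the minimum of \<open>sgn \<alpha> * \<Phi>\<close> over the unit sphere is \<open>1\<close>.
\<close>

definition upward_fundamental_solution ::
  "(real^'n^'n \<Rightarrow> real) \<Rightarrow> (real^'n \<Rightarrow> real) \<Rightarrow> bool"
where
  "upward_fundamental_solution F \<Phi> \<longleftrightarrow>
     (let \<alpha> = scaling_exponent F in
        \<Phi> \<in> homogeneous_class \<alpha> \<and>
        viscosity_solution F (- {0}) \<Phi> \<and>
        (if \<alpha> = 0
         then (LINT x|sphere_measure. \<Phi> x) = 0
         else (\<exists>x\<in>sphere 0 1. sgn \<alpha> * \<Phi> x = 1) \<and> (\<forall>x\<in>sphere 0 1. sgn \<alpha> * \<Phi> x \<ge> 1)))"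

end

(*
  The proof uses neither the Krylov-Safonov nor the Alexandrov theorem. At a strict maximum of a
  semiconvex function, the points at which the function is touched from above by planes form a set
  of positive measure, and blow-ups at points near its density points converge to nonpositive
  quadratic forms. With sup-convolutions this gives the theorem on sums, hence comparison, a
  strong maximum principle for differences of solutions (Hopf barriers), Hoelder estimates (by the
  doubling of variables of Ishii and Lions), a Harnack inequality on spheres and compactness.

  A solution that is bounded on one side near an end of R^n - {0} has a limit there in [-oo, oo].
  If the limits agree, the solution is constant; otherwise duality lets one assume that the limit
  at the origin is the larger one, and comparison shows that u is infinite at the same ends as Phi.
  If the exponent is nonzero, the supremum and the infimum of (u - b) / Phi, b being the finite
  limit, are almost attained on whole spheres (by blowing up along near-extremal points), and
  monotonicity towards the end where Phi vanishes makes them equal. If the exponent is zero, the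
  same is done for the increments u(x / e) - u(x); were their infimum I below their supremum S,
  then u - c Phi with I < c < S would violate the maximum or the minimum principle on an annulus.
*)
theory Submission
  imports Defs "HOL-Complex_Analysis.Great_Picard"
begin

section \<open>Semiconvex functions\<close>

text \<open>F need be neither linear nor convex, so the difference of two solutions solves no
  equation of its own; comparison has to go through the doubled function U(x) + V(y) minus a
  quadratic form. The second derivatives that one would like to have at its maximum are replaced by
  limits of rescalings: touching from above by quadratic polynomials survives rescaling, subtraction
  of affine functions and uniform limits, so a quadratic limit is as good as a Hessian. Such a limit
  exists because a function with second differences between - K |h|^2 and 0 can be blown up where,
  in some direction, they are nearly least; the remainder becomes convex and vanishes on a line,
  hence is constant along that line, and one variable after another splits off. A quadratic limit of
  U(x) + V(y) separates in x and y, which yields the two matrices. At exponent zero u is infinite at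
  both ends, so there is no limit b to subtract before dividing by Phi; the increments u(x / e) -
  u(x) do not see additive constants, and for Phi they equal 1.\<close>

definition semiconvex :: "real \<Rightarrow> ('a::euclidean_space \<Rightarrow> real) \<Rightarrow> bool" where
  "semiconvex K f \<longleftrightarrow> convex_on UNIV (\<lambda>x. f x + K / 2 * (norm x)\<^sup>2)"

lemma norm_sq_add: "(norm (x + y))\<^sup>2 = (norm x)\<^sup>2 + 2 * (x \<bullet> y) + (norm (y::'a::real_inner))\<^sup>2"
  by (simp add: power2_norm_eq_inner inner_add_left inner_add_right inner_commute)

text \<open>The strict epigraph is convex and misses the point (x, f x). A separating hyperplane
  cannot be vertical, because f is finite everywhere, and is therefore the graph of a supporting
  affine function.\<close>

lemma convex_on_subgradient:
  fixes f :: "'a::euclidean_space \<Rightarrow> real"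
  assumes "convex_on UNIV f"
  obtains p where "\<And>y. f x + p \<bullet> (y - x) \<le> f y"
proof -
  let ?S = "{z::'a \<times> real. f (fst z) < snd z}"
  have "convex ?S"
  proof (rule convexI)
    fix z w :: "'a \<times> real" and u v :: real
    assume *: "z \<in> ?S" "w \<in> ?S" "0 \<le> u" "0 \<le> v" "u + v = 1"
    have "f (u *\<^sub>R fst z + v *\<^sub>R fst w) \<le> u * f (fst z) + v * f (fst w)"
      using assms * unfolding convex_on_def by auto
    also have "\<dots> < u * snd z + v * snd w"
    proof (cases "u = 0")
      case False
      then have "u * f (fst z) < u * snd z" "v * f (fst w) \<le> v * snd w"
        using * by (auto intro: mult_left_mono)
      then show ?thesis by linarith
    qed (use * in auto)
    finally show "u *\<^sub>R z + v *\<^sub>R w \<in> ?S" by simp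
  qed
  moreover have "(x, f x + 1) \<in> ?S" "?S \<inter> {(x, f x)} = {}" by auto
  ultimately obtain a b where ab: "a \<noteq> 0" "\<forall>z\<in>?S. inner a z \<le> b" "inner a (x, f x) \<ge> b"
    using separating_hyperplane_sets[of ?S "{(x, f x)}"] by blast
  have *: "fst a \<bullet> y + snd a * t \<le> fst a \<bullet> x + snd a * f x" if "f y < t" for y t
    using ab(2)[rule_format, of "(y, t)"] ab(3) that by (simp add: inner_prod_def)
  have neg: "snd a < 0"
  proof (rule ccontr)
    assume "\<not> snd a < 0"
    moreover have "snd a \<le> 0" using *[of x "f x + 1"] by (simp add: algebra_simps)
    ultimately have 0: "snd a = 0" by simp
    \<comment> \<open>A vertical hyperplane would bound the functional \<open>fst a\<close> on the
      whole space; the point x + \<open>fst a\<close> refutes this unless \<open>fst a\<close>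
      vanishes as well.\<close>
    have "fst a \<bullet> (x + fst a) \<le> fst a \<bullet> x"
      using *[of "x + fst a" "f (x + fst a) + 1"] 0 by simp
    then have "fst a \<bullet> fst a \<le> 0" by (simp add: inner_add_right)
    then have "fst a = 0" by (metis inner_eq_zero_iff inner_ge_zero order_antisym)
    then show False using 0 ab(1) by (simp add: prod_eq_iff)
  qed
  have "f x + (fst a /\<^sub>R (- snd a)) \<bullet> (y - x) \<le> f y" for y
  proof (rule field_le_epsilon)
    fix e :: real assume "e > 0"
    then have "fst a \<bullet> (y - x) \<le> (- snd a) * (f y + e - f x)"
      using *[of y "f y + e"] by (simp add: inner_diff_right algebra_simps)
    then have "(fst a \<bullet> (y - x)) / (- snd a) \<le> f y + e - f x"
      using neg by (simp add: field_simps)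
    then show "f x + (fst a /\<^sub>R (- snd a)) \<bullet> (y - x) \<le> f y + e"
      by (simp add: divide_inverse mult.commute)
  qed
  then show ?thesis using that by blast
qed

lemma semiconvex_subgradient:
  fixes f :: "'a::euclidean_space \<Rightarrow> real"
  assumes "semiconvex K f"
  obtains p where "\<And>y. f x + p \<bullet> (y - x) - K / 2 * (norm (y - x))\<^sup>2 \<le> f y"
proof -
  obtain q where q: "\<And>y. f x + K / 2 * (norm x)\<^sup>2 + q \<bullet> (y - x) \<le> f y + K / 2 * (norm y)\<^sup>2"
    using convex_on_subgradient[OF assms[unfolded semiconvex_def], of x] by blast
  have "f x + (q - K *\<^sub>R x) \<bullet> (y - x) - K / 2 * (norm (y - x))\<^sup>2 \<le> f y" for y
  proof -
    have "(norm y)\<^sup>2 = (norm x)\<^sup>2 + 2 * (x \<bullet> (y - x)) + (norm (y - x))\<^sup>2"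
      using norm_sq_add[of x "y - x"] by simp
    then have "K / 2 * (norm y)\<^sup>2 = K / 2 * (norm x)\<^sup>2 + K * (x \<bullet> (y - x)) + K / 2 * (norm (y - x))\<^sup>2"
      by (simp only: distrib_left)
    then show ?thesis using q[of y] unfolding inner_diff_left[of q] inner_scaleR_left by linarith
  qed
  then show ?thesis using that by blast
qed

lemma semiconvex_continuous:
  assumes "semiconvex K f" shows "continuous_on UNIV f"
proof -
  have "continuous_on UNIV (\<lambda>x. (f x + K / 2 * (norm x)\<^sup>2) - K / 2 * (norm x)\<^sup>2)"
    by (rule continuous_on_diff[OF convex_on_continuous[OF open_UNIV assms[unfolded semiconvex_def]]])
      (intro continuous_intros)
  then show ?thesis by simp
qed

text \<open>The excess of f over its chord attains a maximum on the segment. Reflecting the nearer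
  endpoint, where the excess is zero, in the point of maximum stays inside the segment, so the
  midpoint inequality makes the maximum nonpositive.\<close>

lemma convex_on_midpoint:
  fixes f :: "'a::euclidean_space \<Rightarrow> real"
  assumes cont: "continuous_on UNIV f" and mid: "\<And>x h. 2 * f x \<le> f (x + h) + f (x - h)"
  shows "convex_on UNIV f"
proof
  fix t :: real and x y :: 'a
  assume t: "0 < t" "t < 1"
  define g where "g s = f ((1 - s) *\<^sub>R x + s *\<^sub>R y) - ((1 - s) * f x + s * f y)" for s
  have "continuous_on {0..1} g"
    unfolding g_def by (intro continuous_intros continuous_on_compose2[OF cont]) auto
  then obtain s where s: "s \<in> {0..1}" "\<And>r. r \<in> {0..1} \<Longrightarrow> g r \<le> g s"
    using continuous_attains_sup[of "{0..1::real}" g] by auto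
  have g0: "g 0 = 0" "g 1 = 0" by (auto simp: g_def)
  define d where "d = min s (1 - s)"
  have d: "s - d \<in> {0..1}" "s + d \<in> {0..1}" "s - d = 0 \<or> s + d = 1"
    using s(1) by (auto simp: d_def min_def)
  have "2 * g s \<le> g (s + d) + g (s - d)"
    using mid[of "(1 - s) *\<^sub>R x + s *\<^sub>R y" "d *\<^sub>R (y - x)"]
    by (simp add: g_def algebra_simps)
  then have "g s \<le> 0" using d s(2)[of "s - d"] s(2)[of "s + d"] g0 by force
  then show "f ((1 - t) *\<^sub>R x + t *\<^sub>R y) \<le> (1 - t) * f x + t * f y"
    using s(2)[of t] t by (simp add: g_def)
qed simp

text \<open>The difference quotient from x to y is compared with the chords of length one from x to
  x + e and from x - e to x, where e is the direction of y - x.\<close>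

lemma convex_on_Lipschitz:
  fixes f :: "'a::euclidean_space \<Rightarrow> real"
  assumes cv: "convex_on UNIV f" and B: "\<And>y. norm (y - x) \<le> 1 \<Longrightarrow> \<bar>f y\<bar> \<le> B"
    and y: "norm (y - x) \<le> 1"
  shows "\<bar>f y - f x\<bar> \<le> 2 * B * norm (y - x)"
proof (cases "y = x")
  case False
  define t where "t = norm (y - x)"
  define e where "e = (y - x) /\<^sub>R t"
  have t: "0 < t" "t \<le> 1" using False y by (auto simp: t_def)
  have e: "norm e = 1" "y = x + t *\<^sub>R e" using t by (auto simp: e_def t_def)
  have b: "\<bar>f x\<bar> \<le> B" "\<bar>f (x + e)\<bar> \<le> B" "\<bar>f (x - e)\<bar> \<le> B" using B e by auto
  have "f y \<le> (1 - t) * f x + t * f (x + e)"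
    using convex_onD[OF cv, of t x "x + e"] t e by (simp add: algebra_simps)
  then have 1: "f y - f x \<le> t * (f (x + e) - f x)" by (simp add: algebra_simps)
  \<comment> \<open>x lies between y and x - e, with weight t / (1 + t) on the far point.\<close>
  have "(1 - t / (1 + t)) *\<^sub>R y + (t / (1 + t)) *\<^sub>R (x - e) = x + ((1 - t / (1 + t)) * t - t / (1 + t)) *\<^sub>R e"
    unfolding e(2) by (simp add: algebra_simps)
  moreover have "(1 - t / (1 + t)) * t - t / (1 + t) = 0" using t by (simp add: field_simps)
  ultimately have "(1 - t / (1 + t)) *\<^sub>R y + (t / (1 + t)) *\<^sub>R (x - e) = x" by simp
  then have "f x \<le> (1 - t / (1 + t)) * f y + (t / (1 + t)) * f (x - e)"
    using convex_onD[OF cv, of "t / (1 + t)" y "x - e"] t by simp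
  also have "\<dots> = (f y + t * f (x - e)) / (1 + t)"
  proof -
    have "1 - t / (1 + t) = 1 / (1 + t)" using t by (simp add: field_simps)
    then show ?thesis by (simp add: add_divide_distrib)
  qed
  finally have 2: "f x - f y \<le> t * (f (x - e) - f x)" using t by (simp add: field_simps)
  have "t * (f (x + e) - f x) \<le> t * (2 * B)" "t * (f (x - e) - f x) \<le> t * (2 * B)"
    using b t by (auto intro!: mult_left_mono)
  with 1 2 show ?thesis by (simp add: t_def[symmetric] abs_le_iff mult.commute)
qed simp

text \<open>The hypotheses are required only eventually, since rescaled functions are controlled on
  a given neighbourhood only from some index on. A diagonal subsequence converges on a countable
  dense subset, and equicontinuity carries convergence over to S.\<close>

lemma Ascoli_locally:
  fixes f :: "nat \<Rightarrow> 'a::euclidean_space \<Rightarrow> real"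
  assumes "open S"
    and bdd: "\<And>x. x \<in> S \<Longrightarrow> \<exists>B. \<forall>\<^sub>F n in sequentially. \<bar>f n x\<bar> \<le> B"
    and equi: "\<And>x e. x \<in> S \<Longrightarrow> e > 0 \<Longrightarrow>
      \<exists>d>0. \<forall>\<^sub>F n in sequentially. \<forall>y. dist y x < d \<longrightarrow> \<bar>f n y - f n x\<bar> < e"
  obtains g s where "strict_mono (s :: nat \<Rightarrow> nat)" "continuous_on S g"
    "\<And>C. compact C \<Longrightarrow> C \<subseteq> S \<Longrightarrow> uniform_limit C (\<lambda>n. f (s n)) g sequentially"
proof -
  have "\<exists>B>0. \<forall>n. \<bar>f n x\<bar> \<le> B" if x: "x \<in> S" for x
  proof -
    obtain B where "\<forall>\<^sub>F n in sequentially. \<bar>f n x\<bar> \<le> B" using bdd[OF x] by blast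
    then have "\<forall>\<^sub>F n in sequentially. norm (f n x) \<le> B" by simp
    then have "Bseq (\<lambda>n. f n x)" by (rule BfunI)
    then show ?thesis by (auto simp: Bseq_def)
  qed
  then obtain B where B: "\<And>x n. x \<in> S \<Longrightarrow> \<bar>f n x\<bar> \<le> B x" "\<And>x. x \<in> S \<Longrightarrow> B x > 0"
    by metis
  obtain R where R: "countable R" "R \<subseteq> S" "S \<subseteq> closure R" using separable by metis
  \<comment> \<open>The diagonal selection wants a single bound for all points, hence the
    normalization by B x.\<close>
  have "norm (f n x / B x) \<le> 1" if "x \<in> R" for n x
    using B[of x] that R(2) by (auto simp: divide_le_eq)
  then obtain s where s: "strict_mono (s :: nat \<Rightarrow> nat)"
    "\<And>x. x \<in> R \<Longrightarrow> \<exists>l. (\<lambda>n. f (s n) x / B x) \<longlonglongrightarrow> l"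
    using function_convergent_subsequence[OF R(1), of "\<lambda>n x. f n x / B x" 1] by blast
  have cR: "Cauchy (\<lambda>n. f (s n) x)" if x: "x \<in> R" for x
  proof -
    obtain l where "(\<lambda>n. f (s n) x / B x) \<longlonglongrightarrow> l" using s(2)[OF x] by blast
    then have "(\<lambda>n. f (s n) x / B x * B x) \<longlonglongrightarrow> l * B x" by (intro tendsto_intros)
    moreover have "B x \<noteq> 0" using x R(2) B(2)[of x] by auto
    ultimately show ?thesis by (auto intro: LIMSEQ_imp_Cauchy)
  qed
  have equis: "\<exists>d>0. \<forall>\<^sub>F n in sequentially. \<forall>y. dist y x < d \<longrightarrow> \<bar>f (s n) y - f (s n) x\<bar> < e"
    if "x \<in> S" "e > 0" for x e
  proof -
    obtain d where "d > 0" "\<forall>\<^sub>F n in sequentially. \<forall>y. dist y x < d \<longrightarrow> \<bar>f n y - f n x\<bar> < e"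
      using equi[OF \<open>x \<in> S\<close> \<open>e > 0\<close>] by blast
    then show ?thesis using eventually_subseq[OF s(1)] by blast
  qed
  have conv: "convergent (\<lambda>n. f (s n) x)" if x: "x \<in> S" for x
    unfolding Cauchy_convergent_iff[symmetric]
  proof (rule metric_CauchyI)
    fix e :: real assume "e > 0"
    then obtain d where d: "d > 0" "\<forall>\<^sub>F n in sequentially. \<forall>y. dist y x < d \<longrightarrow> \<bar>f (s n) y - f (s n) x\<bar> < e / 3"
      using equis[OF x, of "e / 3"] by auto
    obtain y where y: "y \<in> R" "dist y x < d"
      using x R(3) d(1) by (auto simp: closure_approachable subset_iff)
    obtain N where N: "\<And>n. n \<ge> N \<Longrightarrow> \<bar>f (s n) y - f (s n) x\<bar> < e / 3"
      using d(2) y(2) by (auto simp: eventually_sequentially)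
    obtain M where M: "\<And>n m. n \<ge> M \<Longrightarrow> m \<ge> M \<Longrightarrow> dist (f (s n) y) (f (s m) y) < e / 3"
      using metric_CauchyD[OF cR[OF y(1)], of "e / 3"] \<open>e > 0\<close> by auto
    show "\<exists>M. \<forall>m\<ge>M. \<forall>n\<ge>M. dist (f (s m) x) (f (s n) x) < e"
    proof (intro exI[of _ "max M N"] allI impI)
      fix m n assume mn: "max M N \<le> m" "max M N \<le> n"
      show "dist (f (s m) x) (f (s n) x) < e"
        using N[of m] N[of n] M[of m n] mn unfolding dist_real_def by linarith
    qed
  qed
  define g where "g x = lim (\<lambda>n. f (s n) x)" for x
  have lim: "(\<lambda>n. f (s n) x) \<longlonglongrightarrow> g x" if "x \<in> S" for x
    using conv[OF that] unfolding g_def by (simp add: convergent_LIMSEQ_iff)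
  have gequi: "\<exists>d>0. \<forall>y\<in>S. dist y x < d \<longrightarrow> \<bar>g y - g x\<bar> \<le> e" if xe: "x \<in> S" "e > 0" for x e
  proof -
    obtain d where d: "d > 0" "\<forall>\<^sub>F n in sequentially. \<forall>y. dist y x < d \<longrightarrow> \<bar>f (s n) y - f (s n) x\<bar> < e"
      using equis[OF xe] by auto
    have "\<bar>g y - g x\<bar> \<le> e" if y: "y \<in> S" "dist y x < d" for y
    proof (rule tendsto_upperbound)
      show "(\<lambda>n. \<bar>f (s n) y - f (s n) x\<bar>) \<longlonglongrightarrow> \<bar>g y - g x\<bar>"
        using lim y xe by (intro tendsto_intros) auto
      show "\<forall>\<^sub>F n in sequentially. \<bar>f (s n) y - f (s n) x\<bar> \<le> e"
        using d(2) by eventually_elim (use y in \<open>auto intro: less_imp_le\<close>)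
    qed simp
    then show ?thesis using d(1) by blast
  qed
  have "continuous_on S g"
    unfolding continuous_on_iff
  proof (intro ballI allI impI)
    fix x and e :: real assume "x \<in> S" "e > 0"
    then obtain d where "d > 0" "\<forall>y\<in>S. dist y x < d \<longrightarrow> \<bar>g y - g x\<bar> \<le> e / 2"
      using gequi[of x "e / 2"] by auto
    then show "\<exists>d>0. \<forall>y\<in>S. dist y x < d \<longrightarrow> dist (g y) (g x) < e"
      using \<open>e > 0\<close> by (fastforce simp: dist_real_def)
  qed
  moreover have "uniform_limit C (\<lambda>n. f (s n)) g sequentially" if C: "compact C" "C \<subseteq> S" for C
  proof (rule uniform_limitI)
    fix e :: real assume e: "e > 0"
    have "\<exists>d>0. (\<forall>\<^sub>F n in sequentially. \<forall>y. dist y x < d \<longrightarrow> \<bar>f (s n) y - f (s n) x\<bar> < e / 3) \<and>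
        (\<forall>y\<in>S. dist y x < d \<longrightarrow> \<bar>g y - g x\<bar> \<le> e / 3)" if x: "x \<in> S" for x
    proof -
      obtain d1 where 1: "d1 > 0" "\<forall>\<^sub>F n in sequentially. \<forall>y. dist y x < d1 \<longrightarrow> \<bar>f (s n) y - f (s n) x\<bar> < e / 3"
        using equis[OF x, of "e / 3"] e by auto
      obtain d2 where 2: "d2 > 0" "\<forall>y\<in>S. dist y x < d2 \<longrightarrow> \<bar>g y - g x\<bar> \<le> e / 3"
        using gequi[OF x, of "e / 3"] e by auto
      show ?thesis using 1 2 by (intro exI[of _ "min d1 d2"]) (auto elim: eventually_mono)
    qed
    then have "\<forall>x\<in>S. \<exists>d. d > 0 \<and> (\<forall>\<^sub>F n in sequentially. \<forall>y. dist y x < d \<longrightarrow> \<bar>f (s n) y - f (s n) x\<bar> < e / 3) \<and>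
        (\<forall>y\<in>S. dist y x < d \<longrightarrow> \<bar>g y - g x\<bar> \<le> e / 3)" by blast
    from bchoice[OF this] obtain d where d': "\<forall>x\<in>S. d x > 0 \<and>
        (\<forall>\<^sub>F n in sequentially. \<forall>y. dist y x < d x \<longrightarrow> \<bar>f (s n) y - f (s n) x\<bar> < e / 3) \<and>
        (\<forall>y\<in>S. dist y x < d x \<longrightarrow> \<bar>g y - g x\<bar> \<le> e / 3)" ..
    have d: "\<And>x. x \<in> S \<Longrightarrow> d x > 0"
      "\<And>x. x \<in> S \<Longrightarrow> \<forall>\<^sub>F n in sequentially. \<forall>y. dist y x < d x \<longrightarrow> \<bar>f (s n) y - f (s n) x\<bar> < e / 3"
      "\<And>x y. x \<in> S \<Longrightarrow> y \<in> S \<Longrightarrow> dist y x < d x \<Longrightarrow> \<bar>g y - g x\<bar> \<le> e / 3"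
      using d' by blast+
    obtain T where T: "T \<subseteq> C" "finite T" "C \<subseteq> (\<Union>x\<in>T. ball x (d x))"
      by (rule compactE_image[OF C(1), of C "\<lambda>x. ball x (d x)"]) (use d(1) C(2) in force)+
    have "\<forall>\<^sub>F n in sequentially. \<forall>x\<in>T. (\<forall>y. dist y x < d x \<longrightarrow> \<bar>f (s n) y - f (s n) x\<bar> < e / 3) \<and> dist (f (s n) x) (g x) < e / 3"
    proof (intro eventually_ball_finite ballI T(2) eventually_conj)
      fix x assume "x \<in> T"
      then have "x \<in> S" using T C by auto
      then show "\<forall>\<^sub>F n in sequentially. \<forall>y. dist y x < d x \<longrightarrow> \<bar>f (s n) y - f (s n) x\<bar> < e / 3"
        using d(2) by blast
      show "\<forall>\<^sub>F n in sequentially. dist (f (s n) x) (g x) < e / 3"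
        using tendstoD[OF lim[OF \<open>x \<in> S\<close>], of "e / 3"] e by simp
    qed
    then show "\<forall>\<^sub>F n in sequentially. \<forall>x\<in>C. dist (f (s n) x) (g x) < e"
    proof eventually_elim
      case (elim n)
      show ?case
      proof
        fix y assume y: "y \<in> C"
        then obtain x where x: "x \<in> T" "dist y x < d x" using T(3) by (auto simp: dist_commute)
        then have "\<bar>g y - g x\<bar> \<le> e / 3" using d(3)[of x y] y T(1) C(2) by auto
        moreover have "\<bar>f (s n) y - f (s n) x\<bar> < e / 3" "dist (f (s n) x) (g x) < e / 3"
          using elim x by auto
        ultimately show "dist (f (s n) y) (g y) < e" unfolding dist_real_def by linarith
      qed
    qed
  qed
  ultimately show ?thesis using that s(1) by blast
qed

text \<open>Local bounds are enough: adding the paraboloid makes the functions convex, and bounded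
  convex functions are equi-Lipschitz. The inequality of convexity passes to pointwise
  limits.\<close>

lemma semiconvex_Ascoli:
  fixes f :: "nat \<Rightarrow> 'a::euclidean_space \<Rightarrow> real"
  assumes sc: "\<And>n. semiconvex K (f n)"
    and bdd: "\<And>R. \<exists>B. \<forall>\<^sub>F n in sequentially. \<forall>x. norm x \<le> R \<longrightarrow> \<bar>f n x\<bar> \<le> B"
  obtains g s where "strict_mono (s :: nat \<Rightarrow> nat)" "semiconvex K g" "continuous_on UNIV g"
    "\<And>C. compact C \<Longrightarrow> uniform_limit C (\<lambda>n. f (s n)) g sequentially"
proof -
  have eq: "\<exists>d>0. \<forall>\<^sub>F n in sequentially. \<forall>y. dist y x < d \<longrightarrow> \<bar>f n y - f n x\<bar> < e" if e: "e > 0" for x e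
  proof -
    obtain B0 where B0: "\<forall>\<^sub>F n in sequentially. \<forall>z. norm z \<le> norm x + 1 \<longrightarrow> \<bar>f n z\<bar> \<le> B0"
      using bdd by blast
    define B where "B = \<bar>B0\<bar> + \<bar>K\<bar> / 2 * (norm x + 1)\<^sup>2"
    have "B \<ge> 0" by (simp add: B_def)
    have "isCont (\<lambda>y. K / 2 * (norm y)\<^sup>2) x" by (intro continuous_intros)
    then obtain d0 where d0: "d0 > 0" "\<And>y. dist y x < d0 \<Longrightarrow> \<bar>K / 2 * (norm y)\<^sup>2 - K / 2 * (norm x)\<^sup>2\<bar> < e / 2"
      unfolding continuous_at_eps_delta dist_real_def using e by (metis half_gt_zero)
    \<comment> \<open>Half of e pays for the convex part, with Lipschitz constant 2 B near x, the
      other half for the modulus of continuity of the paraboloid.\<close>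
    define d where "d = min 1 (min d0 (e / (4 * (B + 1))))"
    have d: "d > 0" "d \<le> 1" "d \<le> d0" "d \<le> e / (4 * (B + 1))" using e d0 \<open>B \<ge> 0\<close> by (auto simp: d_def)
    have "\<forall>\<^sub>F n in sequentially. \<forall>y. dist y x < d \<longrightarrow> \<bar>f n y - f n x\<bar> < e"
      using B0
    proof eventually_elim
      case (elim n)
      have bd: "\<bar>f n y + K / 2 * (norm y)\<^sup>2\<bar> \<le> B" if "norm (y - x) \<le> 1" for y
      proof -
        have ny: "norm y \<le> norm x + 1" using that norm_triangle_ineq2[of y x] by linarith
        then have "(norm y)\<^sup>2 \<le> (norm x + 1)\<^sup>2" by (simp add: power_mono)
        then have "\<bar>K / 2 * (norm y)\<^sup>2\<bar> \<le> \<bar>K\<bar> / 2 * (norm x + 1)\<^sup>2"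
          by (simp add: abs_mult mult_left_mono)
        moreover have "\<bar>f n y\<bar> \<le> \<bar>B0\<bar>" using elim ny by fastforce
        ultimately show ?thesis unfolding B_def by linarith
      qed
      show ?case
      proof (intro allI impI)
        fix y assume y: "dist y x < d"
        then have ny: "norm (y - x) < d" by (simp add: dist_norm)
        have "\<bar>(f n y + K / 2 * (norm y)\<^sup>2) - (f n x + K / 2 * (norm x)\<^sup>2)\<bar> \<le> 2 * B * norm (y - x)"
          by (rule convex_on_Lipschitz[OF sc[unfolded semiconvex_def] bd]) (use ny d in auto)
        also have "\<dots> \<le> 2 * B * (e / (4 * (B + 1)))"
          using ny d \<open>B \<ge> 0\<close> by (intro mult_left_mono) auto
        also have "\<dots> \<le> e / 2" using \<open>B \<ge> 0\<close> e by (simp add: field_simps)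
        finally show "\<bar>f n y - f n x\<bar> < e" using d0(2)[of y] y d by linarith
      qed
    qed
    then show ?thesis using d(1) by blast
  qed
  have bd: "\<exists>B. \<forall>\<^sub>F n in sequentially. \<bar>f n x\<bar> \<le> B" for x
  proof -
    obtain B where "\<forall>\<^sub>F n in sequentially. \<forall>z. norm z \<le> norm x \<longrightarrow> \<bar>f n z\<bar> \<le> B" using bdd by blast
    then have "\<forall>\<^sub>F n in sequentially. \<bar>f n x\<bar> \<le> B" by eventually_elim auto
    then show ?thesis by blast
  qed
  obtain g s where gs: "strict_mono (s :: nat \<Rightarrow> nat)" "continuous_on UNIV g"
    "\<And>C. compact C \<Longrightarrow> C \<subseteq> UNIV \<Longrightarrow> uniform_limit C (\<lambda>n. f (s n)) g sequentially"
    by (rule Ascoli_locally[OF open_UNIV, of f]) (use eq bd in auto)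
  have lim: "(\<lambda>n. f (s n) x) \<longlonglongrightarrow> g x" for x
    using tendsto_uniform_limitI[OF gs(3)[of "{x}"]] by simp
  have "semiconvex K g"
    unfolding semiconvex_def
  proof (rule convex_onI)
    fix t :: real and x y :: 'a assume t: "0 < t" "t < 1"
    let ?z = "(1 - t) *\<^sub>R x + t *\<^sub>R y"
    show "g ?z + K / 2 * (norm ?z)\<^sup>2 \<le> (1 - t) * (g x + K / 2 * (norm x)\<^sup>2) + t * (g y + K / 2 * (norm y)\<^sup>2)"
    proof (rule tendsto_le)
      show "(\<lambda>n. f (s n) ?z + K / 2 * (norm ?z)\<^sup>2) \<longlonglongrightarrow> g ?z + K / 2 * (norm ?z)\<^sup>2"
        by (intro tendsto_intros lim)
      show "(\<lambda>n. (1 - t) * (f (s n) x + K / 2 * (norm x)\<^sup>2) + t * (f (s n) y + K / 2 * (norm y)\<^sup>2))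
         \<longlonglongrightarrow> (1 - t) * (g x + K / 2 * (norm x)\<^sup>2) + t * (g y + K / 2 * (norm y)\<^sup>2)"
        by (intro tendsto_intros lim)
      show "\<forall>\<^sub>F n in sequentially. f (s n) ?z + K / 2 * (norm ?z)\<^sup>2
          \<le> (1 - t) * (f (s n) x + K / 2 * (norm x)\<^sup>2) + t * (f (s n) y + K / 2 * (norm y)\<^sup>2)"
        using convex_onD[OF sc[unfolded semiconvex_def], of t x y] t by (auto intro!: always_eventually)
    qed simp
  qed simp
  from gs(1) this gs(2) show ?thesis
    by (rule that) (use gs(3) in simp)
qed

section \<open>Quadratic blow-ups\<close>

definition diff2 :: "('a::real_vector \<Rightarrow> real) \<Rightarrow> 'a \<Rightarrow> 'a \<Rightarrow> real" where
  "diff2 f x h = f (x + h) + f (x - h) - 2 * f x"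

lemma norm_sq_diff2: "(norm (x + h))\<^sup>2 + (norm (x - h))\<^sup>2 - 2 * (norm x)\<^sup>2 = 2 * (norm (h::'a::real_inner))\<^sup>2"
  using norm_sq_add[of x h] norm_sq_add[of x "-h"] by simp

text \<open>Second differences are additive, annihilate affine functions and scale quadratically; in
  this form semiconvexity is visibly stable under blow-ups.\<close>

lemma semiconvex_iff_diff2:
  fixes f :: "'a::euclidean_space \<Rightarrow> real"
  shows "semiconvex K f \<longleftrightarrow> continuous_on UNIV f \<and> (\<forall>x h. - K * (norm h)\<^sup>2 \<le> diff2 f x h)"
proof
  assume sc: "semiconvex K f"
  have "- K * (norm h)\<^sup>2 \<le> diff2 f x h" for x h
  proof -
    have "(1 - 1/2) *\<^sub>R (x + h) + (1/2) *\<^sub>R (x - h) = x"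
      by (simp add: algebra_simps flip: scaleR_add_left)
    then have "f x + K / 2 * (norm x)\<^sup>2 \<le> (1/2) * (f (x + h) + K / 2 * (norm (x + h))\<^sup>2)
       + (1/2) * (f (x - h) + K / 2 * (norm (x - h))\<^sup>2)"
      using convex_onD[OF sc[unfolded semiconvex_def], of "1/2" "x + h" "x - h"] by simp
    moreover have "K / 2 * ((norm (x + h))\<^sup>2 + (norm (x - h))\<^sup>2 - 2 * (norm x)\<^sup>2) = K * (norm h)\<^sup>2"
      unfolding norm_sq_diff2 by simp
    ultimately show ?thesis by (simp add: diff2_def algebra_simps)
  qed
  then show "continuous_on UNIV f \<and> (\<forall>x h. - K * (norm h)\<^sup>2 \<le> diff2 f x h)"
    using semiconvex_continuous[OF sc] by blast
next
  assume *: "continuous_on UNIV f \<and> (\<forall>x h. - K * (norm h)\<^sup>2 \<le> diff2 f x h)"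
  show "semiconvex K f"
    unfolding semiconvex_def
  proof (rule convex_on_midpoint)
    show "continuous_on UNIV (\<lambda>x. f x + K / 2 * (norm x)\<^sup>2)"
      using * by (intro continuous_intros) auto
    fix x h :: 'a
    have "K / 2 * ((norm (x + h))\<^sup>2 + (norm (x - h))\<^sup>2 - 2 * (norm x)\<^sup>2) = K * (norm h)\<^sup>2"
      unfolding norm_sq_diff2 by simp
    then show "2 * (f x + K / 2 * (norm x)\<^sup>2) \<le> f (x + h) + K / 2 * (norm (x + h))\<^sup>2 + (f (x - h) + K / 2 * (norm (x - h))\<^sup>2)"
      using *[THEN conjunct2, rule_format, of h x] by (simp add: diff2_def algebra_simps)
  qed
qed

text \<open>A zoom at c under which quadratic polynomials keep their Hessian. The slope p has to be
  subtracted because a first-order part would grow like 1 / r.\<close>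

definition renorm :: "('a::real_inner \<Rightarrow> real) \<Rightarrow> 'a \<Rightarrow> real \<Rightarrow> 'a \<Rightarrow> 'a \<Rightarrow> real" where
  "renorm f c r p z = (f (c + r *\<^sub>R z) - f c - r * (p \<bullet> z)) / r\<^sup>2"

lemma renorm_0 [simp]: "renorm f c r p 0 = 0"
  by (simp add: renorm_def)

lemma diff2_renorm: "diff2 (renorm f c r p) x h = diff2 f (c + r *\<^sub>R x) (r *\<^sub>R h) / r\<^sup>2"
  unfolding diff2_def renorm_def
  by (simp add: algebra_simps inner_add_right inner_diff_right diff_divide_distrib add_divide_distrib)

lemma continuous_on_renorm: "continuous_on UNIV f \<Longrightarrow> continuous_on UNIV (renorm f c r p)"
proof -
  assume f: "continuous_on UNIV f"
  have "continuous_on UNIV (\<lambda>z. f (c + r *\<^sub>R z))"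
    by (rule continuous_on_compose2[OF f]) (auto intro!: continuous_intros)
  then show ?thesis unfolding renorm_def divide_inverse by (intro continuous_intros)
qed

text \<open>Blow-ups are iterated once for every dimension; inside a family closed under zooms and
  locally uniform limits no subsequences of subsequences have to be tracked.\<close>

definition blowup_closed :: "('a::euclidean_space \<Rightarrow> real) set \<Rightarrow> bool" where
  "blowup_closed B \<longleftrightarrow>
     (\<forall>f\<in>B. \<forall>c p. \<forall>r>0. renorm f c r p \<in> B) \<and>
     (\<forall>F g. (\<forall>n. F n \<in> B) \<longrightarrow> (\<forall>C. compact C \<longrightarrow> uniform_limit C F g sequentially) \<longrightarrow> g \<in> B)"

lemma blowup_closed_renorm:
  "blowup_closed B \<Longrightarrow> f \<in> B \<Longrightarrow> r > 0 \<Longrightarrow> renorm f c r p \<in> B"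
  unfolding blowup_closed_def by simp

lemma blowup_closed_limit:
  assumes "blowup_closed B" "\<And>n. F n \<in> B" "\<And>C. compact C \<Longrightarrow> uniform_limit C F g sequentially"
  shows "g \<in> B"
  using assms(1)[unfolded blowup_closed_def, THEN conjunct2, rule_format, of F g] assms(2,3) by simp

section \<open>Projection off an orthonormal family, and functions constant along some
  directions\<close>

definition oproj :: "'a::euclidean_space set \<Rightarrow> 'a \<Rightarrow> 'a" where
  "oproj T z = z - (\<Sum>b\<in>T. (b \<bullet> z) *\<^sub>R b)"

definition orthonormal :: "'a::euclidean_space set \<Rightarrow> bool" where
  "orthonormal T \<longleftrightarrow> finite T \<and> (\<forall>b\<in>T. \<forall>c\<in>T. b \<bullet> c = (if b = c then 1 else 0))"

lemma oproj_add: "oproj T (x + y) = oproj T x + oproj T y"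
  by (simp add: oproj_def inner_add_right scaleR_add_left sum.distrib)

lemma oproj_scaleR: "oproj T (r *\<^sub>R x) = r *\<^sub>R oproj T x"
  by (simp add: oproj_def scaleR_diff_right scaleR_sum_right)

lemma oproj_minus: "oproj T (- x) = - oproj T x"
  using oproj_scaleR[of T "-1" x] by simp

lemma oproj_diff: "oproj T (x - y) = oproj T x - oproj T y"
  using oproj_add[of T x "- y"] by (simp add: oproj_minus)

lemma oproj_eq_self: "(\<And>b. b \<in> T \<Longrightarrow> b \<bullet> x = 0) \<Longrightarrow> oproj T x = x"
  by (simp add: oproj_def)

lemma inner_oproj:
  assumes "orthonormal T" "b \<in> T" shows "b \<bullet> oproj T z = 0"
proof -
  have "b \<bullet> oproj T z = b \<bullet> z - (\<Sum>c\<in>T. (c \<bullet> z) * (b \<bullet> c))"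
    by (simp add: oproj_def inner_diff_right inner_sum_right)
  also have "(\<Sum>c\<in>T. (c \<bullet> z) * (b \<bullet> c)) = (\<Sum>c\<in>T. if b = c then c \<bullet> z else 0)"
    using assms by (intro sum.cong) (auto simp: orthonormal_def)
  also have "\<dots> = b \<bullet> z" using assms by (simp add: orthonormal_def)
  finally show ?thesis by simp
qed

lemma oproj_inner_oproj:
  assumes "orthonormal T" shows "oproj T x \<bullet> oproj T z = oproj T x \<bullet> z"
proof -
  have "oproj T x \<bullet> oproj T z = oproj T x \<bullet> z - (\<Sum>b\<in>T. (b \<bullet> z) * (b \<bullet> oproj T x))"
    by (subst (2) oproj_def) (simp add: inner_diff_right inner_sum_right inner_commute)
  then show ?thesis using inner_oproj[OF assms] by simp
qed

lemma norm_oproj_le: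
  assumes "orthonormal T" shows "norm (oproj T z) \<le> norm z"
proof -
  have "(norm (oproj T z))\<^sup>2 = oproj T z \<bullet> z"
    using oproj_inner_oproj[OF assms, of z z] by (simp add: power2_norm_eq_inner)
  also have "\<dots> \<le> norm (oproj T z) * norm z" by (rule norm_cauchy_schwarz)
  finally show ?thesis
    by (cases "oproj T z = 0") (simp_all add: power2_eq_square)
qed

lemma span_invariant:
  assumes "\<And>b z t. b \<in> T \<Longrightarrow> h (z + t *\<^sub>R b) = h z" and "s \<in> span T"
  shows "h (z + s) = (h z :: real)"
  using assms(2)
proof (induction arbitrary: z rule: span_induct_alt)
  case (step c b s)
  then show ?case using assms(1)[of b "z + s" c] step(2)[of z] by (simp add: algebra_simps)
qed simp

lemma span_oproj: "z - oproj T z \<in> span T"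
proof -
  have "(\<Sum>b\<in>T. (b \<bullet> z) *\<^sub>R b) \<in> span T"
    by (intro span_sum span_scale span_base)
  then show ?thesis by (simp add: oproj_def)
qed

lemma invariant_oproj:
  assumes "\<And>b z t. b \<in> T \<Longrightarrow> h (z + t *\<^sub>R b) = h z"
  shows "h (x + oproj T w) = (h (x + w) :: real)" "h (x - oproj T w) = h (x - w)"
  using span_invariant[of T h, OF assms span_oproj[of w T], of "x + oproj T w"]
    span_invariant[of T h, OF assms span_oproj[of "-w" T], of "x - oproj T w"]
  by (simp_all add: oproj_minus)

text \<open>The points (1 - 1/k) z + t e lie on the segments from z to the remote points k t e of
  the line, where f is zero. Convexity bounds f there by (1 - 1/k) f(z), and k tends to infinity;
  replacing t by - t gives the converse.\<close>

lemma convex_line_invariant: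
  fixes f :: "'a::euclidean_space \<Rightarrow> real"
  assumes cv: "convex_on UNIV f" and 0: "\<And>t. f (t *\<^sub>R e) = 0"
  shows "f (z + t *\<^sub>R e) = f z"
proof -
  have le: "f (z + t *\<^sub>R e) \<le> f z" for z t
  proof (rule tendsto_le)
    let ?y = "\<lambda>n::nat. (1 - inverse (real (Suc n))) *\<^sub>R z + t *\<^sub>R e"
    have "?y \<longlonglongrightarrow> (1 - 0) *\<^sub>R z + t *\<^sub>R e"
      by (intro tendsto_intros LIMSEQ_inverse_real_of_nat)
    then have "(\<lambda>n. f (?y n)) \<longlonglongrightarrow> f ((1 - 0) *\<^sub>R z + t *\<^sub>R e)"
      by (rule continuous_on_tendsto_compose[OF convex_on_continuous[OF open_UNIV cv]]) auto
    then show "(\<lambda>n. f (?y n)) \<longlonglongrightarrow> f (z + t *\<^sub>R e)" by simp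
    have "(\<lambda>n. (1 - inverse (real (Suc n))) * f z) \<longlonglongrightarrow> (1 - 0) * f z"
      by (intro tendsto_intros LIMSEQ_inverse_real_of_nat)
    then show "(\<lambda>n. (1 - inverse (real (Suc n))) * f z) \<longlonglongrightarrow> f z" by simp
    show "\<forall>\<^sub>F n in sequentially. f (?y n) \<le> (1 - inverse (real (Suc n))) * f z"
    proof (intro always_eventually allI)
      fix n
      have "inverse (real (Suc n)) \<le> 1" by (simp add: inverse_le_1_iff)
      then show "f (?y n) \<le> (1 - inverse (real (Suc n))) * f z"
        using convex_onD[OF cv, of "inverse (real (Suc n))" z "(real (Suc n) * t) *\<^sub>R e"] 0[of "real (Suc n) * t"]
        by (simp add: mult.assoc[symmetric] del: of_nat_Suc)
    qed
  qed simp
  from le[of z t] le[of "z + t *\<^sub>R e" "-t"] show ?thesis by simp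
qed

text \<open>Let m0 be the infimum of the normalized second differences of h in directions orthogonal
  to T. Removing the paraboloid of opening m0 leaves a convex f which, over suitable segments, is
  almost affine. Zooming in at the centres of these segments, by a factor that makes them long,
  gives a convex limit vanishing on a whole line; this line is the new direction e.\<close>

lemma splitting_step:
  fixes B :: "('a::euclidean_space \<Rightarrow> real) set"
  assumes bc: "blowup_closed B"
    and cont: "\<And>f. f \<in> B \<Longrightarrow> continuous_on UNIV f"
    and d2: "\<And>f x h. f \<in> B \<Longrightarrow> - K * (norm h)\<^sup>2 \<le> diff2 f x h \<and> diff2 f x h \<le> 0"
    and T: "orthonormal T" "card T < DIM('a)"
    and inv: "\<And>b z t. b \<in> T \<Longrightarrow> h (z + t *\<^sub>R b) = h z"
    and g: "(\<lambda>z. (\<Sum>b\<in>T. m b * (b \<bullet> z)\<^sup>2) + h z) \<in> B"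
  obtains e m' h' where "e \<notin> T" "orthonormal (insert e T)"
    "\<And>b z t. b \<in> insert e T \<Longrightarrow> h' (z + t *\<^sub>R b) = h' z"
    "(\<lambda>z. (\<Sum>b\<in>insert e T. m' b * (b \<bullet> z)\<^sup>2) + h' z) \<in> B"
proof -
  have finT: "finite T" using T by (simp add: orthonormal_def)
  define E where "E = {e. norm e = 1 \<and> (\<forall>b\<in>T. b \<bullet> e = 0)}"
  define g where "g z = (\<Sum>b\<in>T. m b * (b \<bullet> z)\<^sup>2) + h z" for z
  have gB: "g \<in> B" using g unfolding g_def .
  have "dim (span T) < DIM('a)"
    using dim_le_card'[OF finT] T(2) by simp
  then obtain x where x: "x \<noteq> 0" "\<And>y. y \<in> span T \<Longrightarrow> orthogonal x y"
    using orthogonal_to_subspace_exists by (metis dim_span)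
  have "x /\<^sub>R norm x \<in> E"
    using x by (auto simp: E_def orthogonal_def inner_commute span_base)
  then have E_ne: "E \<noteq> {}" by blast
  have "E = sphere 0 1 \<inter> (\<Inter>b\<in>T. {e. b \<bullet> e = 0})" by (auto simp: E_def)
  moreover have "closed (\<Inter>b\<in>T. {e. b \<bullet> e = 0})"
    by (intro closed_INT ballI closed_hyperplane)
  ultimately have E_comp: "compact E"
    by (simp add: compact_Int_closed)
  \<comment> \<open>As h ignores the span of T, an increment may be replaced by its projection,
    along which the quadratic part of g does not change. So h inherits the bounds of g.\<close>
  have D2h: "diff2 h x w = diff2 g x (oproj T w)" for x w
  proof -
    have "diff2 (\<lambda>z. \<Sum>b\<in>T. m b * (b \<bullet> z)\<^sup>2) x (oproj T w) = 0"
      using inner_oproj[OF T(1)]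
      by (simp add: diff2_def inner_add_right inner_diff_right)
    moreover have "diff2 g x (oproj T w) = diff2 (\<lambda>z. \<Sum>b\<in>T. m b * (b \<bullet> z)\<^sup>2) x (oproj T w) + diff2 h x (oproj T w)"
      by (simp add: diff2_def g_def)
    ultimately show ?thesis
      using invariant_oproj[OF inv, of T x w] by (simp add: diff2_def)
  qed
  define A where "A = {diff2 h x (t *\<^sub>R e) / t\<^sup>2 | x t e. t > 0 \<and> e \<in> E}"
  have oE: "oproj T e = e" if "e \<in> E" for e using that by (intro oproj_eq_self) (auto simp: E_def)
  have A_lb: "- K \<le> a" if aA: "a \<in> A" for a
  proof -
    obtain x t e where a: "a = diff2 h x (t *\<^sub>R e) / t\<^sup>2" "t > 0" "e \<in> E" using aA by (auto simp: A_def)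
    have "- K * t\<^sup>2 \<le> diff2 h x (t *\<^sub>R e)"
      using d2[OF gB, of "t *\<^sub>R e" x] a(3) by (simp add: D2h oproj_scaleR oE E_def power_mult_distrib)
    then show ?thesis using a by (simp add: pos_le_divide_eq)
  qed
  have A_ne: "A \<noteq> {}" using E_ne by (force simp: A_def intro: zero_less_one)
  define m0 where "m0 = Inf A"
  have m0_le: "m0 \<le> a" if "a \<in> A" for a
    unfolding m0_def by (rule cInf_lower[OF that]) (use A_lb in \<open>auto simp: bdd_below_def\<close>)
  define f where "f z = h z - m0 / 2 * (norm (oproj T z))\<^sup>2" for z
  have D2f: "diff2 f x w = diff2 h x w - m0 * (norm (oproj T w))\<^sup>2" for x w
  proof -
    have "diff2 f x w = diff2 h x w - m0 / 2 * ((norm (oproj T x + oproj T w))\<^sup>2 + (norm (oproj T x - oproj T w))\<^sup>2 - 2 * (norm (oproj T x))\<^sup>2)"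
      by (simp add: diff2_def f_def oproj_add oproj_diff algebra_simps)
    then show ?thesis unfolding norm_sq_diff2 by simp
  qed
  have D2f_ge: "0 \<le> diff2 f x w" for x w
  proof (cases "oproj T w = 0")
    case True
    then show ?thesis unfolding D2f D2h by (simp add: diff2_def)
  next
    case False
    define t where "t = norm (oproj T w)"
    have t: "t > 0" using False by (simp add: t_def)
    define e where "e = oproj T w /\<^sub>R t"
    have e: "e \<in> E" "t *\<^sub>R e = oproj T w"
      using t inner_oproj[OF T(1)] by (auto simp: E_def e_def t_def)
    have "m0 \<le> diff2 h x (t *\<^sub>R e) / t\<^sup>2" using e(1) t by (intro m0_le, unfold A_def) blast
    then have "m0 * t\<^sup>2 \<le> diff2 h x (t *\<^sub>R e)" using t by (simp add: pos_le_divide_eq)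
    moreover have "oproj T (oproj T w) = oproj T w"
      by (rule oproj_eq_self) (use inner_oproj[OF T(1)] in auto)
    ultimately show ?thesis unfolding D2f e(2) D2h by (simp add: t_def)
  qed
  \<comment> \<open>The upper bound on the second differences of g is what keeps the zooms of f
    locally bounded.\<close>
  have D2f_le: "diff2 f x w \<le> \<bar>m0\<bar> * (norm w)\<^sup>2" for x w
  proof -
    have "- m0 * (norm (oproj T w))\<^sup>2 \<le> \<bar>m0\<bar> * (norm w)\<^sup>2"
      using norm_oproj_le[OF T(1), of w] by (intro mult_mono power_mono) auto
    then show ?thesis using d2[OF gB, of "oproj T w" x] by (simp add: D2f D2h)
  qed
  have conth: "continuous_on UNIV h"
  proof -
    have "continuous_on UNIV (\<lambda>z. g z - (\<Sum>b\<in>T. m b * (b \<bullet> z)\<^sup>2))"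
      by (intro continuous_intros cont[OF gB])
    then show ?thesis by (simp add: g_def)
  qed
  have contproj: "continuous_on UNIV (oproj T)"
    unfolding oproj_def by (intro continuous_intros)
  have contf: "continuous_on UNIV f"
    unfolding f_def by (intro continuous_intros conth contproj)
  \<comment> \<open>The cube is chosen for the zoom \<open>r k = t k / real (Suc k)\<close>:
    division by \<open>(r k)\<^sup>2\<close> turns this error into 1 / (k + 1), while the segment
    acquires the half-length k + 1.\<close>
  have "\<exists>x t e. t > 0 \<and> e \<in> E \<and> diff2 f x (t *\<^sub>R e) \<le> t\<^sup>2 / real (Suc k) ^ 3" for k
  proof -
    have "Inf A < m0 + 1 / real (Suc k) ^ 3" by (simp add: m0_def)
    then obtain a where a: "a \<in> A" "a < m0 + 1 / real (Suc k) ^ 3"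
      using cInf_lessD[OF A_ne] by blast
    then obtain x t e where *: "a = diff2 h x (t *\<^sub>R e) / t\<^sup>2" "t > 0" "e \<in> E" by (auto simp: A_def)
    have "diff2 h x (t *\<^sub>R e) \<le> (m0 + 1 / real (Suc k) ^ 3) * t\<^sup>2"
      using a * by (simp add: pos_divide_less_eq)
    moreover have "norm e = 1" using *(3) by (simp add: E_def)
    ultimately show ?thesis using *
      by (intro exI[of _ x] exI[of _ t] exI[of _ e])
        (simp add: D2f oproj_scaleR oE power_mult_distrib algebra_simps del: of_nat_Suc)
  qed
  then obtain x t e where xte: "\<And>k. t k > 0" "\<And>k. e k \<in> E"
    "\<And>k. diff2 f (x k) (t k *\<^sub>R e k) \<le> (t k)\<^sup>2 / real (Suc k) ^ 3"
    by metis
  have cvf: "convex_on UNIV f"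
    by (rule convex_on_midpoint[OF contf]) (use D2f_ge in \<open>simp add: diff2_def algebra_simps\<close>)
  have "\<exists>s. \<forall>y. f (x k) + s \<bullet> (y - x k) \<le> f y" for k
    using convex_on_subgradient[OF cvf] by metis
  then obtain s where s: "\<And>k y. f (x k) + s k \<bullet> (y - x k) \<le> f y" by metis
  define r where "r k = t k / real (Suc k)" for k
  have r: "r k > 0" for k using xte(1) by (simp add: r_def)
  define F where "F k = renorm f (x k) (r k) (s k)" for k
  have F_nonneg: "0 \<le> F k z" for k z
    using s[of k "x k + r k *\<^sub>R z"] r[of k] by (simp add: F_def renorm_def)
  have F_D2: "F k z + F k (- z) = diff2 f (x k) (r k *\<^sub>R z) / (r k)\<^sup>2" for k z
    using diff2_renorm[of f "x k" "r k" "s k" 0 z] by (simp add: diff2_def F_def)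
  have F_le: "F k z \<le> \<bar>m0\<bar> * (norm z)\<^sup>2" for k z
  proof -
    have "F k z + F k (- z) \<le> \<bar>m0\<bar> * (norm (r k *\<^sub>R z))\<^sup>2 / (r k)\<^sup>2"
      unfolding F_D2 by (intro divide_right_mono D2f_le) simp
    then show ?thesis using F_nonneg[of k "- z"] r[of k] by (simp add: power_mult_distrib)
  qed
  have F_sc: "semiconvex 0 (F k)" for k
    unfolding semiconvex_iff_diff2 F_def using D2f_ge
    by (auto simp: diff2_renorm intro!: continuous_on_renorm contf)
  have F_cv: "convex_on UNIV (F k)" for k using F_sc[of k] by (simp add: semiconvex_def)
  have F_seg: "F k (\<tau> *\<^sub>R e k) \<le> 1 / real (Suc k)" if "\<bar>\<tau>\<bar> \<le> real (Suc k)" for k \<tau>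
  proof -
    let ?R = "real (Suc k)"
    have "F k (?R *\<^sub>R e k) + F k (- (?R *\<^sub>R e k)) = diff2 f (x k) (t k *\<^sub>R e k) / (r k)\<^sup>2"
      unfolding F_D2 by (simp add: r_def del: of_nat_Suc)
    also have "\<dots> \<le> ((t k)\<^sup>2 / ?R ^ 3) / (r k)\<^sup>2"
      by (intro divide_right_mono xte) simp
    also have "\<dots> = 1 / ?R"
      using xte(1)[of k] by (simp add: r_def power_divide power2_eq_square power3_eq_cube del: of_nat_Suc)
    finally have *: "F k (?R *\<^sub>R e k) \<le> 1 / ?R" "F k ((-?R) *\<^sub>R e k) \<le> 1 / ?R"
      using F_nonneg[of k "?R *\<^sub>R e k"] F_nonneg[of k "- (?R *\<^sub>R e k)"]
      unfolding scaleR_minus_left by linarith+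
    \<comment> \<open>The position of \<tau> in the interval from - (k + 1) to k + 1, on a scale
      from 0 to 1.\<close>
    define \<theta> where "\<theta> = (1 + \<tau> / ?R) / 2"
    have th: "0 \<le> \<theta>" "\<theta> \<le> 1" using that by (auto simp: \<theta>_def field_simps)
    have "(1 - \<theta>) *\<^sub>R ((-?R) *\<^sub>R e k) + \<theta> *\<^sub>R (?R *\<^sub>R e k) = ((2 * \<theta> - 1) * ?R) *\<^sub>R e k"
      by (simp only: scaleR_scaleR scaleR_add_left[symmetric])
        (rule arg_cong[where f = "\<lambda>c. c *\<^sub>R e k"], simp add: algebra_simps)
    also have "(2 * \<theta> - 1) * ?R = \<tau>" by (simp add: \<theta>_def field_simps del: of_nat_Suc)
    finally have "F k (\<tau> *\<^sub>R e k) \<le> (1 - \<theta>) * F k ((-?R) *\<^sub>R e k) + \<theta> * F k (?R *\<^sub>R e k)"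
      using convex_onD[OF F_cv, of \<theta> "(-?R) *\<^sub>R e k" "?R *\<^sub>R e k" k] th by simp
    also have "\<dots> \<le> (1 - \<theta>) * (1 / ?R) + \<theta> * (1 / ?R)"
      using * th by (intro add_mono mult_left_mono) auto
    also have "\<dots> = 1 / ?R" by (simp flip: add_divide_distrib del: of_nat_Suc)
    finally show ?thesis .
  qed
  obtain f0 \<sigma> where f0: "strict_mono (\<sigma> :: nat \<Rightarrow> nat)" "semiconvex 0 f0" "continuous_on UNIV f0"
    "\<And>C. compact C \<Longrightarrow> uniform_limit C (\<lambda>n. F (\<sigma> n)) f0 sequentially"
  proof (rule semiconvex_Ascoli[of 0 F, OF F_sc])
    fix R :: real
    have "\<bar>F n z\<bar> \<le> \<bar>m0\<bar> * R\<^sup>2" if "norm z \<le> R" for n z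
    proof -
      have "\<bar>m0\<bar> * (norm z)\<^sup>2 \<le> \<bar>m0\<bar> * R\<^sup>2" using that by (intro mult_left_mono power_mono) auto
      then show ?thesis using F_le[of n z] F_nonneg[of n z] by simp
    qed
    then show "\<exists>B. \<forall>\<^sub>F n in sequentially. \<forall>x. norm x \<le> R \<longrightarrow> \<bar>F n x\<bar> \<le> B"
      by (intro exI always_eventually) blast
  qed blast
  obtain e0 \<rho> where e0: "e0 \<in> E" "strict_mono (\<rho> :: nat \<Rightarrow> nat)" "((\<lambda>n. e (\<sigma> n)) \<circ> \<rho>) \<longlonglongrightarrow> e0"
    using E_comp xte(2) unfolding compact_def by (metis (no_types, lifting))
  define \<kappa> where "\<kappa> = (\<lambda>n. \<sigma> (\<rho> n))"
  have \<kappa>: "strict_mono \<kappa>" using strict_mono_o[OF f0(1) e0(2)] by (simp add: \<kappa>_def comp_def)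
  have unif: "uniform_limit C (\<lambda>n. F (\<kappa> n)) f0 sequentially" if "compact C" for C
    unfolding \<kappa>_def using filterlim_compose[OF f0(4)[OF that] filterlim_subseq[OF e0(2)]] .
  have lim: "(\<lambda>n. F (\<kappa> n) z) \<longlonglongrightarrow> f0 z" for z
    using tendsto_uniform_limitI[OF unif[of "{z}"]] by simp
  have ek: "(\<lambda>n. e (\<kappa> n)) \<longlonglongrightarrow> e0" using e0(3) by (simp add: \<kappa>_def comp_def)
  have f0_line: "f0 (\<tau> *\<^sub>R e0) = 0" for \<tau>
  proof -
    have "(\<lambda>n. f0 (\<tau> *\<^sub>R e (\<kappa> n))) \<longlonglongrightarrow> f0 (\<tau> *\<^sub>R e0)"
      by (rule continuous_on_tendsto_compose[OF f0(3)]) (auto intro!: tendsto_intros ek)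
    moreover have "(\<lambda>n. f0 (\<tau> *\<^sub>R e (\<kappa> n))) \<longlonglongrightarrow> 0"
    proof (rule tendstoI)
      fix \<epsilon> :: real assume \<epsilon>: "\<epsilon> > 0"
      have "\<forall>\<^sub>F n in sequentially. \<forall>z\<in>cball 0 \<bar>\<tau>\<bar>. dist (F (\<kappa> n) z) (f0 z) < \<epsilon> / 2"
        using uniform_limitD[OF unif[of "cball 0 \<bar>\<tau>\<bar>"], of "\<epsilon> / 2"] \<epsilon> by simp
      moreover have "\<forall>\<^sub>F n in sequentially. 1 / real (Suc (\<kappa> n)) < \<epsilon> / 2"
      proof -
        have "(\<lambda>n. inverse (real (Suc (\<kappa> n)))) \<longlonglongrightarrow> 0"
          using LIMSEQ_subseq_LIMSEQ[OF LIMSEQ_inverse_real_of_nat \<kappa>] by (simp add: comp_def)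
        from order_tendstoD(2)[OF this half_gt_zero[OF \<epsilon>]] show ?thesis
          by (simp only: inverse_eq_divide)
      qed
      moreover have "\<forall>\<^sub>F n in sequentially. \<bar>\<tau>\<bar> \<le> real (Suc (\<kappa> n))"
      proof -
        obtain N :: nat where "\<bar>\<tau>\<bar> \<le> real N" using real_arch_simple by blast
        then show ?thesis
          using seq_suble[OF \<kappa>] by (intro eventually_sequentiallyI[of N]) (smt (verit) of_nat_Suc of_nat_mono)
      qed
      ultimately show "\<forall>\<^sub>F n in sequentially. dist (f0 (\<tau> *\<^sub>R e (\<kappa> n))) 0 < \<epsilon>"
      proof eventually_elim
        case (elim n)
        have "norm (e (\<kappa> n)) = 1" using xte(2) by (simp add: E_def)
        then have "dist (F (\<kappa> n) (\<tau> *\<^sub>R e (\<kappa> n))) (f0 (\<tau> *\<^sub>R e (\<kappa> n))) < \<epsilon> / 2" using elim(1) by simp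
        moreover have "0 \<le> F (\<kappa> n) (\<tau> *\<^sub>R e (\<kappa> n))" "F (\<kappa> n) (\<tau> *\<^sub>R e (\<kappa> n)) < \<epsilon> / 2"
          using F_nonneg F_seg[OF elim(3)] elim(2) by (auto intro: le_less_trans)
        ultimately show ?case unfolding dist_real_def by linarith
      qed
    qed
    ultimately show ?thesis by (rule LIMSEQ_unique)
  qed
  have f0_e0: "f0 (z + \<tau> *\<^sub>R e0) = f0 z" for z \<tau>
    using f0(2) f0_line by (intro convex_line_invariant) (auto simp: semiconvex_def)
  have oproj_T: "oproj T b = 0" if "b \<in> T" for b
  proof -
    have "(\<Sum>c\<in>T. (c \<bullet> b) *\<^sub>R c) = (\<Sum>c\<in>T. if c = b then c else 0)"
      using T(1) that by (intro sum.cong) (auto simp: orthonormal_def)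
    then show ?thesis using finT that by (simp add: oproj_def)
  qed
  have f_inv: "f (z + \<tau> *\<^sub>R b) = f z" if "b \<in> T" for b z \<tau>
    using inv[OF that] oproj_T[OF that] by (simp add: f_def oproj_add oproj_scaleR)
  \<comment> \<open>f is constant along T, so its subgradients are orthogonal to T and the zooms
    keep the invariance that has already been gained.\<close>
  have s_orth: "s k \<bullet> b = 0" if "b \<in> T" for b k
    using s[of k "x k + 1 *\<^sub>R b"] s[of k "x k + (-1) *\<^sub>R b"]
    unfolding f_inv[OF that] by simp
  have F_inv: "F k (z + \<tau> *\<^sub>R b) = F k z" if "b \<in> T" for b z \<tau> k
    using f_inv[OF that, of "x k + r k *\<^sub>R z" "r k * \<tau>"] s_orth[OF that]
    by (simp add: F_def renorm_def inner_add_right algebra_simps)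
  have f0_T: "f0 (z + \<tau> *\<^sub>R b) = f0 z" if "b \<in> T" for b z \<tau>
    using LIMSEQ_unique[OF lim[of "z + \<tau> *\<^sub>R b", unfolded F_inv[OF that]] lim] .
  define q where "q z = (\<Sum>b\<in>T. m b * (b \<bullet> z)\<^sup>2) + m0 / 2 * (norm (oproj T z))\<^sup>2" for z
  have q_B: "(\<lambda>z. q z + F k z) \<in> B" for k
  proof -
    \<comment> \<open>A slope for g at \<open>x k\<close>: the subgradient of f plus the gradient of
      the quadratic terms.\<close>
    define p where "p = s k + (\<Sum>b\<in>T. (2 * m b * (b \<bullet> x k)) *\<^sub>R b) + m0 *\<^sub>R oproj T (x k)"
    have "renorm g (x k) (r k) p = (\<lambda>z. q z + F k z)"
    proof
      fix z
      let ?c = "x k" and ?r = "r k"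
      have 1: "(\<Sum>b\<in>T. m b * (b \<bullet> (?c + ?r *\<^sub>R z))\<^sup>2) = (\<Sum>b\<in>T. m b * (b \<bullet> ?c)\<^sup>2)
         + ?r * (\<Sum>b\<in>T. 2 * m b * (b \<bullet> ?c) * (b \<bullet> z)) + ?r\<^sup>2 * (\<Sum>b\<in>T. m b * (b \<bullet> z)\<^sup>2)"
        by (simp add: inner_add_right power2_eq_square sum_distrib_left flip: sum.distrib)
          (rule sum.cong, simp_all add: algebra_simps)
      have 2: "(norm (oproj T (?c + ?r *\<^sub>R z)))\<^sup>2 = (norm (oproj T ?c))\<^sup>2 + 2 * ?r * (oproj T ?c \<bullet> z) + ?r\<^sup>2 * (norm (oproj T z))\<^sup>2"
        by (simp add: oproj_add oproj_scaleR norm_sq_add oproj_inner_oproj[OF T(1)] power_mult_distrib)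
      have gf: "g w = (\<Sum>b\<in>T. m b * (b \<bullet> w)\<^sup>2) + m0 / 2 * (norm (oproj T w))\<^sup>2 + f w" for w
        by (simp add: g_def f_def)
      have 3: "p \<bullet> z = s k \<bullet> z + (\<Sum>b\<in>T. 2 * m b * (b \<bullet> ?c) * (b \<bullet> z)) + m0 * (oproj T ?c \<bullet> z)"
        by (simp add: p_def inner_add_left inner_sum_left)
      have "g (?c + ?r *\<^sub>R z) - g ?c - ?r * (p \<bullet> z) = ?r\<^sup>2 * q z + (f (?c + ?r *\<^sub>R z) - f ?c - ?r * (s k \<bullet> z))"
        unfolding gf 1 2 3 q_def by (simp add: algebra_simps)
      then show "renorm g ?c ?r p z = q z + F k z"
        using r[of k] by (simp add: renorm_def F_def add_divide_distrib)
    qed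
    then show ?thesis using blowup_closed_renorm[OF bc gB r[of k]] by metis
  qed
  have q0B: "(\<lambda>z. q z + f0 z) \<in> B"
  proof -
    have "uniform_limit C (\<lambda>n z. q z + F (\<kappa> n) z) (\<lambda>z. q z + f0 z) sequentially" if "compact C" for C
      by (intro uniform_limit_intros unif that)
    then show ?thesis by (rule blowup_closed_limit[OF bc q_B])
  qed
  have e0T: "b \<bullet> e0 = 0" if "b \<in> T" for b using e0(1) that by (simp add: E_def)
  have e0n: "e0 \<bullet> e0 = 1" using e0(1) by (simp add: E_def norm_eq_1)
  have e0_notin: "e0 \<notin> T" using e0T[of e0] e0n by auto
  have on: "orthonormal (insert e0 T)"
    using T(1) e0T e0n e0_notin by (auto simp: orthonormal_def inner_commute)
  have oi: "oproj (insert e0 T) z = oproj T z - (e0 \<bullet> z) *\<^sub>R e0" for z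
    using e0_notin finT by (simp add: oproj_def)
  have split: "(norm (oproj T z))\<^sup>2 = (e0 \<bullet> z)\<^sup>2 + (norm (oproj (insert e0 T) z))\<^sup>2" for z
  proof -
    let ?Q = "oproj (insert e0 T) z"
    have "oproj T z = ?Q + (e0 \<bullet> z) *\<^sub>R e0" by (simp add: oi)
    moreover have "?Q \<bullet> e0 = 0" using inner_oproj[OF on, of e0 z] by (simp add: inner_commute)
    moreover have "norm e0 = 1" using e0(1) by (simp add: E_def)
    ultimately show ?thesis by (simp add: norm_sq_add)
  qed
  define h' where "h' z = m0 / 2 * (norm (oproj (insert e0 T) z))\<^sup>2 + f0 z" for z
  show ?thesis
  proof (rule that[OF e0_notin on])
    have "oproj (insert e0 T) b = 0" if "b \<in> insert e0 T" for b
    proof (cases "b = e0")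
      case True
      then show ?thesis by (simp add: oi oE[OF e0(1)] e0n)
    next
      case False
      then show ?thesis using that oproj_T e0T by (simp add: oi inner_commute)
    qed
    then show "h' (z + t *\<^sub>R b) = h' z" if "b \<in> insert e0 T" for b z t
      using that f0_e0 f0_T by (auto simp: h'_def oproj_add oproj_scaleR)
    have "(\<lambda>z. (\<Sum>b\<in>insert e0 T. (m(e0 := m0 / 2)) b * (b \<bullet> z)\<^sup>2) + h' z) = (\<lambda>z. q z + f0 z)"
    proof
      fix z
      have "(\<Sum>b\<in>T. (m(e0 := m0 / 2)) b * (b \<bullet> z)\<^sup>2) = (\<Sum>b\<in>T. m b * (b \<bullet> z)\<^sup>2)"
        using e0_notin by (intro sum.cong) auto
      then show "(\<Sum>b\<in>insert e0 T. (m(e0 := m0 / 2)) b * (b \<bullet> z)\<^sup>2) + h' z = q z + f0 z"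
        using e0_notin finT by (simp add: q_def h'_def split algebra_simps)
    qed
    then show "(\<lambda>z. (\<Sum>b\<in>insert e0 T. (m(e0 := m0 / 2)) b * (b \<bullet> z)\<^sup>2) + h' z) \<in> B"
      using q0B by simp
  qed
qed

text \<open>After as many splittings as there are dimensions the remainder is invariant in all
  directions, hence constant; a zoom of factor 1 at the origin removes the constant.\<close>

lemma blowup_quadratic:
  fixes B :: "('a::euclidean_space \<Rightarrow> real) set"
  assumes bc: "blowup_closed B" and "B \<noteq> {}"
    and cont: "\<And>f. f \<in> B \<Longrightarrow> continuous_on UNIV f"
    and d2: "\<And>f x h. f \<in> B \<Longrightarrow> - K * (norm h)\<^sup>2 \<le> diff2 f x h \<and> diff2 f x h \<le> 0"
  obtains T m where "finite T" "(\<lambda>z. \<Sum>b\<in>T. m b * (b \<bullet> z)\<^sup>2) \<in> B"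
proof -
  have "\<exists>T m h. orthonormal T \<and> card T = n \<and> (\<forall>b\<in>T. \<forall>z t. h (z + t *\<^sub>R b) = h z) \<and>
     (\<lambda>z. (\<Sum>b\<in>T. m b * (b \<bullet> z)\<^sup>2) + h z) \<in> B" if "n \<le> DIM('a)" for n
    using that
  proof (induction n)
    case 0
    obtain g where "g \<in> B" using \<open>B \<noteq> {}\<close> by blast
    then have "orthonormal {} \<and> card {} = 0 \<and> (\<forall>b\<in>{}. \<forall>z t. g (z + t *\<^sub>R b) = g z) \<and>
     (\<lambda>z. (\<Sum>b\<in>{}. 0 * (b \<bullet> z)\<^sup>2) + g z) \<in> B" by (simp add: orthonormal_def)
    then show ?case by (intro exI[of _ "{}"] exI[of _ "\<lambda>_. 0"] exI[of _ g])
  next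
    case (Suc n)
    then obtain T m h where *: "orthonormal T" "card T = n" "\<And>b z t. b \<in> T \<Longrightarrow> h (z + t *\<^sub>R b) = h z"
      "(\<lambda>z. (\<Sum>b\<in>T. m b * (b \<bullet> z)\<^sup>2) + h z) \<in> B"
      using Suc_leD by blast
    have "card T < DIM('a)" using *(2) Suc.prems by simp
    obtain e m' h' where e: "e \<notin> T" "orthonormal (insert e T)"
      "\<And>b z t. b \<in> insert e T \<Longrightarrow> h' (z + t *\<^sub>R b) = h' z"
      "(\<lambda>z. (\<Sum>b\<in>insert e T. m' b * (b \<bullet> z)\<^sup>2) + h' z) \<in> B"
      by (rule splitting_step[of B K T h m, OF bc cont d2 *(1) \<open>card T < DIM('a)\<close> *(3,4)],
          (assumption | (rule that; assumption))+)
    have "card (insert e T) = Suc n" using e(1) *(1,2) by (simp add: orthonormal_def)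
    then show ?case using e(2-4)
      by (intro exI[of _ "insert e T"] exI[of _ m'] exI[of _ h']) simp
  qed
  from this[of "DIM('a)", OF order_refl] obtain T m h where "orthonormal T \<and> card T = DIM('a) \<and>
      (\<forall>b\<in>T. \<forall>z t. h (z + t *\<^sub>R b) = h z) \<and> (\<lambda>z. (\<Sum>b\<in>T. m b * (b \<bullet> z)\<^sup>2) + h z) \<in> B"
    by (elim exE)
  then have *: "orthonormal T" "card T = DIM('a)"
    "\<And>b z t. b \<in> T \<Longrightarrow> h (z + t *\<^sub>R b) = h z" "(\<lambda>z. (\<Sum>b\<in>T. m b * (b \<bullet> z)\<^sup>2) + h z) \<in> B"
    by simp_all
  have "0 \<notin> T"
  proof
    assume "0 \<in> T"
    then have "(0::'a) \<bullet> 0 = 1" using *(1) unfolding orthonormal_def by metis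
    then show False by simp
  qed
  moreover have "pairwise orthogonal T"
    using *(1) by (simp add: orthonormal_def pairwise_def orthogonal_def)
  ultimately have "independent T" by (rule pairwise_orthogonal_independent[rotated])
  then have "span T = UNIV"
    using card_ge_dim_independent[of T UNIV] *(1,2) by (auto simp: orthonormal_def)
  then have hc: "h z = h 0" for z using span_invariant[of T h z 0, OF *(3)] by simp
  have "renorm (\<lambda>z. (\<Sum>b\<in>T. m b * (b \<bullet> z)\<^sup>2) + h z) 0 1 0 \<in> B"
    by (rule blowup_closed_renorm[OF bc *(4)]) simp
  also have "renorm (\<lambda>z. (\<Sum>b\<in>T. m b * (b \<bullet> z)\<^sup>2) + h z) 0 1 0 = (\<lambda>z. \<Sum>b\<in>T. m b * (b \<bullet> z)\<^sup>2)"
  proof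
    fix z show "renorm (\<lambda>z. (\<Sum>b\<in>T. m b * (b \<bullet> z)\<^sup>2) + h z) 0 1 0 z = (\<Sum>b\<in>T. m b * (b \<bullet> z)\<^sup>2)"
      using hc[of z] by (simp add: renorm_def)
  qed
  finally show ?thesis using that *(1) by (auto simp: orthonormal_def)
qed

section \<open>Contact sets at strict maxima\<close>

lemma tendsto_unif_compact:
  fixes F :: "nat \<Rightarrow> 'a::euclidean_space \<Rightarrow> real"
  assumes unif: "\<And>C. compact C \<Longrightarrow> C \<subseteq> S \<Longrightarrow> uniform_limit C F g sequentially"
    and "open S" "continuous_on S g" "z \<longlonglongrightarrow> w" "w \<in> S"
  shows "(\<lambda>n. F n (z n)) \<longlonglongrightarrow> g w"
proof -
  obtain d where d: "d > 0" "cball w d \<subseteq> S" using \<open>open S\<close> \<open>w \<in> S\<close> open_contains_cball by blast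
  have ev: "\<forall>\<^sub>F n in sequentially. z n \<in> cball w d"
    using tendstoD[OF \<open>z \<longlonglongrightarrow> w\<close> d(1)] by eventually_elim (auto simp: dist_commute)
  have "(\<lambda>n. F n (z n) - g (z n)) \<longlonglongrightarrow> 0"
  proof (rule tendstoI)
    fix e :: real assume "e > 0"
    from uniform_limitD[OF unif[OF compact_cball d(2)] this] ev
    show "\<forall>\<^sub>F n in sequentially. dist (F n (z n) - g (z n)) 0 < e"
      by eventually_elim (auto simp: dist_real_def)
  qed
  moreover have "(\<lambda>n. g (z n)) \<longlonglongrightarrow> g w"
  proof (rule continuous_on_tendsto_compose[OF assms(3-5)])
    show "\<forall>\<^sub>F n in sequentially. z n \<in> S" using ev by eventually_elim (use d(2) in blast)
  qed
  ultimately have "(\<lambda>n. (F n (z n) - g (z n)) + g (z n)) \<longlonglongrightarrow> 0 + g w" by (intro tendsto_add)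
  then show ?thesis by simp
qed

lemma renorm_renorm:
  assumes "r \<noteq> 0"
  shows "renorm (renorm W c r p) c' r' p' = renorm W (c + r *\<^sub>R c') (r * r') (p + r *\<^sub>R p')"
proof
  fix z
  have a: "c + r *\<^sub>R c' + (r * r') *\<^sub>R z = c + r *\<^sub>R (c' + r' *\<^sub>R z)" by (simp add: algebra_simps)
  have "renorm W c r p (c' + r' *\<^sub>R z) - renorm W c r p c' - r' * (p' \<bullet> z)
     = (W (c + r *\<^sub>R (c' + r' *\<^sub>R z)) - W (c + r *\<^sub>R c') - r * r' * (p \<bullet> z) - r\<^sup>2 * (r' * (p' \<bullet> z))) / r\<^sup>2"
    using assms by (simp add: renorm_def inner_add_right field_simps)
  also have "\<dots> = (W (c + r *\<^sub>R c' + (r * r') *\<^sub>R z) - W (c + r *\<^sub>R c') - (r * r') * ((p + r *\<^sub>R p') \<bullet> z)) / r\<^sup>2"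
    unfolding a by (simp add: inner_add_left algebra_simps power2_eq_square)
  finally show "renorm (renorm W c r p) c' r' p' z = renorm W (c + r *\<^sub>R c') (r * r') (p + r *\<^sub>R p') z"
    by (simp add: renorm_def[of _ c'] renorm_def[of W "c + r *\<^sub>R c'"] power_mult_distrib)
qed

text \<open>Locally uniform limits of zooms taken inside S at scales tending to zero. The
  formulation by approximation makes the set closed under limits and further zooms without diagonal
  sequences.\<close>

definition blowups :: "('a::euclidean_space \<Rightarrow> real) \<Rightarrow> 'a set \<Rightarrow> ('a \<Rightarrow> real) set" where
  "blowups W S = {g. \<forall>R>0. \<forall>\<epsilon>>0. \<exists>c r p. 0 < r \<and> r < \<epsilon> \<and> ball c (R * r) \<subseteq> S \<and>
     (\<forall>z. norm z < R \<longrightarrow> \<bar>renorm W c r p z - g z\<bar> \<le> \<epsilon>)}"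

lemma blowups_renorm:
  assumes g: "g \<in> blowups W S" and r': "r' > 0"
  shows "renorm g c' r' p' \<in> blowups W S"
  unfolding blowups_def mem_Collect_eq
proof (intro allI impI)
  fix R \<epsilon> :: real assume R: "R > 0" and \<epsilon>: "\<epsilon> > 0"
  \<comment> \<open>\<open>R1\<close> makes the first zoom cover all points c' + r' z with |z| < R.
    \<open>\<epsilon>1\<close> compensates the division of two errors by \<open>r'\<^sup>2\<close>
    and keeps the composed scale r r' below \<epsilon>.\<close>
  define R1 where "R1 = norm c' + r' * R + 1"
  define \<epsilon>1 where "\<epsilon>1 = min (\<epsilon> * r'\<^sup>2 / 2) (\<epsilon> / r')"
  have pos: "R1 > 0" "\<epsilon>1 > 0" using R \<epsilon> r' by (auto simp: R1_def \<epsilon>1_def intro!: add_nonneg_pos)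
  then obtain c r p where crp: "0 < r" "r < \<epsilon>1" "ball c (R1 * r) \<subseteq> S"
    "\<And>z. norm z < R1 \<Longrightarrow> \<bar>renorm W c r p z - g z\<bar> \<le> \<epsilon>1"
    using g unfolding blowups_def by blast
  have rr: "0 < r * r'" "r * r' < \<epsilon>" using crp(1,2) r' by (auto simp: \<epsilon>1_def field_simps)
  have "ball (c + r *\<^sub>R c') (R * (r * r')) \<subseteq> ball c (R1 * r)"
  proof
    fix y assume "y \<in> ball (c + r *\<^sub>R c') (R * (r * r'))"
    then have "norm (c + r *\<^sub>R c' - y) < R * (r * r')" by (simp add: dist_norm)
    moreover have "norm (c - y) \<le> norm (c + r *\<^sub>R c' - y) + norm (r *\<^sub>R c')"
      using norm_triangle_ineq4[of "c + r *\<^sub>R c' - y" "r *\<^sub>R c'"] by (simp add: algebra_simps)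
    ultimately have "norm (c - y) < R * (r * r') + r * norm c'" using crp(1) by simp
    also have "\<dots> < R1 * r" using crp(1) by (simp add: R1_def algebra_simps)
    finally show "y \<in> ball c (R1 * r)" by (simp add: dist_norm)
  qed
  then have sub: "ball (c + r *\<^sub>R c') (R * (r * r')) \<subseteq> S" using crp(3) by blast
  have "\<bar>renorm W (c + r *\<^sub>R c') (r * r') (p + r *\<^sub>R p') z - renorm g c' r' p' z\<bar> \<le> \<epsilon>" if z: "norm z < R" for z
  proof -
    let ?w = "renorm W c r p"
    have n: "norm (c' + r' *\<^sub>R z) < R1" "norm c' < R1"
    proof -
      have "r' * norm z \<le> r' * R" "0 \<le> r' * R" using z r' R by auto
      moreover have "norm (c' + r' *\<^sub>R z) \<le> norm c' + r' * norm z"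
        using norm_triangle_ineq[of c' "r' *\<^sub>R z"] r' by simp
      ultimately show "norm (c' + r' *\<^sub>R z) < R1" "norm c' < R1"
        unfolding R1_def by linarith+
    qed
    have "renorm ?w c' r' p' z - renorm g c' r' p' z
      = ((?w (c' + r' *\<^sub>R z) - g (c' + r' *\<^sub>R z)) - (?w c' - g c')) / r'\<^sup>2"
      by (simp add: renorm_def[of _ c'] diff_divide_distrib)
    also have "\<bar>\<dots>\<bar> \<le> (\<epsilon>1 + \<epsilon>1) / r'\<^sup>2"
      using crp(4)[OF n(1)] crp(4)[OF n(2)] by (simp add: divide_right_mono)
    also have "\<dots> \<le> \<epsilon>" using r' by (simp add: \<epsilon>1_def divide_le_eq min_le_iff_disj)
    finally show ?thesis using crp(1) by (simp add: renorm_renorm)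
  qed
  then show "\<exists>c r p. 0 < r \<and> r < \<epsilon> \<and> ball c (R * r) \<subseteq> S \<and>
     (\<forall>z. norm z < R \<longrightarrow> \<bar>renorm W c r p z - renorm g c' r' p' z\<bar> \<le> \<epsilon>)"
    using rr sub by blast
qed

lemma blowups_limit:
  assumes F: "\<And>n. F n \<in> blowups W S" and lim: "\<And>C. compact C \<Longrightarrow> uniform_limit C F g sequentially"
  shows "g \<in> blowups W S"
  unfolding blowups_def mem_Collect_eq
proof (intro allI impI)
  fix R \<epsilon> :: real assume R: "R > 0" and \<epsilon>: "\<epsilon> > 0"
  from eventually_happens'[OF sequentially_bot uniform_limitD[OF lim[OF compact_cball] half_gt_zero[OF \<epsilon>]]]
  obtain n where n: "\<forall>z\<in>cball 0 R. dist (F n z) (g z) < \<epsilon> / 2"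
    by blast
  obtain c r p where crp: "0 < r" "r < \<epsilon> / 2" "ball c (R * r) \<subseteq> S"
    "\<And>z. norm z < R \<Longrightarrow> \<bar>renorm W c r p z - F n z\<bar> \<le> \<epsilon> / 2"
    using F[of n] R half_gt_zero[OF \<epsilon>] unfolding blowups_def by blast
  have "\<bar>renorm W c r p z - g z\<bar> \<le> \<epsilon>" if "norm z < R" for z
  proof -
    have "dist (F n z) (g z) < \<epsilon> / 2" using n that by simp
    then show ?thesis using crp(4)[OF that] unfolding dist_real_def by linarith
  qed
  then show "\<exists>c r p. 0 < r \<and> r < \<epsilon> \<and> ball c (R * r) \<subseteq> S \<and> (\<forall>z. norm z < R \<longrightarrow> \<bar>renorm W c r p z - g z\<bar> \<le> \<epsilon>)"
    using crp by (intro exI[of _ c] exI[of _ r] exI[of _ p]) auto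
qed

text \<open>The points z that admit such a p form the upper contact set known from the
  Alexandrov-Bakelman-Pucci estimate.\<close>

definition dominating_slope :: "('a::euclidean_space \<Rightarrow> real) \<Rightarrow> 'a set \<Rightarrow> 'a \<Rightarrow> 'a \<Rightarrow> bool" where
  "dominating_slope W S z p \<longleftrightarrow> (\<forall>w\<in>S. W w \<le> W z + p \<bullet> (w - z))"

text \<open>At an interior contact point W lies below a plane and above a paraboloid. If their
  slopes differed, a small step along the difference would gain linearly and lose only
  quadratically.\<close>

lemma dominating_slope_lower:
  assumes sc: "semiconvex K W" and p: "dominating_slope W S z p" and z: "z \<in> interior S"
  shows "W z + p \<bullet> (w - z) - K / 2 * (norm (w - z))\<^sup>2 \<le> W w"
proof -
  obtain s where s: "\<And>y. W z + s \<bullet> (y - z) - K / 2 * (norm (y - z))\<^sup>2 \<le> W y"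
    using semiconvex_subgradient[OF sc, of z] by blast
  define v where "v = s - p"
  have "v = 0"
  proof (rule ccontr)
    assume v: "v \<noteq> 0"
    obtain e where e: "e > 0" "cball z e \<subseteq> S" using z mem_interior_cball by blast
    define t where "t = min (e / norm v) (1 / (\<bar>K\<bar> + 1))"
    have t: "t > 0" "t \<le> e / norm v" "t \<le> 1 / (\<bar>K\<bar> + 1)" using e v by (auto simp: t_def)
    have "z + t *\<^sub>R v \<in> S" using t e v by (intro set_mp[OF e(2)]) (auto simp: dist_norm field_simps)
    then have "W (z + t *\<^sub>R v) \<le> W z + t * (p \<bullet> v)" using p by (auto simp: dominating_slope_def)
    moreover have "W z + t * (s \<bullet> v) - K / 2 * (t\<^sup>2 * (norm v)\<^sup>2) \<le> W (z + t *\<^sub>R v)"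
      using s[of "z + t *\<^sub>R v"] by (simp add: power_mult_distrib)
    ultimately have "t * (v \<bullet> v) \<le> K / 2 * (t\<^sup>2 * (norm v)\<^sup>2)"
      by (simp add: v_def inner_diff_left right_diff_distrib)
    then have "t * (norm v)\<^sup>2 \<le> t * (norm v)\<^sup>2 * (K / 2 * t)"
      by (simp add: dot_square_norm power2_eq_square[of t] algebra_simps)
    then have "1 \<le> K / 2 * t" using t v by (simp add: mult_le_cancel_left1)
    moreover have "K / 2 * t < 1"
    proof -
      have "K * t \<le> \<bar>K\<bar> * (1 / (\<bar>K\<bar> + 1))" using t by (intro mult_mono) auto
      also have "\<dots> < 1" by simp
      finally show ?thesis by simp
    qed
    ultimately show False by simp
  qed
  then show ?thesis using s[of w] by (simp add: v_def)
qed

text \<open>The plane at z1 and the paraboloid at z2 bound W from opposite sides at z1 + h. The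
  choice of h with length |z2 - z1| and direction p2 - p1 gives the estimate; for z1 = z2 it says
  that the slope is unique. The quarter radius keeps z1 + h inside the ball.\<close>

lemma dominating_slopes_Lipschitz:
  assumes sc: "semiconvex K W"
    and p: "dominating_slope W (cball z0 \<rho>) z1 p1" "dominating_slope W (cball z0 \<rho>) z2 p2"
    and z: "z1 \<in> cball z0 (\<rho> / 4)" "z2 \<in> cball z0 (\<rho> / 4)" and "\<rho> > 0"
  shows "norm (p2 - p1) \<le> 2 * K * norm (z2 - z1)"
proof -
  have int: "z1 \<in> interior (cball z0 \<rho>)" "z2 \<in> interior (cball z0 \<rho>)"
    using z \<open>\<rho> > 0\<close> by auto
  define d where "d = norm (z2 - z1)"
  have "dist z1 z2 \<le> dist z0 z1 + dist z0 z2" by (rule dist_triangle3)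
  then have d: "d \<le> \<rho> / 2" using z by (simp add: d_def dist_norm norm_minus_commute)
  have key: "(p2 - p1) \<bullet> h \<le> K / 2 * (norm (z1 + h - z2))\<^sup>2" if "norm h \<le> \<rho> / 2" for h
  proof -
    have "dist z0 (z1 + h) \<le> dist z0 z1 + norm h"
      using dist_triangle[of z0 "z1 + h" z1] by (simp add: dist_norm)
    then have "z1 + h \<in> cball z0 \<rho>" using z that \<open>\<rho> > 0\<close> by simp
    then have 1: "W (z1 + h) \<le> W z1 + p1 \<bullet> h" 
      using p(1)[unfolded dominating_slope_def, rule_format, of "z1 + h"] by simp
    have "z1 \<in> cball z0 \<rho>" using z \<open>\<rho> > 0\<close> by simp
    then have 2: "W z1 \<le> W z2 + p2 \<bullet> (z1 - z2)" using p(2) by (auto simp: dominating_slope_def)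
    have "W z2 + p2 \<bullet> (z1 + h - z2) - K / 2 * (norm (z1 + h - z2))\<^sup>2 \<le> W (z1 + h)"
      by (rule dominating_slope_lower[OF sc p(2) int(2)])
    with 1 2 show ?thesis by (simp add: inner_diff_left inner_diff_right inner_add_right)
  qed
  show ?thesis
  proof (cases "d = 0 \<or> p2 = p1")
    case True
    have "p2 = p1"
    proof (rule ccontr)
      assume ne: "p2 \<noteq> p1"
      then have z12: "z1 = z2" using True by (simp add: d_def)
      define v where "v = p2 - p1"
      have v: "v \<noteq> 0" using ne by (simp add: v_def)
      define t where "t = min (\<rho> / 2 / norm v) (1 / (\<bar>K\<bar> + 1))"
      have t: "t > 0" "t \<le> \<rho> / 2 / norm v" "t \<le> 1 / (\<bar>K\<bar> + 1)" using \<open>\<rho> > 0\<close> v by (auto simp: t_def)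
      have "norm (t *\<^sub>R v) \<le> \<rho> / 2" using t v by (simp add: field_simps)
      from key[OF this] have "t * (norm v)\<^sup>2 \<le> t * (norm v)\<^sup>2 * (K / 2 * t)"
          by (simp add: z12 v_def[symmetric] dot_square_norm power_mult_distrib power2_eq_square[of t] algebra_simps)
      then have "1 \<le> K / 2 * t" using t v by (simp add: mult_le_cancel_left1)
      moreover have "K * t \<le> \<bar>K\<bar> * (1 / (\<bar>K\<bar> + 1))" using t by (intro mult_mono) auto
      moreover have "\<bar>K\<bar> * (1 / (\<bar>K\<bar> + 1)) < 1" by simp
      ultimately show False by linarith
    qed
    then show ?thesis
    proof (cases "K \<ge> 0")
      case False
      have "norm (z2 - z1) = 0"
      proof (rule ccontr)
        assume "norm (z2 - z1) \<noteq> 0"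
        then have "norm (z1 - z2) > 0" by (simp add: norm_minus_commute)
        then have "K / 2 * (norm (z1 + 0 - z2))\<^sup>2 < 0" using False by (simp add: mult_neg_pos)
        then show False using key[of 0] \<open>\<rho> > 0\<close> by simp
      qed
      then show ?thesis using \<open>p2 = p1\<close> by simp
    qed simp
  next
    case False
    define h where "h = (d / norm (p2 - p1)) *\<^sub>R (p2 - p1)"
    have nh: "norm h = d" using False by (simp add: h_def d_def)
    have "K \<ge> 0"
    proof (rule ccontr)
      assume "\<not> K \<ge> 0"
      moreover have "(norm (z1 + 0 - z2))\<^sup>2 > 0" using False by (simp add: d_def norm_minus_commute)
      ultimately have "K / 2 * (norm (z1 + 0 - z2))\<^sup>2 < 0" by (simp add: mult_neg_pos)
      then show False using key[of 0] \<open>\<rho> > 0\<close> by simp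
    qed
    have "norm (z1 + h - z2) \<le> norm h + norm (z2 - z1)"
      using norm_triangle_ineq4[of h "z2 - z1"] by (simp add: algebra_simps)
    then have "(norm (z1 + h - z2))\<^sup>2 \<le> (2 * d)\<^sup>2" using nh by (intro power_mono) (auto simp: d_def)
    then have "K / 2 * (norm (z1 + h - z2))\<^sup>2 \<le> K / 2 * (2 * d)\<^sup>2"
      using \<open>K \<ge> 0\<close> by (intro mult_left_mono) auto
    then have "(p2 - p1) \<bullet> h \<le> 2 * K * d * d" using key[of h] nh d by (simp add: power2_eq_square)
    moreover have "(p2 - p1) \<bullet> h = d * norm (p2 - p1)"
      using False by (simp add: h_def dot_square_norm power2_eq_square)
    ultimately have "d * norm (p2 - p1) \<le> d * (2 * K * d)" by (simp add: algebra_simps)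
    then show ?thesis using False by (simp add: d_def mult_le_cancel_left)
  qed
qed

text \<open>Near a density point no ball can have a hole of a fixed relative size \<epsilon>.
  Otherwise the balls with holes form a Vitali covering, and disjoint ones among them cover A up to
  a null set inside an open set hardly larger than A. Each of them wastes a fixed fraction of its
  volume, so A would be smaller than itself.\<close>

lemma dense_at_point_of_nonnegligible:
  fixes A :: "'a::euclidean_space set"
  assumes A: "compact A" "\<not> negligible A" and \<epsilon>: "0 < \<epsilon>" "\<epsilon> < 1"
  obtains x d0 where "x \<in> A" "d0 > 0"
    "\<And>d y. 0 < d \<Longrightarrow> d < d0 \<Longrightarrow> ball y (\<epsilon> * d) \<subseteq> ball x d \<Longrightarrow> ball y (\<epsilon> * d) \<inter> A \<noteq> {}"
proof (rule ccontr)
  assume "\<not> thesis"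
  then have "\<not> (\<exists>x\<in>A. \<exists>d0>0. \<forall>d y. 0 < d \<longrightarrow> d < d0 \<longrightarrow> ball y (\<epsilon> * d) \<subseteq> ball x d \<longrightarrow> ball y (\<epsilon> * d) \<inter> A \<noteq> {})"
    using that by blast
  then have hole: "\<exists>d y. 0 < d \<and> d < d0 \<and> ball y (\<epsilon> * d) \<subseteq> ball x d \<and> ball y (\<epsilon> * d) \<inter> A = {}"
    if "x \<in> A" "d0 > 0" for x d0
    using that by blast
  let ?\<mu> = "measure lebesgue"
  have Am: "A \<in> lmeasurable" using A(1) by (rule lmeasurable_compact)
  define m where "m = ?\<mu> A"
  have m: "m > 0" using A(2) Am by (simp add: m_def negligible_iff_measure zero_less_measure_iff)
  \<comment> \<open>The fraction of the volume of a ball that the hole occupies.\<close>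
  define c where "c = \<epsilon> ^ DIM('a)"
  have c: "0 < c" "c < 1" using \<epsilon> by (auto simp: c_def power_less_one_iff)
  \<comment> \<open>The excess c m is such that (1 - c) (m + c m) < m.\<close>
  obtain O' where O': "open O'" "A \<subseteq> O'" "O' \<in> lmeasurable" "?\<mu> O' < m + c * m"
  proof -
    obtain T where T: "open T" "A \<subseteq> T" "T - A \<in> lmeasurable" "emeasure lebesgue (T - A) < ennreal (c * m)"
      using sets_lebesgue_outer_open[OF fmeasurableD[OF Am], of "c * m"] c m by auto
    have "?\<mu> (T - A) < c * m"
      using T(3,4) c m by (simp add: emeasure_eq_measure2 ennreal_less_iff)
    moreover have TA: "T = A \<union> (T - A)" using T(2) by blast
    ultimately have "?\<mu> T < m + c * m"
      using measure_Un_le[of A lebesgue "T - A"] Am T(3) by (auto simp: m_def fmeasurableD)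
    moreover have "T \<in> lmeasurable" using fmeasurable.Un[OF Am T(3)] TA by metis
    ultimately show thesis using that T(1,2) by blast
  qed
  let ?K = "{(x, d). x \<in> A \<and> 0 < d \<and> ball x d \<subseteq> O' \<and> (\<exists>y. ball y (\<epsilon> * d) \<subseteq> ball x d \<and> ball y (\<epsilon> * d) \<inter> A = {})}"
  obtain C where C: "countable C" "C \<subseteq> ?K"
    and pw: "pairwise (\<lambda>i j. disjnt (ball (fst i) (snd i)) (ball (fst j) (snd j))) C"
    and neg: "negligible (A - (\<Union>i \<in> C. ball (fst i) (snd i)))"
  proof (rule Vitali_covering_theorem_balls[of A ?K fst snd])
    fix x and d :: real assume x: "x \<in> A" and "d > 0"
    obtain k where k: "k > 0" "ball x k \<subseteq> O'" using O'(1,2) x by (meson openE subsetD)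
    obtain r y where r: "0 < r" "r < min d k" "ball y (\<epsilon> * r) \<subseteq> ball x r" "ball y (\<epsilon> * r) \<inter> A = {}"
      using hole[OF x, of "min d k"] \<open>d > 0\<close> k by auto
    moreover have "ball x r \<subseteq> O'" using r(2) k(2) by (auto intro: order_trans[OF subset_ball])
    ultimately show "\<exists>i. i \<in> ?K \<and> x \<in> ball (fst i) (snd i) \<and> snd i < d"
      using x by (intro exI[of _ "(x, r)"]) auto
  qed blast
  let ?B = "\<lambda>i::'a \<times> real. ball (fst i) (snd i)"
  have piece: "?\<mu> (A \<inter> ?B i) \<le> (1 - c) * ?\<mu> (?B i)" if i: "i \<in> C" for i
  proof -
    obtain y where y: "0 < snd i" "ball y (\<epsilon> * snd i) \<subseteq> ?B i" "ball y (\<epsilon> * snd i) \<inter> A = {}"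
      using i C(2) by (auto simp: case_prod_unfold)
    have "?\<mu> (A \<inter> ?B i) \<le> ?\<mu> (?B i - ball y (\<epsilon> * snd i))"
      using y(3) Am by (intro measure_mono_fmeasurable) auto
    also have "\<dots> = ?\<mu> (?B i) - ?\<mu> (ball y (\<epsilon> * snd i))"
      using y(2) by (intro measurable_measure_Diff) auto
    also have "?\<mu> (ball y (\<epsilon> * snd i)) = c * ?\<mu> (?B i)"
      using content_ball_conv_unit_ball[of "\<epsilon> * snd i" y] content_ball_conv_unit_ball[of "snd i" "fst i"] y(1) \<epsilon>
      by (simp add: c_def power_mult_distrib)
    finally show ?thesis by (simp add: algebra_simps)
  qed
  have bound: "?\<mu> (\<Union>i\<in>I. A \<inter> ?B i) \<le> (1 - c) * ?\<mu> O'" if I: "I \<subseteq> C" "finite I" for I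
  proof -
    have "?\<mu> (\<Union>i\<in>I. A \<inter> ?B i) \<le> (\<Sum>i\<in>I. ?\<mu> (A \<inter> ?B i))"
      using I Am by (intro measure_UNION_le) auto
    also have "\<dots> \<le> (\<Sum>i\<in>I. (1 - c) * ?\<mu> (?B i))" using I piece by (intro sum_mono) auto
    also have "\<dots> = (1 - c) * ?\<mu> (\<Union>i\<in>I. ?B i)"
      unfolding sum_distrib_left[symmetric]
      by (subst measure_UNION') (use I pw in \<open>auto elim: pairwise_mono\<close>)
    also have "\<dots> \<le> (1 - c) * ?\<mu> O'"
      using I C(2) O'(3) c by (intro mult_left_mono measure_mono_fmeasurable) (auto simp: case_prod_unfold sets.finite_UN)
    finally show ?thesis .
  qed
  have AB: "A \<inter> ?B i \<in> lmeasurable" for i by (rule fmeasurable_Int_fmeasurable[OF Am]) simp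
  have U: "(\<Union>i\<in>C. A \<inter> ?B i) \<in> lmeasurable"
    by (rule fmeasurable_UN_bound[OF C(1) AB bound])
  have U': "?\<mu> (\<Union>i\<in>C. A \<inter> ?B i) \<le> (1 - c) * ?\<mu> O'"
    by (rule measure_UN_bound[OF C(1) AB bound])
  have "m = ?\<mu> (\<Union>i\<in>C. A \<inter> ?B i)"
    unfolding m_def
  proof (rule measure_negligible_symdiff[OF U])
    show "negligible (((\<Union>i\<in>C. A \<inter> ?B i) - A) \<union> (A - (\<Union>i\<in>C. A \<inter> ?B i)))"
      by (rule negligible_subset[OF neg]) auto
  qed
  also have "\<dots> \<le> (1 - c) * ?\<mu> O'" by (rule U')
  also have "\<dots> < (1 - c) * (m + c * m)" using O'(4) c by (intro mult_strict_left_mono) auto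
  also have "\<dots> = m - c * c * m" by (simp add: algebra_simps)
  finally show False using c m by (simp add: mult_less_0_iff)
qed

text \<open>Tilting W by a small linear function moves its maximum only slightly, so all small
  slopes occur at contact points near z0. The slope is a Lipschitz function of the contact point and
  its values fill a ball, which is impossible on a null set.\<close>

lemma contact_set_nonnegligible:
  fixes W :: "'a::euclidean_space \<Rightarrow> real"
  assumes sc: "semiconvex K W" and \<rho>: "\<rho> > 0"
    and strict: "\<And>z. z \<in> cball z0 \<rho> \<Longrightarrow> z \<noteq> z0 \<Longrightarrow> W z < W z0"
  obtains A where "compact A" "\<not> negligible A" "A \<subseteq> cball z0 (\<rho> / 4)"
    "\<And>z. z \<in> A \<Longrightarrow> \<exists>p. dominating_slope W (cball z0 \<rho>) z p"
proof -
  have contW: "continuous_on UNIV W" by (rule semiconvex_continuous[OF sc])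
  let ?S = "cball z0 \<rho> - ball z0 (\<rho> / 4)"
  obtain b :: 'a where b: "b \<in> Basis" using nonempty_Basis by blast
  have "z0 + \<rho> *\<^sub>R b \<in> ?S" using b \<rho> by (simp add: dist_norm)
  moreover have "compact ?S" by (intro compact_diff) auto
  ultimately obtain s where s: "s \<in> ?S" "\<And>z. z \<in> ?S \<Longrightarrow> W z \<le> W s"
    using continuous_attains_sup[of ?S W] continuous_on_subset[OF contW] by blast
  \<comment> \<open>Over the ball a tilt by \<delta> changes W by at most half of the gap between W
    z0 and the maximum over the outer shell.\<close>
  define \<delta> where "\<delta> = (W z0 - W s) / (2 * \<rho>)"
  have "W s < W z0" using s(1) \<rho> by (intro strict) auto
  then have \<delta>: "\<delta> > 0" "\<delta> * \<rho> < W z0 - W s" using \<rho> by (auto simp: \<delta>_def field_simps)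
  \<comment> \<open>Pairs of a contact point and a bounded slope; the bound makes Z compact, and
    with it the projection A.\<close>
  define Z where "Z = (cball z0 (\<rho> / 4) \<times> cball 0 \<delta>) \<inter>
    (\<Inter>w\<in>cball z0 \<rho>. {zp. W w \<le> W (fst zp) + snd zp \<bullet> (w - fst zp)})"
  define A where "A = fst ` Z"
  have cW: "continuous_on UNIV (\<lambda>zp. W (fst zp))"
    by (rule continuous_on_compose2[OF contW]) (auto intro!: continuous_intros)
  have "closed (\<Inter>w\<in>cball z0 \<rho>. {zp. W w \<le> W (fst zp) + snd zp \<bullet> (w - fst zp)})"
    by (intro closed_INT ballI closed_Collect_le continuous_intros cW)
  then have "compact Z" unfolding Z_def by (intro compact_Int_closed compact_Times) auto
  then have A_comp: "compact A" unfolding A_def by (intro compact_continuous_image) (auto intro!: continuous_intros)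
  have A_iff: "z \<in> A \<longleftrightarrow> z \<in> cball z0 (\<rho> / 4) \<and> (\<exists>p. norm p \<le> \<delta> \<and> dominating_slope W (cball z0 \<rho>) z p)" for z
    by (force simp: A_def Z_def dominating_slope_def image_iff)
  have ex: "\<exists>z\<in>cball z0 (\<rho> / 4). dominating_slope W (cball z0 \<rho>) z p" if p: "norm p \<le> \<delta>" for p
  proof -
    have "continuous_on (cball z0 \<rho>) (\<lambda>w. W w - p \<bullet> (w - z0))"
      by (intro continuous_intros continuous_on_subset[OF contW]) auto
    then obtain z where z: "z \<in> cball z0 \<rho>" "\<And>w. w \<in> cball z0 \<rho> \<Longrightarrow> W w - p \<bullet> (w - z0) \<le> W z - p \<bullet> (z - z0)"
      using continuous_attains_sup[of "cball z0 \<rho>" "\<lambda>w. W w - p \<bullet> (w - z0)"] \<rho> by auto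
    have "z \<in> ball z0 (\<rho> / 4)"
    proof (rule ccontr)
      assume "z \<notin> ball z0 (\<rho> / 4)"
      then have "W z \<le> W s" using z(1) by (intro s(2)) auto
      moreover have "- (p \<bullet> (z - z0)) \<le> norm p * norm (z - z0)"
        using Cauchy_Schwarz_ineq2[of p "z - z0"] by linarith
      moreover have "norm p * norm (z - z0) \<le> \<delta> * \<rho>"
        using p z(1) \<delta>(1) by (intro mult_mono) (auto simp: dist_norm norm_minus_commute)
      ultimately show False using z(2)[of z0] \<rho> \<delta>(2) by simp
    qed
    moreover have "dominating_slope W (cball z0 \<rho>) z p"
      unfolding dominating_slope_def
    proof
      fix w assume "w \<in> cball z0 \<rho>"
      from z(2)[OF this] show "W w \<le> W z + p \<bullet> (w - z)" by (simp add: inner_diff_right)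
    qed
    ultimately show ?thesis by (intro bexI[of _ z]) auto
  qed
  have "\<not> negligible A"
  proof
    assume neg: "negligible A"
    obtain P where P: "\<And>z. z \<in> A \<Longrightarrow> dominating_slope W (cball z0 \<rho>) z (P z)"
      using A_iff by metis
    have "negligible (P ` A)"
    proof (rule negligible_locally_Lipschitz_image[OF _ neg])
      fix x assume x: "x \<in> A"
      have "norm (P y - P x) \<le> 2 * K * norm (y - x)" if "y \<in> A" for y
        by (rule dominating_slopes_Lipschitz[OF sc P[OF x] P[OF that]]) (use x that A_iff \<rho> in auto)
      then show "\<exists>T B. open T \<and> x \<in> T \<and> (\<forall>y\<in>A \<inter> T. norm (P y - P x) \<le> B * norm (y - x))"
        by (intro exI[of _ UNIV] exI[of _ "2 * K"]) auto
    qed simp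
    moreover have "ball 0 \<delta> \<subseteq> P ` A"
    proof
      fix p :: 'a assume "p \<in> ball 0 \<delta>"
      then have p: "norm p \<le> \<delta>" by simp
      then obtain z where z: "z \<in> cball z0 (\<rho> / 4)" "dominating_slope W (cball z0 \<rho>) z p" using ex by blast
      then have zA: "z \<in> A" using A_iff p by blast
      have "norm (p - P z) \<le> 2 * K * norm (z - z)"
        by (rule dominating_slopes_Lipschitz[OF sc P[OF zA] z(2)]) (use z \<rho> in auto)
      then show "p \<in> P ` A" using zA by auto
    qed
    ultimately have "negligible (ball (0::'a) \<delta>)" by (rule negligible_subset)
    then show False using open_not_negligible[of "ball (0::'a) \<delta>"] \<delta> by simp
  qed
  then show ?thesis using that[OF A_comp] A_iff by blast
qed

text \<open>At a contact point the symmetric second differences of W are nonpositive. At a density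
  point of the contact set, contact points become dense on the scale of the zoom, so the limit has
  nonpositive second differences everywhere; semiconvexity bounds them from below, and a further
  blow-up makes the limit quadratic.\<close>

theorem blowup_at_strict_max:
  fixes W :: "'a::euclidean_space \<Rightarrow> real"
  assumes sc: "semiconvex K W" and "K \<ge> 0" and \<rho>: "\<rho> > 0"
    and strict: "\<And>z. z \<in> cball z0 \<rho> \<Longrightarrow> z \<noteq> z0 \<Longrightarrow> W z < W z0"
  obtains T m where "finite T" "(\<lambda>z. \<Sum>b\<in>T. m b * (b \<bullet> z)\<^sup>2) \<in> blowups W (ball z0 \<rho>)"
    "\<And>z. (\<Sum>b\<in>T. m b * (b \<bullet> z)\<^sup>2) \<le> 0"
proof -
  obtain A where A: "compact A" "\<not> negligible A" "A \<subseteq> cball z0 (\<rho> / 4)"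
    "\<And>z. z \<in> A \<Longrightarrow> \<exists>p. dominating_slope W (cball z0 \<rho>) z p"
    using contact_set_nonnegligible[OF sc \<rho> strict] by blast
  define B where "B = {g \<in> blowups W (ball z0 \<rho>). continuous_on UNIV g \<and>
    (\<forall>x h. - K * (norm h)\<^sup>2 \<le> diff2 g x h \<and> diff2 g x h \<le> 0)}"
  have "blowup_closed B"
    unfolding blowup_closed_def
  proof (intro conjI allI ballI impI)
    fix f c p and r :: real assume f: "f \<in> B" and r: "r > 0"
    have "- K * (norm h)\<^sup>2 \<le> diff2 (renorm f c r p) x h \<and> diff2 (renorm f c r p) x h \<le> 0" for x h
    proof -
      have "- K * (norm (r *\<^sub>R h))\<^sup>2 / r\<^sup>2 \<le> diff2 f (c + r *\<^sub>R x) (r *\<^sub>R h) / r\<^sup>2 \<and> diff2 f (c + r *\<^sub>R x) (r *\<^sub>R h) / r\<^sup>2 \<le> 0 / r\<^sup>2"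
        using f unfolding B_def mem_Collect_eq by (intro conjI divide_right_mono zero_le_power2) blast+
      then show ?thesis using r by (simp add: diff2_renorm power_mult_distrib)
    qed
    then show "renorm f c r p \<in> B"
      using f r by (simp add: B_def blowups_renorm continuous_on_renorm)
  next
    fix F g assume F: "\<forall>n. F n \<in> B" and lim: "\<forall>C. compact C \<longrightarrow> uniform_limit C F g sequentially"
    have lim1: "(\<lambda>n. F n z) \<longlonglongrightarrow> g z" for z
      using tendsto_uniform_limitI[OF lim[rule_format, of "{z}"]] by simp
    have l: "(\<lambda>n. diff2 (F n) x h) \<longlonglongrightarrow> diff2 g x h" for x h
      unfolding diff2_def by (intro tendsto_intros lim1)
    have "continuous_on (ball 0 R) g" for R
    proof (rule uniform_limit_theorem)
      show "uniform_limit (ball 0 R) F g sequentially"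
        by (rule uniform_limit_on_subset[OF lim[rule_format, OF compact_cball]]) (rule ball_subset_cball)
      show "\<forall>\<^sub>F n in sequentially. continuous_on (ball 0 R) (F n)"
      proof (intro always_eventually allI)
        fix n
        have "continuous_on UNIV (F n)" using F by (simp add: B_def)
        then show "continuous_on (ball 0 R) (F n)" by (rule continuous_on_subset) simp
      qed
    qed simp
    then have "continuous_on (\<Union>R. ball 0 R) g" by (intro continuous_on_open_UN) auto
    moreover have "(\<Union>R. ball (0::'a) R) = UNIV" by (auto intro: gt_ex)
    moreover have "g \<in> blowups W (ball z0 \<rho>)" 
    proof (rule blowups_limit)
      show "F n \<in> blowups W (ball z0 \<rho>)" for n using F by (simp add: B_def)
      show "uniform_limit C F g sequentially" if "compact C" for C using lim that by simp
    qed
    moreover have "- K * (norm h)\<^sup>2 \<le> diff2 g x h" for x h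
      using l by (rule tendsto_lowerbound) (use F in \<open>auto simp: B_def\<close>)
    moreover have "diff2 g x h \<le> 0" for x h
      using l by (rule tendsto_upperbound) (use F in \<open>auto simp: B_def\<close>)
    ultimately show "g \<in> B" by (simp add: B_def)
  qed
  \<comment> \<open>Closedness of B is formal; the substance of the proof is this one member of
    B.\<close>
  moreover have "B \<noteq> {}"
  proof -
    \<comment> \<open>With d = 2 (n + 1) r, a distance \<epsilon> d becomes 2 (n + 1) \<epsilon>
      after a zoom by 1 / r; this is at most 1 / (n + 1) by the choice of \<epsilon>.\<close>
    define \<epsilon> where "\<epsilon> n = 1 / (2 * (real n + 1)\<^sup>2 + 1)" for n :: nat
    have \<epsilon>: "0 < \<epsilon> n" "\<epsilon> n < 1" "\<epsilon> n \<le> 1 / 2" "2 * (real n + 1) * \<epsilon> n \<le> 1 / (real n + 1)" for n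
    proof -
      have "(real n + 1)\<^sup>2 \<ge> 1" by (simp add: power2_eq_square algebra_simps)
      then have D: "2 * (real n + 1)\<^sup>2 + 1 \<ge> 3" by linarith
      have "1 / (2 * (real n + 1)\<^sup>2 + 1) \<le> 1 / 3" "1 / (2 * (real n + 1)\<^sup>2 + 1) > 0"
        using D by (intro frac_le divide_pos_pos; linarith)+
      then show "0 < \<epsilon> n" "\<epsilon> n < 1" "\<epsilon> n \<le> 1 / 2" unfolding \<epsilon>_def by linarith+
      show "2 * (real n + 1) * \<epsilon> n \<le> 1 / (real n + 1)"
      proof -
        have gen: "2 * a * (1 / d) \<le> 1 / a" if "a > 0" "d > 0" "2 * a * a \<le> d" for a d :: real
          using that by (simp add: field_simps)
        show ?thesis unfolding \<epsilon>_def
        proof (rule gen)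
          show "0 < 2 * (real n + 1)\<^sup>2 + 1" using D by linarith
          show "2 * (real n + 1) * (real n + 1) \<le> 2 * (real n + 1)\<^sup>2 + 1"
            unfolding power2_eq_square by linarith
        qed simp
      qed
    qed
    \<comment> \<open>Each hole size comes with its own point, so the centre of the zoom moves with
      n; \<open>blowups\<close> allows this.\<close>
    have "\<exists>x d0. x \<in> A \<and> d0 > 0 \<and> (\<forall>d y. 0 < d \<longrightarrow> d < d0 \<longrightarrow> ball y (\<epsilon> n * d) \<subseteq> ball x d \<longrightarrow> ball y (\<epsilon> n * d) \<inter> A \<noteq> {})" for n
      using dense_at_point_of_nonnegligible[OF A(1,2) \<epsilon>(1,2)[of n]] by (metis (full_types))
    then obtain x d0 where x: "\<And>n. x n \<in> A" "\<And>n. d0 n > 0"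
      "\<And>n d y. 0 < d \<Longrightarrow> d < d0 n \<Longrightarrow> ball y (\<epsilon> n * d) \<subseteq> ball (x n) d \<Longrightarrow> ball y (\<epsilon> n * d) \<inter> A \<noteq> {}"
      by metis
    obtain p where p: "\<And>n. dominating_slope W (cball z0 \<rho>) (x n) (p n)"
      using A(4)[OF x(1)] by metis
    \<comment> \<open>Small enough for the density statement to apply at distance 2 (n + 1) r, twice
      the radius of the zoomed ball of radius n + 1, and tending to zero.\<close>
    define r where "r n = min (d0 n / 2) 1 / (2 * (real n + 1)\<^sup>2)" for n
    have r: "r n > 0" "2 * (real n + 1) * r n < d0 n" "r n \<le> 1 / (real n + 1)" for n
    proof -
      show "r n > 0" using x(2)[of n] by (auto simp: r_def intro!: divide_pos_pos)
      have "2 * (real n + 1) * r n = min (d0 n / 2) 1 / (real n + 1)"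
      proof -
        have gen: "2 * a * (m / (2 * a\<^sup>2)) = m / a" if "a > 0" for a m :: real
          using that by (simp add: power2_eq_square)
        show ?thesis unfolding r_def by (rule gen) simp
      qed
      also have "\<dots> \<le> (d0 n / 2) / 1" using x(2)[of n] by (intro frac_le) auto
      finally show "2 * (real n + 1) * r n < d0 n" using x(2)[of n] by simp
      have "r n \<le> 1 / (2 * (real n + 1)\<^sup>2)" unfolding r_def by (intro divide_right_mono) auto
      also have "\<dots> \<le> 1 / (real n + 1)" by (rule frac_le) (simp_all add: power2_eq_square algebra_simps)
      finally show "r n \<le> 1 / (real n + 1)" .
    qed
    have r0: "r \<longlonglongrightarrow> 0"
    proof (rule tendsto_sandwich[OF _ _ tendsto_const LIMSEQ_inverse_real_of_nat])
      show "\<forall>\<^sub>F n in sequentially. 0 \<le> r n" by (intro always_eventually allI less_imp_le r(1))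
      show "\<forall>\<^sub>F n in sequentially. r n \<le> inverse (real (Suc n))"
        using r(3) by (intro always_eventually allI) (simp add: inverse_eq_divide add.commute)
    qed
    have xcb: "x n \<in> cball z0 (\<rho> / 4)" for n using x(1) A(3) by blast
    have inS: "x n + r n *\<^sub>R z \<in> cball z0 \<rho>" if "norm z * r n \<le> \<rho> / 2" for n z
    proof -
      have "dist z0 (x n + r n *\<^sub>R z) \<le> dist z0 (x n) + norm (r n *\<^sub>R z)"
        using dist_triangle[of z0 "x n + r n *\<^sub>R z" "x n"] by (simp add: dist_norm)
      then show ?thesis using xcb[of n] that r(1)[of n] \<rho> by (simp add: mult.commute)
    qed
    have evsmall: "\<forall>\<^sub>F n in sequentially. R * r n < e" if "e > 0" for R e
    proof -
      have "(\<lambda>n. R * r n) \<longlonglongrightarrow> R * 0" by (intro tendsto_intros r0)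
      then show ?thesis using order_tendstoD(2)[of _ 0 _ e] that by simp
    qed
    define F where "F n = renorm W (x n) (r n) (p n)" for n
    have F_sc: "semiconvex K (F n)" for n
      unfolding semiconvex_iff_diff2 F_def
    proof (intro conjI allI continuous_on_renorm semiconvex_continuous[OF sc])
      fix y h
      have "- K * (norm (r n *\<^sub>R h))\<^sup>2 / (r n)\<^sup>2 \<le> diff2 W (x n + r n *\<^sub>R y) (r n *\<^sub>R h) / (r n)\<^sup>2"
        using sc unfolding semiconvex_iff_diff2 by (intro divide_right_mono zero_le_power2) blast
      then show "- K * (norm h)\<^sup>2 \<le> diff2 (renorm W (x n) (r n) (p n)) y h"
        using r(1)[of n] by (simp add: diff2_renorm power_mult_distrib)
    qed
    have F_le: "F n z \<le> 0" if "norm z * r n \<le> \<rho> / 2" for n z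
      using p[of n, unfolded dominating_slope_def, rule_format, OF inS[OF that]]
      by (simp add: F_def renorm_def divide_le_0_iff)
    have F_ge: "- (K / 2 * (norm z)\<^sup>2) \<le> F n z" for n z
    proof -
      have "x n \<in> interior (cball z0 \<rho>)" using xcb[of n] \<rho> by simp
      from dominating_slope_lower[OF sc p this, of "x n + r n *\<^sub>R z"]
      have "- (K / 2 * (r n)\<^sup>2 * (norm z)\<^sup>2) \<le> W (x n + r n *\<^sub>R z) - W (x n) - r n * (p n \<bullet> z)"
        by (simp add: power_mult_distrib algebra_simps)
      from divide_right_mono[OF this, of "(r n)\<^sup>2"] show ?thesis
        using r(1)[of n] by (simp add: F_def renorm_def)
    qed
    obtain g \<sigma> where g: "strict_mono (\<sigma> :: nat \<Rightarrow> nat)" "semiconvex K g" "continuous_on UNIV g"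
      "\<And>C. compact C \<Longrightarrow> uniform_limit C (\<lambda>n. F (\<sigma> n)) g sequentially"
    proof (rule semiconvex_Ascoli[of K F, OF F_sc])
      fix R :: real
      have "\<forall>\<^sub>F n in sequentially. \<bar>R\<bar> * r n < \<rho> / 2" using evsmall[of "\<rho> / 2"] \<rho> by simp
      then have "\<forall>\<^sub>F n in sequentially. \<forall>x. norm x \<le> R \<longrightarrow> \<bar>F n x\<bar> \<le> K / 2 * R\<^sup>2"
      proof eventually_elim
        case (elim n)
        show ?case
        proof (intro allI impI)
          fix z :: 'a assume z: "norm z \<le> R"
          then have "norm z * r n \<le> \<bar>R\<bar> * r n" using r(1)[of n] by (intro mult_right_mono) auto
          then have "F n z \<le> 0" using elim by (intro F_le) simp
          moreover have "K / 2 * (norm z)\<^sup>2 \<le> K / 2 * R\<^sup>2"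
            using z \<open>K \<ge> 0\<close> by (intro mult_left_mono power_mono) auto
          ultimately show "\<bar>F n z\<bar> \<le> K / 2 * R\<^sup>2" using F_ge[of z n] by linarith
        qed
      qed
      then show "\<exists>B. \<forall>\<^sub>F n in sequentially. \<forall>x. norm x \<le> R \<longrightarrow> \<bar>F n x\<bar> \<le> B" by blast
    qed blast
    have sub: "filterlim \<sigma> sequentially sequentially" by (rule filterlim_subseq[OF g(1)])
    have "g \<in> blowups W (ball z0 \<rho>)"
      unfolding blowups_def mem_Collect_eq
    proof (intro allI impI)
      fix R e :: real assume R: "R > 0" and e: "e > 0"
      have "\<forall>\<^sub>F n in sequentially. \<forall>z\<in>cball 0 R. dist (F (\<sigma> n) z) (g z) < e"
        using uniform_limitD[OF g(4)[OF compact_cball] e] .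
      moreover have "\<forall>\<^sub>F n in sequentially. R * r (\<sigma> n) < \<rho> / 2" "\<forall>\<^sub>F n in sequentially. 1 * r (\<sigma> n) < e"
        using evsmall[of "\<rho> / 2" R, THEN eventually_compose_filterlim[OF _ sub]]
          evsmall[of e 1, THEN eventually_compose_filterlim[OF _ sub]] \<rho> e by auto
      ultimately have "\<forall>\<^sub>F n in sequentially. \<exists>c r p. 0 < r \<and> r < e \<and> ball c (R * r) \<subseteq> ball z0 \<rho> \<and> (\<forall>z. norm z < R \<longrightarrow> \<bar>renorm W c r p z - g z\<bar> \<le> e)"
      proof eventually_elim
        case (elim n)
        have "ball (x (\<sigma> n)) (R * r (\<sigma> n)) \<subseteq> ball z0 \<rho>"
        proof
          fix y assume "y \<in> ball (x (\<sigma> n)) (R * r (\<sigma> n))"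
          then have "dist (x (\<sigma> n)) y < R * r (\<sigma> n)" by simp
          moreover have "dist z0 (x (\<sigma> n)) \<le> \<rho> / 4" using xcb[of "\<sigma> n"] by simp
          ultimately have "dist z0 y < \<rho>"
            using dist_triangle[of z0 y "x (\<sigma> n)"] elim(2) \<rho> by linarith
          then show "y \<in> ball z0 \<rho>" by simp
        qed
        moreover have "\<bar>F (\<sigma> n) z - g z\<bar> \<le> e" if "norm z < R" for z
          using elim(1) that by (auto simp: dist_real_def intro: less_imp_le)
        ultimately show ?case using r(1) elim(3)
          by (intro exI[of _ "x (\<sigma> n)"] exI[of _ "r (\<sigma> n)"] exI[of _ "p (\<sigma> n)"]) (auto simp: F_def)
      qed
      then show "\<exists>c r p. 0 < r \<and> r < e \<and> ball c (R * r) \<subseteq> ball z0 \<rho> \<and> (\<forall>z. norm z < R \<longrightarrow> \<bar>renorm W c r p z - g z\<bar> \<le> e)"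
        using eventually_happens'[OF sequentially_bot] by blast
    qed
    moreover have "diff2 g w h \<le> 0" for w h
    proof -
      \<comment> \<open>Every fixed w is a limit of zoomed contact points, since the ball about it
        of relative size \<open>\<epsilon> n\<close> meets A.\<close>
      have "\<exists>z. norm w \<le> real n + 1 \<longrightarrow> (norm (z - w) \<le> 1 / (real n + 1) \<and> x n + r n *\<^sub>R z \<in> A)" for n
      proof (cases "norm w \<le> real n + 1")
        case True
        define d where "d = 2 * (real n + 1) * r n"
        have d: "0 < d" "d < d0 n" using r(1)[of n] r(2)[of n] by (auto simp: d_def)
        have "ball (x n + r n *\<^sub>R w) (\<epsilon> n * d) \<subseteq> ball (x n) d"
        proof
          fix y assume y: "y \<in> ball (x n + r n *\<^sub>R w) (\<epsilon> n * d)"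
          have "\<epsilon> n * d \<le> 1 / 2 * d" using \<epsilon>(3)[of n] d by (intro mult_right_mono) auto
          moreover have "r n * norm w \<le> r n * (real n + 1)" using True r(1)[of n] by (intro mult_left_mono) auto
          moreover have "dist (x n) y \<le> r n * norm w + dist (x n + r n *\<^sub>R w) y"
            using dist_triangle[of "x n" y "x n + r n *\<^sub>R w"] r(1)[of n] by (simp add: dist_norm)
          moreover have "r n * (real n + 1) = d / 2" by (simp add: d_def)
          moreover have "dist (x n + r n *\<^sub>R w) y < \<epsilon> n * d" using y by simp
          ultimately have "dist (x n) y < d" by linarith
          then show "y \<in> ball (x n) d" by simp
        qed
        then obtain a where a: "a \<in> ball (x n + r n *\<^sub>R w) (\<epsilon> n * d)" "a \<in> A" using x(3)[OF d] by blast
        define z where "z = (a - x n) /\<^sub>R r n"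
        have az: "a = x n + r n *\<^sub>R z" using r(1)[of n] by (simp add: z_def)
        have "norm (r n *\<^sub>R (z - w)) \<le> \<epsilon> n * d" using a(1)
          by (simp add: az dist_norm norm_minus_commute scaleR_diff_right)
        then have "r n * norm (z - w) \<le> \<epsilon> n * d" using r(1)[of n] by simp
        also have "\<epsilon> n * d = r n * (2 * (real n + 1) * \<epsilon> n)" by (simp add: d_def)
        finally have "norm (z - w) \<le> 2 * (real n + 1) * \<epsilon> n" using r(1)[of n] by simp
        then have "norm (z - w) \<le> 1 / (real n + 1)" using \<epsilon>(4)[of n] by linarith
        then show ?thesis using a(2) az by blast
      qed blast
      then obtain z where z: "\<And>n. norm w \<le> real n + 1 \<Longrightarrow> norm (z n - w) \<le> 1 / (real n + 1)"
        "\<And>n. norm w \<le> real n + 1 \<Longrightarrow> x n + r n *\<^sub>R z n \<in> A" by metis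
      have evw: "\<forall>\<^sub>F n in sequentially. norm w \<le> real n + 1"
      proof -
        obtain N :: nat where "norm w \<le> real N" using real_arch_simple by blast
        then show ?thesis by (intro eventually_sequentiallyI[of N]) (smt (verit) of_nat_mono)
      qed
      have "(\<lambda>n. z n - w) \<longlonglongrightarrow> 0"
      proof (rule Lim_null_comparison[OF _ LIMSEQ_inverse_real_of_nat])
        show "\<forall>\<^sub>F n in sequentially. norm (z n - w) \<le> inverse (real (Suc n))"
          using evw by eventually_elim (use z(1) in \<open>auto simp: inverse_eq_divide add.commute\<close>)
      qed
      then have zw: "z \<longlonglongrightarrow> w" using Lim_null by blast
      have zs: "(\<lambda>n. z (\<sigma> n)) \<longlonglongrightarrow> w" using filterlim_compose[OF zw sub] .
      have T: "(\<lambda>n. F (\<sigma> n) (z (\<sigma> n) + k)) \<longlonglongrightarrow> g (w + k)" for k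
        using g(4) by (intro tendsto_unif_compact[OF _ open_UNIV g(3)] tendsto_intros zs) auto
      have "(\<lambda>n. F (\<sigma> n) (z (\<sigma> n) + h) + F (\<sigma> n) (z (\<sigma> n) - h) - 2 * F (\<sigma> n) (z (\<sigma> n))) \<longlonglongrightarrow> diff2 g w h"
        unfolding diff2_def using T[of h] T[of "-h"] T[of 0] by (intro tendsto_intros) auto
      moreover have "\<forall>\<^sub>F n in sequentially. F n (z n + h) + F n (z n - h) - 2 * F n (z n) \<le> 0"
        using evw evsmall[OF half_gt_zero[OF \<rho>], of "norm w + 1 + norm h"]
      proof eventually_elim
        case (elim n)
        obtain q where q: "dominating_slope W (cball z0 \<rho>) (x n + r n *\<^sub>R z n) q"
          using A(4) z(2) elim(1) by blast
        have "1 / (real n + 1) \<le> 1" by simp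
        then have nz: "norm (z n) \<le> norm w + 1"
          using z(1)[OF elim(1)] norm_triangle_ineq2[of "z n" w] by linarith
        have nk: "norm (z n + k) * r n \<le> \<rho> / 2" if "norm k \<le> norm h" for k
        proof -
          have "norm (z n + k) \<le> norm w + 1 + norm h" using nz that norm_triangle_ineq[of "z n" k] by linarith
          then have "norm (z n + k) * r n \<le> (norm w + 1 + norm h) * r n" using r(1)[of n] by (intro mult_right_mono) auto
          then show ?thesis using elim(2) \<rho> by simp
        qed
        have "W (x n + r n *\<^sub>R (z n + k)) \<le> W (x n + r n *\<^sub>R z n) + q \<bullet> (r n *\<^sub>R k)" if "norm k \<le> norm h" for k
          using q inS[OF nk[OF that]] unfolding dominating_slope_def by (force simp: algebra_simps)
        from this[of h] this[of "-h"] have "diff2 W (x n + r n *\<^sub>R z n) (r n *\<^sub>R h) \<le> 0"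
          by (simp add: diff2_def algebra_simps)
        then have "diff2 (F n) (z n) h \<le> 0" by (simp add: F_def diff2_renorm divide_le_0_iff)
        then show ?case by (simp add: diff2_def)
      qed
      then have "\<forall>\<^sub>F n in sequentially. F (\<sigma> n) (z (\<sigma> n) + h) + F (\<sigma> n) (z (\<sigma> n) - h) - 2 * F (\<sigma> n) (z (\<sigma> n)) \<le> 0"
        by (rule eventually_compose_filterlim[OF _ sub])
      ultimately show ?thesis by (rule tendsto_upperbound) simp
    qed
    ultimately have "g \<in> B" using g(2,3) by (simp add: B_def semiconvex_iff_diff2)
    then show ?thesis by blast
  qed
  ultimately obtain T m where Tm: "finite T" "(\<lambda>z. \<Sum>b\<in>T. m b * (b \<bullet> z)\<^sup>2) \<in> B"
    by (rule blowup_quadratic[of B K]) (auto simp: B_def)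
  have "(\<Sum>b\<in>T. m b * (b \<bullet> z)\<^sup>2) \<le> 0" for z
  proof -
    have "diff2 (\<lambda>z. \<Sum>b\<in>T. m b * (b \<bullet> z)\<^sup>2) 0 z \<le> 0" using Tm(2) by (simp add: B_def)
    then show ?thesis by (simp add: diff2_def)
  qed
  then show ?thesis using that Tm by (auto simp: B_def)
qed

section \<open>Viscosity inequalities\<close>

lemma symmetric_mat_inner:
  fixes X :: "real^'n^'n"
  assumes "symmetric_mat X" shows "(X *v a) \<bullet> b = a \<bullet> (X *v b)"
  using assms dot_lmul_matrix[of a X b] unfolding symmetric_mat_def
  by (metis transpose_matrix_vector)

lemma symmetric_matI:
  fixes X :: "real^'n^'n"
  assumes "\<And>a b. (X *v a) \<bullet> b = a \<bullet> (X *v b)" shows "symmetric_mat X"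
proof -
  have "transpose X *v a = X *v a" for a
    by (subst vector_eq_rdot[symmetric]) (simp add: dot_lmul_matrix assms)
  then show ?thesis unfolding symmetric_mat_def by (metis matrix_eq)
qed

lemma matrix_vector_mult_sums:
  fixes A B :: "real^'n^'n"
  shows "(A - B) *v x = A *v x - B *v x" "(- A) *v x = - (A *v x)" "(c *\<^sub>R A) *v x = c *\<^sub>R (A *v x)"
proof -
  show "(A - B) *v x = A *v x - B *v x" by (simp add: matrix_vector_mult_diff_rdistrib)
  show "(c *\<^sub>R A) *v x = c *\<^sub>R (A *v x)" by (simp add: scaleR_matrix_vector_assoc)
  show "(- A) *v x = - (A *v x)" using scaleR_matrix_vector_assoc[of "-1" A x] by simp
qed

lemmas mvm_simps = matrix_vector_mult_sums matrix_vector_mult_add_rdistrib matrix_vector_right_distrib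
  matrix_vector_mult_diff_distrib matrix_vector_mult_scaleR matrix_vector_mul_lid

lemma symmetric_mat_ops:
  fixes A B :: "real^'n^'n"
  shows "symmetric_mat A \<Longrightarrow> symmetric_mat B \<Longrightarrow> symmetric_mat (A + B)"
    "symmetric_mat A \<Longrightarrow> symmetric_mat B \<Longrightarrow> symmetric_mat (A - B)"
    "symmetric_mat A \<Longrightarrow> symmetric_mat (- A)"
    "symmetric_mat A \<Longrightarrow> symmetric_mat (c *\<^sub>R A)"
    "symmetric_mat (mat 1 :: real^'n^'n)" "symmetric_mat (0 :: real^'n^'n)"
  by (auto simp: symmetric_mat_def transpose_def vec_eq_iff mat_def)

lemma trace_ops:
  fixes A B :: "real^'n^'n"
  shows "trace (A + B) = trace A + trace B" "trace (c *\<^sub>R A) = c * trace A"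
    "trace (mat 1 :: real^'n^'n) = real CARD('n)"
  by (simp_all add: trace_def sum.distrib sum_distrib_left mat_def)

text \<open>The trace may be computed in an orthonormal basis containing e, where all diagonal
  entries are nonnegative.\<close>

lemma trace_ge_quadratic_form:
  fixes N :: "real^'n^'n"
  assumes N: "nonneg_definite N" and e: "norm e = 1"
  shows "e \<bullet> (N *v e) \<le> trace N"
proof -
  have "\<exists>B. pairwise orthogonal B \<and> e \<in> B \<and> (\<forall>x\<in>B. norm x = 1) \<and> independent B \<and> card B = CARD('n) \<and> span B = UNIV"
    using vector_in_orthonormal_basis[of e] e by (metis DIM_cart DIM_real mult.right_neutral)
  then obtain B :: "(real^'n) set" where B: "pairwise orthogonal B" "e \<in> B" "\<And>x. x \<in> B \<Longrightarrow> norm x = 1"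
    "card B = CARD('n)" "independent B" "span B = UNIV" by blast
  have fin: "finite B" using B(5) independent_imp_finite by blast
  have expand: "x = (\<Sum>b\<in>B. (b \<bullet> x) *\<^sub>R b)" for x
    using orthonormal_basis_expand[OF B(1,3) _ fin, of x] B(6) by (simp add: inner_commute)
  have "trace N = (\<Sum>i\<in>UNIV. axis i 1 \<bullet> (N *v axis i 1))"
    by (simp add: trace_def inner_axis' matrix_vector_mul_component inner_axis row_def)
  also have "\<dots> = (\<Sum>i\<in>UNIV. \<Sum>b\<in>B. (b \<bullet> axis i 1) * (b \<bullet> (N *v axis i 1)))"
  proof (rule sum.cong[OF refl])
    fix i
    show "axis i 1 \<bullet> (N *v axis i 1) = (\<Sum>b\<in>B. (b \<bullet> axis i 1) * (b \<bullet> (N *v axis i 1)))"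
      by (subst (1) expand[of "axis i 1"]) (simp add: inner_sum_left)
  qed
  also have "\<dots> = (\<Sum>b\<in>B. \<Sum>i\<in>UNIV. (b \<bullet> axis i 1) * ((N *v b) \<bullet> axis i 1))"
    using N by (subst sum.swap) (simp add: nonneg_definite_def symmetric_mat_inner)
  also have "\<dots> = (\<Sum>b\<in>B. b \<bullet> (N *v b))"
  proof (rule sum.cong[OF refl])
    fix b
    have "(\<Sum>i\<in>UNIV. (b \<bullet> axis i 1) * ((N *v b) \<bullet> axis i 1)) = (\<Sum>i\<in>UNIV. b $ i * (N *v b) $ i)"
      by (simp add: inner_axis)
    also have "\<dots> = b \<bullet> (N *v b)" by (simp add: inner_vec_def)
    finally show "(\<Sum>i\<in>UNIV. (b \<bullet> axis i 1) * ((N *v b) \<bullet> axis i 1)) = b \<bullet> (N *v b)" .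
  qed
  also have "\<dots> \<ge> e \<bullet> (N *v e)"
    by (rule member_le_sum[OF B(2) _ fin]) (use N in \<open>auto simp: nonneg_definite_def\<close>)
  finally show ?thesis .
qed

lemma uniformly_elliptic_add:
  fixes F :: "real^'n^'n \<Rightarrow> real"
  assumes "uniformly_elliptic lam Lam F" "symmetric_mat M" "nonneg_definite P"
  shows "F M - Lam * trace P \<le> F (M + P)" "F (M + P) \<le> F M - lam * trace P"
proof -
  have "symmetric_mat (M + P)" using assms by (auto simp: nonneg_definite_def intro: symmetric_mat_ops)
  then have "lam * trace P \<le> F (M + P - P) - F (M + P) \<and> F (M + P - P) - F (M + P) \<le> Lam * trace P"
    using assms unfolding uniformly_elliptic_def by blast
  then show "F M - Lam * trace P \<le> F (M + P)" "F (M + P) \<le> F M - lam * trace P" by simp_all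
qed

lemma nonneg_definite_scal: "c \<ge> 0 \<Longrightarrow> nonneg_definite (c *\<^sub>R mat 1 :: real^'n^'n)"
  by (simp add: nonneg_definite_def symmetric_mat_ops mvm_simps)

lemma uniformly_elliptic_add_scal:
  fixes M :: "real^'n^'n"
  assumes "uniformly_elliptic lam Lam F" "symmetric_mat M" "c \<ge> 0"
  shows "F M \<le> F (M + c *\<^sub>R mat 1) + Lam * (c * real CARD('n))"
  using uniformly_elliptic_add(1)[OF assms(1,2) nonneg_definite_scal[OF assms(3)]] by (simp add: trace_ops)

lemma dual_dual [simp]: "dual_operator (dual_operator F) = F"
  by (simp add: dual_operator_def fun_eq_iff)

lemma uniformly_elliptic_dual:
  fixes F :: "real^'n^'n \<Rightarrow> real"
  assumes "uniformly_elliptic lam Lam F" shows "uniformly_elliptic lam Lam (dual_operator F)"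
  unfolding uniformly_elliptic_def
proof (intro conjI allI impI)
  fix M N :: "real^'n^'n" assume "symmetric_mat M" "nonneg_definite N"
  from uniformly_elliptic_add[OF assms symmetric_mat_ops(3)[OF this(1)] this(2)]
  show "lam * trace N \<le> dual_operator F (M - N) - dual_operator F M"
    "dual_operator F (M - N) - dual_operator F M \<le> Lam * trace N"
    by (simp_all add: dual_operator_def)
qed (use assms in \<open>auto simp: uniformly_elliptic_def\<close>)

text \<open>Touching from above by quadratic polynomials suffices for all that follows, and is preserved by
  rescaling and subtraction of affine functions without any regularity bookkeeping.\<close>

definition qsub :: "(real^'n^'n \<Rightarrow> real) \<Rightarrow> (real^'n) set \<Rightarrow> (real^'n \<Rightarrow> real) \<Rightarrow> bool" where
  "qsub F S u \<longleftrightarrow> (\<forall>x\<in>S. \<forall>X p d. symmetric_mat X \<longrightarrow> d > 0 \<longrightarrow>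
     (\<forall>h. norm h < d \<longrightarrow> u (x + h) \<le> u x + p \<bullet> h + h \<bullet> (X *v h) / 2) \<longrightarrow> F X \<le> 0)"

lemma qsubD:
  fixes F :: "real^'n^'n \<Rightarrow> real"
  assumes "qsub F S u" "x \<in> S" "symmetric_mat X" "d > 0"
    "\<And>h. norm h < d \<Longrightarrow> u (x + h) \<le> u x + p \<bullet> h + h \<bullet> (X *v h) / 2"
  shows "F X \<le> 0"
  using assms unfolding qsub_def by blast

lemma qsub_subset: "qsub F S u \<Longrightarrow> T \<subseteq> S \<Longrightarrow> qsub F T u"
  unfolding qsub_def by blast

text \<open>These are the test functions through which the viscosity inequalities enter.\<close>

lemma C2_on_quadratic:
  fixes X :: "real^'n^'n"
  assumes "symmetric_mat X"
  shows "C2_on S (\<lambda>y. p \<bullet> (y - x) + (y - x) \<bullet> (X *v (y - x)) / 2) (\<lambda>y. p + X *v (y - x)) (\<lambda>_. X)"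
  unfolding C2_on_def
proof (intro conjI ballI)
  fix y
  have lin: "((\<lambda>y. X *v (y - x)) has_derivative (\<lambda>h. X *v h)) (at y)"
  proof -
    have "((\<lambda>y. X *v (y - x)) has_derivative (\<lambda>h. X *v (h - 0))) (at y)"
      by (intro bounded_linear.has_derivative[OF matrix_vector_mul_bounded_linear] derivative_intros)
    then show ?thesis by simp
  qed
  have "((\<lambda>y. p \<bullet> (y - x) + (1 / 2) * ((y - x) \<bullet> (X *v (y - x)))) has_derivative
     (\<lambda>h. p \<bullet> (h - 0) + (1 / 2) * ((y - x) \<bullet> (X *v h) + (h - 0) \<bullet> (X *v (y - x))))) (at y)"
    by (intro has_derivative_add has_derivative_mult_right has_derivative_inner lin derivative_intros)
  moreover have "(y - x) \<bullet> (X *v h) = h \<bullet> (X *v (y - x))" for h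
    by (metis assms inner_commute symmetric_mat_inner)
  ultimately show "GDERIV (\<lambda>y. p \<bullet> (y - x) + (y - x) \<bullet> (X *v (y - x)) / 2) y :> p + X *v (y - x)"
    unfolding gderiv_def by (simp add: inner_add_right inner_commute[of p])
  show "((\<lambda>y. p + X *v (y - x)) has_derivative (\<lambda>h. X *v h)) (at y)"
    using has_derivative_add[OF has_derivative_const[of p] lin] by simp
qed (rule continuous_on_const)

lemma qsub_viscosity_subsolution:
  fixes F :: "real^'n^'n \<Rightarrow> real"
  assumes "viscosity_subsolution F S u" shows "qsub F S u"
  unfolding qsub_def
proof (intro ballI allI impI)
  fix x p :: "real^'n" and X :: "real^'n^'n" and d :: real
  assume x: "x \<in> S" and X: "symmetric_mat X" and d: "0 < d"
    and *: "\<forall>h::real^'n. norm h < d \<longrightarrow> u (x + h) \<le> u x + p \<bullet> h + h \<bullet> (X *v h) / 2"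
  let ?f = "\<lambda>y. p \<bullet> (y - x) + (y - x) \<bullet> (X *v (y - x)) / 2"
  have "\<forall>\<^sub>F y in nhds x. y \<in> ball x d" using d by (intro eventually_nhds_in_open) auto
  then have "\<forall>\<^sub>F y in nhds x. u y - ?f y \<le> u x - ?f x"
  proof eventually_elim
    case (elim y)
    then show ?case using *[rule_format, of "y - x"] by (simp add: dist_norm norm_minus_commute)
  qed
  then show "F X \<le> 0"
    using assms C2_on_quadratic[OF X, of S p x] x unfolding viscosity_subsolution_def by blast
qed

lemma qsub_viscosity_supersolution:
  fixes F :: "real^'n^'n \<Rightarrow> real"
  assumes "viscosity_supersolution F S u" shows "qsub (dual_operator F) S (\<lambda>x. - u x)"
  unfolding qsub_def
proof (intro ballI allI impI)
  fix x p :: "real^'n" and X :: "real^'n^'n" and d :: real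
  assume x: "x \<in> S" and X: "symmetric_mat X" and d: "0 < d"
    and *: "\<forall>h::real^'n. norm h < d \<longrightarrow> - u (x + h) \<le> - u x + p \<bullet> h + h \<bullet> (X *v h) / 2"
  let ?f = "\<lambda>y. (- p) \<bullet> (y - x) + (y - x) \<bullet> ((- X) *v (y - x)) / 2"
  have "\<forall>\<^sub>F y in nhds x. y \<in> ball x d" using d by (intro eventually_nhds_in_open) auto
  then have "\<forall>\<^sub>F y in nhds x. u y - ?f y \<ge> u x - ?f x"
  proof eventually_elim
    case (elim y)
    then have "- u y \<le> - u x + p \<bullet> (y - x) + (y - x) \<bullet> (X *v (y - x)) / 2"
      using *[rule_format, of "y - x"] by (simp add: dist_norm norm_minus_commute)
    moreover have "(y - x) \<bullet> ((- X) *v (y - x)) = - ((y - x) \<bullet> (X *v (y - x)))"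
      by (simp add: matrix_vector_mult_sums(2))
    ultimately show ?case by simp
  qed
  then have "F (- X) \<ge> 0"
    using assms C2_on_quadratic[OF symmetric_mat_ops(3)[OF X], of S "- p" x] x
    unfolding viscosity_supersolution_def by blast
  then show "dual_operator F X \<le> 0" by (simp add: dual_operator_def)
qed

text \<open>Since \<open>renorm\<close> preserves Hessians, a polynomial touching the zoom turns
  into one touching u with the same matrix X.\<close>

lemma qsub_renorm:
  fixes F :: "real^'n^'n \<Rightarrow> real"
  assumes "qsub F S u" "r > 0"
  shows "qsub F {\<xi>. c + r *\<^sub>R \<xi> \<in> S} (renorm u c r p)"
  unfolding qsub_def
proof (intro ballI allI impI)
  fix \<xi> q :: "real^'n" and X :: "real^'n^'n" and d :: real
  assume x: "\<xi> \<in> {\<xi>. c + r *\<^sub>R \<xi> \<in> S}" and X: "symmetric_mat X" and d: "0 < d"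
    and *: "\<forall>h::real^'n. norm h < d \<longrightarrow> renorm u c r p (\<xi> + h) \<le> renorm u c r p \<xi> + q \<bullet> h + h \<bullet> (X *v h) / 2"
  show "F X \<le> 0"
  proof (rule qsubD[OF assms(1) _ X])
    show "c + r *\<^sub>R \<xi> \<in> S" using x by simp
    show "r * d > 0" using d assms by simp
    fix k :: "real^'n" assume k: "norm k < r * d"
    define h where "h = k /\<^sub>R r"
    have kh: "k = r *\<^sub>R h" using assms by (simp add: h_def)
    have "norm h < d" using k assms by (simp add: kh)
    then have "r\<^sup>2 * renorm u c r p (\<xi> + h) \<le> r\<^sup>2 * (renorm u c r p \<xi> + q \<bullet> h + h \<bullet> (X *v h) / 2)"
      using * by (intro mult_left_mono) auto
    moreover have R: "r\<^sup>2 * renorm u c r p z = u (c + r *\<^sub>R z) - u c - r * (p \<bullet> z)" for z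
      using assms by (simp add: renorm_def)
    moreover have "c + r *\<^sub>R (\<xi> + h) = c + r *\<^sub>R \<xi> + k" by (simp add: kh scaleR_add_right)
    moreover have "(p + r *\<^sub>R q) \<bullet> k = r * (p \<bullet> (\<xi> + h)) - r * (p \<bullet> \<xi>) + r\<^sup>2 * (q \<bullet> h)"
      "k \<bullet> (X *v k) = r\<^sup>2 * (h \<bullet> (X *v h))"
      by (simp_all add: kh mvm_simps inner_add_left inner_add_right power2_eq_square algebra_simps)
    ultimately show "u (c + r *\<^sub>R \<xi> + k) \<le> u (c + r *\<^sub>R \<xi>) + (p + r *\<^sub>R q) \<bullet> k + k \<bullet> (X *v k) / 2"
      using R[of \<xi>] by (simp add: distrib_left)
  qed
qed

lemma quadratic_recenter:
  fixes X :: "real^'n^'n"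
  assumes "symmetric_mat X"
  shows "p \<bullet> (z + h) + (z + h) \<bullet> (X *v (z + h)) / 2
    = (p \<bullet> z + z \<bullet> (X *v z) / 2) + (p + X *v z) \<bullet> h + h \<bullet> (X *v h) / 2"
proof -
  have "h \<bullet> (X *v z) = (X *v z) \<bullet> h" "z \<bullet> (X *v h) = (X *v z) \<bullet> h"
    using symmetric_mat_inner[OF assms, of z h] by (auto simp: inner_commute)
  then show ?thesis by (simp add: mvm_simps inner_add_left inner_add_right field_simps)
qed

text \<open>Raising the polynomial by a paraboloid of small opening c makes the contact strict, so
  nearby maxima for the approximating functions stay in the interior. The price of c is bounded by
  ellipticity.\<close>

lemma qsub_limit:
  fixes F :: "real^'n^'n \<Rightarrow> real"
  assumes ue: "uniformly_elliptic lam Lam F" and "open S"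
    and qs: "\<And>C. compact C \<Longrightarrow> C \<subseteq> S \<Longrightarrow> \<forall>\<^sub>F n in sequentially. qsub F C (f n) \<and> continuous_on C (f n)"
    and lim: "\<And>C. compact C \<Longrightarrow> C \<subseteq> S \<Longrightarrow> uniform_limit C f u sequentially"
  shows "qsub F S u"
  unfolding qsub_def
proof (intro ballI allI impI)
  fix x p :: "real^'n" and X :: "real^'n^'n" and d0 :: real
  assume x: "x \<in> S" and X: "symmetric_mat X" and d0: "0 < d0"
    and *: "\<forall>h::real^'n. norm h < d0 \<longrightarrow> u (x + h) \<le> u x + p \<bullet> h + h \<bullet> (X *v h) / 2"
  obtain d1 where d1: "d1 > 0" "cball x d1 \<subseteq> S" using \<open>open S\<close> x open_contains_cball by blast
  define d where "d = min d1 (d0 / 2)"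
  have d: "d > 0" "d < d0" "cball x d \<subseteq> S"
    using d0 d1 by (auto simp: d_def intro: order_trans[OF subset_cball])
  have "F X \<le> \<epsilon>" if \<epsilon>: "\<epsilon> > 0" for \<epsilon>
  proof -
    have Lam: "Lam > 0" using ue by (auto simp: uniformly_elliptic_def)
    \<comment> \<open>The perturbation costs at most Lam times the trace of c I, which is exactly
      \<epsilon>.\<close>
    define c where "c = \<epsilon> / (Lam * real CARD('n))"
    have c: "c > 0" using \<epsilon> Lam by (simp add: c_def)
    let ?X = "X + c *\<^sub>R mat 1"
    have X': "symmetric_mat ?X" using X by (intro symmetric_mat_ops)
    let ?q = "\<lambda>h. p \<bullet> h + h \<bullet> (?X *v h) / 2"
    have q: "?q h = p \<bullet> h + h \<bullet> (X *v h) / 2 + c / 2 * (norm h)\<^sup>2" for h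
      by (simp add: mvm_simps inner_add_right power2_norm_eq_inner)
    have cd: "c * d\<^sup>2 / 8 > 0" using c d by simp
    obtain n where n: "qsub F (cball x d) (f n)" "continuous_on (cball x d) (f n)"
      "\<And>y. y \<in> cball x d \<Longrightarrow> \<bar>f n y - u y\<bar> < c * d\<^sup>2 / 8"
      using eventually_happens'[OF sequentially_bot eventually_conj[OF qs[OF compact_cball d(3)]
        uniform_limitD[OF lim[OF compact_cball d(3)] cd]]]
      by (auto simp: dist_real_def)
    have "continuous_on (cball x d) (\<lambda>y. f n y - ?q (y - x))"
      by (intro continuous_intros n(2) bounded_linear.continuous_on[OF matrix_vector_mul_bounded_linear])
        auto
    then obtain y where y: "y \<in> cball x d" "\<And>z. z \<in> cball x d \<Longrightarrow> f n z - ?q (z - x) \<le> f n y - ?q (y - x)"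
      using continuous_attains_sup[of "cball x d" "\<lambda>y. f n y - ?q (y - x)"] d(1) by auto
    have "f n x \<le> f n y - ?q (y - x)" using y(2)[of x] d(1) by simp
    moreover have "u y \<le> u x + p \<bullet> (y - x) + (y - x) \<bullet> (X *v (y - x)) / 2"
      using *[rule_format, of "y - x"] y(1) d(2) by (simp add: dist_norm norm_minus_commute)
    moreover have "\<bar>f n x - u x\<bar> < c * d\<^sup>2 / 8" "\<bar>f n y - u y\<bar> < c * d\<^sup>2 / 8" using n(3) y(1) d(1) by auto
    ultimately have "c / 2 * (norm (y - x))\<^sup>2 < c / 2 * (d\<^sup>2 / 2)" unfolding q by linarith
    then have "(norm (y - x))\<^sup>2 < d\<^sup>2 / 2" using c by simp
    also have "\<dots> \<le> d\<^sup>2" by simp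
    finally have nyx: "norm (y - x) < d" using d(1) by (simp add: power2_less_imp_less)
    have "F ?X \<le> 0"
    proof (rule qsubD[OF n(1) y(1) X'])
      show "d - norm (y - x) > 0" using nyx by simp
      fix h :: "real^'n" assume h: "norm h < d - norm (y - x)"
      have "dist x (y + h) \<le> norm (y - x) + norm h"
        using norm_triangle_ineq[of "y - x" h] by (simp add: dist_norm norm_minus_commute algebra_simps)
      then have "y + h \<in> cball x d" using h by simp
      from y(2)[OF this] have "f n (y + h) \<le> f n y + (?q ((y - x) + h) - ?q (y - x))"
        by (simp add: algebra_simps)
      then show "f n (y + h) \<le> f n y + (p + ?X *v (y - x)) \<bullet> h + h \<bullet> (?X *v h) / 2"
        unfolding quadratic_recenter[OF X'] by simp
    qed
    moreover have "Lam * (c * real CARD('n)) = \<epsilon>" using Lam by (simp add: c_def)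
    moreover have "F X \<le> F ?X + Lam * (c * real CARD('n))"
      by (rule uniformly_elliptic_add_scal[OF ue X less_imp_le[OF c]])
    ultimately show ?thesis by linarith
  qed
  then show "F X \<le> 0" by (rule field_le_epsilon) simp
qed

text \<open>After addition of k |x|^2 the function U becomes a supremum of affine functions of x,
  hence convex; compactness of C makes the supremum attained.\<close>

lemma sup_convolution:
  fixes u :: "'a::euclidean_space \<Rightarrow> real"
  assumes C: "compact C" "C \<noteq> {}" "continuous_on C u"
  obtains U where "semiconvex (2 * k) U" "\<And>x a. a \<in> C \<Longrightarrow> u a - k * (norm (x - a))\<^sup>2 \<le> U x"
    "\<And>x. \<exists>a\<in>C. U x = u a - k * (norm (x - a))\<^sup>2"
proof -
  have "\<exists>a\<in>C. \<forall>b\<in>C. u b - k * (norm (x - b))\<^sup>2 \<le> u a - k * (norm (x - a))\<^sup>2" for x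
    by (rule continuous_attains_sup[OF C(1,2)]) (intro continuous_intros C(3))
  then obtain a where a: "\<And>x. a x \<in> C" "\<And>x b. b \<in> C \<Longrightarrow> u b - k * (norm (x - b))\<^sup>2 \<le> u (a x) - k * (norm (x - a x))\<^sup>2"
    by metis
  define U where "U x = u (a x) - k * (norm (x - a x))\<^sup>2" for x
  have sq: "k * (norm (x - b))\<^sup>2 = k * (norm x)\<^sup>2 - 2 * k * (x \<bullet> b) + k * (norm b)\<^sup>2" for x b :: 'a
  proof -
    have "(norm (x - b))\<^sup>2 = (norm x)\<^sup>2 - 2 * (x \<bullet> b) + (norm b)\<^sup>2" using norm_sq_add[of x "- b"] by simp
    then show ?thesis by (simp only:) (simp add: algebra_simps)
  qed
  have "semiconvex (2 * k) U"
    unfolding semiconvex_def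
  proof (rule convex_onI)
    fix t :: real and x y :: 'a assume t: "0 < t" "t < 1"
    let ?z = "(1 - t) *\<^sub>R x + t *\<^sub>R y"
    define l where "l w = u (a ?z) + 2 * k * (w \<bullet> a ?z) - k * (norm (a ?z))\<^sup>2" for w
    have "U ?z + 2 * k / 2 * (norm ?z)\<^sup>2 = l ?z" by (simp add: U_def sq l_def)
    also have "\<dots> = (1 - t) * l x + t * l y" by (simp add: l_def inner_add_left algebra_simps)
    also have "\<dots> \<le> (1 - t) * (U x + 2 * k / 2 * (norm x)\<^sup>2) + t * (U y + 2 * k / 2 * (norm y)\<^sup>2)"
    proof -
      have "l w \<le> U w + 2 * k / 2 * (norm w)\<^sup>2" for w
        using a(2)[OF a(1), of ?z w] by (simp add: l_def U_def sq)
      then show ?thesis using t by (intro add_mono mult_left_mono) auto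
    qed
    finally show "U ?z + 2 * k / 2 * (norm ?z)\<^sup>2 \<le> (1 - t) * (U x + 2 * k / 2 * (norm x)\<^sup>2) + t * (U y + 2 * k / 2 * (norm y)\<^sup>2)" .
  qed simp
  then show ?thesis
  proof (rule that)
    show "u b - k * (norm (x - b))\<^sup>2 \<le> U x" if "b \<in> C" for x b
      unfolding U_def using that by (rule a(2))
    show "\<exists>b\<in>C. U x = u b - k * (norm (x - b))\<^sup>2" for x
      using a(1)[of x] unfolding U_def by blast
  qed
qed

text \<open>A polynomial touching U at x, translated by a - x, touches u at the maximizer a. That a
  is interior to C allows all nearby points a + h to compete in the supremum.\<close>

lemma qsub_sup_convolution:
  fixes F :: "real^'n^'n \<Rightarrow> real"
  assumes qs: "qsub F S u" and up: "\<And>x a. a \<in> C \<Longrightarrow> u a - k * (norm (x - a))\<^sup>2 \<le> U x"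
    and att: "\<And>x. x \<in> T \<Longrightarrow> \<exists>a. a \<in> S \<and> a \<in> interior C \<and> U x = u a - k * (norm (x - a))\<^sup>2"
  shows "qsub F T U"
  unfolding qsub_def
proof (intro ballI allI impI)
  fix x p :: "real^'n" and X :: "real^'n^'n" and d :: real
  assume x: "x \<in> T" and X: "symmetric_mat X" and d: "0 < d"
    and *: "\<forall>h::real^'n. norm h < d \<longrightarrow> U (x + h) \<le> U x + p \<bullet> h + h \<bullet> (X *v h) / 2"
  obtain a where a: "a \<in> S" "a \<in> interior C" "U x = u a - k * (norm (x - a))\<^sup>2" using att[OF x] by blast
  obtain e where e: "e > 0" "cball a e \<subseteq> C" using a(2) mem_interior_cball by blast
  show "F X \<le> 0"
  proof (rule qsubD[OF qs a(1) X])
    show "min d e > 0" using d e by simp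
    fix h :: "real^'n" assume h: "norm h < min d e"
    then have "a + h \<in> C" using e(2) by (auto simp: dist_norm)
    from up[OF this, of "x + h"] have "u (a + h) - k * (norm (x - a))\<^sup>2 \<le> U (x + h)" by simp
    then show "u (a + h) \<le> u a + p \<bullet> h + h \<bullet> (X *v h) / 2" using *[rule_format, of h] h a(3) by simp
  qed
qed

section \<open>The theorem on sums\<close>

lemma norm_Pair_sq: "(norm (h :: 'a::real_normed_vector \<times> 'b::real_normed_vector))\<^sup>2 = (norm (fst h))\<^sup>2 + (norm (snd h))\<^sup>2"
  by (cases h) (simp add: norm_Pair)

lemma quadratic_diff2:
  fixes L :: "'a::euclidean_space \<Rightarrow> 'a"
  assumes "linear L"
  shows "diff2 (\<lambda>z. g \<bullet> z + z \<bullet> L z / 2) z h = h \<bullet> L h"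
  by (simp add: diff2_def linear_add[OF assms] linear_diff[OF assms] inner_add_left inner_add_right
      inner_diff_left inner_diff_right field_simps)

text \<open>Zooms of the doubled function at its strict maximum converge to a quadratic form Q0 <=
  0. On each coordinate plane only one of the zooms of U and V is present, so both converge
  separately and the limit of their sum has no mixed term. Its diagonal blocks are the matrices X
  and Y, and Q0 <= 0 is the matrix inequality.\<close>

lemma semiconvex_sum_jets:
  fixes U V :: "real^'n \<Rightarrow> real" and F G :: "real^'n^'n \<Rightarrow> real"
    and L :: "(real^'n) \<times> (real^'n) \<Rightarrow> (real^'n) \<times> (real^'n)"
  assumes ue: "uniformly_elliptic lam Lam F" "uniformly_elliptic lam Lam G"
    and sc: "semiconvex K U" "semiconvex K V" "K \<ge> 0"
    and L: "linear L" "\<And>a b. L a \<bullet> b = a \<bullet> L b"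
    and \<rho>: "\<rho> > 0"
    and strict: "\<And>z. z \<in> cball z0 \<rho> \<Longrightarrow> z \<noteq> z0 \<Longrightarrow>
      U (fst z) + V (snd z) - (g \<bullet> z + z \<bullet> L z / 2) < U (fst z0) + V (snd z0) - (g \<bullet> z0 + z0 \<bullet> L z0 / 2)"
    and qU: "qsub F (ball (fst z0) \<rho>) U" and qV: "qsub G (ball (snd z0) \<rho>) V"
  shows "\<exists>X Y. symmetric_mat X \<and> symmetric_mat Y \<and> F X \<le> 0 \<and> G Y \<le> 0 \<and>
    (\<forall>\<xi> \<eta>. \<xi> \<bullet> (X *v \<xi>) + \<eta> \<bullet> (Y *v \<eta>) \<le> (\<xi>, \<eta>) \<bullet> L (\<xi>, \<eta>))"
proof -
  define W where "W z = U (fst z) + V (snd z) - (g \<bullet> z + z \<bullet> L z / 2)" for z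
  obtain C where C: "C > 0" "\<And>z. norm (L z) \<le> C * norm z"
    using linear_bounded_pos[OF L(1)] by blast
  have contL: "continuous_on UNIV L" by (rule linear_continuous_on[OF linear_conv_bounded_linear[THEN iffD1, OF L(1)]])
  have "semiconvex (K + C) W"
    unfolding semiconvex_iff_diff2
  proof (intro conjI allI)
    have "continuous_on UNIV (\<lambda>z. U (fst z))" "continuous_on UNIV (\<lambda>z. V (snd z))"
      by (rule continuous_on_compose2[OF semiconvex_continuous[OF sc(1)]] continuous_on_compose2[OF semiconvex_continuous[OF sc(2)]];
        auto intro!: continuous_intros)+
    then show "continuous_on UNIV W"
      unfolding W_def by (intro continuous_intros contL) auto
    fix z h
    have "diff2 W z h = diff2 U (fst z) (fst h) + diff2 V (snd z) (snd h) - diff2 (\<lambda>z. g \<bullet> z + z \<bullet> L z / 2) z h"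
      by (simp add: diff2_def W_def)
    then have "diff2 W z h = diff2 U (fst z) (fst h) + diff2 V (snd z) (snd h) - h \<bullet> L h"
      unfolding quadratic_diff2[OF L(1)] .
    moreover have "- K * (norm (fst h))\<^sup>2 \<le> diff2 U (fst z) (fst h)" "- K * (norm (snd h))\<^sup>2 \<le> diff2 V (snd z) (snd h)"
      using sc(1,2) by (auto simp: semiconvex_iff_diff2)
    moreover have "h \<bullet> L h \<le> C * (norm h)\<^sup>2"
    proof -
      have "h \<bullet> L h \<le> norm h * norm (L h)" by (rule norm_cauchy_schwarz)
      also have "\<dots> \<le> norm h * (C * norm h)" by (intro mult_left_mono C) simp
      finally show ?thesis by (simp add: power2_eq_square algebra_simps)
    qed
    ultimately show "- (K + C) * (norm h)\<^sup>2 \<le> diff2 W z h"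
      by (simp add: norm_Pair_sq algebra_simps)
  qed
  then obtain T m where Tm: "finite T" "(\<lambda>z. \<Sum>b\<in>T. m b * (b \<bullet> z)\<^sup>2) \<in> blowups W (ball z0 \<rho>)"
    "\<And>z. (\<Sum>b\<in>T. m b * (b \<bullet> z)\<^sup>2) \<le> 0"
  proof (rule blowup_at_strict_max[OF _ _ \<rho>])
    show "0 \<le> K + C" using sc(3) C(1) by simp
    show "W z < W z0" if "z \<in> cball z0 \<rho>" "z \<noteq> z0" for z
      unfolding W_def by (rule strict[OF that])
  qed blast
  define Q0 where "Q0 z = (\<Sum>b\<in>T. m b * (b \<bullet> z)\<^sup>2)" for z
  have "\<exists>c r p. 0 < r \<and> ball c ((real n + 1) * r) \<subseteq> ball z0 \<rho> \<and>
      (\<forall>z. norm z < real n + 1 \<longrightarrow> \<bar>renorm W c r p z - Q0 z\<bar> \<le> 1 / (real n + 1))" for n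
  proof -
    have "real n + 1 > 0" "1 / (real n + 1) > 0" by simp_all
    then show ?thesis using Tm(2) unfolding blowups_def Q0_def mem_Collect_eq by blast
  qed
  then obtain c r p where crp: "\<And>n. 0 < r n" "\<And>n. ball (c n) ((real n + 1) * r n) \<subseteq> ball z0 \<rho>"
    "\<And>n z. norm z < real n + 1 \<Longrightarrow> \<bar>renorm W (c n) (r n) (p n) z - Q0 z\<bar> \<le> 1 / (real n + 1)"
    by metis
  \<comment> \<open>The slope used for the doubled function, with the gradient of the subtracted
    polynomial at \<open>c n\<close> added back.\<close>
  define P where "P n = p n + g + L (c n)" for n
  define U' where "U' n = renorm U (fst (c n)) (r n) (fst (P n))" for n
  define V' where "V' n = renorm V (snd (c n)) (r n) (snd (P n))" for n
  define q where "q z = Q0 z + z \<bullet> L z / 2" for z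
  have UV: "U' n (fst z) + V' n (snd z) = renorm W (c n) (r n) (p n) z + z \<bullet> L z / 2" for n z
  proof -
    let ?c = "c n" and ?r = "r n"
    have Lc: "?c \<bullet> L z = L ?c \<bullet> z" "z \<bullet> L ?c = L ?c \<bullet> z" using L(2)[of ?c z] by (auto simp: inner_commute)
    have "(?c + ?r *\<^sub>R z) \<bullet> L (?c + ?r *\<^sub>R z) = ?c \<bullet> L ?c + 2 * ?r * (L ?c \<bullet> z) + ?r\<^sup>2 * (z \<bullet> L z)"
      by (simp add: linear_add[OF L(1)] linear_scale[OF L(1)] inner_add_left inner_add_right Lc power2_eq_square algebra_simps)
    then have "W (?c + ?r *\<^sub>R z) - W ?c - ?r * (p n \<bullet> z) = (U (fst ?c + ?r *\<^sub>R fst z) - U (fst ?c) - ?r * (fst (P n) \<bullet> fst z))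
      + (V (snd ?c + ?r *\<^sub>R snd z) - V (snd ?c) - ?r * (snd (P n) \<bullet> snd z)) - ?r\<^sup>2 * (z \<bullet> L z / 2)"
      by (simp add: W_def P_def inner_add_left inner_add_right inner_prod_def[of g] inner_prod_def[of "p n"]
          inner_prod_def[of "L ?c"] algebra_simps)
    then show ?thesis using crp(1)[of n]
      by (simp add: U'_def V'_def renorm_def add_divide_distrib diff_divide_distrib)
  qed
  \<comment> \<open>At (\<xi>, 0) the zoom of V contributes nothing, as \<open>renorm\<close>
    vanishes at the origin.\<close>
  have U'q: "\<bar>U' n \<xi> - q (\<xi>, 0)\<bar> \<le> 1 / (real n + 1)" if "norm \<xi> < real n + 1" for n \<xi>
    using UV[of n "(\<xi>, 0)"] crp(3)[of "(\<xi>, 0)" n] that by (simp add: q_def V'_def norm_Pair)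
  have V'q: "\<bar>V' n \<eta> - q (0, \<eta>)\<bar> \<le> 1 / (real n + 1)" if "norm \<eta> < real n + 1" for n \<eta>
    using UV[of n "(0, \<eta>)"] crp(3)[of "(0, \<eta>)" n] that by (simp add: q_def U'_def norm_Pair)
  have UVq: "\<bar>U' n (fst z) + V' n (snd z) - q z\<bar> \<le> 1 / (real n + 1)" if "norm z < real n + 1" for n z
    using UV[of n z] crp(3)[OF that] by (simp add: q_def)
  have inv0: "(\<lambda>n. 1 / (real n + 1)) \<longlonglongrightarrow> 0"
    using LIMSEQ_inverse_real_of_nat by (simp add: inverse_eq_divide add.commute)
  have evn: "\<forall>\<^sub>F n in sequentially. R < real n + 1" for R :: real
  proof -
    obtain N :: nat where "R \<le> real N" using real_arch_simple by blast
    then show ?thesis by (intro eventually_sequentiallyI[of N]) (smt (verit) of_nat_mono)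
  qed
  have limI: "f \<longlonglongrightarrow> l" if "\<And>n. R < real n + 1 \<Longrightarrow> \<bar>f n - l\<bar> \<le> 1 / (real n + 1)" for f :: "nat \<Rightarrow> real" and l R
  proof -
    have "(\<lambda>n. f n - l) \<longlonglongrightarrow> 0"
      by (rule Lim_null_comparison[OF _ inv0]) (use evn[of R] that in \<open>auto elim: eventually_mono\<close>)
    then show ?thesis using Lim_null by blast
  qed
  have unifI: "uniform_limit C f l sequentially"
    if C: "compact C" and cl: "\<And>n \<xi>. norm \<xi> < real n + 1 \<Longrightarrow> \<bar>f n \<xi> - l \<xi>\<bar> \<le> 1 / (real n + 1)" for C and f :: "nat \<Rightarrow> real^'n \<Rightarrow> real" and l
  proof (rule uniform_limitI)
    fix e :: real assume e: "e > 0"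
    obtain R where R: "\<And>x. x \<in> C \<Longrightarrow> norm x \<le> R" using compact_imp_bounded[OF C] by (auto simp: bounded_iff)
    show "\<forall>\<^sub>F n in sequentially. \<forall>x\<in>C. dist (f n x) (l x) < e"
      using evn[of R] order_tendstoD(2)[OF inv0 e]
    proof eventually_elim
      case (elim n)
      show ?case
      proof
        fix x assume "x \<in> C"
        then have "norm x < real n + 1" using R[of x] elim(1) by simp
        from cl[OF this] show "dist (f n x) (l x) < e" using elim(2) by (simp add: dist_real_def)
      qed
    qed
  qed
  have qsq: "qsub F UNIV (\<lambda>\<xi>. q (\<xi>, 0))"
  proof (rule qsub_limit[OF ue(1) open_UNIV, where f = U'])
    fix S :: "(real^'n) set" assume S: "compact S"
    show "uniform_limit S U' (\<lambda>\<xi>. q (\<xi>, 0)) sequentially" by (rule unifI[OF S U'q])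
    obtain R where R: "\<And>x. x \<in> S \<Longrightarrow> norm x \<le> R" using compact_imp_bounded[OF S] by (auto simp: bounded_iff)
    show "\<forall>\<^sub>F n in sequentially. qsub F S (U' n) \<and> continuous_on S (U' n)"
      using evn[of R]
    proof eventually_elim
      case (elim n)
      have "S \<subseteq> {\<xi>. fst (c n) + r n *\<^sub>R \<xi> \<in> ball (fst z0) \<rho>}"
      proof
        fix \<xi> assume "\<xi> \<in> S"
        then have "norm \<xi> < real n + 1" using R[of \<xi>] elim by simp
        then have "c n + r n *\<^sub>R (\<xi>, 0) \<in> ball (c n) ((real n + 1) * r n)"
          using crp(1)[of n] by (simp add: dist_norm norm_Pair)
        then have "c n + r n *\<^sub>R (\<xi>, 0) \<in> ball z0 \<rho>" by (rule subsetD[OF crp(2)])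
        then show "\<xi> \<in> {\<xi>. fst (c n) + r n *\<^sub>R \<xi> \<in> ball (fst z0) \<rho>}"
          using dist_fst_le[of z0 "c n + r n *\<^sub>R (\<xi>, 0)"] by simp
      qed
      then have "qsub F S (U' n)" unfolding U'_def by (rule qsub_subset[OF qsub_renorm[OF qU crp(1)]])
      moreover have "continuous_on S (U' n)" unfolding U'_def
        by (rule continuous_on_subset[OF continuous_on_renorm[OF semiconvex_continuous[OF sc(1)]]]) simp
      ultimately show ?case ..
    qed
  qed
  have qsq': "qsub G UNIV (\<lambda>\<eta>. q (0, \<eta>))"
  proof (rule qsub_limit[OF ue(2) open_UNIV, where f = V'])
    fix S :: "(real^'n) set" assume S: "compact S"
    show "uniform_limit S V' (\<lambda>\<eta>. q (0, \<eta>)) sequentially" by (rule unifI[OF S V'q])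
    obtain R where R: "\<And>x. x \<in> S \<Longrightarrow> norm x \<le> R" using compact_imp_bounded[OF S] by (auto simp: bounded_iff)
    show "\<forall>\<^sub>F n in sequentially. qsub G S (V' n) \<and> continuous_on S (V' n)"
      using evn[of R]
    proof eventually_elim
      case (elim n)
      have "S \<subseteq> {\<eta>. snd (c n) + r n *\<^sub>R \<eta> \<in> ball (snd z0) \<rho>}"
      proof
        fix \<eta> assume "\<eta> \<in> S"
        then have "norm \<eta> < real n + 1" using R[of \<eta>] elim by simp
        then have "c n + r n *\<^sub>R (0, \<eta>) \<in> ball (c n) ((real n + 1) * r n)"
          using crp(1)[of n] by (simp add: dist_norm norm_Pair)
        then have "c n + r n *\<^sub>R (0, \<eta>) \<in> ball z0 \<rho>" by (rule subsetD[OF crp(2)])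
        then show "\<eta> \<in> {\<eta>. snd (c n) + r n *\<^sub>R \<eta> \<in> ball (snd z0) \<rho>}"
          using dist_snd_le[of z0 "c n + r n *\<^sub>R (0, \<eta>)"] by simp
      qed
      then have "qsub G S (V' n)" unfolding V'_def by (rule qsub_subset[OF qsub_renorm[OF qV crp(1)]])
      moreover have "continuous_on S (V' n)" unfolding V'_def
        by (rule continuous_on_subset[OF continuous_on_renorm[OF semiconvex_continuous[OF sc(2)]]]) simp
      ultimately show ?case ..
    qed
  qed
  \<comment> \<open>Two computations of the limit of the same sequence; mixed terms cannot
    survive.\<close>
  have split: "q (\<xi>, \<eta>) = q (\<xi>, 0) + q (0, \<eta>)" for \<xi> \<eta>
  proof (rule LIMSEQ_unique)
    show "(\<lambda>n. U' n \<xi> + V' n \<eta>) \<longlonglongrightarrow> q (\<xi>, \<eta>)"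
      by (rule limI[of "norm (\<xi>, \<eta>)"]) (use UVq[of "(\<xi>, \<eta>)"] in auto)
    show "(\<lambda>n. U' n \<xi> + V' n \<eta>) \<longlonglongrightarrow> q (\<xi>, 0) + q (0, \<eta>)"
      by (intro tendsto_add limI[of "norm \<xi>"] limI[of "norm \<eta>"] U'q V'q)
  qed
  \<comment> \<open>The Hessian of q.\<close>
  define M where "M z = (\<Sum>b\<in>T. (2 * m b * (b \<bullet> z)) *\<^sub>R b) + L z" for z
  have linM: "linear M"
    by (rule linearI) (simp_all add: M_def linear_add[OF L(1)] linear_scale[OF L(1)] inner_add_right
        scaleR_add_left sum.distrib scaleR_add_right scaleR_sum_right algebra_simps)
  have MB: "a \<bullet> M b = (\<Sum>\<beta>\<in>T. 2 * m \<beta> * (\<beta> \<bullet> a) * (\<beta> \<bullet> b)) + a \<bullet> L b" for a b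
    by (simp add: M_def inner_add_right inner_sum_right algebra_simps inner_commute[of a])
  have Msym: "a \<bullet> M b = b \<bullet> M a" for a b
    unfolding MB using L(2)[of a b] by (simp add: algebra_simps inner_commute)
  have Mq: "z \<bullet> M z = 2 * q z" for z
    unfolding MB by (simp add: q_def Q0_def sum_distrib_left power2_eq_square algebra_simps)
  define X where "X = matrix (\<lambda>\<xi>. fst (M (\<xi>, 0)))"
  define Y where "Y = matrix (\<lambda>\<eta>. snd (M (0, \<eta>)))"
  have "linear (\<lambda>\<xi>. fst (M (\<xi>, 0)))"
  proof (rule linearI)
    show "fst (M (a + b, 0)) = fst (M (a, 0)) + fst (M (b, 0))" for a b
      using linear_add[OF linM, of "(a, 0)" "(b, 0)"] by simp
    show "fst (M (t *\<^sub>R a, 0)) = t *\<^sub>R fst (M (a, 0))" for t a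
      using linear_scale[OF linM, of t "(a, 0)"] by simp
  qed
  then have X: "X *v \<xi> = fst (M (\<xi>, 0))" for \<xi>
    unfolding X_def by (metis matrix_vector_mul(2))
  have "linear (\<lambda>\<eta>. snd (M (0, \<eta>)))"
  proof (rule linearI)
    show "snd (M (0, a + b)) = snd (M (0, a)) + snd (M (0, b))" for a b
      using linear_add[OF linM, of "(0, a)" "(0, b)"] by simp
    show "snd (M (0, t *\<^sub>R a)) = t *\<^sub>R snd (M (0, a))" for t a
      using linear_scale[OF linM, of t "(0, a)"] by simp
  qed
  then have Y: "Y *v \<xi> = snd (M (0, \<xi>))" for \<xi>
    unfolding Y_def by (metis matrix_vector_mul(2))
  have aX: "a \<bullet> (X *v b) = (a, 0) \<bullet> M (b, 0)" for a b by (simp add: X inner_prod_def)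
  have aY: "a \<bullet> (Y *v b) = (0, a) \<bullet> M (0, b)" for a b by (simp add: Y inner_prod_def)
  have Xs: "symmetric_mat X"
    by (rule symmetric_matI) (simp only: inner_commute[of "X *v _"] aX Msym)
  have Ys: "symmetric_mat Y"
    by (rule symmetric_matI) (simp only: inner_commute[of "Y *v _"] aY Msym)
  have q0: "q 0 = 0" using Mq[of 0] by simp
  have "F X \<le> 0"
    by (rule qsubD[OF qsq _ Xs zero_less_one, where x = 0 and p = 0])
      (use q0 in \<open>auto simp: aX Mq zero_prod_def\<close>)
  moreover have "G Y \<le> 0"
    by (rule qsubD[OF qsq' _ Ys zero_less_one, where x = 0 and p = 0])
      (use q0 in \<open>auto simp: aY Mq zero_prod_def\<close>)
  moreover have "\<xi> \<bullet> (X *v \<xi>) + \<eta> \<bullet> (Y *v \<eta>) \<le> (\<xi>, \<eta>) \<bullet> L (\<xi>, \<eta>)" for \<xi> \<eta>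
  proof -
    have "\<xi> \<bullet> (X *v \<xi>) + \<eta> \<bullet> (Y *v \<eta>) = 2 * q (\<xi>, \<eta>)" unfolding aX aY Mq using split[of \<xi> \<eta>] by simp
    then show ?thesis using Tm(3)[of "(\<xi>, \<eta>)"] by (simp add: q_def Q0_def)
  qed
  ultimately show ?thesis using Xs Ys by blast
qed

text \<open>Sup-convolutions replace u and w by semiconvex functions. The penalty of weight
  \<epsilon> / 4 centred at z0 keeps the new maximum z1 near z0, and a second one centred at z1
  makes that maximum strict; together they add \<epsilon> to the Hessian.\<close>

theorem theorem_on_sums:
  fixes u w :: "real^'n \<Rightarrow> real" and F G :: "real^'n^'n \<Rightarrow> real"
    and L :: "(real^'n) \<times> (real^'n) \<Rightarrow> (real^'n) \<times> (real^'n)"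
  assumes ue: "uniformly_elliptic lam Lam F" "uniformly_elliptic lam Lam G"
    and S: "open S" "continuous_on S u" "continuous_on S w" "qsub F S u" "qsub G S w" "x0 \<in> S" "y0 \<in> S"
    and L: "linear L" "\<And>a b. L a \<bullet> b = a \<bullet> L b"
    and d0: "d0 > 0" "\<And>h. norm h < d0 \<Longrightarrow> u (x0 + fst h) + w (y0 + snd h) \<le> u x0 + w y0 + g \<bullet> h + h \<bullet> L h / 2"
    and \<epsilon>: "\<epsilon> > 0"
  shows "\<exists>X Y. symmetric_mat X \<and> symmetric_mat Y \<and> F X \<le> 0 \<and> G Y \<le> 0 \<and>
    (\<forall>\<xi> \<eta>. \<xi> \<bullet> (X *v \<xi>) + \<eta> \<bullet> (Y *v \<eta>) \<le> (\<xi>, \<eta>) \<bullet> L (\<xi>, \<eta>) + \<epsilon> * ((norm \<xi>)\<^sup>2 + (norm \<eta>)\<^sup>2))"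
proof -
  define z0 where "z0 = (x0, y0)"
  obtain d1 d2 where d12: "d1 > 0" "cball x0 d1 \<subseteq> S" "d2 > 0" "cball y0 d2 \<subseteq> S"
    using S(1,6,7) open_contains_cball by metis
  define d where "d = min (min d1 d2) (d0 / 3)"
  have d: "d > 0" "2 * d < d0" "cball x0 d \<subseteq> S" "cball y0 d \<subseteq> S"
    using d12 d0(1) by (auto simp: d_def intro: order_trans[OF subset_cball])
  let ?Cx = "cball x0 d" and ?Cy = "cball y0 d"
  have cu: "continuous_on ?Cx u" and cw: "continuous_on ?Cy w"
    using S(2,3) d(3,4) continuous_on_subset by blast+
  obtain Mu Mw where "\<forall>a\<in>?Cx. \<bar>u a\<bar> \<le> Mu" "\<forall>a\<in>?Cy. \<bar>w a\<bar> \<le> Mw"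
    using compact_imp_bounded[OF compact_continuous_image[OF cu compact_cball]]
      compact_imp_bounded[OF compact_continuous_image[OF cw compact_cball]]
    by (auto simp: bounded_iff)
  moreover define M where "M = max 0 (max Mu Mw)"
  ultimately have M: "M \<ge> 0" "\<And>a. a \<in> ?Cx \<Longrightarrow> \<bar>u a\<bar> \<le> M" "\<And>a. a \<in> ?Cy \<Longrightarrow> \<bar>w a\<bar> \<le> M"
    by fastforce+
  obtain C where C: "C > 0" "\<And>z. norm (L z) \<le> C * norm z"
    using linear_bounded_pos[OF L(1)] by blast
  define q0 where "q0 h = g \<bullet> h + h \<bullet> L h / 2" for h
  \<comment> \<open>A Lipschitz constant of q0 on the ball of radius 2 d, enlarged by 1 to be
    positive.\<close>
  define A where "A = norm g + 2 * d * C + 1"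
  have A: "A > 0" using C d by (auto simp: A_def intro!: add_nonneg_pos add_nonneg_nonneg)
  have q0_Lip: "q0 h - q0 h' \<le> A * norm (h - h')" if h: "norm h \<le> 2 * d" "norm h' \<le> 2 * d" for h h'
  proof -
    have "q0 h - q0 h' = g \<bullet> (h - h') + ((h - h') \<bullet> L h + h' \<bullet> L (h - h')) / 2"
      by (simp add: q0_def linear_diff[OF L(1)] inner_diff_left inner_diff_right field_simps)
    moreover have "g \<bullet> (h - h') \<le> norm g * norm (h - h')" by (rule norm_cauchy_schwarz)
    moreover have "(h - h') \<bullet> L h \<le> 2 * d * C * norm (h - h')"
    proof -
      have "norm (L h) \<le> C * (2 * d)" using C(2)[of h] mult_left_mono[OF h(1) less_imp_le[OF C(1)]] by linarith
      from mult_left_mono[OF this norm_ge_zero, of "h - h'"] norm_cauchy_schwarz[of "h - h'" "L h"]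
      show ?thesis by (simp add: algebra_simps)
    qed
    moreover have "h' \<bullet> L (h - h') \<le> 2 * d * C * norm (h - h')"
    proof -
      have "norm h' * norm (L (h - h')) \<le> (2 * d) * (C * norm (h - h'))"
        using h(2) C(2) d(1) by (intro mult_mono) auto
      then show ?thesis using norm_cauchy_schwarz[of h' "L (h - h')"] by (simp add: algebra_simps)
    qed
    moreover have "A * norm (h - h') = norm g * norm (h - h') + 2 * d * C * norm (h - h') + norm (h - h')"
      by (simp add: A_def algebra_simps)
    moreover have "norm (h - h') \<ge> 0" by simp
    ultimately show ?thesis by argo
  qed
  \<comment> \<open>The second summand forces z1 to within d / 4 of z0; the third one forces the
    maximizers in the sup-convolutions to within d / 4 of the points where these are
    evaluated.\<close>
  define k where "k = 1 + A\<^sup>2 / (\<epsilon> / 4 * (d / 4)\<^sup>2) + 2 * M / (d / 4)\<^sup>2"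
  have d4: "(d / 4)\<^sup>2 > 0" using d by simp
  have k: "k > 0" "A\<^sup>2 / k \<le> \<epsilon> / 4 * (d / 4)\<^sup>2" "2 * M / k \<le> (d / 4)\<^sup>2"
  proof -
    have 1: "0 \<le> A\<^sup>2 / (\<epsilon> / 4 * (d / 4)\<^sup>2)" "0 \<le> 2 * M / (d / 4)\<^sup>2" using \<epsilon> M d4 by auto
    then show k0: "k > 0" by (simp add: k_def)
    have "A\<^sup>2 / (\<epsilon> / 4 * (d / 4)\<^sup>2) \<le> k" "2 * M / (d / 4)\<^sup>2 \<le> k" using 1 by (auto simp: k_def)
    then show "A\<^sup>2 / k \<le> \<epsilon> / 4 * (d / 4)\<^sup>2" "2 * M / k \<le> (d / 4)\<^sup>2"
      using k0 \<epsilon> d4 by (simp_all add: pos_divide_le_eq mult.commute)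
  qed
  have ne: "?Cx \<noteq> {}" "?Cy \<noteq> {}" using d by auto
  obtain U where U: "semiconvex (2 * k) U" "\<And>x a. a \<in> ?Cx \<Longrightarrow> u a - k * (norm (x - a))\<^sup>2 \<le> U x"
    "\<And>x. \<exists>a\<in>?Cx. U x = u a - k * (norm (x - a))\<^sup>2"
    by (rule sup_convolution[OF compact_cball ne(1) cu, of k]) (rule that; assumption)
  obtain V where V: "semiconvex (2 * k) V" "\<And>x a. a \<in> ?Cy \<Longrightarrow> w a - k * (norm (x - a))\<^sup>2 \<le> V x"
    "\<And>x. \<exists>a\<in>?Cy. V x = w a - k * (norm (x - a))\<^sup>2"
    by (rule sup_convolution[OF compact_cball ne(2) cw, of k]) (rule that; assumption)
  define \<Psi> where "\<Psi> z = U (fst z) + V (snd z) - q0 (z - z0) - \<epsilon> / 4 * (norm (z - z0))\<^sup>2" for z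
  have contL: "continuous_on UNIV L" by (rule linear_continuous_on[OF linear_conv_bounded_linear[THEN iffD1, OF L(1)]])
  have "continuous_on UNIV (\<lambda>z. U (fst z))" "continuous_on UNIV (\<lambda>z. V (snd z))"
    by (rule continuous_on_compose2[OF semiconvex_continuous[OF U(1)]] continuous_on_compose2[OF semiconvex_continuous[OF V(1)]];
      auto intro!: continuous_intros)+
  moreover have "continuous_on UNIV (\<lambda>z. L (z - z0))"
    by (rule continuous_on_compose2[OF contL]) (auto intro!: continuous_intros)
  ultimately have "continuous_on UNIV \<Psi>"
    unfolding \<Psi>_def q0_def by (intro continuous_intros) auto
  then have "continuous_on (cball z0 d) \<Psi>" by (rule continuous_on_subset) simp
  then obtain z1 where z1: "z1 \<in> cball z0 d" "\<And>z. z \<in> cball z0 d \<Longrightarrow> \<Psi> z \<le> \<Psi> z1"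
    using continuous_attains_sup[of "cball z0 d" \<Psi>] d(1) by auto
  obtain a where a: "a \<in> ?Cx" "U (fst z1) = u a - k * (norm (fst z1 - a))\<^sup>2" using U(3) by blast
  obtain b where b: "b \<in> ?Cy" "V (snd z1) = w b - k * (norm (snd z1 - b))\<^sup>2" using V(3) by blast
  define s where "s = norm (z1 - (a, b))"
  have s2: "s\<^sup>2 = (norm (fst z1 - a))\<^sup>2 + (norm (snd z1 - b))\<^sup>2" by (simp add: s_def norm_Pair_sq)
  have nab: "norm ((a, b) - z0) \<le> 2 * d"
  proof -
    have "norm ((a, b) - z0) \<le> norm (a - x0) + norm (b - y0)"
      unfolding z0_def by (simp add: norm_Pair sqrt_sum_squares_le_sum)
    then show ?thesis using a(1) b(1) by (simp add: dist_norm norm_minus_commute)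
  qed
  have nz1: "norm (z1 - z0) \<le> d" using z1(1) by (simp add: dist_norm norm_minus_commute)
  have key: "k * s\<^sup>2 + \<epsilon> / 4 * (norm (z1 - z0))\<^sup>2 \<le> A * s"
  proof -
    have "u x0 + w y0 \<le> \<Psi> z0"
      using U(2)[of x0 x0] V(2)[of y0 y0] d(1) by (simp add: \<Psi>_def z0_def q0_def linear_0[OF L(1)])
    also have "\<dots> \<le> \<Psi> z1" using z1(2) d(1) by simp
    finally have "u x0 + w y0 \<le> u a + w b - k * s\<^sup>2 - q0 (z1 - z0) - \<epsilon> / 4 * (norm (z1 - z0))\<^sup>2"
      by (simp add: \<Psi>_def a b s2 algebra_simps)
    moreover have "u a + w b \<le> u x0 + w y0 + q0 ((a, b) - z0)"
      using d0(2)[of "(a, b) - z0"] nab d(2) by (simp add: z0_def q0_def)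
    moreover have "q0 ((a, b) - z0) - q0 (z1 - z0) \<le> A * norm (((a, b) - z0) - (z1 - z0))"
      using nab nz1 d(1) by (intro q0_Lip) auto
    moreover have "norm (((a, b) - z0) - (z1 - z0)) = s" by (simp add: s_def norm_minus_commute)
    ultimately show ?thesis by simp
  qed
  have "s \<le> A / k"
  proof (cases "s = 0")
    case False
    have "0 \<le> \<epsilon> / 4 * (norm (z1 - z0))\<^sup>2" using \<epsilon> by simp
    then have "k * s\<^sup>2 \<le> A * s" using key by linarith
    then have "s * (k * s) \<le> s * A" by (simp add: power2_eq_square algebra_simps)
    moreover have "s > 0" using False by (simp add: s_def)
    ultimately show ?thesis using k(1) by (simp add: field_simps)
  qed (use A k in simp)
  then have "A * s \<le> A\<^sup>2 / k" using mult_left_mono[of s "A / k" A] A by (simp add: power2_eq_square)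
  moreover have "0 \<le> k * s\<^sup>2" using k by simp
  ultimately have "\<epsilon> / 4 * (norm (z1 - z0))\<^sup>2 \<le> \<epsilon> / 4 * (d / 4)\<^sup>2" using key k(2) by linarith
  then have "(norm (z1 - z0))\<^sup>2 \<le> (d / 4)\<^sup>2" using \<epsilon> by simp
  then have near: "norm (z1 - z0) \<le> d / 4" using d(1) by (simp add: power2_le_iff_abs_le)
  have x1: "dist x0 (fst z1) \<le> d / 4" "dist y0 (snd z1) \<le> d / 4"
    using near dist_fst_le[of z0 z1] dist_snd_le[of z0 z1] by (simp_all add: z0_def dist_norm norm_minus_commute)
  have close: "dist c a < 3 * d / 4"
    if x: "x \<in> ball x1 (d / 4)" and cx: "dist c x1 \<le> d / 4" and f: "\<bar>f a\<bar> \<le> M" "\<bar>f x\<bar> \<le> M"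
      "f x \<le> f a - k * (norm (x - a))\<^sup>2" for c a x x1 :: "real^'n" and f
  proof -
    have "k * (norm (x - a))\<^sup>2 \<le> 2 * M" using f by linarith
    then have "(norm (x - a))\<^sup>2 \<le> 2 * M / k" using k(1) by (simp add: pos_le_divide_eq mult.commute)
    then have "(norm (x - a))\<^sup>2 \<le> (d / 4)\<^sup>2" using k(3) by linarith
    then have "dist x a \<le> d / 4" using d(1) by (simp add: power2_le_iff_abs_le dist_norm)
    moreover have "dist x1 x < d / 4" using x by simp
    ultimately show ?thesis using cx dist_triangle[of c a x1] dist_triangle[of x1 a x] by linarith
  qed
  have qU: "qsub F (ball (fst z1) (d / 4)) U"
  proof (rule qsub_sup_convolution[OF S(4) U(2)])
    fix x assume x: "x \<in> ball (fst z1) (d / 4)"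
    obtain a where a: "a \<in> ?Cx" "U x = u a - k * (norm (x - a))\<^sup>2" using U(3) by blast
    have "dist x0 x < d" using x x1(1) dist_triangle[of x0 x "fst z1"] d(1) by simp
    then have xC: "x \<in> ?Cx" by simp
    have "u x \<le> u a - k * (norm (x - a))\<^sup>2" using U(2)[OF xC, of x] a by simp
    then have "dist x0 a < 3 * d / 4" using close[OF x x1(1), of u a] M(2) a(1) xC by blast
    then have "a \<in> interior ?Cx" using d(1) by simp
    then show "\<exists>a. a \<in> S \<and> a \<in> interior ?Cx \<and> U x = u a - k * (norm (x - a))\<^sup>2"
      using a d(3) by blast
  qed
  have qV: "qsub G (ball (snd z1) (d / 4)) V"
  proof (rule qsub_sup_convolution[OF S(5) V(2)])
    fix x assume x: "x \<in> ball (snd z1) (d / 4)"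
    obtain a where a: "a \<in> ?Cy" "V x = w a - k * (norm (x - a))\<^sup>2" using V(3) by blast
    have "dist y0 x < d" using x x1(2) dist_triangle[of y0 x "snd z1"] d(1) by simp
    then have xC: "x \<in> ?Cy" by simp
    have "w x \<le> w a - k * (norm (x - a))\<^sup>2" using V(2)[OF xC, of x] a by simp
    then have "dist y0 a < 3 * d / 4" using close[OF x x1(2), of w a] M(3) a(1) xC by blast
    then have "a \<in> interior ?Cy" using d(1) by simp
    then show "\<exists>a. a \<in> S \<and> a \<in> interior ?Cy \<and> V x = w a - k * (norm (x - a))\<^sup>2"
      using a d(4) by blast
  qed
  define L' where "L' z = L z + \<epsilon> *\<^sub>R z" for z
  \<comment> \<open>The gradient at the origin of the polynomial that is written out in
    \<open>expand\<close>.\<close>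
  define g' where "g' = g - L z0 - (\<epsilon> / 2) *\<^sub>R z0 - (\<epsilon> / 2) *\<^sub>R z1"
  have L': "linear L'" "L' a \<bullet> b = a \<bullet> L' b" for a b
    by (rule linearI) (simp_all add: L'_def linear_add[OF L(1)] linear_scale[OF L(1)] L(2) inner_add_left inner_add_right algebra_simps)
  define cst where "cst = g \<bullet> z0 - z0 \<bullet> L z0 / 2 - \<epsilon> / 4 * (norm z0)\<^sup>2 - \<epsilon> / 4 * (norm z1)\<^sup>2"
  have expand: "g' \<bullet> z + z \<bullet> L' z / 2 = q0 (z - z0) + \<epsilon> / 4 * (norm (z - z0))\<^sup>2 + \<epsilon> / 4 * (norm (z - z1))\<^sup>2 + cst" for z
  proof -
    have sq: "(norm (z - w))\<^sup>2 = z \<bullet> z - 2 * (w \<bullet> z) + w \<bullet> w" for w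
      by (simp add: power2_norm_eq_inner inner_diff_left inner_diff_right inner_commute)
    have e1: "(z - z0) \<bullet> L (z - z0) = z \<bullet> L z - 2 * (L z0 \<bullet> z) + z0 \<bullet> L z0"
      using L(2)[of z0 z] by (simp add: linear_diff[OF L(1)] inner_diff_left inner_diff_right inner_commute)
    have e2: "g' \<bullet> z = g \<bullet> z - L z0 \<bullet> z - \<epsilon> / 2 * (z0 \<bullet> z) - \<epsilon> / 2 * (z1 \<bullet> z)"
      by (simp add: g'_def inner_diff_left)
    have e3: "z \<bullet> L' z = z \<bullet> L z + \<epsilon> * (z \<bullet> z)" by (simp add: L'_def inner_add_right)
    have e4: "q0 (z - z0) = g \<bullet> z - g \<bullet> z0 + (z \<bullet> L z - 2 * (L z0 \<bullet> z) + z0 \<bullet> L z0) / 2"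
      unfolding q0_def e1 by (simp add: inner_diff_right)
    show ?thesis
      unfolding e2 e3 e4 cst_def sq unfolding power2_norm_eq_inner by (simp add: field_simps)
  qed
  have "\<exists>X Y. symmetric_mat X \<and> symmetric_mat Y \<and> F X \<le> 0 \<and> G Y \<le> 0 \<and>
    (\<forall>\<xi> \<eta>. \<xi> \<bullet> (X *v \<xi>) + \<eta> \<bullet> (Y *v \<eta>) \<le> (\<xi>, \<eta>) \<bullet> L' (\<xi>, \<eta>))"
  proof (rule semiconvex_sum_jets[OF ue U(1) V(1) _ L' _ _ qU qV, where g = g'])
    show "2 * k \<ge> 0" "d / 4 > 0" using k d by auto
    fix z assume z: "z \<in> cball z1 (d / 4)" "z \<noteq> z1"
    have "dist z0 z \<le> dist z0 z1 + dist z1 z" by (rule dist_triangle)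
    then have "z \<in> cball z0 d" using z(1) near d(1) by (simp add: dist_norm norm_minus_commute)
    then have "\<Psi> z \<le> \<Psi> z1" by (rule z1(2))
    moreover have "0 < \<epsilon> / 4 * (norm (z - z1))\<^sup>2" using \<epsilon> z(2) by simp
    ultimately show "U (fst z) + V (snd z) - (g' \<bullet> z + z \<bullet> L' z / 2) < U (fst z1) + V (snd z1) - (g' \<bullet> z1 + z1 \<bullet> L' z1 / 2)"
      unfolding expand \<Psi>_def by simp
  qed
  moreover have "(\<xi>, \<eta>) \<bullet> L' (\<xi>, \<eta>) = (\<xi>, \<eta>) \<bullet> L (\<xi>, \<eta>) + \<epsilon> * ((norm \<xi>)\<^sup>2 + (norm \<eta>)\<^sup>2)" for \<xi> \<eta>
    by (simp add: L'_def inner_add_right inner_prod_def[of "(\<xi>, \<eta>)" "(\<epsilon> *\<^sub>R \<xi>, \<epsilon> *\<^sub>R \<eta>)"] power2_norm_eq_inner algebra_simps)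
  ultimately show ?thesis by simp
qed

section \<open>Radial test functions and the Hoelder estimate\<close>

lemma second_order_Taylor:
  fixes f f' f'' :: "real \<Rightarrow> real"
  assumes "\<delta>0 > 0" and D: "\<And>t. \<bar>t - s0\<bar> < \<delta>0 \<Longrightarrow> DERIV f t :> f' t" "\<And>t. \<bar>t - s0\<bar> < \<delta>0 \<Longrightarrow> DERIV f' t :> f'' t"
    and cont: "isCont f'' s0" and \<epsilon>: "\<epsilon> > 0"
  obtains \<delta> where "\<delta> > 0" "\<And>\<sigma>. \<bar>\<sigma>\<bar> < \<delta> \<Longrightarrow> \<bar>f (s0 + \<sigma>) - (f s0 + f' s0 * \<sigma> + f'' s0 / 2 * \<sigma>\<^sup>2)\<bar> \<le> \<epsilon> * \<sigma>\<^sup>2"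
proof -
  obtain d where d: "d > 0" "\<And>t. \<bar>t - s0\<bar> < d \<Longrightarrow> \<bar>f'' t - f'' s0\<bar> < 2 * \<epsilon>"
    using cont \<epsilon> unfolding continuous_at_eps_delta dist_real_def by (metis mult_pos_pos zero_less_numeral)
  define \<delta> where "\<delta> = min d \<delta>0"
  have \<delta>: "\<delta> > 0" using d assms(1) by (simp add: \<delta>_def)
  have "\<bar>f (s0 + \<sigma>) - (f s0 + f' s0 * \<sigma> + f'' s0 / 2 * \<sigma>\<^sup>2)\<bar> \<le> \<epsilon> * \<sigma>\<^sup>2" if \<sigma>: "\<bar>\<sigma>\<bar> < \<delta>" for \<sigma>
  proof (cases "\<sigma> = 0")
    case False
    define diff where "diff m = (if m = 0 then f else if m = 1 then f' else f'')" for m :: nat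
    have "\<exists>t. (if s0 + \<sigma> < s0 then s0 + \<sigma> < t \<and> t < s0 else s0 < t \<and> t < s0 + \<sigma>) \<and>
      f (s0 + \<sigma>) = (\<Sum>m<2. diff m s0 / fact m * (s0 + \<sigma> - s0) ^ m) + diff 2 t / fact 2 * (s0 + \<sigma> - s0) ^ 2"
    proof (rule Taylor[where a = "s0 - \<bar>\<sigma>\<bar>" and b = "s0 + \<bar>\<sigma>\<bar>"])
      show "\<forall>m t. m < 2 \<and> s0 - \<bar>\<sigma>\<bar> \<le> t \<and> t \<le> s0 + \<bar>\<sigma>\<bar> \<longrightarrow> DERIV (diff m) t :> diff (Suc m) t"
      proof (intro allI impI)
        fix m :: nat and t assume *: "m < 2 \<and> s0 - \<bar>\<sigma>\<bar> \<le> t \<and> t \<le> s0 + \<bar>\<sigma>\<bar>"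
        then have "\<bar>t - s0\<bar> < \<delta>0" using \<sigma> by (auto simp: \<delta>_def)
        moreover have "m = 0 \<or> m = 1" using * by auto
        ultimately show "DERIV (diff m) t :> diff (Suc m) t" using D by (auto simp: diff_def)
      qed
    qed (use False in \<open>auto simp: diff_def\<close>)
    then obtain t where t0: "if s0 + \<sigma> < s0 then s0 + \<sigma> < t \<and> t < s0 else s0 < t \<and> t < s0 + \<sigma>"
      "f (s0 + \<sigma>) = (\<Sum>m<2. diff m s0 / fact m * (s0 + \<sigma> - s0) ^ m) + diff 2 t / fact 2 * (s0 + \<sigma> - s0) ^ 2"
      by blast
    have t: "\<bar>t - s0\<bar> < \<bar>\<sigma>\<bar>" using t0(1) by (auto split: if_splits)
    have ft: "f (s0 + \<sigma>) = f s0 + f' s0 * \<sigma> + f'' t / 2 * \<sigma>\<^sup>2"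
      using t0(2) by (simp add: diff_def numeral_2_eq_2)
    have "\<bar>f'' t - f'' s0\<bar> * \<sigma>\<^sup>2 \<le> 2 * \<epsilon> * \<sigma>\<^sup>2"
      using d(2)[of t] t \<sigma> by (intro mult_right_mono) (auto simp: \<delta>_def)
    moreover have "\<bar>f (s0 + \<sigma>) - (f s0 + f' s0 * \<sigma> + f'' s0 / 2 * \<sigma>\<^sup>2)\<bar> = \<bar>f'' t - f'' s0\<bar> * \<sigma>\<^sup>2 / 2"
    proof -
      have "f (s0 + \<sigma>) - (f s0 + f' s0 * \<sigma> + f'' s0 / 2 * \<sigma>\<^sup>2) = (f'' t - f'' s0) * \<sigma>\<^sup>2 / 2"
        unfolding ft by (simp add: algebra_simps diff_divide_distrib)
      then show ?thesis by (simp only:) (simp add: abs_mult)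
    qed
    ultimately show ?thesis by simp
  qed (use \<epsilon> in simp)
  then show ?thesis using that \<delta> by blast
qed

text \<open>Radial functions are written in the variable |x|^2, whose increment 2 z.h + |h|^2 is a
  polynomial in h. The Hessian at z is 2 f' I plus 4 f'' times the rank-one form of z.\<close>

lemma radial_Taylor:
  fixes f f' f'' :: "real \<Rightarrow> real" and z :: "'a::euclidean_space"
  assumes "\<delta>0 > 0" and D: "\<And>t. \<bar>t - (norm z)\<^sup>2\<bar> < \<delta>0 \<Longrightarrow> DERIV f t :> f' t" "\<And>t. \<bar>t - (norm z)\<^sup>2\<bar> < \<delta>0 \<Longrightarrow> DERIV f' t :> f'' t"
    and cont: "isCont f'' ((norm z)\<^sup>2)" and \<epsilon>: "\<epsilon> > 0"
  obtains d where "d > 0" "\<And>h. norm h < d \<Longrightarrow> \<bar>f ((norm (z + h))\<^sup>2) - (f ((norm z)\<^sup>2) + 2 * f' ((norm z)\<^sup>2) * (z \<bullet> h)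
    + f' ((norm z)\<^sup>2) * (norm h)\<^sup>2 + 2 * f'' ((norm z)\<^sup>2) * (z \<bullet> h)\<^sup>2)\<bar> \<le> \<epsilon> * (norm h)\<^sup>2"
proof -
  define s0 where "s0 = (norm z)\<^sup>2"
  define A where "A = 2 * norm z + 1"
  have A: "A \<ge> 1" by (simp add: A_def)
  define \<epsilon>1 where "\<epsilon>1 = \<epsilon> / 2 / A\<^sup>2"
  have \<epsilon>1: "\<epsilon>1 > 0" using \<epsilon> A by (simp add: \<epsilon>1_def)
  obtain \<delta> where \<delta>: "\<delta> > 0" "\<And>\<sigma>. \<bar>\<sigma>\<bar> < \<delta> \<Longrightarrow> \<bar>f (s0 + \<sigma>) - (f s0 + f' s0 * \<sigma> + f'' s0 / 2 * \<sigma>\<^sup>2)\<bar> \<le> \<epsilon>1 * \<sigma>\<^sup>2"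
    by (rule second_order_Taylor[OF assms(1) D cont \<epsilon>1, folded s0_def], (assumption | (rule that; assumption))+)
  define F where "F = \<bar>f'' s0\<bar> * A + 1"
  have F: "F > 0" using A by (auto simp: F_def intro!: add_nonneg_pos)
  define d where "d = min 1 (min (\<delta> / A) (\<epsilon> / (4 * F)))"
  have d: "d > 0" "d \<le> 1" "d \<le> \<delta> / A" "d \<le> \<epsilon> / (4 * F)" using \<delta> A \<epsilon> F by (auto simp: d_def)
  have "\<bar>f ((norm (z + h))\<^sup>2) - (f s0 + 2 * f' s0 * (z \<bullet> h) + f' s0 * (norm h)\<^sup>2 + 2 * f'' s0 * (z \<bullet> h)\<^sup>2)\<bar> \<le> \<epsilon> * (norm h)\<^sup>2"
    if h: "norm h < d" for h
  proof -
    define \<sigma> where "\<sigma> = 2 * (z \<bullet> h) + (norm h)\<^sup>2"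
    define n where "n = norm h"
    have n: "0 \<le> n" "n < 1" "n < \<delta> / A" "n \<le> \<epsilon> / (4 * F)" using h d by (auto simp: n_def)
    have zh: "\<bar>z \<bullet> h\<bar> \<le> norm z * n" unfolding n_def by (rule Cauchy_Schwarz_ineq2)
    have n2: "n\<^sup>2 \<le> n" using n by (simp add: power2_eq_square mult_left_le_one_le)
    have "\<bar>\<sigma>\<bar> \<le> 2 * (norm z * n) + n" 
      unfolding \<sigma>_def n_def[symmetric] using zh n2 zero_le_power2[of n] unfolding abs_le_iff by linarith
    also have "\<dots> = A * n" by (simp add: A_def algebra_simps)
    finally have \<sigma>A: "\<bar>\<sigma>\<bar> \<le> A * n" .
    also have "A * n < \<delta>" using n(3) A by (simp add: field_simps)
    finally have "\<bar>f (s0 + \<sigma>) - (f s0 + f' s0 * \<sigma> + f'' s0 / 2 * \<sigma>\<^sup>2)\<bar> \<le> \<epsilon>1 * \<sigma>\<^sup>2" by (rule \<delta>(2))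
    also have "\<epsilon>1 * \<sigma>\<^sup>2 \<le> \<epsilon>1 * (A * n)\<^sup>2"
      using \<sigma>A \<epsilon>1 abs_le_square_iff[of \<sigma> "A * n"] by (intro mult_left_mono) auto
    also have "\<dots> = \<epsilon> / 2 * n\<^sup>2" using A by (simp add: \<epsilon>1_def power_mult_distrib)
    finally have 1: "\<bar>f (s0 + \<sigma>) - (f s0 + f' s0 * \<sigma> + f'' s0 / 2 * \<sigma>\<^sup>2)\<bar> \<le> \<epsilon> / 2 * n\<^sup>2" .
    have "\<sigma>\<^sup>2 - 4 * (z \<bullet> h)\<^sup>2 = n\<^sup>2 * (4 * (z \<bullet> h) + n\<^sup>2)" by (simp add: \<sigma>_def n_def power2_eq_square algebra_simps)
    then have "\<bar>\<sigma>\<^sup>2 - 4 * (z \<bullet> h)\<^sup>2\<bar> = n\<^sup>2 * \<bar>4 * (z \<bullet> h) + n\<^sup>2\<bar>" by (simp add: abs_mult)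
    also have "\<dots> \<le> n\<^sup>2 * (4 * A * n)"
    proof (rule mult_left_mono)
      have "\<bar>4 * (z \<bullet> h) + n\<^sup>2\<bar> \<le> 4 * (norm z * n) + n"
        using zh n2 zero_le_power2[of n] unfolding abs_le_iff by linarith
      also have "\<dots> \<le> 4 * A * n" using n(1) by (simp add: A_def algebra_simps)
      finally show "\<bar>4 * (z \<bullet> h) + n\<^sup>2\<bar> \<le> 4 * A * n" .
    qed simp
    finally have "\<bar>f'' s0 / 2\<bar> * \<bar>\<sigma>\<^sup>2 - 4 * (z \<bullet> h)\<^sup>2\<bar> \<le> \<bar>f'' s0 / 2\<bar> * (n\<^sup>2 * (4 * A * n))" by (intro mult_left_mono) auto
    also have "\<dots> = 2 * (\<bar>f'' s0\<bar> * A) * n * n\<^sup>2" by (simp add: algebra_simps)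
    also have "\<dots> \<le> 2 * F * n * n\<^sup>2" using n by (intro mult_right_mono) (auto simp: F_def)
    also have "\<dots> \<le> \<epsilon> / 2 * n\<^sup>2"
      using n(4) F by (intro mult_right_mono) (auto simp: field_simps)
    finally have 2: "\<bar>f'' s0 / 2 * (\<sigma>\<^sup>2 - 4 * (z \<bullet> h)\<^sup>2)\<bar> \<le> \<epsilon> / 2 * n\<^sup>2" by (simp add: abs_mult)
    have e: "(norm (z + h))\<^sup>2 = s0 + \<sigma>" by (simp add: norm_sq_add s0_def \<sigma>_def)
    have "f s0 + 2 * f' s0 * (z \<bullet> h) + f' s0 * (norm h)\<^sup>2 + 2 * f'' s0 * (z \<bullet> h)\<^sup>2
       = (f s0 + f' s0 * \<sigma> + f'' s0 / 2 * \<sigma>\<^sup>2) - f'' s0 / 2 * (\<sigma>\<^sup>2 - 4 * (z \<bullet> h)\<^sup>2)"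
      by (simp add: \<sigma>_def[symmetric] algebra_simps) (simp add: \<sigma>_def algebra_simps)
    moreover have "\<epsilon> / 2 * n\<^sup>2 + \<epsilon> / 2 * n\<^sup>2 = \<epsilon> * (norm h)\<^sup>2" by (simp add: n_def)
    ultimately show ?thesis using 1 2 unfolding e by linarith
  qed
  then show ?thesis using that[OF d(1)] unfolding s0_def by blast
qed

text \<open>The matrix P = c I - (X + Y) is nonnegative with trace at least \<kappa>, so F(X + P) <=
  - lam \<kappa>. But X + P = - Y + c I, where F is at least - Lam times the trace of c I.\<close>

lemma elliptic_gap:
  fixes F :: "real^'n^'n \<Rightarrow> real"
  assumes ue: "uniformly_elliptic lam Lam F" and X: "symmetric_mat X" "F X \<le> 0"
    and Y: "symmetric_mat Y" "dual_operator F Y \<le> 0" and "c \<ge> 0"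
    and all: "\<And>\<xi>. \<xi> \<bullet> (X *v \<xi>) + \<xi> \<bullet> (Y *v \<xi>) \<le> c * (norm \<xi>)\<^sup>2"
    and e: "norm e = 1" "e \<bullet> (X *v e) + e \<bullet> (Y *v e) \<le> c - \<kappa>"
  shows "lam * \<kappa> \<le> Lam * (c * real CARD('n))"
proof -
  define P where "P = c *\<^sub>R mat 1 - (X + Y)"
  have P: "\<xi> \<bullet> (P *v \<xi>) = c * (norm \<xi>)\<^sup>2 - (\<xi> \<bullet> (X *v \<xi>) + \<xi> \<bullet> (Y *v \<xi>))" for \<xi>
    by (simp add: P_def mvm_simps inner_diff_right inner_add_right power2_norm_eq_inner)
  have "symmetric_mat P" unfolding P_def by (intro symmetric_mat_ops X Y)
  then have psd: "nonneg_definite P" using P all by (simp add: nonneg_definite_def)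
  have "\<kappa> \<le> e \<bullet> (P *v e)" using e by (simp add: P)
  also have "\<dots> \<le> trace P" by (rule trace_ge_quadratic_form[OF psd e(1)])
  finally have "lam * \<kappa> \<le> lam * trace P" using ue by (simp add: uniformly_elliptic_def)
  moreover have "F (X + P) \<le> F X - lam * trace P" by (rule uniformly_elliptic_add(2)[OF ue X(1) psd])
  moreover have "X + P = - Y + c *\<^sub>R mat 1" by (simp add: P_def)
  moreover have "F (- Y) \<le> F (- Y + c *\<^sub>R mat 1) + Lam * (c * real CARD('n))"
    by (rule uniformly_elliptic_add_scal[OF ue symmetric_mat_ops(3)[OF Y(1)] \<open>c \<ge> 0\<close>])
  moreover have "F (- Y) \<ge> 0" using Y(2) by (simp add: dual_operator_def)
  ultimately show ?thesis using X(2) by simp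
qed

text \<open>Doubling the variables with the penalty k |x - y|^2 reduces contact of the sum u + w at
  a single point to the theorem on sums; testing with equal vectors removes the penalty.\<close>

lemma difference_jets:
  fixes u w :: "real^'n \<Rightarrow> real" and F G :: "real^'n^'n \<Rightarrow> real" and D :: "real^'n \<Rightarrow> real^'n"
  assumes ue: "uniformly_elliptic lam Lam F" "uniformly_elliptic lam Lam G"
    and S: "open S" "continuous_on S u" "continuous_on S w" "qsub F S u" "qsub G S w" "x0 \<in> S"
    and D: "linear D" "\<And>a b. D a \<bullet> b = a \<bullet> D b"
    and d0: "d0 > 0" "\<And>h. norm h < d0 \<Longrightarrow> u (x0 + h) + w (x0 + h) \<le> u x0 + w x0 + g \<bullet> h + h \<bullet> D h / 2"
    and \<epsilon>: "\<epsilon> > 0"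
  shows "\<exists>X Y. symmetric_mat X \<and> symmetric_mat Y \<and> F X \<le> 0 \<and> G Y \<le> 0 \<and>
    (\<forall>\<xi>. \<xi> \<bullet> (X *v \<xi>) + \<xi> \<bullet> (Y *v \<xi>) \<le> \<xi> \<bullet> D \<xi> + \<epsilon> * (norm \<xi>)\<^sup>2)"
proof -
  obtain d1 where d1: "d1 > 0" "cball x0 d1 \<subseteq> S" using S(1,6) open_contains_cball by metis
  define d where "d = min d1 (d0 / 2)"
  have d: "d > 0" "d < d0" "cball x0 d \<subseteq> S"
    using d1 d0(1) by (auto simp: d_def intro: order_trans[OF subset_cball])
  let ?C = "cball x0 d"
  have cu: "continuous_on ?C u" and cw: "continuous_on ?C w" using S(2,3) d(3) continuous_on_subset by blast+
  define q where "q h = g \<bullet> h + h \<bullet> D h / 2" for h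
  have q_add: "q (z + h) - q z = g \<bullet> h + D z \<bullet> h + h \<bullet> D h / 2" for z h
  proof -
    have "z \<bullet> D h = D z \<bullet> h" "h \<bullet> D z = D z \<bullet> h" using D(2)[of z h] by (auto simp: inner_commute)
    then show ?thesis by (simp add: q_def linear_add[OF D(1)] inner_add_left inner_add_right add_divide_distrib)
  qed
  \<comment> \<open>Twice e comes from the localizing paraboloid and twice e from the theorem on
    sums.\<close>
  define e where "e = \<epsilon> / 4"
  have e: "e > 0" using \<epsilon> by (simp add: e_def)
  have contD: "continuous_on UNIV D" by (rule linear_continuous_on[OF linear_conv_bounded_linear[THEN iffD1, OF D(1)]])
  have contq: "continuous_on UNIV (\<lambda>x. q (x - x0))"
    unfolding q_def by (intro continuous_intros continuous_on_compose2[OF contD]) auto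
  have "uniformly_continuous_on ?C w" by (rule compact_uniformly_continuous[OF cw compact_cball])
  moreover have "e * (d / 2)\<^sup>2 > 0" using e d by simp
  ultimately obtain \<delta> where \<delta>: "\<delta> > 0" "\<And>x y. x \<in> ?C \<Longrightarrow> y \<in> ?C \<Longrightarrow> dist x y < \<delta> \<Longrightarrow> dist (w x) (w y) < e * (d / 2)\<^sup>2"
    unfolding uniformly_continuous_on_def by (metis dist_commute)
  have "bounded ((\<lambda>x. u x - q (x - x0)) ` ?C)" "bounded (w ` ?C)"
    using cu cw contq by (auto intro!: compact_imp_bounded compact_continuous_image continuous_intros intro: continuous_on_subset)
  then obtain M1 M2 where M12: "\<forall>x\<in>?C. \<bar>u x - q (x - x0)\<bar> \<le> M1" "\<forall>x\<in>?C. \<bar>w x\<bar> \<le> M2"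
    by (auto simp: bounded_iff)
  \<comment> \<open>So large that the total oscillation forces |a - b| below d / 2 and below the
    range in which w varies by less than e (d / 2)^2.\<close>
  define k where "k = (2 * M1 + 2 * M2 + 1) / (min \<delta> (d / 2))\<^sup>2"
  have "x0 \<in> ?C" using d(1) by simp
  then have M0: "M1 \<ge> 0" "M2 \<ge> 0" using M12 order_trans[OF abs_ge_zero] by blast+
  have md: "(min \<delta> (d / 2))\<^sup>2 > 0" using \<delta> d by simp
  have k: "k > 0" using M0 md by (auto simp: k_def intro!: divide_pos_pos)
  define \<Phi> where "\<Phi> z = u (fst z) + w (snd z) - q (fst z - x0) - e * (norm (fst z - x0))\<^sup>2 - k * (norm (fst z - snd z))\<^sup>2" for z
  have "continuous_on (?C \<times> ?C) \<Phi>"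
    unfolding \<Phi>_def
    by (intro continuous_intros continuous_on_compose2[OF cu] continuous_on_compose2[OF cw] continuous_on_compose2[OF contq]) auto
  then obtain a b where ab: "a \<in> ?C" "b \<in> ?C" "\<And>x y. x \<in> ?C \<Longrightarrow> y \<in> ?C \<Longrightarrow> \<Phi> (x, y) \<le> \<Phi> (a, b)"
    using continuous_attains_sup[of "?C \<times> ?C" \<Phi>] d(1) by (force simp: compact_Times)
  have "u x0 + w x0 \<le> \<Phi> (a, b)" using ab(3)[of x0 x0] d(1) by (simp add: \<Phi>_def q_def linear_0[OF D(1)])
  then have base: "k * (norm (a - b))\<^sup>2 + e * (norm (a - x0))\<^sup>2 \<le> u a + w b - q (a - x0) - u x0 - w x0"
    by (simp add: \<Phi>_def)
  have e0: "0 \<le> e * (norm (a - x0))\<^sup>2" "0 \<le> k * (norm (a - b))\<^sup>2" using e k by simp_all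
  have "\<bar>u x0\<bar> \<le> M1" using M12(1)[rule_format, of x0] d(1) by (simp add: q_def linear_0[OF D(1)])
  then have "k * (norm (a - b))\<^sup>2 < 2 * M1 + 2 * M2 + 1"
    using base e0 M12(1)[rule_format, OF ab(1)] M12(2)[rule_format, OF ab(2)] M12(2)[rule_format, of x0] d(1)
    unfolding abs_le_iff by simp
  moreover have "k * (min \<delta> (d / 2))\<^sup>2 = 2 * M1 + 2 * M2 + 1" using md by (simp add: k_def)
  ultimately have "k * (norm (a - b))\<^sup>2 < k * (min \<delta> (d / 2))\<^sup>2" by linarith
  then have "(norm (a - b))\<^sup>2 < (min \<delta> (d / 2))\<^sup>2"
    by (rule mult_left_less_imp_less[OF _ less_imp_le[OF k]])
  then have nab: "norm (a - b) < min \<delta> (d / 2)" by (rule power2_less_imp_less) (use \<delta>(1) d(1) in auto)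
  have "u a + w a \<le> u x0 + w x0 + q (a - x0)"
    using d0(2)[of "a - x0"] ab(1) d(2) by (simp add: q_def dist_norm norm_minus_commute)
  moreover have "\<bar>w b - w a\<bar> < e * (d / 2)\<^sup>2"
    using \<delta>(2)[OF ab(2,1)] nab by (simp add: dist_norm norm_minus_commute)
  ultimately have "e * (norm (a - x0))\<^sup>2 < e * (d / 2)\<^sup>2" using base e0 by linarith
  then have "(norm (a - x0))\<^sup>2 < (d / 2)\<^sup>2" using e by simp
  then have na: "norm (a - x0) < d / 2" by (rule power2_less_imp_less) (use d(1) in auto)
  have nb: "norm (b - x0) < d" using na nab norm_triangle_ineq[of "b - a" "a - x0"] by (simp add: norm_minus_commute)
  define L where "L h = (D (fst h) + (2 * e) *\<^sub>R fst h + (2 * k) *\<^sub>R (fst h - snd h), (- 2 * k) *\<^sub>R (fst h - snd h))" for h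
  have linL: "linear L"
    by (rule linearI) (simp_all add: L_def linear_add[OF D(1)] linear_scale[OF D(1)] algebra_simps)
  have Lh: "h \<bullet> L h' = fst h \<bullet> D (fst h') + 2 * e * (fst h \<bullet> fst h') + 2 * k * ((fst h - snd h) \<bullet> (fst h' - snd h'))" for h h'
    by (simp add: L_def inner_prod_def inner_add_right inner_diff_left inner_diff_right algebra_simps)
  have symL: "L h \<bullet> h' = h \<bullet> L h'" for h h'
    unfolding inner_commute[of "L h"] Lh using D(2)[of "fst h" "fst h'"] by (simp add: inner_commute)
  define G' where "G' = (g + D (a - x0) + (2 * e) *\<^sub>R (a - x0) + (2 * k) *\<^sub>R (a - b), (- 2 * k) *\<^sub>R (a - b))"
  define d2 where "d2 = min (d / 2) (d - norm (b - x0))"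
  have d2: "d2 > 0" using nb d(1) by (simp add: d2_def)
  have ineq: "u (a + fst h) + w (b + snd h) \<le> u a + w b + G' \<bullet> h + h \<bullet> L h / 2" if h: "norm h < d2" for h
  proof -
    have h12: "norm (fst h) < d2" "norm (snd h) < d2" 
      using h norm_fst_le[of "fst h" "snd h"] norm_snd_le[of "snd h" "fst h"] by simp_all
    have "norm (a + fst h - x0) \<le> norm (a - x0) + norm (fst h)" "norm (b + snd h - x0) \<le> norm (b - x0) + norm (snd h)"
      using norm_triangle_ineq[of "a - x0" "fst h"] norm_triangle_ineq[of "b - x0" "snd h"] by (simp_all add: algebra_simps)
    then have "a + fst h \<in> ?C" "b + snd h \<in> ?C"
      using h12 na by (auto simp: d2_def dist_norm norm_minus_commute)
    from ab(3)[OF this] have "u (a + fst h) + w (b + snd h) \<le> u a + w b + (q (a - x0 + fst h) - q (a - x0))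
       + e * ((norm (a - x0 + fst h))\<^sup>2 - (norm (a - x0))\<^sup>2) + k * ((norm (a - b + (fst h - snd h)))\<^sup>2 - (norm (a - b))\<^sup>2)"
      by (simp add: \<Phi>_def algebra_simps)
    also have "q (a - x0 + fst h) - q (a - x0) = g \<bullet> fst h + D (a - x0) \<bullet> fst h + fst h \<bullet> D (fst h) / 2"
      by (rule q_add)
    also have "e * ((norm (a - x0 + fst h))\<^sup>2 - (norm (a - x0))\<^sup>2) = 2 * e * ((a - x0) \<bullet> fst h) + e * (fst h \<bullet> fst h)"
      unfolding norm_sq_add by (simp add: power2_norm_eq_inner[of "fst h"] distrib_left)
    also have "k * ((norm (a - b + (fst h - snd h)))\<^sup>2 - (norm (a - b))\<^sup>2) = 2 * k * ((a - b) \<bullet> (fst h - snd h)) + k * ((fst h - snd h) \<bullet> (fst h - snd h))"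
      unfolding norm_sq_add by (simp add: power2_norm_eq_inner[of "fst h - snd h"] distrib_left)
    also have "u a + w b + (g \<bullet> fst h + D (a - x0) \<bullet> fst h + fst h \<bullet> D (fst h) / 2) + (2 * e * ((a - x0) \<bullet> fst h) + e * (fst h \<bullet> fst h))
      + (2 * k * ((a - b) \<bullet> (fst h - snd h)) + k * ((fst h - snd h) \<bullet> (fst h - snd h))) = u a + w b + G' \<bullet> h + h \<bullet> L h / 2"
    proof -
      have "G' \<bullet> h = g \<bullet> fst h + D (a - x0) \<bullet> fst h + 2 * e * ((a - x0) \<bullet> fst h) + 2 * k * ((a - b) \<bullet> (fst h - snd h))"
        by (simp add: G'_def inner_prod_def inner_add_left inner_diff_right right_diff_distrib)
      then show ?thesis unfolding Lh by (simp add: add_divide_distrib)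
    qed
    finally show ?thesis .
  qed
  have aS: "a \<in> S" "b \<in> S" using ab(1,2) d(3) by auto
  obtain X Y where XY: "symmetric_mat X" "symmetric_mat Y" "F X \<le> 0" "G Y \<le> 0"
    "\<And>\<xi> \<eta>. \<xi> \<bullet> (X *v \<xi>) + \<eta> \<bullet> (Y *v \<eta>) \<le> (\<xi>, \<eta>) \<bullet> L (\<xi>, \<eta>) + e * ((norm \<xi>)\<^sup>2 + (norm \<eta>)\<^sup>2)"
    using theorem_on_sums[OF ue S(1-5) aS linL symL d2 ineq e] by blast
  have "\<xi> \<bullet> (X *v \<xi>) + \<xi> \<bullet> (Y *v \<xi>) \<le> \<xi> \<bullet> D \<xi> + \<epsilon> * (norm \<xi>)\<^sup>2" for \<xi>
    using XY(5)[of \<xi> \<xi>] unfolding Lh by (simp add: e_def power2_norm_eq_inner)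
  then show ?thesis using XY(1-4) by blast
qed

text \<open>If \<open>u + w - f(|\<cdot> - y0|\<^sup>2)\<close> has a local maximum, the radial function cannot be strictly
  on the wrong side of the extremal equation.\<close>

lemma radial_touching:
  fixes u w :: "real^'n \<Rightarrow> real" and F :: "real^'n^'n \<Rightarrow> real"
  assumes ue: "uniformly_elliptic lam Lam F"
    and S: "open S" "continuous_on S u" "continuous_on S w" "qsub F S u" "qsub (dual_operator F) S w" "x0 \<in> S"
    and ne: "x0 \<noteq> y0" and s0: "s0 = (norm (x0 - y0))\<^sup>2"
    and f: "\<delta>0 > 0" "\<And>t. \<bar>t - s0\<bar> < \<delta>0 \<Longrightarrow> DERIV f t :> f' t" "\<And>t. \<bar>t - s0\<bar> < \<delta>0 \<Longrightarrow> DERIV f' t :> f'' t" "isCont f'' s0"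
    and f0: "f' s0 \<ge> 0"
    and d0: "d0 > 0" "\<And>x. norm (x - x0) < d0 \<Longrightarrow> u x + w x - f ((norm (x - y0))\<^sup>2) \<le> u x0 + w x0 - f s0"
  shows "lam * (- 4 * f'' s0 * s0) \<le> Lam * (2 * f' s0 * real CARD('n))"
proof -
  define z where "z = x0 - y0"
  have zs: "s0 = (norm z)\<^sup>2" using s0 by (simp add: z_def)
  have z: "z \<noteq> 0" using ne by (simp add: z_def)
  have approx: "lam * (- 4 * f'' s0 * s0) \<le> Lam * ((2 * f' s0 + 3 * \<epsilon>) * real CARD('n))" if \<epsilon>: "\<epsilon> > 0" for \<epsilon>
  proof -
    obtain d1 where d1: "d1 > 0" "\<And>h. norm h < d1 \<Longrightarrow> \<bar>f ((norm (z + h))\<^sup>2) - (f s0 + 2 * f' s0 * (z \<bullet> h)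
      + f' s0 * (norm h)\<^sup>2 + 2 * f'' s0 * (z \<bullet> h)\<^sup>2)\<bar> \<le> \<epsilon> * (norm h)\<^sup>2"
      using radial_Taylor[OF f(1), of z f f' f'' \<epsilon>, folded zs, OF f(2-4) \<epsilon>] by blast
    define D where "D h = (2 * f' s0 + 2 * \<epsilon>) *\<^sub>R h + (4 * f'' s0 * (z \<bullet> h)) *\<^sub>R z" for h
    have linD: "linear D" by (rule linearI) (simp_all add: D_def inner_add_right algebra_simps)
    have Dh: "a \<bullet> D b = (2 * f' s0 + 2 * \<epsilon>) * (a \<bullet> b) + 4 * f'' s0 * (z \<bullet> b) * (z \<bullet> a)" for a b
      by (simp add: D_def inner_add_right inner_commute)
    have Dhh: "h \<bullet> D h = 2 * f' s0 * (norm h)\<^sup>2 + 2 * \<epsilon> * (norm h)\<^sup>2 + 4 * f'' s0 * (z \<bullet> h)\<^sup>2" for h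
      unfolding Dh by (simp add: dot_square_norm power2_eq_square[of "z \<bullet> h"] distrib_right)
    have symD: "D a \<bullet> b = a \<bullet> D b" for a b
      unfolding inner_commute[of "D a"] Dh by (simp add: inner_commute)
    have ineq: "u (x0 + h) + w (x0 + h) \<le> u x0 + w x0 + ((2 * f' s0) *\<^sub>R z) \<bullet> h + h \<bullet> D h / 2" if h: "norm h < min d0 d1" for h
    proof -
      have "u (x0 + h) + w (x0 + h) \<le> u x0 + w x0 + (f ((norm (z + h))\<^sup>2) - f s0)"
        using d0(2)[of "x0 + h"] h by (simp add: z_def algebra_simps)
      moreover have "\<bar>f ((norm (z + h))\<^sup>2) - (f s0 + 2 * f' s0 * (z \<bullet> h)
        + f' s0 * (norm h)\<^sup>2 + 2 * f'' s0 * (z \<bullet> h)\<^sup>2)\<bar> \<le> \<epsilon> * (norm h)\<^sup>2" using d1(2) h by simp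
      moreover have "h \<bullet> D h / 2 = f' s0 * (norm h)\<^sup>2 + \<epsilon> * (norm h)\<^sup>2 + 2 * f'' s0 * (z \<bullet> h)\<^sup>2"
        unfolding Dhh by (simp add: add_divide_distrib)
      moreover have "((2 * f' s0) *\<^sub>R z) \<bullet> h = 2 * f' s0 * (z \<bullet> h)" by simp
      ultimately show ?thesis by linarith
    qed
    have "min d0 d1 > 0" using d0(1) d1(1) by simp
    from difference_jets[OF ue uniformly_elliptic_dual[OF ue] S linD symD this ineq \<epsilon>]
    obtain X Y where XY: "symmetric_mat X" "symmetric_mat Y" "F X \<le> 0" "dual_operator F Y \<le> 0"
      "\<And>\<xi>. \<xi> \<bullet> (X *v \<xi>) + \<xi> \<bullet> (Y *v \<xi>) \<le> \<xi> \<bullet> D \<xi> + \<epsilon> * (norm \<xi>)\<^sup>2" by blast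
    have nn: "0 \<le> Lam * ((2 * f' s0 + 3 * \<epsilon>) * real CARD('n))"
      using f0 \<epsilon> ue by (auto simp: uniformly_elliptic_def intro!: mult_nonneg_nonneg)
    show ?thesis
    proof (cases "f'' s0 \<le> 0")
      case True
      show ?thesis
      proof (rule elliptic_gap[OF ue XY(1,3,2,4)])
        show "0 \<le> 2 * f' s0 + 3 * \<epsilon>" using f0 \<epsilon> by simp
        have "4 * f'' s0 * (z \<bullet> \<xi>)\<^sup>2 \<le> 0" for \<xi> using True by (simp add: mult_nonpos_nonneg)
        then show "\<xi> \<bullet> (X *v \<xi>) + \<xi> \<bullet> (Y *v \<xi>) \<le> (2 * f' s0 + 3 * \<epsilon>) * (norm \<xi>)\<^sup>2" for \<xi>
          using XY(5)[of \<xi>] add_mono[OF XY(5)[of \<xi>], of "- (4 * f'' s0 * (z \<bullet> \<xi>)\<^sup>2)"] unfolding Dhh distrib_right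
          by (smt (verit) distrib_right)
        \<comment> \<open>In the radial direction the rank-one term contributes 4 f'' s0, which is
          the whole gap.\<close>
        define e where "e = z /\<^sub>R norm z"
        show ne1: "norm e = 1" using z by (simp add: e_def)
        have "z \<bullet> e = norm z" using z by (simp add: e_def dot_square_norm power2_eq_square)
        then have "(z \<bullet> e)\<^sup>2 = s0" by (simp add: zs)
        then show "e \<bullet> (X *v e) + e \<bullet> (Y *v e) \<le> 2 * f' s0 + 3 * \<epsilon> - - 4 * f'' s0 * s0"
          using XY(5)[of e] unfolding Dhh ne1 by simp
      qed
    next
      case False
      then have "lam * (- 4 * f'' s0 * s0) \<le> 0"
        using ue by (auto simp: uniformly_elliptic_def zs intro!: mult_nonneg_nonpos)
      then show ?thesis using nn by linarith
    qed
  qed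
  have *: "lam * (- 4 * f'' s0 * s0) \<le> Lam * (2 * f' s0 * real CARD('n)) + \<epsilon> * (3 * Lam * real CARD('n))" if "\<epsilon> > 0" for \<epsilon>
  proof -
    have "Lam * ((2 * f' s0 + 3 * \<epsilon>) * real CARD('n)) = Lam * (2 * f' s0 * real CARD('n)) + \<epsilon> * (3 * Lam * real CARD('n))"
      by (simp add: algebra_simps)
    then show ?thesis using approx[OF that] by simp
  qed
  define A where "A = 3 * Lam * real CARD('n)"
  have A: "A > 0" using ue by (auto simp: uniformly_elliptic_def A_def)
  show ?thesis
  proof (rule field_le_epsilon)
    fix e :: real assume "e > 0"
    then have "e / A > 0" using A by simp
    moreover have "e / A * A = e" using A by simp
    ultimately show "lam * (- 4 * f'' s0 * s0) \<le> Lam * (2 * f' s0 * real CARD('n)) + e"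
      using *[of "e / A", folded A_def] by simp
  qed
qed

section \<open>Hoelder continuity by doubling of variables\<close>

lemma DERIV_powr_const:
  fixes a c t :: real
  assumes "t > 0" shows "DERIV (\<lambda>t. c * t powr a) t :> c * a * t powr (a - 1)"
  using assms by (auto intro!: derivative_eq_intros simp: powr_diff field_simps)

lemma matrix_vector_mult_minus: "(X :: real^'n^'n) *v (- x) = - (X *v x)"
  using matrix_vector_mult_diff_distrib[of X 0 x] by simp

lemma positively_homogeneous_dual:
  fixes F :: "real^'n^'n \<Rightarrow> real"
  assumes "positively_homogeneous F" shows "positively_homogeneous (dual_operator F)"
  unfolding positively_homogeneous_def
proof (intro allI impI)
  fix t :: real and M :: "real^'n^'n" assume "t \<ge> 0" "symmetric_mat M"
  then have "F (t *\<^sub>R (- M)) = t * F (- M)"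
    using assms symmetric_mat_ops(3)[of M] unfolding positively_homogeneous_def by blast
  then show "dual_operator F (t *\<^sub>R M) = t * dual_operator F M" by (simp add: dual_operator_def)
qed

lemma qsub_scale:
  fixes F :: "real^'n^'n \<Rightarrow> real"
  assumes ph: "positively_homogeneous F" and qs: "qsub F S u" and "c > 0"
  shows "qsub F S (\<lambda>x. c * u x + b)"
  unfolding qsub_def
proof (intro ballI allI impI)
  fix x p :: "real^'n" and X :: "real^'n^'n" and d :: real
  assume x: "x \<in> S" and X: "symmetric_mat X" and d: "0 < d"
    and *: "\<forall>h::real^'n. norm h < d \<longrightarrow> c * u (x + h) + b \<le> c * u x + b + p \<bullet> h + h \<bullet> (X *v h) / 2"
  have "F ((1 / c) *\<^sub>R X) \<le> 0"
  proof (rule qsubD[OF qs x symmetric_mat_ops(4)[OF X] d])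
    fix h :: "real^'n" assume "norm h < d"
    then have "c * u (x + h) \<le> c * u x + (p \<bullet> h + h \<bullet> (X *v h) / 2)" using * by auto
    then have "u (x + h) \<le> (c * u x + (p \<bullet> h + h \<bullet> (X *v h) / 2)) / c"
      using \<open>c > 0\<close> by (simp add: pos_le_divide_eq mult.commute)
    also have "\<dots> = u x + (p /\<^sub>R c) \<bullet> h + h \<bullet> ((1 / c) *\<^sub>R X *v h) / 2"
      using \<open>c > 0\<close> by (simp add: mvm_simps field_simps)
    finally show "u (x + h) \<le> u x + (p /\<^sub>R c) \<bullet> h + h \<bullet> ((1 / c) *\<^sub>R X *v h) / 2" .
  qed
  moreover have "F ((1 / c) *\<^sub>R X) = (1 / c) * F X"
    using ph X \<open>c > 0\<close> by (simp add: positively_homogeneous_def)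
  ultimately show "F X \<le> 0" using \<open>c > 0\<close> by (simp add: divide_le_0_iff)
qed

text \<open>If the estimate failed, u(x) - u(y) - L |x - y|^(1/2) - 4 |x - x0|^2 would have a
  positive maximum off the diagonal. For the opposite vectors (e, - e) along x - y the concavity of
  the square root makes the form at most - \<kappa> with \<kappa> >= L, up to localization, whereas
  equal vectors see the localization only. For large L this contradicts ellipticity.\<close>

lemma Hoelder_unit:
  fixes F :: "real^'n^'n \<Rightarrow> real" and u :: "real^'n \<Rightarrow> real"
  assumes ue: "uniformly_elliptic lam Lam F" and L: "L \<ge> 2" "lam * L > 8 * Lam * real CARD('n)"
    and cu: "continuous_on (cball x0 1) u" and qu: "qsub F (ball x0 1) u" "qsub (dual_operator F) (ball x0 1) (\<lambda>x. - u x)"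
    and osc: "\<And>x y. x \<in> cball x0 1 \<Longrightarrow> y \<in> cball x0 1 \<Longrightarrow> u x - u y \<le> 1"
    and y: "y \<in> cball x0 1"
  shows "u x0 - u y \<le> L * sqrt (dist x0 y)"
proof (rule ccontr)
  assume neg: "\<not> u x0 - u y \<le> L * sqrt (dist x0 y)"
  let ?C = "cball x0 1"
  \<comment> \<open>The square root of the distance as a function of the squared distance.\<close>
  define f where "f t = L * t powr (1 / 4)" for t
  define f' where "f' t = L * (1 / 4) * t powr (1 / 4 - 1)" for t
  define f'' where "f'' t = L * (1 / 4) * (1 / 4 - 1) * t powr (1 / 4 - 1 - 1)" for t
  have fs: "f ((norm z)\<^sup>2) = L * sqrt (norm z)" for z :: "real^'n"
  proof (cases "z = 0")
    case False
    then have "((norm z)\<^sup>2) powr (1 / 4) = norm z powr (1 / 2)" by (simp add: powr_powr flip: powr_numeral)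
    then show ?thesis by (simp add: f_def powr_half_sqrt)
  qed (simp add: f_def)
  \<comment> \<open>As the oscillation is at most 1, the weight 4 gives |a - x0| < 1/2 and L >= 2
    gives |a - b| < 1/4, so that both points are interior.\<close>
  define \<Phi> where "\<Phi> z = u (fst z) - u (snd z) - L * sqrt (norm (fst z - snd z)) - 4 * (norm (fst z - x0))\<^sup>2" for z
  have "continuous_on (?C \<times> ?C) \<Phi>"
    unfolding \<Phi>_def by (intro continuous_intros continuous_on_compose2[OF cu]) auto
  then obtain a b where ab: "a \<in> ?C" "b \<in> ?C" "\<And>x y. x \<in> ?C \<Longrightarrow> y \<in> ?C \<Longrightarrow> \<Phi> (x, y) \<le> \<Phi> (a, b)"
    using continuous_attains_sup[of "?C \<times> ?C" \<Phi>] by (force simp: compact_Times)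
  have "0 < \<Phi> (x0, y)" using neg by (simp add: \<Phi>_def dist_norm)
  also have "\<dots> \<le> \<Phi> (a, b)" using ab(3)[of x0 y] y by simp
  finally have pos: "L * sqrt (norm (a - b)) + 4 * (norm (a - x0))\<^sup>2 < u a - u b" by (simp add: \<Phi>_def)
  have ne: "a \<noteq> b"
  proof
    assume "a = b"
    moreover have "0 \<le> (norm (a - x0))\<^sup>2" by simp
    ultimately show False using pos by simp
  qed
  have lt1: "L * sqrt (norm (a - b)) < 1" "4 * (norm (a - x0))\<^sup>2 < 1"
  proof -
    have "0 \<le> L * sqrt (norm (a - b))" "0 \<le> 4 * (norm (a - x0))\<^sup>2" using L by auto
    then show "L * sqrt (norm (a - b)) < 1" "4 * (norm (a - x0))\<^sup>2 < 1"
      using pos osc[OF ab(1,2)] by linarith+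
  qed
  have nax: "norm (a - x0) < 1 / 2"
    by (rule power2_less_imp_less) (use lt1(2) in \<open>auto simp: power2_eq_square\<close>)
  have "2 * sqrt (norm (a - b)) < 1" using lt1(1) L(1) mult_right_mono[of 2 L "sqrt (norm (a - b))"] by simp
  then have "(sqrt (norm (a - b)))\<^sup>2 < (1 / 2)\<^sup>2" by (intro power_strict_mono) auto
  then have nab: "norm (a - b) < 1 / 4" by (simp add: power2_eq_square)
  have nbx: "norm (b - x0) < 3 / 4"
    using nax nab norm_triangle_ineq[of "b - a" "a - x0"] by (simp add: norm_minus_commute)
  define z where "z = a - b"
  define s0 where "s0 = (norm z)\<^sup>2"
  have s0: "s0 > 0" using ne by (simp add: s0_def z_def)
  have D1: "DERIV f t :> f' t" and D2: "DERIV f' t :> f'' t" if "\<bar>t - s0\<bar> < s0" for t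
  proof -
    have "t > 0" using that by linarith
    then show "DERIV f t :> f' t" "DERIV f' t :> f'' t"
      unfolding f_def f'_def f''_def by (rule DERIV_powr_const)+
  qed
  have ct: "isCont f'' s0" unfolding f''_def using s0 by (intro continuous_intros) auto
  \<comment> \<open>The two terms are 2 L and - 3 L times s0^(-3/4).\<close>
  define \<kappa> where "\<kappa> = L * s0 powr (1 / 4 - 1)"
  have kap: "8 * f' s0 + 16 * f'' s0 * s0 = - \<kappa>"
  proof -
    have "s0 powr (1 / 4 - 1 - 1) * s0 = s0 powr (1 / 4 - 1)"
      using s0 powr_add[of s0 "1 / 4 - 1 - 1" 1] by simp
    then have "f'' s0 * s0 = L * (1 / 4) * (1 / 4 - 1) * s0 powr (1 / 4 - 1)" by (simp add: f''_def)
    then show ?thesis by (simp add: f'_def \<kappa>_def)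
  qed
  have gap: "lam * \<kappa> \<le> Lam * ((8 + 12 * \<epsilon>) * real CARD('n))" if \<epsilon>: "\<epsilon> > 0" for \<epsilon>
  proof -
    obtain d1 where d1: "d1 > 0" "\<And>h. norm h < d1 \<Longrightarrow> \<bar>f ((norm (z + h))\<^sup>2) - (f s0 + 2 * f' s0 * (z \<bullet> h)
      + f' s0 * (norm h)\<^sup>2 + 2 * f'' s0 * (z \<bullet> h)\<^sup>2)\<bar> \<le> \<epsilon> * (norm h)\<^sup>2"
      using radial_Taylor[of s0 z f f' f'' \<epsilon>, folded s0_def, OF s0 D1 D2 ct \<epsilon>] by blast
    define k where "k = (\<lambda>h :: (real^'n) \<times> (real^'n). fst h - snd h)"
    define R where "R k = (2 * f' s0 + 2 * \<epsilon>) *\<^sub>R k + (4 * f'' s0 * (z \<bullet> k)) *\<^sub>R z" for k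
    define M where "M h = (R (k h) + 8 *\<^sub>R fst h, - R (k h))" for h
    have linM: "linear M"
      by (rule linearI) (simp_all add: M_def R_def k_def inner_add_right inner_diff_right algebra_simps)
    have Mh: "h \<bullet> M h' = k h \<bullet> R (k h') + 8 * (fst h \<bullet> fst h')" for h h'
      by (simp add: M_def k_def inner_prod_def inner_add_right inner_diff_left)
    have Rs: "a \<bullet> R b = (2 * f' s0 + 2 * \<epsilon>) * (a \<bullet> b) + 4 * f'' s0 * (z \<bullet> b) * (z \<bullet> a)" for a b
      by (simp add: R_def inner_add_right inner_commute)
    have symM: "M a \<bullet> b = a \<bullet> M b" for a b
      unfolding inner_commute[of "M a"] Mh Rs by (simp add: inner_commute)
    have Rhh: "h \<bullet> R h = 2 * f' s0 * (norm h)\<^sup>2 + 2 * \<epsilon> * (norm h)\<^sup>2 + 4 * f'' s0 * (z \<bullet> h)\<^sup>2" for h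
      unfolding Rs by (simp add: dot_square_norm power2_eq_square[of "z \<bullet> h"] distrib_right)
    define g where "g = ((2 * f' s0) *\<^sub>R z + 8 *\<^sub>R (a - x0), - (2 * f' s0) *\<^sub>R z)"
    define d2 where "d2 = min (d1 / 2) (1 / 4)"
    have d2: "d2 > 0" using d1(1) by (simp add: d2_def)
    have ineq: "u (a + fst h) + (- u (b + snd h)) \<le> u a + (- u b) + g \<bullet> h + h \<bullet> M h / 2" if h: "norm h < d2" for h
    proof -
      have h12: "norm (fst h) < d2" "norm (snd h) < d2"
        using h norm_fst_le[of "fst h" "snd h"] norm_snd_le[of "snd h" "fst h"] by simp_all
      have "norm (a + fst h - x0) \<le> norm (a - x0) + norm (fst h)" "norm (b + snd h - x0) \<le> norm (b - x0) + norm (snd h)"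
        using norm_triangle_ineq[of "a - x0" "fst h"] norm_triangle_ineq[of "b - x0" "snd h"] by (simp_all add: algebra_simps)
      then have "a + fst h \<in> ?C" "b + snd h \<in> ?C"
        using h12 nax nbx by (auto simp: d2_def dist_norm norm_minus_commute)
      from ab(3)[OF this] have "u (a + fst h) - u (b + snd h) \<le> u a - u b
         + (f ((norm (z + k h))\<^sup>2) - f s0) + 4 * ((norm (a - x0 + fst h))\<^sup>2 - (norm (a - x0))\<^sup>2)"
        by (simp add: \<Phi>_def z_def k_def s0_def fs algebra_simps)
      moreover have "norm (k h) < d1"
        using h12 norm_triangle_ineq4[of "fst h" "snd h"] by (simp add: k_def d2_def)
      note d1(2)[OF this]
      moreover have "4 * ((norm (a - x0 + fst h))\<^sup>2 - (norm (a - x0))\<^sup>2) = 8 * ((a - x0) \<bullet> fst h) + 4 * (fst h \<bullet> fst h)"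
        unfolding norm_sq_add by (simp add: power2_norm_eq_inner[of "fst h"])
      moreover have "h \<bullet> M h / 2 = f' s0 * (norm (k h))\<^sup>2 + \<epsilon> * (norm (k h))\<^sup>2 + 2 * f'' s0 * (z \<bullet> k h)\<^sup>2 + 4 * (fst h \<bullet> fst h)"
        unfolding Mh Rhh by (simp add: add_divide_distrib)
      moreover have "g \<bullet> h = 2 * f' s0 * (z \<bullet> k h) + 8 * ((a - x0) \<bullet> fst h)"
        by (simp add: g_def k_def inner_prod_def inner_add_left inner_diff_right right_diff_distrib)
      ultimately show ?thesis by linarith
    qed
    have aS: "a \<in> ball x0 1" "b \<in> ball x0 1" using nax nbx by (auto simp: dist_norm norm_minus_commute)
    have cu': "continuous_on (ball x0 1) u" "continuous_on (ball x0 1) (\<lambda>x. - u x)"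
      using continuous_on_subset[OF cu ball_subset_cball] by (auto intro: continuous_intros)
    obtain X Y where XY: "symmetric_mat X" "symmetric_mat Y" "F X \<le> 0" "dual_operator F Y \<le> 0"
      "\<And>\<xi> \<eta>. \<xi> \<bullet> (X *v \<xi>) + \<eta> \<bullet> (Y *v \<eta>) \<le> (\<xi>, \<eta>) \<bullet> M (\<xi>, \<eta>) + \<epsilon> * ((norm \<xi>)\<^sup>2 + (norm \<eta>)\<^sup>2)"
      using theorem_on_sums[OF ue uniformly_elliptic_dual[OF ue] open_ball cu' qu aS linM symM d2 ineq \<epsilon>] by blast
    show ?thesis
    proof (rule elliptic_gap[OF ue XY(1,3,2,4)])
      show "0 \<le> 8 + 12 * \<epsilon>" using \<epsilon> by simp
      show "\<xi> \<bullet> (X *v \<xi>) + \<xi> \<bullet> (Y *v \<xi>) \<le> (8 + 12 * \<epsilon>) * (norm \<xi>)\<^sup>2" for \<xi>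
      proof -
        have "\<xi> \<bullet> (X *v \<xi>) + \<xi> \<bullet> (Y *v \<xi>) \<le> 8 * (norm \<xi>)\<^sup>2 + 2 * \<epsilon> * (norm \<xi>)\<^sup>2"
          using XY(5)[of \<xi> \<xi>] unfolding Mh by (simp add: k_def R_def dot_square_norm)
        moreover have "0 \<le> \<epsilon> * (norm \<xi>)\<^sup>2" using \<epsilon> by simp
        ultimately show ?thesis unfolding distrib_right by simp
      qed
      define e where "e = z /\<^sub>R norm z"
      have z0: "z \<noteq> 0" using ne by (simp add: z_def)
      show ne1: "norm e = 1" using z0 by (simp add: e_def)
      have "z \<bullet> e = norm z" using z0 by (simp add: e_def dot_square_norm power2_eq_square)
      then have ze: "(z \<bullet> e)\<^sup>2 = s0" by (simp add: s0_def)
      \<comment> \<open>Opposite vectors double the displacement and thus see four times the radial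
        curvature.\<close>
      have k2: "k (e, - e) = 2 *\<^sub>R e" by (simp add: k_def scaleR_2)
      have "k (e, - e) \<bullet> R (k (e, - e)) = 8 * f' s0 + 8 * \<epsilon> + 16 * f'' s0 * s0"
        unfolding k2 Rhh using ne1 ze by (simp add: power_mult_distrib)
      then have "e \<bullet> (X *v e) + e \<bullet> (Y *v e) \<le> - \<kappa> + 8 * \<epsilon> + 8 + 2 * \<epsilon>"
        using XY(5)[of e "- e"] kap unfolding Mh by (simp add: ne1 dot_square_norm matrix_vector_mult_minus)
      then show "e \<bullet> (X *v e) + e \<bullet> (Y *v e) \<le> 8 + 12 * \<epsilon> - \<kappa>" using \<epsilon> by linarith
    qed
  qed
  have s01: "s0 \<le> 1" using nab power_mono[of "norm (a - b)" 1 2] by (simp add: s0_def z_def)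
  have "s0 powr 0 \<le> s0 powr (1 / 4 - 1)" using s0 s01 by (intro powr_mono') auto
  then have "L * 1 \<le> \<kappa>" using s0 L(1) unfolding \<kappa>_def by (intro mult_left_mono) auto
  then have "lam * L \<le> lam * \<kappa>" using ue by (simp add: uniformly_elliptic_def)
  have "lam * L \<le> 8 * Lam * real CARD('n)"
  proof (rule field_le_epsilon)
    fix e :: real assume e: "e > 0"
    define A where "A = 12 * Lam * real CARD('n)"
    have A: "A > 0" using ue by (auto simp: uniformly_elliptic_def A_def)
    have "Lam * ((8 + 12 * (e / A)) * real CARD('n)) = 8 * Lam * real CARD('n) + e / A * A" by (simp add: A_def algebra_simps)
    moreover have "e / A * A = e" using A by simp
    ultimately show "lam * L \<le> 8 * Lam * real CARD('n) + e"
      using gap[of "e / A"] e A \<open>lam * L \<le> lam * \<kappa>\<close> by simp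
  qed
  then show False using L(2) by simp
qed

section \<open>The strong maximum principle\<close>

text \<open>Stating the supersolution half as a subsolution property for the dual operator lets
  every one-sided lemma serve twice.\<close>

definition qsol :: "(real^'n^'n \<Rightarrow> real) \<Rightarrow> (real^'n) set \<Rightarrow> (real^'n \<Rightarrow> real) \<Rightarrow> bool" where
  "qsol F S u \<longleftrightarrow> continuous_on S u \<and> qsub F S u \<and> qsub (dual_operator F) S (\<lambda>x. - u x)"

lemma qsol_subset: "qsol F S u \<Longrightarrow> T \<subseteq> S \<Longrightarrow> qsol F T u"
  unfolding qsol_def using qsub_subset continuous_on_subset by blast

lemma qsol_dual: "qsol F S u \<Longrightarrow> qsol (dual_operator F) S (\<lambda>x. - u x)"
  unfolding qsol_def by (auto intro: continuous_intros)

section \<open>Invariance of the equation under scaling and affine changes of the solution\<close>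

lemma qsub_rescale:
  fixes F :: "real^'n^'n \<Rightarrow> real"
  assumes ph: "positively_homogeneous F" and qs: "qsub F S u" and "r > 0"
  shows "qsub F {x. c + r *\<^sub>R x \<in> S} (\<lambda>x. u (c + r *\<^sub>R x))"
proof -
  have "qsub F {x. c + r *\<^sub>R x \<in> S} (\<lambda>x. r\<^sup>2 * renorm u c r 0 x + u c)"
    using \<open>r > 0\<close> by (intro qsub_scale[OF ph qsub_renorm[OF qs]]) auto
  then show ?thesis using \<open>r > 0\<close> by (simp add: renorm_def)
qed

locale elliptic_operator =
  fixes F :: "real^'n^'n \<Rightarrow> real" and lam Lam :: real
  assumes ue: "uniformly_elliptic lam Lam F" and ph: "positively_homogeneous F"
begin

lemma dual: "elliptic_operator (dual_operator F) lam Lam"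
  using uniformly_elliptic_dual[OF ue] positively_homogeneous_dual[OF ph] by unfold_locales

lemma lam_pos: "lam > 0" "Lam > 0"
  using ue by (auto simp: uniformly_elliptic_def)

lemma qsol_affine:
  assumes "qsol F S u" "c > 0" shows "qsol F S (\<lambda>x. c * u x + b)"
proof -
  have "qsub (dual_operator F) S (\<lambda>x. c * (- u x) + (- b))"
    using assms positively_homogeneous_dual[OF ph] by (intro qsub_scale) (auto simp: qsol_def)
  moreover have "(\<lambda>x. c * (- u x) + (- b)) = (\<lambda>x. - (c * u x + b))" by auto
  ultimately show ?thesis
    using assms qsub_scale[OF ph] unfolding qsol_def by (auto intro!: continuous_intros)
qed

lemma qsol_rescale:
  assumes "qsol F S u" "r > 0" shows "qsol F {x. c + r *\<^sub>R x \<in> S} (\<lambda>x. u (c + r *\<^sub>R x))"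
  unfolding qsol_def
proof (intro conjI)
  show "continuous_on {x. c + r *\<^sub>R x \<in> S} (\<lambda>x. u (c + r *\<^sub>R x))"
    by (rule continuous_on_compose2[of S u]) (use assms in \<open>auto simp: qsol_def intro!: continuous_intros\<close>)
  show "qsub F {x. c + r *\<^sub>R x \<in> S} (\<lambda>x. u (c + r *\<^sub>R x))"
    using assms by (intro qsub_rescale[OF ph]) (auto simp: qsol_def)
  show "qsub (dual_operator F) {x. c + r *\<^sub>R x \<in> S} (\<lambda>x. - u (c + r *\<^sub>R x))"
    using assms qsub_rescale[OF positively_homogeneous_dual[OF ph], of S "\<lambda>x. - u x"] by (auto simp: qsol_def)
qed

text \<open>A polynomial touching a constant from above has a nonnegative matrix, as the values at h
  and - h show together, and homogeneity gives F(0) = 0.\<close>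

lemma qsub_const: "qsub F S (\<lambda>_. b)"
  unfolding qsub_def
proof (intro ballI allI impI)
  fix x p :: "real^'n" and X :: "real^'n^'n" and d :: real
  assume X: "symmetric_mat X" and d: "0 < d" and *: "\<forall>h::real^'n. norm h < d \<longrightarrow> b \<le> b + p \<bullet> h + h \<bullet> (X *v h) / 2"
  have "0 \<le> h \<bullet> (X *v h)" for h
  proof (cases "h = 0")
    case False
    define t where "t = d / 2 / norm h"
    have t: "t > 0" "norm (t *\<^sub>R h) < d" using d False by (auto simp: t_def)
    from *[rule_format, of "t *\<^sub>R h"] *[rule_format, of "- (t *\<^sub>R h)"] t(2)
    have "0 \<le> (t *\<^sub>R h) \<bullet> (X *v (t *\<^sub>R h))" by (simp add: matrix_vector_mult_minus)
    then show ?thesis using t(1) by (simp add: mvm_simps zero_le_mult_iff)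
  qed simp
  then have psd: "nonneg_definite X" using X by (simp add: nonneg_definite_def)
  have "0 \<le> axis undefined 1 \<bullet> (X *v axis undefined 1)" using psd by (simp add: nonneg_definite_def)
  also have "\<dots> \<le> trace X" by (rule trace_ge_quadratic_form[OF psd]) simp
  finally have "0 \<le> lam * trace X" using lam_pos by simp
  moreover have "F 0 = 0" using ph[unfolded positively_homogeneous_def, rule_format, of 0 0] symmetric_mat_ops(6) by simp
  ultimately show "F X \<le> 0" using uniformly_elliptic_add(2)[OF ue symmetric_mat_ops(6) psd] by simp
qed

lemma qsol_const: "qsol F S (\<lambda>_. b)"
  using qsub_const elliptic_operator.qsub_const[OF dual] by (simp add: qsol_def continuous_on_const)

text \<open>For this \<gamma> the function |x|^(-\<gamma>) is a strict subsolution: its radial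
  curvature, weighted by lam, outweighs the tangential ones, weighted by Lam.\<close>

definition barrier_exponent :: real where
  "barrier_exponent = Lam * real CARD('n) / lam"

lemma barrier_exponent_pos: "barrier_exponent > 0"
  using lam_pos by (simp add: barrier_exponent_def)

text \<open>At such a maximum the sum u + w would be touched from above by a constant minus the
  barrier, and \<open>radial_touching\<close> would give lam (2 \<gamma> + 4) <= 2 Lam n, against
  lam \<gamma> = Lam n.\<close>

lemma no_barrier_touching:
  assumes S: "open S" "continuous_on S u" "continuous_on S w" "qsub F S u" "qsub (dual_operator F) S w" "x0 \<in> S"
    and "x0 \<noteq> y0" "\<kappa> > 0"
    and d0: "d0 > 0" "\<And>x. norm (x - x0) < d0 \<Longrightarrow>
      u x + w x + \<kappa> * norm (x - y0) powr (- barrier_exponent) \<le> u x0 + w x0 + \<kappa> * norm (x0 - y0) powr (- barrier_exponent)"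
  shows False
proof -
  define \<gamma> where "\<gamma> = barrier_exponent"
  define s0 where "s0 = (norm (x0 - y0))\<^sup>2"
  have s0: "s0 > 0" using assms by (simp add: s0_def)
  define a where "a = - \<gamma> / 2"
  define f where "f t = - \<kappa> * t powr a" for t
  define f' where "f' t = - \<kappa> * a * t powr (a - 1)" for t
  define f'' where "f'' t = - \<kappa> * a * (a - 1) * t powr (a - 1 - 1)" for t
  have g: "\<gamma> > 0" using barrier_exponent_pos by (simp add: \<gamma>_def)
  have D: "DERIV f t :> f' t" "DERIV f' t :> f'' t" if "\<bar>t - s0\<bar> < s0" for t
  proof -
    have "t > 0" using that by linarith
    then show "DERIV f t :> f' t" "DERIV f' t :> f'' t"
      unfolding f_def f'_def f''_def by (rule DERIV_powr_const)+
  qed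
  have ct: "isCont f'' s0" unfolding f''_def using s0 by (intro continuous_intros) auto
  have fx: "f ((norm z)\<^sup>2) = - \<kappa> * norm z powr (- \<gamma>)" for z :: "real^'n"
  proof (cases "z = 0")
    case False
    then have "((norm z)\<^sup>2) powr a = norm z powr (- \<gamma>)" by (simp add: powr_powr a_def flip: powr_numeral)
    then show ?thesis by (simp add: f_def)
  qed (simp add: f_def)
  have f0: "f' s0 \<ge> 0" using \<open>\<kappa> > 0\<close> g by (simp add: f'_def a_def)
  have "lam * (- 4 * f'' s0 * s0) \<le> Lam * (2 * f' s0 * real CARD('n))"
  proof (rule radial_touching[OF ue S \<open>x0 \<noteq> y0\<close> s0_def s0 D ct f0 d0(1)])
    show "u x + w x - f ((norm (x - y0))\<^sup>2) \<le> u x0 + w x0 - f s0" if "norm (x - x0) < d0" for x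
      using d0(2)[OF that] unfolding s0_def fx by (simp add: \<gamma>_def)
  qed
  moreover have "- 4 * f'' s0 * s0 = (2 * \<gamma> + 4) * f' s0"
  proof -
    have "s0 powr (a - 1 - 1) * s0 = s0 powr (a - 1)" using s0 powr_add[of s0 "a - 1 - 1" 1] by simp
    then have "f'' s0 * s0 = (a - 1) * f' s0" by (simp add: f''_def f'_def)
    then have "- 4 * (f'' s0 * s0) = - 4 * ((a - 1) * f' s0)" by simp
    also have "\<dots> = (2 * \<gamma> + 4) * f' s0" by (simp add: a_def algebra_simps)
    finally show ?thesis by simp
  qed
  moreover have "f' s0 > 0" using \<open>\<kappa> > 0\<close> g s0 by (simp add: f'_def a_def)
  ultimately have "f' s0 * (lam * (2 * \<gamma> + 4)) \<le> f' s0 * (2 * Lam * real CARD('n))"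
    by (simp only: mult_ac)
  then have "lam * (2 * \<gamma> + 4) \<le> 2 * Lam * real CARD('n)" using \<open>f' s0 > 0\<close> by simp
  moreover have "lam * \<gamma> = Lam * real CARD('n)" using lam_pos by (simp add: \<gamma>_def barrier_exponent_def)
  ultimately show False using lam_pos by (simp add: algebra_simps)
qed

text \<open>Hopf's argument without normal derivatives: a ball about a point y with smaller value is
  enlarged until it meets the set of maximum points at x1. On an annulus whose interior contains x1,
  adding a small multiple of the barrier produces an interior maximum, because the sum is strictly
  smaller on the inner sphere and the barrier is strictly smaller on the outer one.\<close>

lemma strong_maximum_local:
  assumes S: "open S" "continuous_on S u" "continuous_on S w" "qsub F S u" "qsub (dual_operator F) S w" "x0 \<in> S"
    and le: "\<And>x. x \<in> S \<Longrightarrow> u x + w x \<le> c" and eq: "u x0 + w x0 = c"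
  shows "\<exists>d>0. \<forall>x\<in>ball x0 d. u x + w x = c"
proof -
  obtain R where R: "R > 0" "cball x0 R \<subseteq> S" using S(1,6) open_contains_cball by blast
  \<comment> \<open>For y within r of x0 the touching radius \<rho> is below r, and the ball of
    radius 2 \<rho> about y stays within 3 r of x0.\<close>
  define r where "r = R / 3"
  have r: "r > 0" "cball x0 (3 * r) \<subseteq> S" using R by (auto simp: r_def)
  have "u y + w y = c" if y: "y \<in> ball x0 r" for y
  proof (rule ccontr)
    assume "u y + w y \<noteq> c"
    define Z where "Z = {x \<in> cball x0 (3 * r). u x + w x = c}"
    have cont: "continuous_on (cball x0 (3 * r)) (\<lambda>x. u x + w x)"
      using S(2,3) r(2) by (auto intro!: continuous_intros intro: continuous_on_subset)
    have "closedin (top_of_set (cball x0 (3 * r))) (cball x0 (3 * r) \<inter> (\<lambda>x. u x + w x) -` {c})"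
      by (rule continuous_closedin_preimage[OF cont]) simp
    moreover have "cball x0 (3 * r) \<inter> (\<lambda>x. u x + w x) -` {c} = Z" by (auto simp: Z_def)
    ultimately have "compact Z" using closedin_compact compact_cball by metis
    moreover have x0Z: "x0 \<in> Z" using eq r by (simp add: Z_def)
    ultimately obtain x1 where x1: "x1 \<in> Z" "\<And>x. x \<in> Z \<Longrightarrow> dist y x1 \<le> dist y x"
      using continuous_attains_inf[of Z "dist y"] by (force intro: continuous_intros)
    define \<rho> where "\<rho> = dist y x1"
    have "\<rho> \<le> dist y x0" unfolding \<rho>_def by (rule x1(2)[OF x0Z])
    then have \<rho>r: "\<rho> < r" using y by (simp add: dist_commute)
    have \<rho>: "\<rho> > 0"
    proof (rule ccontr)
      assume "\<not> \<rho> > 0"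
      then have "y = x1" by (simp add: \<rho>_def)
      then show False using x1(1) \<open>u y + w y \<noteq> c\<close> by (simp add: Z_def)
    qed
    have sub: "cball y (2 * \<rho>) \<subseteq> ball x0 (3 * r)"
    proof
      fix x assume "x \<in> cball y (2 * \<rho>)"
      then show "x \<in> ball x0 (3 * r)" using dist_triangle[of x0 x y] y \<rho>r by simp
    qed
    have subS: "cball y (2 * \<rho>) \<subseteq> S" using sub r(2) ball_subset_cball by blast
    let ?A = "cball y (2 * \<rho>) - ball y (\<rho> / 2)"
    let ?\<gamma> = "barrier_exponent"
    have g: "?\<gamma> > 0" by (rule barrier_exponent_pos)
    let ?b = "\<lambda>x. norm (x - y) powr (- ?\<gamma>)"
    have cW: "continuous_on (sphere y (\<rho> / 2)) (\<lambda>x. u x + w x)"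
    proof (rule continuous_on_subset[OF cont])
      have "sphere y (\<rho> / 2) \<subseteq> cball y (2 * \<rho>)" using \<rho> by auto
      then show "sphere y (\<rho> / 2) \<subseteq> cball x0 (3 * r)" using sub ball_subset_cball by blast
    qed
    have "sphere y (\<rho> / 2) \<noteq> {}" using \<rho> by simp
    then obtain s where s: "s \<in> sphere y (\<rho> / 2)" "\<And>x. x \<in> sphere y (\<rho> / 2) \<Longrightarrow> u x + w x \<le> u s + w s"
      using continuous_attains_sup[OF compact_sphere _ cW] by blast
    have sS: "s \<in> cball y (2 * \<rho>)" using s(1) \<rho> by simp
    have "u s + w s \<noteq> c"
    proof
      assume "u s + w s = c"
      moreover have "s \<in> cball x0 (3 * r)" using sS sub ball_subset_cball by blast
      ultimately have "s \<in> Z" by (simp add: Z_def)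
      then show False using x1(2)[of s] s(1) \<rho> by (simp add: \<rho>_def[symmetric])
    qed
    then have \<eta>: "u s + w s < c" using le[of s] sS subS by fastforce
    define D where "D = (\<rho> / 2) powr (- ?\<gamma>) - \<rho> powr (- ?\<gamma>)"
    have D: "D > 0" using \<rho> g by (simp add: D_def powr_less_mono2_neg)
    \<comment> \<open>Half of the value at which the barrier would use up the deficit on the inner
      sphere.\<close>
    define \<kappa> where "\<kappa> = (c - (u s + w s)) / (2 * D)"
    have \<kappa>: "\<kappa> > 0" "\<kappa> * D < c - (u s + w s)" 
    proof -
      show "\<kappa> > 0" using \<eta> D by (simp add: \<kappa>_def)
      have "2 * (\<kappa> * D) = c - (u s + w s)" using D by (simp add: \<kappa>_def)
      then show "\<kappa> * D < c - (u s + w s)" using \<eta> by linarith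
    qed
    have "compact ?A" by (intro compact_diff) auto
    moreover have x1A: "x1 \<in> ?A" using \<rho> by (simp add: \<rho>_def)
    moreover have "continuous_on ?A (\<lambda>x. u x + w x + \<kappa> * ?b x)"
    proof -
      have "?A \<subseteq> cball x0 (3 * r)" using sub ball_subset_cball by blast
      then have c1: "continuous_on ?A (\<lambda>x. u x + w x)" by (rule continuous_on_subset[OF cont])
      have c2: "continuous_on ?A ?b" by (intro continuous_intros) (use \<rho> in auto)
      show ?thesis by (rule continuous_on_add[OF c1 continuous_on_mult_left[OF c2]])
    qed
    ultimately obtain x2 where x2: "x2 \<in> ?A" "\<And>x. x \<in> ?A \<Longrightarrow> u x + w x + \<kappa> * ?b x \<le> u x2 + w x2 + \<kappa> * ?b x2"
      using continuous_attains_sup[of ?A "\<lambda>x. u x + w x + \<kappa> * ?b x"] by blast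
    have "u x1 + w x1 + \<kappa> * ?b x1 = c + \<kappa> * \<rho> powr (- ?\<gamma>)"
      using x1(1) by (simp add: Z_def \<rho>_def dist_norm norm_minus_commute)
    then have x2v: "c + \<kappa> * \<rho> powr (- ?\<gamma>) \<le> u x2 + w x2 + \<kappa> * ?b x2" using x2(2)[OF x1A] by simp
    have "dist y x2 \<noteq> \<rho> / 2"
    proof
      assume d: "dist y x2 = \<rho> / 2"
      then have "u x2 + w x2 \<le> u s + w s" by (intro s(2)) simp
      moreover have "norm (x2 - y) = \<rho> / 2" using d by (simp add: dist_norm norm_minus_commute)
      then have "?b x2 = (\<rho> / 2) powr (- ?\<gamma>)" by (simp only:)
      ultimately show False using x2v \<kappa>(2) by (simp add: D_def right_diff_distrib)
    qed
    moreover have "dist y x2 \<noteq> 2 * \<rho>"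
    proof
      assume d: "dist y x2 = 2 * \<rho>"
      have "u x2 + w x2 \<le> c" using x2(1) subS by (intro le) auto
      moreover have "?b x2 = (2 * \<rho>) powr (- ?\<gamma>)" using d by (simp add: dist_norm norm_minus_commute)
      moreover have "(2 * \<rho>) powr (- ?\<gamma>) < \<rho> powr (- ?\<gamma>)" using \<rho> g by (simp add: powr_less_mono2_neg)
      then have "\<kappa> * (2 * \<rho>) powr (- ?\<gamma>) < \<kappa> * \<rho> powr (- ?\<gamma>)" using \<kappa>(1) by simp
      ultimately show False using x2v by simp
    qed
    ultimately have int: "\<rho> / 2 < dist y x2" "dist y x2 < 2 * \<rho>" using x2(1) by auto
    define d where "d = min (dist y x2 - \<rho> / 2) (2 * \<rho> - dist y x2)"
    show False
    proof (rule no_barrier_touching[OF S(1-5), of x2 y \<kappa> d])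
      show "x2 \<in> S" using x2(1) subS by auto
      show "x2 \<noteq> y" using int \<rho> by auto
      show "d > 0" using int by (simp add: d_def)
      fix x assume "norm (x - x2) < d"
      then have "dist x x2 < d" by (simp add: dist_norm)
      then have "x \<in> ?A"
        using dist_triangle[of y x x2] dist_triangle[of y x2 x] by (auto simp: d_def dist_commute)
      then show "u x + w x + \<kappa> * ?b x \<le> u x2 + w x2 + \<kappa> * ?b x2" by (rule x2(2))
    qed (rule \<kappa>(1))
  qed
  then show ?thesis using r(1) by blast
qed

lemma strong_maximum:
  assumes S: "open S" "connected S" "continuous_on S u" "continuous_on S w" "qsub F S u" "qsub (dual_operator F) S w" "x0 \<in> S"
    and le: "\<And>x. x \<in> S \<Longrightarrow> u x + w x \<le> c" and eq: "u x0 + w x0 = c" and x: "x \<in> S"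
  shows "u x + w x = c"
proof -
  let ?Z = "S \<inter> (\<lambda>x. u x + w x) -` {c}"
  have "closedin (top_of_set S) ?Z"
    by (rule continuous_closedin_preimage) (auto intro!: continuous_intros S(3,4))
  moreover have "open ?Z"
    unfolding open_contains_ball
  proof
    fix y assume y: "y \<in> ?Z"
    then obtain d1 where d1: "d1 > 0" "\<forall>x\<in>ball y d1. u x + w x = c"
      using strong_maximum_local[OF S(1,3-6) _ le, of y] by auto
    obtain d2 where "d2 > 0" "ball y d2 \<subseteq> S" using S(1) y by (meson IntD1 openE)
    then show "\<exists>e>0. ball y e \<subseteq> ?Z" using d1 by (intro exI[of _ "min d1 d2"]) auto
  qed
  then have "openin (top_of_set S) ?Z" by (auto intro: openin_open_eq[THEN iffD2] simp: S(1))
  moreover have "?Z \<noteq> {}" using S(7) eq by auto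
  ultimately have "?Z = S" using S(2) unfolding connected_clopen by blast
  then show ?thesis using x by blast
qed

text \<open>If the maximum exceeded the boundary values, it would be attained on a nonempty set that
  is compact and, by the strong principle, open.\<close>

lemma maximum_principle:
  assumes S: "continuous_on S u" "continuous_on S w" "qsub F S u" "qsub (dual_operator F) S w"
    and A: "compact A" "A \<subseteq> S" and bd: "\<And>x. x \<in> frontier A \<Longrightarrow> u x + w x \<le> c" and x: "x \<in> A"
  shows "u x + w x \<le> c"
proof (rule ccontr)
  assume gt: "\<not> u x + w x \<le> c"
  have cont: "continuous_on A (\<lambda>x. u x + w x)"
    using S(1,2) A(2) by (auto intro!: continuous_intros intro: continuous_on_subset)
  obtain m where m: "m \<in> A" "\<And>y. y \<in> A \<Longrightarrow> u y + w y \<le> u m + w m"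
    using continuous_attains_sup[OF A(1) _ cont] x by blast
  let ?c = "u m + w m"
  have big: "c < ?c" using m(2)[OF x] gt by simp
  let ?Z = "A \<inter> (\<lambda>x. u x + w x) -` {?c}"
  have Zint: "y \<in> interior A" if "y \<in> ?Z" for y
    using that bd[of y] big A(1) by (auto simp: frontier_def compact_imp_closed)
  have intS: "interior A \<subseteq> S" using A(2) interior_subset by blast
  have "closedin (top_of_set A) ?Z" by (rule continuous_closedin_preimage[OF cont]) simp
  then have "compact ?Z" using A(1) closedin_compact by blast
  moreover have "open ?Z"
    unfolding open_contains_ball
  proof
    fix y assume y: "y \<in> ?Z"
    have "\<exists>d>0. \<forall>x\<in>ball y d. u x + w x = ?c"
    proof (rule strong_maximum_local[OF open_interior])
      show "continuous_on (interior A) u" "continuous_on (interior A) w" using S(1,2) intS continuous_on_subset by blast+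
      show "qsub F (interior A) u" "qsub (dual_operator F) (interior A) w" using S(3,4) intS qsub_subset by blast+
      show "y \<in> interior A" by (rule Zint[OF y])
      show "u x + w x \<le> ?c" if "x \<in> interior A" for x using m(2) that interior_subset by blast
      show "u y + w y = ?c" using y by simp
    qed
    then obtain d1 where d1: "d1 > 0" "\<forall>x\<in>ball y d1. u x + w x = ?c" by blast
    obtain d2 where "d2 > 0" "ball y d2 \<subseteq> A" using Zint[OF y] mem_interior by blast
    then show "\<exists>e>0. ball y e \<subseteq> ?Z" using d1 by (intro exI[of _ "min d1 d2"]) auto
  qed
  ultimately have "?Z = {}" using compact_open[of ?Z] by (simp only: simp_thms)
  then show False using m(1) by auto
qed

text \<open>The unit estimate, scaled by R in space and by M in value. L depends only on the
  ellipticity constants and the dimension; hence it serves the dual operator too, which yields the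
  absolute value.\<close>

lemma Hoelder_estimate:
  obtains L where "L \<ge> 2" "\<And>u x0 R M y. qsol F (ball x0 R) u \<Longrightarrow> continuous_on (cball x0 R) u \<Longrightarrow> R > 0 \<Longrightarrow> M > 0 \<Longrightarrow>
    (\<And>x y. x \<in> cball x0 R \<Longrightarrow> y \<in> cball x0 R \<Longrightarrow> u x - u y \<le> M) \<Longrightarrow> y \<in> cball x0 R \<Longrightarrow>
    \<bar>u x0 - u y\<bar> \<le> M * L * sqrt (dist x0 y / R)"
proof -
  define L where "L = max 2 (8 * Lam * real CARD('n) / lam + 1)"
  have L2: "L \<ge> 2" by (simp add: L_def)
  have "8 * Lam * real CARD('n) / lam < L" by (simp add: L_def)
  then have L: "lam * L > 8 * Lam * real CARD('n)" using lam_pos by (simp add: pos_divide_less_eq mult.commute)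
  have *: "v x0 - v y \<le> M * L * sqrt (dist x0 y / R)"
    if ell: "elliptic_operator G lam Lam" and v: "qsol G (ball x0 R) v" "continuous_on (cball x0 R) v" "R > 0" "M > 0"
    and osc: "\<And>x y. x \<in> cball x0 R \<Longrightarrow> y \<in> cball x0 R \<Longrightarrow> v x - v y \<le> M" and y: "y \<in> cball x0 R"
    for v x0 R M y and G :: "real^'n^'n \<Rightarrow> real"
  proof -
    interpret G: elliptic_operator G lam Lam by (rule ell)
    define k where "k \<xi> = (1 / M) * v (x0 + R *\<^sub>R \<xi>) + 0" for \<xi>
    have inc: "x0 + R *\<^sub>R \<xi> \<in> cball x0 R" if "\<xi> \<in> cball 0 1" for \<xi>
      using that \<open>R > 0\<close> by (simp add: dist_norm mult_le_cancel_left1)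
    have "qsol G {\<xi>. x0 + R *\<^sub>R \<xi> \<in> ball x0 R} k"
      unfolding k_def using v by (intro G.qsol_affine G.qsol_rescale) auto
    moreover have "ball 0 1 \<subseteq> {\<xi>. x0 + R *\<^sub>R \<xi> \<in> ball x0 R}" using \<open>R > 0\<close> by (auto simp: dist_norm)
    ultimately have k: "qsol G (ball 0 1) k" by (rule qsol_subset)
    define \<xi> where "\<xi> = (y - x0) /\<^sub>R R"
    have n\<xi>: "norm \<xi> = dist x0 y / R"
      using \<open>R > 0\<close> by (simp add: \<xi>_def dist_norm norm_minus_commute divide_inverse mult.commute)
    have \<xi>: "\<xi> \<in> cball 0 1" "x0 + R *\<^sub>R \<xi> = y" "dist 0 \<xi> = dist x0 y / R"
      using y \<open>R > 0\<close> n\<xi> by (simp_all add: \<xi>_def)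
    have "k 0 - k \<xi> \<le> L * sqrt (dist 0 \<xi>)"
    proof (rule Hoelder_unit[OF G.ue L2 L])
      show "continuous_on (cball 0 1) k"
        unfolding k_def by (intro continuous_intros continuous_on_compose2[OF v(2)]) (use inc in auto)
      show "qsub G (ball 0 1) k" "qsub (dual_operator G) (ball 0 1) (\<lambda>x. - k x)" using k by (auto simp: qsol_def)
      show "k x - k y \<le> 1" if "x \<in> cball 0 1" "y \<in> cball 0 1" for x y
        using osc[OF inc[OF that(1)] inc[OF that(2)]] \<open>M > 0\<close> by (simp add: k_def diff_divide_distrib[symmetric])
    qed (rule \<xi>(1))
    then have "(v x0 - v y) / M \<le> L * sqrt (dist x0 y / R)"
      unfolding \<xi>(3) by (simp add: k_def \<xi>(2) diff_divide_distrib)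
    then show ?thesis using \<open>M > 0\<close> by (simp add: pos_divide_le_eq algebra_simps)
  qed
  show ?thesis
  proof (rule that[OF L2])
    fix u x0 R M y assume u: "qsol F (ball x0 R) u" "continuous_on (cball x0 R) u" "R > 0" "M > 0"
      and osc: "\<And>x y. x \<in> cball x0 R \<Longrightarrow> y \<in> cball x0 R \<Longrightarrow> u x - u y \<le> M" and y: "y \<in> cball x0 R"
    have "u x0 - u y \<le> M * L * sqrt (dist x0 y / R)"
      by (rule *[OF elliptic_operator.intro[OF ue ph] u osc y])
    moreover have "- u x0 - - u y \<le> M * L * sqrt (dist x0 y / R)"
    proof (rule *[OF dual qsol_dual[OF u(1)] _ u(3,4) _ y])
      show "continuous_on (cball x0 R) (\<lambda>x. - u x)" using u(2) by (intro continuous_intros)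
      show "- u x - - u y \<le> M" if "x \<in> cball x0 R" "y \<in> cball x0 R" for x y using osc[OF that(2,1)] by simp
    qed
    ultimately show "\<bar>u x0 - u y\<bar> \<le> M * L * sqrt (dist x0 y / R)" by (simp add: abs_le_iff)
  qed
qed

end

section \<open>Harnack inequality and compactness\<close>

context elliptic_operator
begin

text \<open>Let x1 maximize u(x) (1 - |x|)^\<gamma> and let d = 1 - |x1|. Near x1 the function u is
  at most a multiple of u(x1), so the Hoelder estimate keeps it above u(x1) / 2 on a ball of radius
  proportional to d. A barrier centred at x1 carries this bound to z and loses precisely the factor
  d^\<gamma> contained in the weight.\<close>

lemma Harnack_unit:
  obtains C where "C > 0" "\<And>u y z. qsol F (ball 0 5) u \<Longrightarrow> (\<And>x. x \<in> ball 0 5 \<Longrightarrow> 0 \<le> u x) \<Longrightarrow>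
    y \<in> cball 0 (1 / 2) \<Longrightarrow> z \<in> cball 0 1 \<Longrightarrow> u y \<le> C * u z"
proof -
  obtain L where L: "L \<ge> 2" "\<And>u x0 R M y. qsol F (ball x0 R) u \<Longrightarrow> continuous_on (cball x0 R) u \<Longrightarrow> R > 0 \<Longrightarrow> M > 0 \<Longrightarrow>
    (\<And>x y. x \<in> cball x0 R \<Longrightarrow> y \<in> cball x0 R \<Longrightarrow> u x - u y \<le> M) \<Longrightarrow> y \<in> cball x0 R \<Longrightarrow>
    \<bar>u x0 - u y\<bar> \<le> M * L * sqrt (dist x0 y / R)"
    using Hoelder_estimate by blast
  define \<gamma> where "\<gamma> = barrier_exponent"
  have g: "\<gamma> > 0" using barrier_exponent_pos by (simp add: \<gamma>_def)
  define P where "P = (2::real) powr \<gamma>"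
  have P: "P \<ge> 1" using g by (simp add: P_def ge_one_powr_ge_zero)
  \<comment> \<open>On the ball of radius d / 2 the oscillation is at most P u(x1); within the
    fraction \<kappa> of that radius the Hoelder estimate reduces it to u(x1) / 2.\<close>
  define \<kappa> where "\<kappa> = (1 / (2 * P * L))\<^sup>2"
  have PL: "2 * P * L \<ge> 1" using P L(1) mult_mono[of 1 "2 * P" 1 L] by simp
  then have k0: "0 < 1 / (2 * P * L)" using P L(1) by simp
  have "1 / (2 * P * L) \<le> 1" using frac_le[of 1 1 1 "2 * P * L"] PL by simp
  with k0 have \<kappa>: "0 < \<kappa>" "\<kappa> \<le> 1" unfolding \<kappa>_def by (intro zero_less_power power_le_one; simp)+
  have "sqrt \<kappa> = 1 / (2 * P * L)" unfolding \<kappa>_def real_sqrt_abs using k0 by (rule abs_of_pos)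
  then have sq\<kappa>: "P * L * sqrt \<kappa> = 1 / 2" using P L(1) by simp
  \<comment> \<open>The barrier at distance 2, the largest possible from x1 to z, after it has been
    lowered to vanish at distance 3.\<close>
  define \<theta> where "\<theta> = (2::real) powr (- \<gamma>) - 3 powr (- \<gamma>)"
  have "(2::real) powr (- \<gamma>) \<le> 1" using g by (simp add: powr_minus_divide divide_le_eq ge_one_powr_ge_zero)
  moreover have "(3::real) powr (- \<gamma>) > 0" by simp
  moreover have "(3::real) powr (- \<gamma>) < 2 powr (- \<gamma>)" using g by (intro powr_less_mono2_neg) auto
  ultimately have \<theta>: "0 < \<theta>" "\<theta> \<le> 1" unfolding \<theta>_def by linarith+
  define K where "K = (\<kappa> / 2) powr \<gamma> / 2 * \<theta>"
  have K: "K > 0" using \<kappa> \<theta> by (simp add: K_def)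
  have "u y \<le> P / K * u z"
    if u: "qsol F (ball 0 5) u" and nn: "\<And>x. x \<in> ball 0 5 \<Longrightarrow> 0 \<le> u x" and y: "y \<in> cball 0 (1 / 2)" and z: "z \<in> cball 0 1" for u y z
  proof -
    have cu: "continuous_on (ball 0 5) u" using u by (simp add: qsol_def)
    have sub1: "cball (0::real^'n) 1 \<subseteq> ball 0 5" by auto
    have "continuous_on (cball 0 1) (\<lambda>x. u x * (1 - norm x) powr \<gamma>)"
      using g by (intro continuous_on_mult continuous_on_subset[OF cu sub1] continuous_on_powr') (auto intro!: continuous_intros)
    then obtain x1 where x1: "x1 \<in> cball 0 1" "\<And>x. x \<in> cball 0 1 \<Longrightarrow> u x * (1 - norm x) powr \<gamma> \<le> u x1 * (1 - norm x1) powr \<gamma>"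
      using continuous_attains_sup[of "cball 0 1" "\<lambda>x. u x * (1 - norm x) powr \<gamma>"] by auto
    define d where "d = 1 - norm x1"
    define S where "S = u x1 * d powr \<gamma>"
    have "0 \<le> u z" using nn z by auto
    have uS: "u x * (1 - norm x) powr \<gamma> \<le> S" if "x \<in> cball 0 1" for x
      using x1(2)[OF that] by (simp add: S_def d_def)
    have yS: "u y \<le> P * S"
    proof -
      have "(1 / 2) powr \<gamma> \<le> (1 - norm y) powr \<gamma>" using y g by (intro powr_mono2) auto
      moreover have "0 \<le> u y" using y by (intro nn) auto
      ultimately have "u y * (1 / 2) powr \<gamma> \<le> u y * (1 - norm y) powr \<gamma>" by (rule mult_left_mono)
      also have "\<dots> \<le> S" using y by (intro uS) auto
      finally have "u y * (1 / 2) powr \<gamma> \<le> S" .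
      moreover have "(1 / 2) powr \<gamma> = 1 / P" by (simp add: P_def powr_divide)
      ultimately show ?thesis using P by (simp add: field_simps)
    qed
    show "u y \<le> P / K * u z"
    proof (cases "S \<le> 0")
      case True
      then have "P * S \<le> 0" using P by (simp add: mult_nonneg_nonpos)
      moreover have "0 \<le> P / K * u z" using P K \<open>0 \<le> u z\<close> by simp
      ultimately show ?thesis using yS by linarith
    next
      case False
      have d: "d > 0"
      proof (rule ccontr)
        assume "\<not> d > 0"
        then have "d = 0" using x1(1) by (simp add: d_def)
        then show False using False by (simp add: S_def)
      qed
      have d1: "d \<le> 1" by (simp add: d_def)
      define u1 where "u1 = u x1"
      have u1: "u1 > 0" using False d by (simp add: S_def u1_def zero_less_mult_iff not_le)
      have inB: "x \<in> ball 0 5" if "dist x1 x \<le> 3" for x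
        using that x1(1) dist_triangle[of 0 x x1] by simp
      have near: "x \<in> cball 0 1 \<and> u x \<le> P * u1" if "x \<in> cball x1 (d / 2)" for x
      proof -
        have "norm x \<le> norm x1 + d / 2" using that dist_triangle[of 0 x x1] by simp
        then have nx: "d / 2 \<le> 1 - norm x" by (simp add: d_def field_simps)
        then have xB: "x \<in> cball 0 1" using d by simp
        have "0 \<le> u x" using xB by (intro nn) auto
        moreover have "(d / 2) powr \<gamma> \<le> (1 - norm x) powr \<gamma>" using nx d g by (intro powr_mono2) auto
        ultimately have "u x * (d / 2) powr \<gamma> \<le> u x * (1 - norm x) powr \<gamma>" by (intro mult_left_mono)
        also have "\<dots> \<le> u1 * d powr \<gamma>" using uS[OF xB] by (simp add: S_def u1_def)
        also have "d powr \<gamma> = P * (d / 2) powr \<gamma>" using d by (simp add: P_def powr_divide)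
        finally have "u x * (d / 2) powr \<gamma> \<le> (P * u1) * (d / 2) powr \<gamma>" by (simp add: mult_ac)
        moreover have "(d / 2) powr \<gamma> > 0" using d by simp
        ultimately show ?thesis using xB by simp
      qed
      have subd: "cball x1 (d / 2) \<subseteq> ball 0 5" using near sub1 by blast
      define \<delta> where "\<delta> = \<kappa> * (d / 2)"
      have "\<kappa> * (d / 2) \<le> 1 * (d / 2)" using \<kappa>(2) d by (intro mult_right_mono) auto
      then have \<delta>2: "\<delta> \<le> d / 2" by (simp add: \<delta>_def)
      then have \<delta>: "\<delta> > 0" "\<delta> \<le> d / 2" "\<delta> < 1" using \<kappa>(1) d d1 by (simp add: \<delta>_def, linarith+)
      have low: "u1 / 2 \<le> u x" if x: "dist x1 x \<le> \<delta>" for x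
      proof -
        have "\<bar>u x1 - u x\<bar> \<le> (P * u1) * L * sqrt (dist x1 x / (d / 2))"
        proof (rule L(2))
          show "qsol F (ball x1 (d / 2)) u" using subd ball_subset_cball by (intro qsol_subset[OF u]) blast
          show "continuous_on (cball x1 (d / 2)) u" by (rule continuous_on_subset[OF cu subd])
          show "d / 2 > 0" "P * u1 > 0" using d P u1 by auto
          show "u a - u b \<le> P * u1" if "a \<in> cball x1 (d / 2)" "b \<in> cball x1 (d / 2)" for a b
            using near[OF that(1)] nn[of b] that(2) subd by fastforce
          show "x \<in> cball x1 (d / 2)" using x \<delta> by simp
        qed
        also have "sqrt (dist x1 x / (d / 2)) \<le> sqrt \<kappa>"
          using x d by (simp add: \<delta>_def pos_divide_le_eq)
        then have "(P * u1) * L * sqrt (dist x1 x / (d / 2)) \<le> (P * u1) * L * sqrt \<kappa>"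
          using P u1 L(1) by (intro mult_left_mono) auto
        also have "(P * u1) * L * sqrt \<kappa> = u1 * (P * L * sqrt \<kappa>)" by simp
        also have "\<dots> = u1 / 2" unfolding sq\<kappa> by simp
        finally show ?thesis unfolding u1_def by linarith
      qed
      \<comment> \<open>With this factor the barrier equals u1 / 2 on the sphere of radius
        \<delta>.\<close>
      define c1 where "c1 = u1 / 2 * \<delta> powr \<gamma>"
      have c1: "c1 > 0" using u1 \<delta> by (simp add: c1_def)
      let ?b = "\<lambda>x. c1 * norm (x - x1) powr (- \<gamma>)"
      have barrier: "c1 * norm (x - x1) powr (- \<gamma>) - c1 * 3 powr (- \<gamma>) \<le> u x" if x: "\<delta> \<le> dist x1 x" "dist x1 x \<le> 3" for x
      proof (rule ccontr)
        assume bad: "\<not> ?thesis"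
        let ?A = "cball x1 3 - ball x1 \<delta>"
        have A5: "?A \<subseteq> ball 0 5" using inB by auto
        have "continuous_on ?A (\<lambda>x. - u x + ?b x)"
          using continuous_on_subset[OF cu A5] by (intro continuous_intros) (use \<delta> in auto)
        moreover have "compact ?A" by (intro compact_diff) auto
        moreover have xA: "x \<in> ?A" using x by simp
        ultimately obtain x2 where x2: "x2 \<in> ?A" "\<And>w. w \<in> ?A \<Longrightarrow> - u w + ?b w \<le> - u x2 + ?b x2"
          using continuous_attains_sup[of ?A "\<lambda>x. - u x + ?b x"] by blast
        have big: "c1 * 3 powr (- \<gamma>) < - u x2 + ?b x2" using x2(2)[OF xA] bad by linarith
        have "dist x1 x2 \<noteq> \<delta>"
        proof
          assume e: "dist x1 x2 = \<delta>"
          then have "norm (x2 - x1) = \<delta>" by (simp add: dist_norm norm_minus_commute)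
          then have "?b x2 = c1 * \<delta> powr (- \<gamma>)" by (simp only:)
          also have "\<dots> = u1 / 2" using \<delta> by (simp add: c1_def powr_minus)
          finally have "?b x2 \<le> u x2" using low[of x2] e by simp
          moreover have "c1 * 3 powr (- \<gamma>) > 0" using c1 by simp
          ultimately show False using big by linarith
        qed
        moreover have "dist x1 x2 \<noteq> 3"
        proof
          assume e: "dist x1 x2 = 3"
          then have "norm (x2 - x1) = 3" by (simp add: dist_norm norm_minus_commute)
          then have "?b x2 = c1 * 3 powr (- \<gamma>)" by (simp only:)
          moreover have "0 \<le> u x2" using e by (intro nn inB) simp
          ultimately show False using big by linarith
        qed
        ultimately have int: "\<delta> < dist x1 x2" "dist x1 x2 < 3" using x2(1) by auto
        define e where "e = min (dist x1 x2 - \<delta>) (3 - dist x1 x2)"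
        show False
        proof (rule no_barrier_touching[of "ball 0 5" "\<lambda>_. 0" "\<lambda>x. - u x" x2 x1 c1 e])
          show "continuous_on (ball 0 5) (\<lambda>x. - u x)" using cu by (intro continuous_intros)
          show "qsub (dual_operator F) (ball 0 5) (\<lambda>x. - u x)" using u by (simp add: qsol_def)
          show "x2 \<in> ball 0 5" using x2(1) A5 by blast
          show "x2 \<noteq> x1" using int \<delta> by auto
          show "e > 0" using int by (simp add: e_def)
          fix w assume "norm (w - x2) < e"
          then have "dist w x2 < e" by (simp add: dist_norm)
          then have "w \<in> ?A"
            using dist_triangle[of x1 w x2] dist_triangle[of x1 x2 w] by (auto simp: e_def dist_commute)
          then show "0 + - u w + c1 * norm (w - x1) powr (- barrier_exponent) \<le> 0 + - u x2 + c1 * norm (x2 - x1) powr (- barrier_exponent)"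
            using x2(2)[of w] by (simp add: \<gamma>_def)
        qed (use c1 in \<open>auto intro: qsub_const continuous_on_const\<close>)
      qed
      have zx1: "dist x1 z \<le> 2" using z x1(1) dist_triangle3[of x1 z 0] by simp
      have "\<delta> powr \<gamma> \<le> 1" using \<delta> g powr_mono2[of \<gamma> \<delta> 1] by simp
      then have "c1 \<le> u1 / 2" using u1 mult_left_mono[of "\<delta> powr \<gamma>" 1 "u1 / 2"] by (simp add: c1_def)
      moreover have "c1 * \<theta> \<le> c1 * 1" using \<theta> c1 by (intro mult_left_mono) auto
      ultimately have c1\<theta>: "c1 * \<theta> \<le> u1 / 2" by linarith
      have low_z: "c1 * \<theta> \<le> u z"
      proof (cases "dist x1 z \<le> \<delta>")
        case True
        then show ?thesis using low[of z] c1\<theta> by simp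
      next
        case False
        then have "x1 \<noteq> z" using \<delta> by auto
        then have "2 powr (- \<gamma>) \<le> norm (z - x1) powr (- \<gamma>)"
          using zx1 g by (intro powr_mono2') (auto simp: dist_norm norm_minus_commute)
        then have "c1 * 2 powr (- \<gamma>) \<le> c1 * norm (z - x1) powr (- \<gamma>)" using c1 by simp
        then show ?thesis using barrier[of z] False zx1 by (simp add: \<theta>_def right_diff_distrib)
      qed
      have "c1 * \<theta> = K * S"
      proof -
        have "\<delta> powr \<gamma> = (\<kappa> / 2) powr \<gamma> * d powr \<gamma>" using \<kappa> d by (simp add: \<delta>_def powr_mult[symmetric])
        then show ?thesis by (simp add: c1_def K_def S_def u1_def)
      qed
      then have "S \<le> u z / K" using low_z K by (simp add: pos_le_divide_eq mult.commute)
      then have "P * S \<le> P * (u z / K)" using P by (intro mult_left_mono) auto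
      then show ?thesis using yS by simp
    qed
  qed
  then show ?thesis using that[of "P / K"] P K by simp
qed

lemma Harnack_ball:
  obtains C where "C > 0" "\<And>u x0 r y z. qsol F (ball x0 (5 * r)) u \<Longrightarrow> r > 0 \<Longrightarrow> (\<And>x. x \<in> ball x0 (5 * r) \<Longrightarrow> 0 \<le> u x) \<Longrightarrow>
    y \<in> cball x0 (r / 2) \<Longrightarrow> z \<in> cball x0 r \<Longrightarrow> u y \<le> C * u z"
proof -
  obtain C where C: "C > 0" "\<And>u y z. qsol F (ball 0 5) u \<Longrightarrow> (\<And>x. x \<in> ball 0 5 \<Longrightarrow> 0 \<le> u x) \<Longrightarrow>
    y \<in> cball 0 (1 / 2) \<Longrightarrow> z \<in> cball 0 1 \<Longrightarrow> u y \<le> C * u z"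
    using Harnack_unit by blast
  show ?thesis
  proof (rule that[OF C(1)])
    fix u x0 r y z assume u: "qsol F (ball x0 (5 * r)) u" and r: "r > 0" and nn: "\<And>x. x \<in> ball x0 (5 * r) \<Longrightarrow> 0 \<le> u x"
      and y: "y \<in> cball x0 (r / 2)" and z: "z \<in> cball x0 r"
    define k where "k \<xi> = u (x0 + r *\<^sub>R \<xi>)" for \<xi>
    have inc: "x0 + r *\<^sub>R \<xi> \<in> ball x0 (5 * r)" if "\<xi> \<in> ball 0 5" for \<xi>
      using that r by (simp add: dist_norm)
    have k: "qsol F (ball 0 5) k"
      unfolding k_def by (rule qsol_subset[OF qsol_rescale[OF u r]]) (use inc in blast)
    have rep: "x0 + r *\<^sub>R ((w - x0) /\<^sub>R r) = w" "norm ((w - x0) /\<^sub>R r) = dist x0 w / r" for w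
      using r by (simp_all add: dist_norm norm_minus_commute divide_inverse mult.commute)
    have "k ((y - x0) /\<^sub>R r) \<le> C * k ((z - x0) /\<^sub>R r)"
    proof (rule C(2)[OF k])
      show "0 \<le> k x" if "x \<in> ball 0 5" for x unfolding k_def by (rule nn[OF inc[OF that]])
      show "(y - x0) /\<^sub>R r \<in> cball 0 (1 / 2)" "(z - x0) /\<^sub>R r \<in> cball 0 1"
        unfolding mem_cball_0 rep(2) using y z r by (simp_all add: pos_divide_le_eq)
    qed
    then show "u y \<le> C * u z" unfolding k_def rep(1) .
  qed
qed

text \<open>Comparability with a constant independent of u is an equivalence relation whose classes
  are open by the inequality on balls; the annulus is connected since n >= 2. Compactness of the
  sphere makes the constant uniform.\<close>

lemma Harnack_annulus:
  assumes n: "CARD('n) \<ge> 2"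
  obtains C where "C > 0" "\<And>u r x y. r > 0 \<Longrightarrow> qsol F {x. r / 4 < norm x \<and> norm x < 4 * r} u \<Longrightarrow>
    (\<And>x. r / 4 < norm x \<Longrightarrow> norm x < 4 * r \<Longrightarrow> 0 \<le> u x) \<Longrightarrow> norm x = r \<Longrightarrow> norm y = r \<Longrightarrow> u x \<le> C * u y"
proof -
  obtain C0 where C0: "C0 > 0" "\<And>u x0 r y z. qsol F (ball x0 (5 * r)) u \<Longrightarrow> r > 0 \<Longrightarrow> (\<And>x. x \<in> ball x0 (5 * r) \<Longrightarrow> 0 \<le> u x) \<Longrightarrow>
    y \<in> cball x0 (r / 2) \<Longrightarrow> z \<in> cball x0 r \<Longrightarrow> u y \<le> C0 * u z"
    using Harnack_ball by blast
  define A :: "(real^'n) set" where "A = {x. 1 / 4 < norm x \<and> norm x < 4}"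
  define P where "P u \<longleftrightarrow> qsol F A u \<and> (\<forall>x\<in>A. 0 \<le> u x)" for u
  have opA: "open A" unfolding A_def by (intro open_Collect_conj open_Collect_less continuous_intros)
  have "connected {x::real^'n. 1 / 4 < norm (x - 0) \<and> norm (x - 0) < 4}"
    by (rule connected_annulus(1)) (use n in simp)
  then have conA: "connected A" by (simp add: A_def)
  define R where "R a b \<longleftrightarrow> (\<exists>C>0. \<forall>u. P u \<longrightarrow> u a \<le> C * u b \<and> u b \<le> C * u a)" for a b
  have loc: "\<exists>r>0. ball a r \<subseteq> A \<and> (\<forall>x\<in>ball a r. \<forall>y\<in>ball a r. \<forall>u. P u \<longrightarrow> u x \<le> C0 * u y)" if a: "a \<in> A" for a
  proof -
    obtain e where e: "e > 0" "ball a e \<subseteq> A" using opA a by (meson openE)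
    define r where "r = e / 5"
    have "u x \<le> C0 * u y" if "x \<in> ball a (r / 2)" "y \<in> ball a (r / 2)" "P u" for x y u
    proof (rule C0(2)[of a r])
      have s: "ball a (5 * r) \<subseteq> A" using e by (simp add: r_def)
      show "qsol F (ball a (5 * r)) u" using that(3) qsol_subset[OF _ s] by (simp add: P_def)
      show "0 \<le> u x" if "x \<in> ball a (5 * r)" for x using \<open>P u\<close> s that by (auto simp: P_def)
      show "r > 0" using e by (simp add: r_def)
      then show "y \<in> cball a r" using that(2) by simp
      show "x \<in> cball a (r / 2)" using that(1) by simp
    qed
    moreover have "ball a (r / 2) \<subseteq> A" using e by (intro order_trans[OF subset_ball e(2)]) (simp add: r_def)
    ultimately show ?thesis using e(1) by (intro exI[of _ "r / 2"]) (auto simp: r_def)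
  qed
  have R: "R a b" if "a \<in> A" "b \<in> A" for a b
  proof (rule connected_equivalence_relation[OF conA that])
    show "R y x" if "R x y" for x y using that unfolding R_def by blast
    show "R x z" if xyz: "R x y" "R y z" "x \<in> A" "y \<in> A" "z \<in> A" for x y z
    proof -
      obtain C1 where C1: "C1 > 0" "\<And>u. P u \<Longrightarrow> u x \<le> C1 * u y \<and> u y \<le> C1 * u x" using xyz(1) unfolding R_def by blast
      obtain C2 where C2: "C2 > 0" "\<And>u. P u \<Longrightarrow> u y \<le> C2 * u z \<and> u z \<le> C2 * u y" using xyz(2) unfolding R_def by blast
      have "u x \<le> C1 * C2 * u z \<and> u z \<le> C1 * C2 * u x" if "P u" for u
        using C1(2)[OF that] C2(2)[OF that] mult_left_mono[of "u y" "C2 * u z" C1] mult_left_mono[of "u y" "C1 * u x" C2] C1(1) C2(1)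
        by (auto simp: mult_ac intro: order_trans)
      then show ?thesis unfolding R_def using C1(1) C2(1) by (intro exI[of _ "C1 * C2"]) auto
    qed
    show "\<exists>T. openin (top_of_set A) T \<and> a \<in> T \<and> (\<forall>x\<in>T. R a x)" if aA: "a \<in> A" for a
    proof -
      obtain r where r: "r > 0" "ball a r \<subseteq> A" "\<forall>x\<in>ball a r. \<forall>y\<in>ball a r. \<forall>u. P u \<longrightarrow> u x \<le> C0 * u y"
        using loc[OF aA] by blast
      have "R a x" if "x \<in> ball a r" for x
        unfolding R_def using r(1,3) that C0(1) by (intro exI[of _ C0]) simp
      moreover have "openin (top_of_set A) (ball a r)" using r(2) opA by (simp add: openin_open_eq)
      ultimately show ?thesis using r(1) by (intro exI[of _ "ball a r"]) simp
    qed
  qed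
  obtain e :: "real^'n" where e: "norm e = 1" by (metis norm_axis_1)
  have eA: "e \<in> A" using e by (simp add: A_def)
  \<comment> \<open>All points of the sphere are compared with the fixed point e, whence the square
    of the constant in the end.\<close>
  have SA: "sphere 0 1 \<subseteq> A" by (auto simp: A_def)
  have "\<forall>a\<in>sphere 0 1. \<exists>r C. r > 0 \<and> C > 0 \<and> (\<forall>x\<in>ball a r. \<forall>u. P u \<longrightarrow> u x \<le> C * u e \<and> u e \<le> C * u x)"
  proof
    fix a :: "real^'n" assume "a \<in> sphere 0 1"
    then have aA: "a \<in> A" using SA by blast
    obtain r where r: "r > 0" "\<And>x u. x \<in> ball a r \<Longrightarrow> P u \<Longrightarrow> u x \<le> C0 * u a \<and> u a \<le> C0 * u x"
      using loc[OF aA] by (metis centre_in_ball)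
    obtain C1 where C1: "C1 > 0" "\<And>u. P u \<Longrightarrow> u a \<le> C1 * u e \<and> u e \<le> C1 * u a" using R[OF aA eA] unfolding R_def by blast
    have "u x \<le> C0 * C1 * u e \<and> u e \<le> C0 * C1 * u x" if "x \<in> ball a r" "P u" for x u
      using r(2)[OF that] C1(2)[OF that(2)] mult_left_mono[of "u a" "C1 * u e" C0] mult_left_mono[of "u a" "C0 * u x" C1] C0(1) C1(1)
      by (auto simp: mult_ac intro: order_trans)
    then show "\<exists>r C. r > 0 \<and> C > 0 \<and> (\<forall>x\<in>ball a r. \<forall>u. P u \<longrightarrow> u x \<le> C * u e \<and> u e \<le> C * u x)"
      using r(1) C0(1) C1(1) by (intro exI[of _ r] exI[of _ "C0 * C1"]) auto
  qed
  from bchoice[OF this] obtain r where "\<forall>a\<in>sphere 0 1. \<exists>C. r a > 0 \<and> C > 0 \<and> (\<forall>x\<in>ball a (r a). \<forall>u. P u \<longrightarrow> u x \<le> C * u e \<and> u e \<le> C * u x)" ..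
  from bchoice[OF this] obtain C where rC: "\<forall>a\<in>sphere 0 1. r a > 0 \<and> C a > 0 \<and> (\<forall>x\<in>ball a (r a). \<forall>u. P u \<longrightarrow> u x \<le> C a * u e \<and> u e \<le> C a * u x)" ..
  have cov: "sphere 0 1 \<subseteq> (\<Union>a\<in>sphere 0 1. ball a (r a))"
  proof
    fix a :: "real^'n" assume a: "a \<in> sphere 0 1"
    then have "a \<in> ball a (r a)" using rC by simp
    then show "a \<in> (\<Union>a\<in>sphere 0 1. ball a (r a))" using a by blast
  qed
  obtain T where T: "T \<subseteq> sphere 0 1" "finite T" "sphere 0 1 \<subseteq> (\<Union>a\<in>T. ball a (r a))"
  proof (rule compactE_image[OF compact_sphere _ cov])
    show "open (ball a (r a))" if "a \<in> sphere 0 1" for a by simp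
  qed (rule that)
  define M where "M = (\<Sum>a\<in>T. C a) + 1"
  have CM: "C a \<le> M" if "a \<in> T" for a
    using member_le_sum[OF that, of C] T rC by (fastforce simp: M_def intro: less_imp_le)
  have "0 \<le> sum C T" by (rule sum_nonneg) (use T(1) rC in \<open>auto intro: less_imp_le\<close>)
  then have M: "M > 0" by (simp add: M_def)
  have unit: "u x \<le> M * M * u y" if "P u" "norm x = 1" "norm y = 1" for u x y
  proof -
    have 1: "u x \<le> M * u e \<and> u e \<le> M * u x" if x: "norm x = 1" for x
    proof -
      obtain a where a: "a \<in> T" "x \<in> ball a (r a)" using T(3) x by (auto simp: subset_iff)
      have nn: "0 \<le> u e" "0 \<le> u x" using \<open>P u\<close> eA x SA by (auto simp: P_def)
      have "u x \<le> C a * u e" "u e \<le> C a * u x" using rC a T(1) \<open>P u\<close> by blast+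
      then show ?thesis using nn CM[OF a(1)] mult_right_mono[of "C a" M "u e"] mult_right_mono[of "C a" M "u x"] by linarith
    qed
    from 1[OF that(2)] 1[OF that(3)] have "u x \<le> M * u e" "M * u e \<le> M * (M * u y)" using M by auto
    then show ?thesis by simp
  qed
  show ?thesis
  proof (rule that[of "M * M"])
    show "M * M > 0" using M by simp
    fix u :: "real^'n \<Rightarrow> real" and x y :: "real^'n" and r :: real
    assume r: "r > 0" and u: "qsol F {x. r / 4 < norm x \<and> norm x < 4 * r} u"
      and nn: "\<And>x. r / 4 < norm x \<Longrightarrow> norm x < 4 * r \<Longrightarrow> 0 \<le> u x" and xy: "norm x = r" "norm y = r"
    define k where "k \<xi> = u (0 + r *\<^sub>R \<xi>)" for \<xi>
    have inc: "r / 4 < norm (0 + r *\<^sub>R \<xi>)" "norm (0 + r *\<^sub>R \<xi>) < 4 * r" if "\<xi> \<in> A" for \<xi>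
      using that r by (auto simp: A_def)
    have "P k"
      unfolding P_def
    proof
      show "qsol F A k" unfolding k_def by (rule qsol_subset[OF qsol_rescale[OF u r]]) (use inc in blast)
      show "\<forall>x\<in>A. 0 \<le> k x" using nn inc by (simp add: k_def)
    qed
    then have "k (x /\<^sub>R r) \<le> M * M * k (y /\<^sub>R r)" using xy r by (intro unit) auto
    then show "u x \<le> M * M * u y" using r by (simp add: k_def)
  qed
qed

text \<open>Locally bounded solutions are equicontinuous by the Hoelder estimate, and both halves of
  the equation are stable under locally uniform limits.\<close>

lemma qsol_compactness:
  assumes S: "open S" and v: "\<And>k. qsol F S (v k)"
    and bdd: "\<And>C. compact C \<Longrightarrow> C \<subseteq> S \<Longrightarrow> \<exists>B. \<forall>\<^sub>F k in sequentially. \<forall>x\<in>C. \<bar>v k x\<bar> \<le> B"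
  obtains s g where "strict_mono (s :: nat \<Rightarrow> nat)" "qsol F S g"
    "\<And>C. compact C \<Longrightarrow> C \<subseteq> S \<Longrightarrow> uniform_limit C (\<lambda>k. v (s k)) g sequentially"
proof -
  obtain L where L: "L \<ge> 2" "\<And>u x0 R M y. qsol F (ball x0 R) u \<Longrightarrow> continuous_on (cball x0 R) u \<Longrightarrow> R > 0 \<Longrightarrow> M > 0 \<Longrightarrow>
    (\<And>x y. x \<in> cball x0 R \<Longrightarrow> y \<in> cball x0 R \<Longrightarrow> u x - u y \<le> M) \<Longrightarrow> y \<in> cball x0 R \<Longrightarrow>
    \<bar>u x0 - u y\<bar> \<le> M * L * sqrt (dist x0 y / R)"
    using Hoelder_estimate by blast
  have pt: "\<exists>B. \<forall>\<^sub>F n in sequentially. \<bar>v n x\<bar> \<le> B" if "x \<in> S" for x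
    using bdd[of "{x}"] that by auto
  have equi: "\<exists>d>0. \<forall>\<^sub>F n in sequentially. \<forall>y. dist y x < d \<longrightarrow> \<bar>v n y - v n x\<bar> < e" if x: "x \<in> S" and e: "e > 0" for x e
  proof -
    obtain R where R: "R > 0" "cball x R \<subseteq> S" using S x open_contains_cball by blast
    obtain B0 where B0: "\<forall>\<^sub>F k in sequentially. \<forall>y\<in>cball x R. \<bar>v k y\<bar> \<le> B0" using bdd[OF compact_cball R(2)] by blast
    define M where "M = 2 * \<bar>B0\<bar> + 1"
    have M: "M > 0" by (simp add: M_def)
    \<comment> \<open>Solves M L sqrt (d / R) = e / 2, cut off at R.\<close>
    define d where "d = min R (R * (e / (2 * M * L))\<^sup>2)"
    have d: "d > 0" using R(1) e M L(1) by (simp add: d_def)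
    have "\<forall>\<^sub>F n in sequentially. \<forall>y. dist y x < d \<longrightarrow> \<bar>v n y - v n x\<bar> < e"
      using B0
    proof eventually_elim
      case (elim n)
      show ?case
      proof (intro allI impI)
        fix y assume y: "dist y x < d"
        have "\<bar>v n x - v n y\<bar> \<le> M * L * sqrt (dist x y / R)"
        proof (rule L(2)[OF _ _ R(1) M])
          show "qsol F (ball x R) (v n)" using R(2) ball_subset_cball by (intro qsol_subset[OF v]) blast
          show "continuous_on (cball x R) (v n)" using v R(2) continuous_on_subset unfolding qsol_def by blast
          show "v n a - v n b \<le> M" if "a \<in> cball x R" "b \<in> cball x R" for a b
          proof -
            have "\<bar>v n a\<bar> \<le> B0" "\<bar>v n b\<bar> \<le> B0" using elim that by auto
            then show ?thesis unfolding M_def by linarith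
          qed
          show "y \<in> cball x R" using y by (simp add: d_def dist_commute)
        qed
        also have "dist x y / R \<le> (e / (2 * M * L))\<^sup>2" using y R(1) by (simp add: d_def dist_commute pos_divide_le_eq mult.commute)
        then have "sqrt (dist x y / R) \<le> e / (2 * M * L)" using e M L(1) by (intro real_le_lsqrt) auto
        then have "M * L * sqrt (dist x y / R) \<le> M * L * (e / (2 * M * L))" using M L(1) by (intro mult_left_mono) auto
        also have "\<dots> = e / 2" using M L(1) by simp
        finally show "\<bar>v n y - v n x\<bar> < e" using e by (simp add: abs_minus_commute)
      qed
    qed
    then show ?thesis using d by blast
  qed
  obtain g s where gs: "strict_mono (s :: nat \<Rightarrow> nat)" "continuous_on S g"
    "\<And>C. compact C \<Longrightarrow> C \<subseteq> S \<Longrightarrow> uniform_limit C (\<lambda>n. v (s n)) g sequentially"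
    by (rule Ascoli_locally[OF S, of v]) (use pt equi in blast)+
  have "qsub F S g"
  proof (rule qsub_limit[OF ue S, of "\<lambda>n. v (s n)"])
    show "\<forall>\<^sub>F n in sequentially. qsub F C (v (s n)) \<and> continuous_on C (v (s n))" if "C \<subseteq> S" for C
      using qsol_subset[OF v that] by (intro always_eventually) (auto simp: qsol_def)
  qed (rule gs(3))
  moreover have "qsub (dual_operator F) S (\<lambda>x. - g x)"
  proof (rule qsub_limit[OF uniformly_elliptic_dual[OF ue] S, of "\<lambda>n x. - v (s n) x"])
    show "\<forall>\<^sub>F n in sequentially. qsub (dual_operator F) C (\<lambda>x. - v (s n) x) \<and> continuous_on C (\<lambda>x. - v (s n) x)" if "C \<subseteq> S" for C
      using qsol_subset[OF v that] by (intro always_eventually) (auto simp: qsol_def intro: continuous_intros)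
    show "uniform_limit C (\<lambda>n x. - v (s n) x) (\<lambda>x. - g x) sequentially" if "compact C" "C \<subseteq> S" for C
      by (intro uniform_limit_uminus gs(3) that)
  qed
  ultimately have "qsol F S g" using gs(2) by (simp add: qsol_def)
  then show ?thesis using that gs(1,3) by blast
qed

end

section \<open>Limits at the ends\<close>

text \<open>The end of \<open>\<real>\<^sup>n \<setminus> {0}\<close> at the origin corresponds to the sign \<open>s = - 1\<close>, the end at infinity to \<open>s = 1\<close>.\<close>

definition depth :: "real \<Rightarrow> 'a::real_normed_vector \<Rightarrow> real" where
  "depth s x = s * ln (norm x)"

text \<open>The filter of sets containing all points of large depth. The origin is cut out because
  its \<open>depth\<close> has no meaning.\<close>

definition ending :: "real \<Rightarrow> 'a::real_normed_vector filter" where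
  "ending s = inf (filtercomap (depth s) at_top) (principal (- {0}))"

lemma eventually_ending:
  "eventually P (ending s) \<longleftrightarrow> (\<exists>T. \<forall>x. x \<noteq> 0 \<longrightarrow> T \<le> depth s x \<longrightarrow> P x)"
  unfolding ending_def eventually_inf_principal eventually_filtercomap_at_top_linorder by auto

lemma norm_depth: "s = 1 \<or> s = -1 \<Longrightarrow> x \<noteq> 0 \<Longrightarrow> norm x = exp (s * depth s x)"
  by (auto simp: depth_def)

lemma depth_exp: "s = 1 \<or> s = -1 \<Longrightarrow> norm e = 1 \<Longrightarrow> depth s (exp (s * t) *\<^sub>R e) = t"
  by (auto simp: depth_def)

lemma depth_scale: "r > 0 \<Longrightarrow> x \<noteq> 0 \<Longrightarrow> depth s (r *\<^sub>R x) = s * ln r + depth s x"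
  by (simp add: depth_def ln_mult algebra_simps)

lemma depth_minus: "depth (- s) x = - depth s x"
  by (simp add: depth_def)

lemma ending_nontrivial:
  assumes "s = 1 \<or> s = -1" shows "ending s \<noteq> (bot :: (real^'n) filter)"
proof -
  obtain e :: "real^'n" where e: "norm e = 1" by (metis norm_axis_1)
  have "\<exists>x::real^'n. x \<noteq> 0 \<and> T \<le> depth s x" for T
  proof (intro exI conjI)
    show "exp (s * T) *\<^sub>R e \<noteq> 0" using e by auto
    show "T \<le> depth s (exp (s * T) *\<^sub>R e)" using depth_exp[OF assms e, of T] by simp
  qed
  then have "\<not> eventually (\<lambda>_. False) (ending s :: (real^'n) filter)"
    unfolding eventually_ending by blast
  then show ?thesis by (metis eventually_bot)
qed

locale elliptic_operator_ge2 = elliptic_operator F lam Lam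
  for F :: "real^'n^'n \<Rightarrow> real" and lam Lam +
  assumes dim: "CARD('n) \<ge> 2"
begin

lemma dual_ge2: "elliptic_operator_ge2 (dual_operator F) lam Lam"
  using dual dim unfolding elliptic_operator_ge2_def elliptic_operator_ge2_axioms_def by simp

abbreviation sol :: "(real^'n \<Rightarrow> real) \<Rightarrow> bool" where
  "sol u \<equiv> qsol F (- {0}) u"

lemma sol_cont: "sol u \<Longrightarrow> continuous_on (- {0}) u"
  by (simp add: qsol_def)

lemma sol_scale_nonneg: "sol u \<Longrightarrow> c \<ge> 0 \<Longrightarrow> sol (\<lambda>x. c * u x + b)"
  using qsol_affine[of "- {0}" u c b] qsol_const[of "- {0}" b] by (cases "c = 0") auto

lemma sol_rescale: "sol u \<Longrightarrow> r > 0 \<Longrightarrow> sol (\<lambda>x. u (r *\<^sub>R x))"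
  by (rule qsol_subset[OF qsol_rescale[of "- {0}" u r 0, simplified]]) auto

lemma connected_punctured: "connected (- {0 :: real^'n})"
  using connected_punctured_universe[where 'N = "real^'n"] dim by simp

text \<open>Equality spreads from x0 because the punctured space is connected, which needs n >=
  2.\<close>

lemma difference_constant:
  assumes "sol u" "sol v" "\<And>x. x \<noteq> 0 \<Longrightarrow> u x \<le> v x + c" "x0 \<noteq> 0" "u x0 = v x0 + c" "x \<noteq> 0"
  shows "u x = v x + c"
proof -
  have "u x + - v x = c"
    by (rule strong_maximum[OF open_Compl[OF closed_singleton] connected_punctured, of u "\<lambda>x. - v x" x0])
      (use assms in \<open>force simp: qsol_def intro: continuous_intros\<close>)+
  then show ?thesis by simp
qed

section \<open>Comparison between spheres and towards the ends\<close>

lemma annulus_comparison: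
  assumes u: "sol u" and v: "sol v" and x: "x \<noteq> 0" "a \<le> ln (norm x)" "ln (norm x) \<le> b"
    and bd: "\<And>y. y \<noteq> 0 \<Longrightarrow> ln (norm y) = a \<or> ln (norm y) = b \<Longrightarrow> u y \<le> v y + c"
  shows "u x \<le> v x + c"
proof -
  let ?A = "cball 0 (exp b) - ball 0 (exp a) :: (real^'n) set"
  have sub: "?A \<subseteq> - {0}" by auto
  have fr: "ln (norm y) = a \<or> ln (norm y) = b" if y: "y \<in> frontier ?A" for y
  proof (rule ccontr)
    assume no: "\<not> (ln (norm y) = a \<or> ln (norm y) = b)"
    have "closed ?A" by (intro closed_Diff) auto
    then have yA: "y \<in> ?A" "y \<notin> interior ?A" using y by (auto simp: frontier_def)
    then have "norm y > 0" by (metis exp_gt_zero DiffD2 mem_ball_0 not_less order_less_le_trans)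
    then have "norm y \<noteq> exp a" "norm y \<noteq> exp b" using no by auto
    then have "y \<in> ball 0 (exp b) - cball 0 (exp a)" using yA by auto
    moreover have "open (ball 0 (exp b) - cball 0 (exp a) :: (real^'n) set)" by (intro open_Diff) auto
    moreover have "ball 0 (exp b) - cball 0 (exp a) \<subseteq> ?A" by auto
    ultimately have "y \<in> interior ?A" by (metis interiorI)
    then show False using yA by blast
  qed
  have "u x + - v x \<le> c"
  proof (rule maximum_principle[of "- {0}" u "\<lambda>x. - v x" ?A])
    show "compact ?A" by (intro compact_diff) auto
    show "u y + - v y \<le> c" if "y \<in> frontier ?A" for y
    proof -
      have "closed ?A" by (intro closed_Diff) auto
      then have "y \<in> ?A" using that by (auto simp: frontier_def)
      then have "y \<noteq> 0" using sub by blast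
      then show ?thesis using bd[OF _ fr[OF that]] by simp
    qed
    have "norm x = exp (ln (norm x))" using x(1) by simp
    then have "exp a \<le> norm x" "norm x \<le> exp b" using x(2,3) by (metis exp_le_cancel_iff)+
    then show "x \<in> ?A" by simp
  qed (use u v sub in \<open>auto simp: qsol_def intro: continuous_intros\<close>)
  then show ?thesis by simp
qed

lemma depth_comparison:
  assumes s: "s = 1 \<or> s = -1" and u: "sol u" and v: "sol v" and x: "x \<noteq> 0" "p \<le> depth s x" "depth s x \<le> q"
    and bd: "\<And>y. y \<noteq> 0 \<Longrightarrow> depth s y = p \<or> depth s y = q \<Longrightarrow> u y \<le> v y + c"
  shows "u x \<le> v x + c"
proof (cases "s = 1")
  case True
  show ?thesis by (rule annulus_comparison[OF u v x(1), of p q]) (use x bd True in \<open>auto simp: depth_def\<close>)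
next
  case False
  then have "s = -1" using s by simp
  then show ?thesis
    using x bd by (intro annulus_comparison[OF u v x(1), of "- q" "- p"]) (auto simp: depth_def)
qed

lemma end_comparison:
  assumes s: "s = 1 \<or> s = -1" and u: "sol u" and v: "sol v" and x: "x \<noteq> 0" "p \<le> depth s x"
    and bd: "\<And>y. y \<noteq> 0 \<Longrightarrow> depth s y = p \<Longrightarrow> u y \<le> v y + c"
    and ev: "\<And>\<delta>. \<delta> > 0 \<Longrightarrow> eventually (\<lambda>y. u y \<le> v y + c + \<delta>) (ending s)"
  shows "u x \<le> v x + c"
proof (rule field_le_epsilon)
  fix \<delta> :: real assume \<delta>: "\<delta> > 0"
  obtain T where T: "\<And>y. y \<noteq> 0 \<Longrightarrow> T \<le> depth s y \<Longrightarrow> u y \<le> v y + c + \<delta>"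
    using ev[OF \<delta>] unfolding eventually_ending by blast
  have "u x \<le> v x + (c + \<delta>)"
  proof (rule depth_comparison[OF s u v x])
    show "depth s x \<le> max T (depth s x)" by simp
    show "u y \<le> v y + (c + \<delta>)" if "y \<noteq> 0" "depth s y = p \<or> depth s y = max T (depth s x)" for y
      using that bd[OF that(1)] T[OF that(1)] \<delta> by fastforce
  qed
  then show "u x \<le> v x + c + \<delta>" by simp
qed

lemma two_ends_comparison:
  assumes u: "sol u" and v: "sol v" and x: "x \<noteq> 0"
    and ev: "\<And>s. s = 1 \<or> s = -1 \<Longrightarrow> eventually (\<lambda>y. u y \<le> v y + c) (ending s)"
  shows "u x \<le> v x + c"
proof -
  obtain T1 where T1: "\<And>y. y \<noteq> 0 \<Longrightarrow> T1 \<le> depth 1 y \<Longrightarrow> u y \<le> v y + c"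
    using ev[of 1] unfolding eventually_ending by auto
  obtain T2 where T2: "\<And>y. y \<noteq> 0 \<Longrightarrow> T2 \<le> depth (-1) y \<Longrightarrow> u y \<le> v y + c"
    using ev[of "-1"] unfolding eventually_ending by auto
  show ?thesis
  proof (rule depth_comparison[of 1, OF _ u v x])
    show "min (- T2) (depth 1 x) \<le> depth 1 x" "depth 1 x \<le> max T1 (depth 1 x)" by simp_all
    show "u y \<le> v y + c" if "y \<noteq> 0" "depth 1 y = min (- T2) (depth 1 x) \<or> depth 1 y = max T1 (depth 1 x)" for y
      using that(2) T1[OF that(1)] T2[OF that(1)] by (auto simp: depth_minus[of 1])
  qed simp
qed

lemma Harnack_depth:
  obtains C where "C > 0" "\<And>u B s x y. s = 1 \<or> s = -1 \<Longrightarrow> sol u \<Longrightarrow> x \<noteq> 0 \<Longrightarrow> y \<noteq> 0 \<Longrightarrow> depth s x = depth s y \<Longrightarrow>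
    (\<And>z. z \<noteq> 0 \<Longrightarrow> \<bar>depth s z - depth s x\<bar> < 2 \<Longrightarrow> B \<le> u z) \<Longrightarrow> u x - B \<le> C * (u y - B)"
proof -
  obtain C where C: "C > 0" "\<And>u r x y. r > 0 \<Longrightarrow> qsol F {x. r / 4 < norm x \<and> norm x < 4 * r} u \<Longrightarrow>
    (\<And>x. r / 4 < norm x \<Longrightarrow> norm x < 4 * r \<Longrightarrow> 0 \<le> u x) \<Longrightarrow> norm x = r \<Longrightarrow> norm y = r \<Longrightarrow> u x \<le> C * u y"
    using Harnack_annulus[OF dim] by blast
  have e2: "exp 2 \<ge> (4::real)"
  proof -
    have "(2::real) \<le> exp 1" using exp_ge_add_one_self[of 1] by simp
    then have "2 * 2 \<le> exp 1 * (exp 1 :: real)" by (intro mult_mono) auto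
    also have "\<dots> = exp 2" by (simp flip: exp_add)
    finally show ?thesis by simp
  qed
  show ?thesis
  proof (rule that[OF C(1)])
    fix u :: "real^'n \<Rightarrow> real" and x y :: "real^'n" and B s :: real
    assume s: "s = 1 \<or> s = -1" and u: "sol u" and xy: "x \<noteq> 0" "y \<noteq> 0" "depth s x = depth s y"
      and low: "\<And>z. z \<noteq> 0 \<Longrightarrow> \<bar>depth s z - depth s x\<bar> < 2 \<Longrightarrow> B \<le> u z"
    define r where "r = norm x"
    have r: "r > 0" using xy by (simp add: r_def)
    have "norm y = r" using norm_depth[OF s xy(1)] norm_depth[OF s xy(2)] xy(3) by (simp add: r_def)
    have k: "sol (\<lambda>z. 1 * u z + - B)" using u by (intro qsol_affine) auto
    have "1 * u x + - B \<le> C * (1 * u y + - B)"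
    proof (rule C(2)[OF r])
      show "qsol F {x. r / 4 < norm x \<and> norm x < 4 * r} (\<lambda>z. 1 * u z + - B)"
        by (rule qsol_subset[OF k]) (use r in auto)
      fix z :: "real^'n" assume z: "r / 4 < norm z" "norm z < 4 * r"
      have z0: "z \<noteq> 0" using z r by auto
      have "norm z < exp 2 * r" using z(2) e2 r mult_right_mono[of 4 "exp 2" r] by linarith
      then have "ln (norm z) < ln (exp 2 * r)" using z0 r by simp
      then have 1: "ln (norm z) < 2 + ln r" using r by (simp add: ln_mult)
      have "r < 4 * norm z" using z(1) by linarith
      also have "4 * norm z \<le> exp 2 * norm z" using e2 by (intro mult_right_mono) auto
      finally have "r < exp 2 * norm z" .
      then have "ln r < ln (exp 2 * norm z)" using z0 r by simp
      then have 2: "ln r < 2 + ln (norm z)" using z0 by (simp add: ln_mult)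
      have "\<bar>depth s z - depth s x\<bar> < 2" using 1 2 s by (auto simp: depth_def r_def)
      then show "0 \<le> 1 * u z + - B" using low[OF z0] by simp
    qed (use \<open>norm y = r\<close> in \<open>auto simp: r_def\<close>)
    then show "u x - B \<le> C * (u y - B)" by simp
  qed
qed

text \<open>Turns near-contact at one point into near-contact on a whole sphere. Limits g <= f of
  the two sequences touch at some unit vector, so the strong maximum principle makes them equal, and
  uniform convergence on the unit sphere does the rest.\<close>

lemma touching_sequences:
  assumes v: "\<And>k. sol (v k)" and h: "\<And>k. sol (h k)"
    and bdv: "\<And>C. compact C \<Longrightarrow> C \<subseteq> - {0} \<Longrightarrow> \<exists>B. \<forall>\<^sub>F k in sequentially. \<forall>x\<in>C. \<bar>v k x\<bar> \<le> B"
    and bdh: "\<And>C. compact C \<Longrightarrow> C \<subseteq> - {0} \<Longrightarrow> \<exists>B. \<forall>\<^sub>F k in sequentially. \<forall>x\<in>C. \<bar>h k x\<bar> \<le> B"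
    and up: "\<And>x \<delta>. x \<noteq> 0 \<Longrightarrow> \<delta> > 0 \<Longrightarrow> \<forall>\<^sub>F k in sequentially. v k x \<le> h k x + \<delta>"
    and \<xi>: "\<And>k. norm (\<xi> k) = 1" "\<And>\<delta>. \<delta> > 0 \<Longrightarrow> \<forall>\<^sub>F k in sequentially. h k (\<xi> k) - \<delta> \<le> v k (\<xi> k)"
    and \<epsilon>: "\<epsilon> > 0"
  shows "\<exists>k\<ge>N. \<forall>x. norm x = 1 \<longrightarrow> h k x - \<epsilon> \<le> v k x"
proof -
  have opS: "open (- {0 :: real^'n})" by (rule open_Compl[OF closed_singleton])
  obtain s1 f where sf: "strict_mono (s1 :: nat \<Rightarrow> nat)" "sol f"
    "\<And>C. compact C \<Longrightarrow> C \<subseteq> - {0} \<Longrightarrow> uniform_limit C (\<lambda>k. h (s1 k)) f sequentially"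
    by (rule qsol_compactness[OF opS h bdh], (assumption | (rule that; assumption))+)
  have sub1: "filterlim s1 sequentially sequentially" by (rule filterlim_subseq[OF sf(1)])
  have bdv1: "\<exists>B. \<forall>\<^sub>F k in sequentially. \<forall>x\<in>C. \<bar>v (s1 k) x\<bar> \<le> B" if C: "compact C" "C \<subseteq> - {0}" for C
  proof -
    obtain B where B: "\<forall>\<^sub>F k in sequentially. \<forall>x\<in>C. \<bar>v k x\<bar> \<le> B" using bdv[OF C] by blast
    show ?thesis using eventually_compose_filterlim[OF B sub1] by blast
  qed
  obtain s2 g where sg: "strict_mono (s2 :: nat \<Rightarrow> nat)" "sol g"
    "\<And>C. compact C \<Longrightarrow> C \<subseteq> - {0} \<Longrightarrow> uniform_limit C (\<lambda>k. v (s1 (s2 k))) g sequentially"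
    by (rule qsol_compactness[OF opS v bdv1], (assumption | (rule that; assumption))+)
  have sub2: "filterlim s2 sequentially sequentially" by (rule filterlim_subseq[OF sg(1)])
  define s where "s k = s1 (s2 k)" for k
  have sub: "filterlim s sequentially sequentially"
    unfolding s_def by (rule filterlim_compose[OF sub1 sub2])
  have ulv: "\<forall>\<^sub>F k in sequentially. \<forall>x\<in>C. dist (v (s k) x) (g x) < e" if "compact C" "C \<subseteq> - {0}" "e > 0" for C e
    using uniform_limitD[OF sg(3)[OF that(1,2)] that(3)] by (simp add: s_def)
  have ulh: "\<forall>\<^sub>F k in sequentially. \<forall>x\<in>C. dist (h (s k) x) (f x) < e" if "compact C" "C \<subseteq> - {0}" "e > 0" for C e
    using eventually_compose_filterlim[OF uniform_limitD[OF sf(3)[OF that(1,2)] that(3)] sub2] by (simp add: s_def)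
  have le: "g x \<le> f x + 0" if x: "x \<noteq> 0" for x
  proof (rule field_le_epsilon)
    fix \<delta> :: real assume \<delta>: "\<delta> > 0"
    then have \<delta>3: "\<delta> / 3 > 0" by simp
    have X: "compact {x}" "{x} \<subseteq> - {0}" using x by auto
    from ulv[OF X \<delta>3] ulh[OF X \<delta>3] eventually_compose_filterlim[OF up[OF x \<delta>3] sub]
    have "\<forall>\<^sub>F k in sequentially. g x \<le> f x + 0 + \<delta>"
    proof eventually_elim
      case (elim k)
      then have "dist (v (s k) x) (g x) < \<delta> / 3" "dist (h (s k) x) (f x) < \<delta> / 3" by blast+
      then show ?case using elim(3) unfolding dist_real_def by linarith
    qed
    then show "g x \<le> f x + 0 + \<delta>" by simp
  qed
  let ?S = "sphere 0 1 :: (real^'n) set"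
  have S: "compact ?S" "?S \<subseteq> - {0}" by auto
  have cont: "continuous_on ?S (\<lambda>x. f x - g x)"
    using sol_cont[OF sf(2)] sol_cont[OF sg(2)] S(2) by (intro continuous_intros) (auto intro: continuous_on_subset)
  obtain x0 where x0: "x0 \<in> ?S" "\<And>x. x \<in> ?S \<Longrightarrow> f x0 - g x0 \<le> f x - g x"
    using continuous_attains_inf[OF S(1) _ cont] by auto
  have "f x0 - g x0 \<le> 0"
  proof (rule field_le_epsilon)
    fix \<delta> :: real assume "\<delta> > 0"
    then have \<delta>3: "\<delta> / 3 > 0" by simp
    from ulv[OF S \<delta>3] ulh[OF S \<delta>3] eventually_compose_filterlim[OF \<xi>(2)[OF \<delta>3] sub]
    have "\<forall>\<^sub>F k in sequentially. f x0 - g x0 \<le> 0 + \<delta>"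
    proof eventually_elim
      case (elim k)
      have "\<xi> (s k) \<in> ?S" using \<xi>(1) by simp
      then have "dist (v (s k) (\<xi> (s k))) (g (\<xi> (s k))) < \<delta> / 3" "dist (h (s k) (\<xi> (s k))) (f (\<xi> (s k))) < \<delta> / 3"
        "f x0 - g x0 \<le> f (\<xi> (s k)) - g (\<xi> (s k))"
        using elim(1,2) x0(2) by blast+
      then show ?case using elim(3) unfolding dist_real_def by linarith
    qed
    then show "f x0 - g x0 \<le> 0 + \<delta>" by simp
  qed
  then have eq0: "g x0 = f x0 + 0" using le[of x0] x0(1) by force
  have gf: "g x = f x" if "x \<noteq> 0" for x
    using difference_constant[OF sg(2) sf(2) le _ eq0 that] x0(1) by force
  have \<epsilon>2: "\<epsilon> / 2 > 0" using \<epsilon> by simp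
  have "\<forall>\<^sub>F k in sequentially. N \<le> s k"
    using eventually_compose_filterlim[OF eventually_ge_at_top[of N] sub] .
  with ulv[OF S \<epsilon>2] ulh[OF S \<epsilon>2]
  have "\<forall>\<^sub>F k in sequentially. N \<le> s k \<and> (\<forall>x. norm x = 1 \<longrightarrow> h (s k) x - \<epsilon> \<le> v (s k) x)"
  proof eventually_elim
    case (elim k)
    have "h (s k) x - \<epsilon> \<le> v (s k) x" if x: "norm x = 1" for x
    proof -
      have "dist (v (s k) x) (g x) < \<epsilon> / 2" "dist (h (s k) x) (f x) < \<epsilon> / 2" using elim x by auto
      moreover have "g x = f x" using x by (intro gf) auto
      ultimately show ?thesis unfolding dist_real_def by linarith
    qed
    then show ?case using elim(3) by blast
  qed
  from eventually_happens'[OF sequentially_bot this] show ?thesis by blast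
qed

lemma touching_limit:
  assumes v: "\<And>k. sol (v k)" and h: "sol h"
    and bdd: "\<And>C. compact C \<Longrightarrow> C \<subseteq> - {0} \<Longrightarrow> \<exists>B. \<forall>\<^sub>F k in sequentially. \<forall>x\<in>C. \<bar>v k x\<bar> \<le> B"
    and up: "\<And>x \<delta>. x \<noteq> 0 \<Longrightarrow> \<delta> > 0 \<Longrightarrow> \<forall>\<^sub>F k in sequentially. v k x \<le> h x + \<delta>"
    and \<xi>: "\<And>k. norm (\<xi> k) = 1" "\<And>\<delta>. \<delta> > 0 \<Longrightarrow> \<forall>\<^sub>F k in sequentially. h (\<xi> k) - \<delta> \<le> v k (\<xi> k)"
    and \<epsilon>: "\<epsilon> > 0"
  shows "\<exists>k\<ge>N. \<forall>x. norm x = 1 \<longrightarrow> h x - \<epsilon> \<le> v k x"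
proof (rule touching_sequences[where h = "\<lambda>_. h", OF v h bdd _ up \<xi> \<epsilon>])
  fix C :: "(real^'n) set" assume C: "compact C" "C \<subseteq> - {0}"
  from compact_imp_bounded[OF compact_continuous_image[OF continuous_on_subset[OF sol_cont[OF h] C(2)] C(1)]]
  obtain B where "\<forall>x\<in>C. \<bar>h x\<bar> \<le> B" by (auto simp: bounded_iff)
  then show "\<exists>B. \<forall>\<^sub>F k in sequentially. \<forall>x\<in>C. \<bar>h x\<bar> \<le> B" by (auto intro!: exI[of _ B])
qed

lemma compact_depth_bounded:
  assumes "compact C" "C \<subseteq> - {0 :: real^'n}"
  obtains b where "\<And>x. x \<in> C \<Longrightarrow> \<bar>ln (norm x)\<bar> \<le> b"
proof -
  have "continuous_on C (\<lambda>x. ln (norm x))" using assms(2) by (intro continuous_intros) auto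
  from compact_imp_bounded[OF compact_continuous_image[OF this assms(1)]] show ?thesis
    using that by (auto simp: bounded_iff)
qed

text \<open>A lower bound on arbitrarily deep spheres spreads to everything between them. If u is
  unbounded above, the Harnack inequality provides such spheres for every bound; if u is bounded,
  blowing up at points where u is near its upper limit l provides them for every bound below
  l.\<close>

lemma limit_at_end:
  assumes s: "s = 1 \<or> s = -1" and u: "sol u" and low: "eventually (\<lambda>x. B \<le> u x) (ending s)"
  shows "\<exists>L :: ereal. ((\<lambda>x. ereal (u x)) \<longlongrightarrow> L) (ending s)"
proof -
  obtain T0 where T0: "\<And>x. x \<noteq> 0 \<Longrightarrow> T0 \<le> depth s x \<Longrightarrow> B \<le> u x"
    using low unfolding eventually_ending by blast
  have beyond: "eventually (\<lambda>y. M \<le> u y) (ending s)"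
    if far: "\<And>T. \<exists>x::real^'n. x \<noteq> 0 \<and> T \<le> depth s x \<and> (\<forall>y. y \<noteq> 0 \<longrightarrow> depth s y = depth s x \<longrightarrow> M \<le> u y)" for M
  proof -
    obtain x1 :: "real^'n" where x1: "x1 \<noteq> 0" "\<And>y. y \<noteq> 0 \<Longrightarrow> depth s y = depth s x1 \<Longrightarrow> M \<le> u y" using far by blast
    have "M \<le> u y" if y: "y \<noteq> 0" "depth s x1 \<le> depth s y" for y
    proof -
      obtain x2 :: "real^'n" where x2: "x2 \<noteq> 0" "depth s y \<le> depth s x2" "\<And>z. z \<noteq> 0 \<Longrightarrow> depth s z = depth s x2 \<Longrightarrow> M \<le> u z" using far by blast
      have "(\<lambda>_. M) y \<le> u y + 0"
        by (rule depth_comparison[OF s qsol_const u y(1) y(2) x2(2)]) (use x1(2) x2(3) in auto)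
      then show ?thesis by simp
    qed
    then show ?thesis unfolding eventually_ending by blast
  qed
  show ?thesis
  proof (cases "\<exists>M. eventually (\<lambda>x. u x \<le> M) (ending s)")
    case False
    obtain C where C: "C > 0" "\<And>u B s x y. s = 1 \<or> s = -1 \<Longrightarrow> sol u \<Longrightarrow> x \<noteq> 0 \<Longrightarrow> y \<noteq> 0 \<Longrightarrow> depth s x = depth s y \<Longrightarrow>
      (\<And>z. z \<noteq> 0 \<Longrightarrow> \<bar>depth s z - depth s x\<bar> < 2 \<Longrightarrow> B \<le> u z) \<Longrightarrow> u x - B \<le> C * (u y - B)"
      using Harnack_depth by blast
    have "eventually (\<lambda>y. M \<le> u y) (ending s)" for M
    proof (rule beyond)
      fix T
      \<comment> \<open>The shift by 2 keeps the window of the Harnack inequality where B <= u; the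
        threshold is the value that the inequality turns into M.\<close>
      have "\<exists>x. x \<noteq> 0 \<and> max T (T0 + 2) \<le> depth s x \<and> B + C * (M - B) < u x"
        using False unfolding eventually_ending by (meson not_le)
      then obtain x where x: "x \<noteq> 0" "max T (T0 + 2) \<le> depth s x" "B + C * (M - B) < u x" by blast
      have "M \<le> u y" if "y \<noteq> 0" "depth s y = depth s x" for y
      proof -
        have "u x - B \<le> C * (u y - B)"
          by (rule C(2)[OF s u x(1) that(1) that(2)[symmetric]]) (use T0 x(2) in auto)
        then have "C * (M - B) < C * (u y - B)" using x(3) by linarith
        then show ?thesis using C(1) by simp
      qed
      then show "\<exists>x::real^'n. x \<noteq> 0 \<and> T \<le> depth s x \<and> (\<forall>y. y \<noteq> 0 \<longrightarrow> depth s y = depth s x \<longrightarrow> M \<le> u y)"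
        using x(1,2) by (intro exI[of _ x]) simp
    qed
    then have "filterlim u at_top (ending s)" by (simp add: filterlim_at_top)
    then show ?thesis using tendsto_PInfty_eq_at_top by blast
  next
    case True
    then obtain M1 where "eventually (\<lambda>x. u x \<le> M1) (ending s)" by blast
    then obtain T1 where T1: "\<And>x. x \<noteq> 0 \<Longrightarrow> T1 \<le> depth s x \<Longrightarrow> u x \<le> M1"
      unfolding eventually_ending by blast
    define A where "A = {M. eventually (\<lambda>x. u x \<le> M) (ending s)}"
    have A: "A \<noteq> {}" using True by (auto simp: A_def)
    have lb: "B \<le> M" if "M \<in> A" for M
    proof -
      have "eventually (\<lambda>x. B \<le> M) (ending s :: (real^'n) filter)"
        using low that[unfolded A_def mem_Collect_eq] by eventually_elim linarith
      then show ?thesis using ending_nontrivial[OF s, where 'n = 'n] by (simp add: eventually_const_iff)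
    qed
    define l where "l = Inf A"
    have up: "eventually (\<lambda>x. u x \<le> l + \<epsilon>) (ending s)" if "\<epsilon> > 0" for \<epsilon>
    proof -
      obtain M where M: "M \<in> A" "M < l + \<epsilon>" using cInf_lessD[OF A, of "l + \<epsilon>"] \<open>\<epsilon> > 0\<close> unfolding l_def by auto
      from M(1)[unfolded A_def mem_Collect_eq] show ?thesis by eventually_elim (use M(2) in simp)
    qed
    have notA: "l - \<epsilon> \<notin> A" if "\<epsilon> > 0" for \<epsilon>
      using cInf_lower[of "l - \<epsilon>" A] lb that by (auto simp: l_def bdd_below_def)
    have "\<exists>x. x \<noteq> 0 \<and> real k \<le> depth s x \<and> l - 1 / real (Suc k) < u x" for k
      using notA[of "1 / real (Suc k)"] unfolding A_def mem_Collect_eq eventually_ending by (meson not_le of_nat_0_less_iff zero_less_Suc zero_less_divide_1_iff)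
    then obtain x where x: "\<And>k. x k \<noteq> 0" "\<And>k. real k \<le> depth s (x k)" "\<And>k. l - 1 / real (Suc k) < u (x k)" by metis
    \<comment> \<open>Moves \<open>x k\<close> to the unit sphere; a fixed compact set is then
      carried ever deeper into the end.\<close>
    define v where "v k z = u (norm (x k) *\<^sub>R z)" for k z
    have v: "sol (v k)" for k unfolding v_def using x(1) by (intro sol_rescale[OF u]) auto
    have dv: "depth s (norm (x k) *\<^sub>R z) = depth s (x k) + depth s z" if "z \<noteq> 0" for k z
      using depth_scale[of "norm (x k)" z s] x(1) that by (simp add: depth_def)
    have evT: "\<forall>\<^sub>F k in sequentially. T \<le> depth s (x k) - b" for T b
    proof -
      obtain N :: nat where "T + b \<le> real N" using real_arch_simple by blast
      then show ?thesis using x(2) by (intro eventually_sequentiallyI[of N]) (smt (verit) of_nat_mono)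
    qed
    have "eventually (\<lambda>y. l - \<epsilon> \<le> u y) (ending s)" if \<epsilon>: "\<epsilon> > 0" for \<epsilon>
    proof (rule beyond)
      fix T :: real
      obtain N :: nat where N: "T \<le> real N" using real_arch_simple by blast
      have "\<exists>k\<ge>N. \<forall>z. norm z = 1 \<longrightarrow> (\<lambda>_. l) z - \<epsilon> \<le> v k z"
      proof (rule touching_limit[OF v qsol_const])
        fix C :: "(real^'n) set" assume C: "compact C" "C \<subseteq> - {0}"
        obtain b where b: "\<And>x. x \<in> C \<Longrightarrow> \<bar>ln (norm x)\<bar> \<le> b" using compact_depth_bounded[OF C] by blast
        have "\<forall>\<^sub>F k in sequentially. \<forall>z\<in>C. \<bar>v k z\<bar> \<le> \<bar>B\<bar> + \<bar>M1\<bar>"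
          using evT[of T0 b] evT[of T1 b]
        proof eventually_elim
          case (elim k)
          show ?case
          proof
            fix z assume z: "z \<in> C"
            then have z0: "z \<noteq> 0" using C(2) by blast
            have "- b \<le> depth s z" using b[OF z] s by (auto simp: depth_def abs_le_iff)
            then have "T0 \<le> depth s (norm (x k) *\<^sub>R z)" "T1 \<le> depth s (norm (x k) *\<^sub>R z)"
              unfolding dv[OF z0] using elim by linarith+
            then have "B \<le> v k z" "v k z \<le> M1" unfolding v_def using T0 T1 z0 x(1) by auto
            then show "\<bar>v k z\<bar> \<le> \<bar>B\<bar> + \<bar>M1\<bar>" by linarith
          qed
        qed
        then show "\<exists>B. \<forall>\<^sub>F k in sequentially. \<forall>x\<in>C. \<bar>v k x\<bar> \<le> B" by blast
      next
        fix z :: "real^'n" and \<delta> :: real assume z: "z \<noteq> 0" and \<delta>: "\<delta> > 0"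
        obtain T2 where T2: "\<And>x. x \<noteq> 0 \<Longrightarrow> T2 \<le> depth s x \<Longrightarrow> u x \<le> l + \<delta>"
          using up[OF \<delta>] unfolding eventually_ending by blast
        show "\<forall>\<^sub>F k in sequentially. v k z \<le> l + \<delta>"
          using evT[of T2 "- depth s z"]
        proof eventually_elim
          case (elim k)
          then show ?case unfolding v_def using x(1) z by (intro T2) (auto simp: dv)
        qed
      next
        show "norm (x k /\<^sub>R norm (x k)) = 1" for k using x(1) by simp
        fix \<delta> :: real assume \<delta>: "\<delta> > 0"
        have "\<forall>\<^sub>F k in sequentially. 1 / real (Suc k) < \<delta>"
          using order_tendstoD(2)[OF LIMSEQ_inverse_real_of_nat \<delta>] by (simp only: inverse_eq_divide)
        then show "\<forall>\<^sub>F k in sequentially. l - \<delta> \<le> v k (x k /\<^sub>R norm (x k))"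
        proof eventually_elim
          case (elim k)
          have "v k (x k /\<^sub>R norm (x k)) = u (x k)" using x(1) by (simp add: v_def)
          then show ?case using x(3)[of k] elim by linarith
        qed
      qed (rule \<epsilon>)
      then obtain k where k: "k \<ge> N" "\<And>z. norm z = 1 \<Longrightarrow> l - \<epsilon> \<le> v k z" by auto
      have "l - \<epsilon> \<le> u y" if y: "y \<noteq> 0" "depth s y = depth s (x k)" for y
      proof -
        have n: "norm y = norm (x k)" using norm_depth[OF s y(1)] norm_depth[OF s x(1), of k] y(2) by simp
        have "l - \<epsilon> \<le> v k (y /\<^sub>R norm y)" using y(1) by (intro k(2)) simp
        also have "v k (y /\<^sub>R norm y) = u y" using y(1) by (simp add: v_def n[symmetric])
        finally show ?thesis .
      qed
      moreover have "T \<le> depth s (x k)" using N k(1) x(2)[of k] by (meson of_nat_mono order_trans)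
      ultimately show "\<exists>x::real^'n. x \<noteq> 0 \<and> T \<le> depth s x \<and> (\<forall>y. y \<noteq> 0 \<longrightarrow> depth s y = depth s x \<longrightarrow> l - \<epsilon> \<le> u y)"
        using x(1) by blast
    qed
    note down = this
    have "(u \<longlongrightarrow> l) (ending s)"
    proof (rule tendstoI)
      fix e :: real assume e: "e > 0"
      from up[OF half_gt_zero[OF e]] down[OF half_gt_zero[OF e]]
      show "eventually (\<lambda>x. dist (u x) l < e) (ending s)"
        by eventually_elim (use e in \<open>auto simp: dist_real_def abs_less_iff field_simps\<close>)
    qed
    then have "((\<lambda>x. ereal (u x)) \<longlongrightarrow> ereal l) (ending s)" by simp
    then show ?thesis by blast
  qed
qed

end

section \<open>Comparison with positive homogeneous solutions\<close>

lemma filterlim_depth: "filterlim (depth s) at_top (ending s)"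
  unfolding filterlim_at_top eventually_ending by blast

lemma tendsto_MInfty_eq_at_bot: "((\<lambda>x. ereal (f x)) \<longlongrightarrow> - \<infinity>) F \<longleftrightarrow> filterlim f at_bot F"
  by (simp add: tendsto_MInfty filterlim_at_bot_dense)

text \<open>The quantity for which a three-spheres statement in the manner of Hadamard will be
  proved.\<close>

definition smin :: "real \<Rightarrow> (real^'n \<Rightarrow> real) \<Rightarrow> real \<Rightarrow> real" where
  "smin s f t = Inf (f ` {x. x \<noteq> 0 \<and> depth s x = t})"

lemma smin_attained_least:
  fixes f :: "real^'n \<Rightarrow> real"
  assumes s: "s = 1 \<or> s = -1" and f: "continuous_on (- {0}) f"
  obtains x where "x \<noteq> 0" "depth s x = t" "f x = smin s f t" "\<And>y. y \<noteq> 0 \<Longrightarrow> depth s y = t \<Longrightarrow> smin s f t \<le> f y"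
proof -
  have eq: "{x::real^'n. x \<noteq> 0 \<and> depth s x = t} = sphere 0 (exp (s * t))" (is "?A = _")
  proof (intro equalityI subsetI)
    fix x :: "real^'n" assume "x \<in> ?A"
    then show "x \<in> sphere 0 (exp (s * t))" using norm_depth[OF s, of x] by auto
  next
    fix x :: "real^'n" assume x: "x \<in> sphere 0 (exp (s * t))"
    then have "norm x = exp (s * t)" by simp
    then have "x \<noteq> 0" "depth s x = t" using s by (auto simp: depth_def)
    then show "x \<in> ?A" by simp
  qed
  have A: "compact ?A" "?A \<noteq> {}" unfolding eq by auto
  have cont: "continuous_on ?A f" by (rule continuous_on_subset[OF f]) auto
  obtain x where x: "x \<in> ?A" "\<And>y. y \<in> ?A \<Longrightarrow> f x \<le> f y"
    using continuous_attains_inf[OF A cont] by blast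
  have "smin s f t = f x" unfolding smin_def
    by (rule cInf_eq_minimum) (use x in auto)
  then show ?thesis using that[of x] x by auto
qed

lemma smin_le:
  fixes f :: "real^'n \<Rightarrow> real"
  assumes "s = 1 \<or> s = -1" "continuous_on (- {0}) f" "x \<noteq> 0" shows "smin s f (depth s x) \<le> f x"
  by (rule smin_attained_least[OF assms(1,2), of "depth s x"]) (use assms(3) in blast)

lemma smin_attained:
  fixes f :: "real^'n \<Rightarrow> real"
  assumes "s = 1 \<or> s = -1" "continuous_on (- {0}) f"
  obtains x where "x \<noteq> 0" "depth s x = t" "f x = smin s f t"
  by (rule smin_attained_least[OF assms, of t]) (rule that)

lemma homogeneous_quotient_bounds:
  fixes \<Psi> :: "real^'n \<Rightarrow> real"
  assumes cont: "continuous_on (- {0}) \<Psi>" and pos: "\<And>x. x \<noteq> 0 \<Longrightarrow> \<Psi> x > 0"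
    and hom: "\<And>r x. r > 0 \<Longrightarrow> x \<noteq> 0 \<Longrightarrow> \<Psi> (r *\<^sub>R x) = r powr (- \<alpha>) * \<Psi> x"
  obtains c C where "c > 0" "C > 0" "\<And>x. x \<noteq> 0 \<Longrightarrow> c * exp (- \<alpha> * ln (norm x)) \<le> \<Psi> x"
    "\<And>x. x \<noteq> 0 \<Longrightarrow> \<Psi> x \<le> C * exp (- \<alpha> * ln (norm x))"
proof -
  let ?S = "sphere 0 1 :: (real^'n) set"
  have cS: "continuous_on ?S \<Psi>" by (rule continuous_on_subset[OF cont]) auto
  have S: "compact ?S" "?S \<noteq> {}" by auto
  obtain a where a: "a \<in> ?S" "\<And>x. x \<in> ?S \<Longrightarrow> \<Psi> a \<le> \<Psi> x" using continuous_attains_inf[OF S cS] by blast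
  obtain b where b: "b \<in> ?S" "\<And>x. x \<in> ?S \<Longrightarrow> \<Psi> x \<le> \<Psi> b" using continuous_attains_sup[OF S cS] by blast
  have eq: "\<Psi> x = exp (- \<alpha> * ln (norm x)) * \<Psi> (x /\<^sub>R norm x)" "x /\<^sub>R norm x \<in> ?S" if "x \<noteq> 0" for x
    using hom[of "norm x" "x /\<^sub>R norm x"] that by (auto simp: powr_def)
  show ?thesis
  proof (rule that[of "\<Psi> a" "\<Psi> b"])
    have "a \<noteq> 0" "b \<noteq> 0" using a(1) b(1) by auto
    then show "\<Psi> a > 0" "\<Psi> b > 0" using pos by auto
    fix x :: "real^'n" assume x: "x \<noteq> 0"
    show "\<Psi> a * exp (- \<alpha> * ln (norm x)) \<le> \<Psi> x" "\<Psi> x \<le> \<Psi> b * exp (- \<alpha> * ln (norm x))"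
      using eq[OF x] a(2) b(2) by (simp_all add: mult.commute)
  qed
qed

text \<open>\<Psi> decays at infinity for \<alpha> > 0 and at the origin for \<alpha> < 0; the end
  of sign sgn \<alpha> covers both.\<close>

lemma power_limits:
  fixes \<Psi> :: "real^'n \<Rightarrow> real"
  assumes cont: "continuous_on (- {0}) \<Psi>" and pos: "\<And>x. x \<noteq> 0 \<Longrightarrow> \<Psi> x > 0"
    and hom: "\<And>r x. r > 0 \<Longrightarrow> x \<noteq> 0 \<Longrightarrow> \<Psi> (r *\<^sub>R x) = r powr (- \<alpha>) * \<Psi> x" and \<alpha>: "\<alpha> \<noteq> 0"
  shows "(\<Psi> \<longlongrightarrow> 0) (ending (sgn \<alpha>))" "filterlim \<Psi> at_top (ending (- sgn \<alpha>))"
proof -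
  obtain c C where c: "c > 0" "C > 0" "\<And>x. x \<noteq> 0 \<Longrightarrow> c * exp (- \<alpha> * ln (norm x)) \<le> \<Psi> x"
    "\<And>x. x \<noteq> 0 \<Longrightarrow> \<Psi> x \<le> C * exp (- \<alpha> * ln (norm x))"
    by (rule homogeneous_quotient_bounds[OF cont pos hom]) (assumption | (rule that; assumption))+
  have ev: "eventually (\<lambda>x::real^'n. x \<noteq> 0) (ending s)" for s unfolding eventually_ending by blast
  have e1: "- \<alpha> * ln (norm x) = - (\<bar>\<alpha>\<bar> * depth (sgn \<alpha>) x)" "- \<alpha> * ln (norm x) = \<bar>\<alpha>\<bar> * depth (- sgn \<alpha>) x" for x :: "real^'n"
    by (auto simp: depth_def sgn_if)
  have "((\<lambda>t. C * exp (- (\<bar>\<alpha>\<bar> * t))) \<longlongrightarrow> 0) at_top" using \<alpha> by real_asymp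
  from filterlim_compose[OF this filterlim_depth[of "sgn \<alpha>"]]
  have lim: "((\<lambda>x::real^'n. C * exp (- (\<bar>\<alpha>\<bar> * depth (sgn \<alpha>) x))) \<longlongrightarrow> 0) (ending (sgn \<alpha>))" .
  have up: "eventually (\<lambda>x. \<Psi> x \<le> C * exp (- (\<bar>\<alpha>\<bar> * depth (sgn \<alpha>) x))) (ending (sgn \<alpha>))"
    using ev by eventually_elim (use c(4) e1(1) in simp)
  have low: "eventually (\<lambda>x. 0 \<le> \<Psi> x) (ending (sgn \<alpha>))"
    using ev by eventually_elim (use pos in force)
  show "(\<Psi> \<longlongrightarrow> 0) (ending (sgn \<alpha>))"
    by (rule tendsto_sandwich[OF low up tendsto_const lim])
  have "filterlim (\<lambda>t. c * exp (\<bar>\<alpha>\<bar> * t)) at_top at_top" using \<alpha> c(1) by real_asymp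
  from filterlim_compose[OF this filterlim_depth[of "- sgn \<alpha>"]]
  have lim: "filterlim (\<lambda>x::real^'n. c * exp (\<bar>\<alpha>\<bar> * depth (- sgn \<alpha>) x)) at_top (ending (- sgn \<alpha>))" .
  show "filterlim \<Psi> at_top (ending (- sgn \<alpha>))"
    by (rule filterlim_at_top_mono[OF lim], use ev in eventually_elim) (use c(3) e1(2) in simp)
qed

context elliptic_operator_ge2
begin

lemma smin_quasiconcave:
  assumes s: "s = 1 \<or> s = -1" and u: "sol u" and v: "sol v" and t: "a \<le> b" "b \<le> c"
  shows "min (smin s (\<lambda>x. u x - v x) a) (smin s (\<lambda>x. u x - v x) c) \<le> smin s (\<lambda>x. u x - v x) b"
proof -
  let ?D = "\<lambda>x. u x - v x"
  have cont: "continuous_on (- {0}) ?D" by (intro continuous_on_diff sol_cont u v)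
  obtain x where x: "x \<noteq> 0" "depth s x = b" "u x - v x = smin s ?D b"
    by (rule smin_attained[OF s cont])
  let ?m = "min (smin s ?D a) (smin s ?D c)"
  have "v x \<le> u x + - ?m"
  proof (rule depth_comparison[OF s v u x(1), of a c])
    fix y :: "real^'n" assume y: "y \<noteq> 0" "depth s y = a \<or> depth s y = c"
    then have "?m \<le> u y - v y" using smin_le[OF s cont y(1)] by auto
    then show "v y \<le> u y + - ?m" by linarith
  qed (use x t in auto)
  then show ?thesis using x(3) by linarith
qed

text \<open>If q were finite, v would be bounded above near the end and hence dominated there by any
  small multiple of u. Comparison from a sphere on which v < r, for some r between q' and q, gives v
  <= r up to that multiple, and then q <= r.\<close>

lemma end_matching:
  assumes s: "s = 1 \<or> s = -1" and u: "sol u" and v: "sol v" and top: "filterlim u at_top (ending s)"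
    and q: "((\<lambda>x. ereal (v x)) \<longlongrightarrow> q) (ending s)" and q': "((\<lambda>x. ereal (v x)) \<longlongrightarrow> q') (ending (- s))" and lt: "q' < q"
  shows "q = \<infinity>"
proof (rule ccontr)
  assume fin: "q \<noteq> \<infinity>"
  obtain r where r: "q' < ereal r" "ereal r < q" using ereal_dense2[OF lt] by blast
  obtain R where R: "q < ereal R" using fin by (metis less_PInf_Ex_of_nat ereal_infty_less(1))
  have "eventually (\<lambda>x. v x < r) (ending (- s))" using order_tendstoD(2)[OF q' r(1)] by simp
  then obtain T where T: "\<And>x. x \<noteq> 0 \<Longrightarrow> T \<le> depth (- s) x \<Longrightarrow> v x < r" unfolding eventually_ending by blast
  have R': "eventually (\<lambda>x. v x < R) (ending s)" using order_tendstoD(2)[OF q R] by simp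
  define m where "m = smin s u (- T)"
  have m: "m \<le> u y" if "y \<noteq> 0" "depth s y = - T" for y
    using smin_le[OF s sol_cont[OF u] that(1)] that(2) by (simp add: m_def)
  have le: "v x \<le> r" if x: "x \<noteq> 0" "- T \<le> depth s x" for x
  proof (rule field_le_epsilon)
    fix \<delta> :: real assume \<delta>: "\<delta> > 0"
    \<comment> \<open>The multiple of u is tuned to the fixed point x, so that it costs at most
      \<delta> there.\<close>
    define \<epsilon> where "\<epsilon> = \<delta> / (\<bar>u x - m\<bar> + 1)"
    have \<epsilon>: "\<epsilon> > 0" using \<delta> by (simp add: \<epsilon>_def)
    have "v x \<le> (\<epsilon> * u x + (r - \<epsilon> * m)) + 0"
    proof (rule end_comparison[OF s v _ x])
      show "sol (\<lambda>x. \<epsilon> * u x + (r - \<epsilon> * m))" using \<epsilon> u by (intro qsol_affine)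
      fix y :: "real^'n" assume y: "y \<noteq> 0" "depth s y = - T"
      have "v y < r" using T[OF y(1)] y(2) by (simp add: depth_minus)
      moreover have "\<epsilon> * m \<le> \<epsilon> * u y" using m[OF y] \<epsilon> by simp
      ultimately show "v y \<le> \<epsilon> * u y + (r - \<epsilon> * m) + 0" by linarith
    next
      fix d :: real assume d: "d > 0"
      have "eventually (\<lambda>y. (R - r) / \<epsilon> + m \<le> u y) (ending s)" using top unfolding filterlim_at_top by blast
      with R' show "eventually (\<lambda>y. v y \<le> \<epsilon> * u y + (r - \<epsilon> * m) + 0 + d) (ending s)"
      proof eventually_elim
        case (elim y)
        have "\<epsilon> * ((R - r) / \<epsilon> + m) \<le> \<epsilon> * u y" using elim(2) \<epsilon> by (intro mult_left_mono) auto
        then have "R - r + \<epsilon> * m \<le> \<epsilon> * u y" using \<epsilon> by (simp add: distrib_left)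
        then show ?case using elim(1) d by linarith
      qed
    qed
    also have "\<dots> = r + \<epsilon> * (u x - m)" by (simp add: algebra_simps)
    also have "\<epsilon> * (u x - m) \<le> \<epsilon> * (\<bar>u x - m\<bar> + 1)" using \<epsilon> by (intro mult_left_mono) auto
    also have "\<dots> = \<delta>" by (simp add: \<epsilon>_def)
    finally show "v x \<le> r + \<delta>" by simp
  qed
  have "eventually (\<lambda>x. ereal (v x) \<le> ereal r) (ending s)" unfolding eventually_ending using le by auto
  then have "q \<le> ereal r" by (rule tendsto_upperbound[OF q _ ending_nontrivial[OF s]])
  then show False using r(2) by simp
qed

lemma end_matching_bot:
  assumes s: "s = 1 \<or> s = -1" and u: "sol u" and v: "sol v" and bot: "filterlim u at_bot (ending s)"
    and q: "((\<lambda>x. ereal (v x)) \<longlongrightarrow> q) (ending s)" and q': "((\<lambda>x. ereal (v x)) \<longlongrightarrow> q') (ending (- s))" and lt: "q < q'"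
  shows "q = - \<infinity>"
proof -
  interpret D: elliptic_operator_ge2 "dual_operator F" lam Lam by (rule dual_ge2)
  have "- q = \<infinity>"
  proof (rule D.end_matching[OF s qsol_dual[OF u] qsol_dual[OF v]])
    show "filterlim (\<lambda>x. - u x) at_top (ending s)" using bot by (simp add: filterlim_uminus_at_top)
    show "((\<lambda>x. ereal (- v x)) \<longlongrightarrow> - q) (ending s)" "((\<lambda>x. ereal (- v x)) \<longlongrightarrow> - q') (ending (- s))"
      using tendsto_uminus_ereal[OF q] tendsto_uminus_ereal[OF q'] by simp_all
    show "- q' < - q" using lt by simp
  qed
  then show ?thesis by (metis ereal_uminus_uminus)
qed

text \<open>The scaling \<open>U\<close> to \<open>r powr \<alpha> * U (r *\<^sub>R z)\<close>
  leaves \<Psi> unchanged. Carrying nearly extremal points to the unit sphere therefore keeps U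
  between fixed multiples of \<Psi>, and in the limit it touches S \<Psi>.\<close>

lemma touching_ratio:
  assumes U: "sol U" and S\<Psi>: "sol (\<lambda>x. S * \<Psi> x)" and cont: "continuous_on (- {0}) \<Psi>"
    and pos: "\<And>x. x \<noteq> 0 \<Longrightarrow> \<Psi> x > 0"
    and hom: "\<And>r x. r > 0 \<Longrightarrow> x \<noteq> 0 \<Longrightarrow> \<Psi> (r *\<^sub>R x) = r powr (- \<alpha>) * \<Psi> x"
    and up: "\<And>x. x \<noteq> 0 \<Longrightarrow> U x \<le> S * \<Psi> x" and low: "\<And>x. x \<noteq> 0 \<Longrightarrow> - B * \<Psi> x \<le> U x"
    and sup: "\<And>\<delta>. \<delta> > 0 \<Longrightarrow> \<exists>x. x \<noteq> 0 \<and> (S - \<delta>) * \<Psi> x \<le> U x" and \<epsilon>: "\<epsilon> > 0"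
  shows "\<exists>r>0. \<forall>x. norm x = r \<longrightarrow> (S - \<epsilon>) * \<Psi> x \<le> U x"
proof -
  obtain c C where c: "c > 0" "C > 0" "\<And>x. x \<noteq> 0 \<Longrightarrow> c * exp (- \<alpha> * ln (norm x)) \<le> \<Psi> x"
    "\<And>x. x \<noteq> 0 \<Longrightarrow> \<Psi> x \<le> C * exp (- \<alpha> * ln (norm x))"
    by (rule homogeneous_quotient_bounds[OF cont pos hom]) (assumption | (rule that; assumption))+
  have unit: "c \<le> \<Psi> x" "\<Psi> x \<le> C" if "norm x = 1" for x
  proof -
    have "x \<noteq> 0" using that by auto
    then show "c \<le> \<Psi> x" "\<Psi> x \<le> C" using c(3,4)[of x] that by simp_all
  qed
  have "\<exists>x. x \<noteq> 0 \<and> (S - 1 / real (Suc k)) * \<Psi> x \<le> U x" for k by (rule sup) simp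
  then obtain x where x: "\<And>k. x k \<noteq> 0" "\<And>k. (S - 1 / real (Suc k)) * \<Psi> (x k) \<le> U (x k)" by metis
  define v where "v k z = norm (x k) powr \<alpha> * U (norm (x k) *\<^sub>R z)" for k z
  have pw: "norm (x k) powr \<alpha> * \<Psi> (norm (x k) *\<^sub>R z) = \<Psi> z" if "z \<noteq> 0" for k z
    using hom[of "norm (x k)" z] that x(1) by (simp add: powr_minus)
  have vup: "v k z \<le> S * \<Psi> z" and vlow: "- B * \<Psi> z \<le> v k z" if z: "z \<noteq> 0" for k z
  proof -
    have nz: "norm (x k) *\<^sub>R z \<noteq> 0" using x(1) z by simp
    have "v k z \<le> norm (x k) powr \<alpha> * (S * \<Psi> (norm (x k) *\<^sub>R z))"
      unfolding v_def using up[OF nz] by (intro mult_left_mono) auto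
    also have "\<dots> = S * \<Psi> z" using pw[OF z, of k] by (metis mult.left_commute)
    finally show "v k z \<le> S * \<Psi> z" .
    have "- B * \<Psi> z = norm (x k) powr \<alpha> * (- B * \<Psi> (norm (x k) *\<^sub>R z))" using pw[OF z, of k] by (metis mult.left_commute)
    also have "\<dots> \<le> v k z" unfolding v_def using low[OF nz] by (intro mult_left_mono) auto
    finally show "- B * \<Psi> z \<le> v k z" .
  qed
  have "\<exists>k\<ge>0. \<forall>z. norm z = 1 \<longrightarrow> S * \<Psi> z - \<epsilon> * c \<le> v k z"
  proof (rule touching_limit[OF _ S\<Psi>])
    show "sol (v k)" for k
      using sol_scale_nonneg[OF sol_rescale[OF U, of "norm (x k)"], of "norm (x k) powr \<alpha>" 0] x(1) by (simp add: v_def[abs_def])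
  next
    fix K :: "(real^'n) set" assume K: "compact K" "K \<subseteq> - {0}"
    from compact_imp_bounded[OF compact_continuous_image[OF continuous_on_subset[OF cont K(2)] K(1)]]
    obtain M where M: "\<And>z. z \<in> K \<Longrightarrow> \<bar>\<Psi> z\<bar> \<le> M" by (auto simp: bounded_iff)
    have "\<bar>v k z\<bar> \<le> (\<bar>S\<bar> + \<bar>B\<bar>) * M" if z: "z \<in> K" for k z
    proof -
      have z0: "z \<noteq> 0" using z K(2) by blast
      have "\<bar>v k z\<bar> \<le> \<bar>S * \<Psi> z\<bar> + \<bar>B * \<Psi> z\<bar>" using vup[OF z0, of k] vlow[OF z0, of k] by (simp add: abs_if split: if_splits)
      also have "\<dots> = (\<bar>S\<bar> + \<bar>B\<bar>) * \<bar>\<Psi> z\<bar>" by (simp add: abs_mult distrib_right)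
      also have "\<dots> \<le> (\<bar>S\<bar> + \<bar>B\<bar>) * M" using M[OF z] by (intro mult_left_mono) auto
      finally show ?thesis .
    qed
    then show "\<exists>B. \<forall>\<^sub>F k in sequentially. \<forall>z\<in>K. \<bar>v k z\<bar> \<le> B" by (intro exI always_eventually allI ballI)
  next
    show "\<forall>\<^sub>F k in sequentially. v k z \<le> S * \<Psi> z + \<delta>" if "z \<noteq> 0" "\<delta> > 0" for z \<delta>
      using vup[OF that(1)] that(2) by (intro always_eventually allI) (meson add_increasing2 less_imp_le order_trans)
  next
    show "norm (x k /\<^sub>R norm (x k)) = 1" for k using x(1) by simp
  next
    fix \<delta> :: real assume \<delta>: "\<delta> > 0"
    have "\<forall>\<^sub>F k in sequentially. 1 / real (Suc k) < \<delta> / C"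
      using order_tendstoD(2)[OF LIMSEQ_inverse_real_of_nat, of "\<delta> / C"] \<delta> c(2) by (simp add: inverse_eq_divide)
    then show "\<forall>\<^sub>F k in sequentially. S * \<Psi> (x k /\<^sub>R norm (x k)) - \<delta> \<le> v k (x k /\<^sub>R norm (x k))"
    proof eventually_elim
      case (elim k)
      let ?z = "x k /\<^sub>R norm (x k)" and ?n = "norm (x k) powr \<alpha>"
      have z: "norm ?z = 1" "?z \<noteq> 0" "norm (x k) *\<^sub>R ?z = x k" using x(1)[of k] by auto
      have "1 / real (Suc k) * \<Psi> ?z \<le> \<delta> / C * C"
        using elim unit(2)[OF z(1)] pos[OF z(2)] \<delta> c(2) by (intro mult_mono) auto
      then have "S * \<Psi> ?z - \<delta> \<le> (S - 1 / real (Suc k)) * \<Psi> ?z" using c(2) by (simp add: left_diff_distrib)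
      also have "\<dots> = ?n * ((S - 1 / real (Suc k)) * \<Psi> (x k))" using pw[OF z(2), of k] unfolding z(3) by (metis mult.left_commute)
      also have "\<dots> \<le> ?n * U (x k)" using x(2) by (intro mult_left_mono) auto
      also have "\<dots> = v k ?z" unfolding v_def z(3) ..
      finally show ?case .
    qed
  next
    show "\<epsilon> * c > 0" using \<epsilon> c by simp
  qed
  then obtain k where k: "\<And>z. norm z = 1 \<Longrightarrow> S * \<Psi> z - \<epsilon> * c \<le> v k z" by blast
  have "(S - \<epsilon>) * \<Psi> y \<le> U y" if y: "norm y = norm (x k)" for y
  proof -
    let ?z = "y /\<^sub>R norm y" and ?n = "norm (x k) powr \<alpha>"
    have y0: "y \<noteq> 0" using y x(1)[of k] by auto
    have z: "norm ?z = 1" "?z \<noteq> 0" "norm (x k) *\<^sub>R ?z = y" using y0 unfolding y[symmetric] by auto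
    have "\<epsilon> * c \<le> \<epsilon> * \<Psi> ?z" using unit(1)[OF z(1)] \<epsilon> by simp
    then have "(S - \<epsilon>) * \<Psi> ?z \<le> v k ?z" using k[OF z(1)] by (simp add: left_diff_distrib)
    then have "?n * ((S - \<epsilon>) * \<Psi> y) \<le> ?n * U y"
      unfolding v_def z(3) using pw[OF z(2), of k] unfolding z(3) by (metis mult.left_commute)
    then show ?thesis using x(1)[of k] by simp
  qed
  then show ?thesis using x(1)[of k] by (intro exI[of _ "norm (x k)"]) simp
qed

text \<open>As both functions vanish at the end s, bounds for the ratio U / \<Psi> on a sphere
  persist towards s. Harnack makes the ratio comparable on spheres, hence bounded. Its supremum and
  infimum are nearly attained on whole spheres, and both near-equalities hold on the deeper one of
  the two.\<close>

lemma ratio_constant: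
  assumes s: "s = 1 \<or> s = -1" and U: "sol U" and \<Psi>: "sol \<Psi>" and U0: "\<And>x. x \<noteq> 0 \<Longrightarrow> 0 \<le> U x"
    and pos: "\<And>x. x \<noteq> 0 \<Longrightarrow> \<Psi> x > 0"
    and hom: "\<And>r x. r > 0 \<Longrightarrow> x \<noteq> 0 \<Longrightarrow> \<Psi> (r *\<^sub>R x) = r powr (- \<alpha>) * \<Psi> x"
    and Ulim: "(U \<longlongrightarrow> 0) (ending s)" and \<Psi>lim: "(\<Psi> \<longlongrightarrow> 0) (ending s)"
  shows "\<exists>a\<ge>0. \<forall>x. x \<noteq> 0 \<longrightarrow> U x = a * \<Psi> x"
proof -
  have small: "eventually (\<lambda>y. g y \<le> \<delta>) (ending s)" if "(g \<longlongrightarrow> 0) (ending s)" "\<delta> > 0" for g :: "real^'n \<Rightarrow> real" and \<delta>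
    using order_tendstoD(2)[OF that] by eventually_elim simp
  have nz: "eventually (\<lambda>y::real^'n. y \<noteq> 0) (ending s)" unfolding eventually_ending by blast
  have beyond_low: "a * \<Psi> x \<le> U x" if a: "a \<ge> 0" and sph: "\<And>y. y \<noteq> 0 \<Longrightarrow> depth s y = p \<Longrightarrow> a * \<Psi> y \<le> U y"
    and x: "x \<noteq> 0" "p \<le> depth s x" for a p x
  proof -
    have a\<Psi>: "sol (\<lambda>x. a * \<Psi> x)" using sol_scale_nonneg[OF \<Psi> a, of 0] by simp
    have lim: "((\<lambda>x. a * \<Psi> x) \<longlongrightarrow> 0) (ending s)" using tendsto_mult_left[OF \<Psi>lim, of a] by simp
    have "a * \<Psi> x \<le> U x + 0"
    proof (rule end_comparison[OF s a\<Psi> U x])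
      fix \<delta> :: real assume "\<delta> > 0"
      from small[OF lim this] nz show "eventually (\<lambda>y. a * \<Psi> y \<le> U y + 0 + \<delta>) (ending s)"
        by eventually_elim (use U0 in force)
    qed (use sph in simp)
    then show ?thesis by simp
  qed
  have beyond_up: "U x \<le> a * \<Psi> x" if a: "a \<ge> 0" and sph: "\<And>y. y \<noteq> 0 \<Longrightarrow> depth s y = p \<Longrightarrow> U y \<le> a * \<Psi> y"
    and x: "x \<noteq> 0" "p \<le> depth s x" for a p x
  proof -
    have a\<Psi>: "sol (\<lambda>x. a * \<Psi> x)" using sol_scale_nonneg[OF \<Psi> a, of 0] by simp
    have "U x \<le> a * \<Psi> x + 0"
    proof (rule end_comparison[OF s U a\<Psi> x])
      fix \<delta> :: real assume "\<delta> > 0"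
      from small[OF Ulim this] nz show "eventually (\<lambda>y. U y \<le> a * \<Psi> y + 0 + \<delta>) (ending s)"
      proof eventually_elim
        case (elim y)
        have "0 \<le> a * \<Psi> y" using a pos[OF elim(2)] by simp
        then show ?case using elim(1) by linarith
      qed
    qed (use sph in simp)
    then show ?thesis by simp
  qed
  define \<rho> where "\<rho> x = U x / \<Psi> x" for x
  have \<rho>le: "\<rho> x \<le> a \<longleftrightarrow> U x \<le> a * \<Psi> x" and \<rho>ge: "a \<le> \<rho> x \<longleftrightarrow> a * \<Psi> x \<le> U x" if "x \<noteq> 0" for x a
    using pos[OF that] by (simp_all add: \<rho>_def pos_divide_le_eq pos_le_divide_eq)
  have \<rho>0: "\<rho> x \<ge> 0" if "x \<noteq> 0" for x using U0[OF that] pos[OF that] by (simp add: \<rho>_def)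
  obtain C where C: "C > 0" "\<And>u B s x y. s = 1 \<or> s = -1 \<Longrightarrow> sol u \<Longrightarrow> x \<noteq> 0 \<Longrightarrow> y \<noteq> 0 \<Longrightarrow> depth s x = depth s y \<Longrightarrow>
      (\<And>z. z \<noteq> 0 \<Longrightarrow> \<bar>depth s z - depth s x\<bar> < 2 \<Longrightarrow> B \<le> u z) \<Longrightarrow> u x - B \<le> C * (u y - B)"
    using Harnack_depth by blast
  have harnack: "\<rho> x \<le> C\<^sup>2 * \<rho> y" if xy: "x \<noteq> 0" "y \<noteq> 0" "depth s x = depth s y" for x y
  proof -
    have 1: "U x \<le> C * U y" using C(2)[OF s U xy, of 0] U0 by simp
    have 2: "\<Psi> y \<le> C * \<Psi> x" using C(2)[OF s \<Psi> xy(2,1) xy(3)[symmetric], of 0] pos by (simp add: less_imp_le)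
    have "U x * \<Psi> y \<le> (C * U y) * (C * \<Psi> x)"
      using 1 2 pos[OF xy(2)] U0[OF xy(2)] C(1) by (intro mult_mono) auto
    then show ?thesis using pos[OF xy(1)] pos[OF xy(2)]
      by (simp add: \<rho>_def pos_divide_le_eq pos_le_divide_eq power2_eq_square mult_ac)
  qed
  obtain e :: "real^'n" where e1: "norm e = 1" by (metis norm_axis_1)
  then have e: "e \<noteq> 0" "depth s e = 0" by (auto simp: depth_def)
  have bound: "\<rho> x \<le> C\<^sup>2 * \<rho> e" if x: "x \<noteq> 0" for x
  proof (cases "0 \<le> depth s x")
    case True
    have "U x \<le> (C\<^sup>2 * \<rho> e) * \<Psi> x"
    proof (rule beyond_up[OF _ _ x True])
      show "0 \<le> C\<^sup>2 * \<rho> e" using \<rho>0[OF e(1)] by simp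
      fix y :: "real^'n" assume y: "y \<noteq> 0" "depth s y = 0"
      show "U y \<le> (C\<^sup>2 * \<rho> e) * \<Psi> y" using harnack[OF y(1) e(1)] y(2) e(2) \<rho>le[OF y(1)] by simp
    qed
    then show ?thesis using \<rho>le[OF x] by simp
  next
    \<comment> \<open>Towards the other end the propagation is used backwards: a large ratio at x
      would be felt at e.\<close>
    case False
    define a where "a = \<rho> x / C\<^sup>2"
    have "a * \<Psi> e \<le> U e"
    proof (rule beyond_low[of a "depth s x" e])
      show "0 \<le> a" using \<rho>0[OF x] by (simp add: a_def)
      fix y :: "real^'n" assume y: "y \<noteq> 0" "depth s y = depth s x"
      have "a \<le> \<rho> y" using harnack[OF x y(1) y(2)[symmetric]] C(1) by (simp add: a_def pos_divide_le_eq mult.commute)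
      then show "a * \<Psi> y \<le> U y" using \<rho>ge[OF y(1)] by simp
    qed (use e False in auto)
    then have "a \<le> \<rho> e" using \<rho>ge[OF e(1)] by simp
    then show ?thesis using C(1) by (simp add: a_def pos_divide_le_eq mult.commute)
  qed
  define S where "S = Sup (\<rho> ` (- {0}))"
  define I where "I = Inf (\<rho> ` (- {0}))"
  have ne: "\<rho> ` (- {0}) \<noteq> {}" using e by auto
  have ba: "bdd_above (\<rho> ` (- {0}))" using bound by (auto simp: bdd_above_def)
  have bb: "bdd_below (\<rho> ` (- {0}))" using \<rho>0 by (auto simp: bdd_below_def)
  have leS: "\<rho> x \<le> S" and Ile: "I \<le> \<rho> x" if "x \<noteq> 0" for x
    using that ba bb by (auto simp: S_def I_def intro: cSup_upper cInf_lower)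
  have I0: "0 \<le> I" unfolding I_def using ne \<rho>0 by (intro cInf_greatest) auto
  have S0: "0 \<le> S" using leS[OF e(1)] \<rho>0[OF e(1)] by linarith
  have appS: "\<exists>x. x \<noteq> 0 \<and> S - \<delta> \<le> \<rho> x" if "\<delta> > 0" for \<delta>
    using less_cSupD[OF ne, of "S - \<delta>"] that unfolding S_def[symmetric] by force
  have appI: "\<exists>x. x \<noteq> 0 \<and> \<rho> x \<le> I + \<delta>" if "\<delta> > 0" for \<delta>
    using cInf_lessD[OF ne, of "I + \<delta>"] that unfolding I_def[symmetric] by force
  have contP: "continuous_on (- {0}) \<Psi>" by (rule sol_cont[OF \<Psi>])
  have "S \<le> I"
  proof (rule field_le_epsilon)
    fix \<epsilon> :: real assume \<epsilon>: "\<epsilon> > 0"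
    have \<epsilon>2: "\<epsilon> / 2 > 0" using \<epsilon> by simp
    have "\<exists>r>0. \<forall>x. norm x = r \<longrightarrow> (S - \<epsilon> / 2) * \<Psi> x \<le> U x"
    proof (rule touching_ratio[OF U _ contP pos hom, where B = 0])
      show "sol (\<lambda>x. S * \<Psi> x)" using sol_scale_nonneg[OF \<Psi> S0, of 0] by simp
      show "U x \<le> S * \<Psi> x" if "x \<noteq> 0" for x using leS[OF that] \<rho>le[OF that] by simp
      show "\<exists>x. x \<noteq> 0 \<and> (S - \<delta>) * \<Psi> x \<le> U x" if "\<delta> > 0" for \<delta> using appS[OF that] \<rho>ge by blast
    qed (use U0 \<epsilon>2 in auto)
    then obtain r1 where r1: "r1 > 0" "\<And>x. norm x = r1 \<Longrightarrow> (S - \<epsilon> / 2) * \<Psi> x \<le> U x" by blast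
    interpret D: elliptic_operator_ge2 "dual_operator F" lam Lam by (rule dual_ge2)
    have "\<exists>r>0. \<forall>x. norm x = r \<longrightarrow> (- I - \<epsilon> / 2) * \<Psi> x \<le> - U x"
    proof (rule D.touching_ratio[OF qsol_dual[OF U] _ contP pos hom, where B = S])
      show "D.sol (\<lambda>x. - I * \<Psi> x)" using qsol_dual[OF sol_scale_nonneg[OF \<Psi> I0, of 0]] by simp
      show "- U x \<le> - I * \<Psi> x" if "x \<noteq> 0" for x using Ile[OF that] \<rho>ge[OF that] by simp
      show "- S * \<Psi> x \<le> - U x" if "x \<noteq> 0" for x using leS[OF that] \<rho>le[OF that] by simp
      show "\<exists>x. x \<noteq> 0 \<and> (- I - \<delta>) * \<Psi> x \<le> - U x" if d: "\<delta> > 0" for \<delta>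
      proof -
        obtain x where x: "x \<noteq> 0" "\<rho> x \<le> I + \<delta>" using appI[OF d] by blast
        then have "U x \<le> (I + \<delta>) * \<Psi> x" using \<rho>le by simp
        then show ?thesis using x(1) by (intro exI[of _ x]) (simp add: algebra_simps)
      qed
    qed (use \<epsilon>2 in auto)
    then obtain r2 where r2: "r2 > 0" "\<And>x. norm x = r2 \<Longrightarrow> (- I - \<epsilon> / 2) * \<Psi> x \<le> - U x" by blast
    have dr: "norm y = r" if "y \<noteq> 0" "depth s y = s * ln r" "r > 0" for y :: "real^'n" and r
      using norm_depth[OF s that(1)] that s by auto
    define t where "t = max (s * ln r1) (s * ln r2)"
    define x :: "real^'n" where "x = exp (s * t) *\<^sub>R e"
    have x: "x \<noteq> 0" "depth s x = t" using e depth_exp[OF s e1, of t] by (auto simp: x_def)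
    \<comment> \<open>\<open>beyond_low\<close> takes nonnegative factors only, and U >= 0 makes the
      truncation harmless.\<close>
    have 1: "max 0 (S - \<epsilon> / 2) * \<Psi> x \<le> U x"
    proof (rule beyond_low[of _ "s * ln r1"])
      fix y :: "real^'n" assume y: "y \<noteq> 0" "depth s y = s * ln r1"
      show "max 0 (S - \<epsilon> / 2) * \<Psi> y \<le> U y" using r1(2)[OF dr[OF y r1(1)]] U0[OF y(1)] by (simp add: max_def)
    qed (use x in \<open>auto simp: t_def\<close>)
    have 2: "U x \<le> (I + \<epsilon> / 2) * \<Psi> x"
    proof (rule beyond_up[of _ "s * ln r2"])
      fix y :: "real^'n" assume y: "y \<noteq> 0" "depth s y = s * ln r2"
      show "U y \<le> (I + \<epsilon> / 2) * \<Psi> y" using r2(2)[OF dr[OF y r2(1)]] by (simp add: algebra_simps)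
    qed (use x I0 \<epsilon>2 in \<open>auto simp: t_def\<close>)
    have "max 0 (S - \<epsilon> / 2) \<le> I + \<epsilon> / 2" using order_trans[OF 1 2] pos[OF x(1)] by simp
    then show "S \<le> I + \<epsilon>" by linarith
  qed
  then have "\<rho> x = S" if "x \<noteq> 0" for x using leS[OF that] Ile[OF that] by linarith
  then have "U x = S * \<Psi> x" if "x \<noteq> 0" for x using that pos[OF that] by (fastforce simp: \<rho>_def field_simps)
  then show ?thesis using S0 by blast
qed

text \<open>Matching with \<Psi> shows that u is infinite where \<Psi> is and finite where \<Psi>
  vanishes; subtraction of the finite limit reduces everything to
  \<open>ratio_constant\<close>.\<close>

lemma power_classification:
  assumes u: "sol u" and \<Psi>: "sol \<Psi>" and pos: "\<And>x. x \<noteq> 0 \<Longrightarrow> \<Psi> x > 0" and \<alpha>: "\<alpha> \<noteq> 0"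
    and hom: "\<And>r x. r > 0 \<Longrightarrow> x \<noteq> 0 \<Longrightarrow> \<Psi> (r *\<^sub>R x) = r powr (- \<alpha>) * \<Psi> x"
    and L: "((\<lambda>x. ereal (u x)) \<longlongrightarrow> L) (ending (sgn \<alpha>))" and L': "((\<lambda>x. ereal (u x)) \<longlongrightarrow> L') (ending (- sgn \<alpha>))"
    and lt: "L < L'"
  shows "\<exists>a>0. \<exists>b. \<forall>x. x \<noteq> 0 \<longrightarrow> u x = a * \<Psi> x + b"
proof -
  define s where "s = sgn \<alpha>"
  have s: "s = 1 \<or> s = -1" "- s = 1 \<or> - s = -1" using \<alpha> by (auto simp: s_def sgn_if)
  note L = L[folded s_def] and L' = L'[folded s_def]
  have \<Psi>0: "(\<Psi> \<longlongrightarrow> 0) (ending s)" and \<Psi>top: "filterlim \<Psi> at_top (ending (- s))"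
    using power_limits[OF sol_cont[OF \<Psi>] pos hom \<alpha>] by (simp_all add: s_def)
  have L'top: "L' = \<infinity>" by (rule end_matching[OF s(2) \<Psi> u \<Psi>top L' _ lt]) (simp add: L)
  then have utop: "filterlim u at_top (ending (- s))" using L' tendsto_PInfty_eq_at_top by blast
  have "L \<noteq> - \<infinity>"
  proof
    assume "L = - \<infinity>"
    then have "filterlim u at_bot (ending s)" using L by (simp add: tendsto_MInfty_eq_at_bot)
    \<comment> \<open>The roles are exchanged: u going to minus infinity would drag \<Psi> along,
      although \<Psi> tends to 0 at this end.\<close>
    from end_matching_bot[OF s(1) u \<Psi> this, of 0 \<infinity>] \<Psi>0 \<Psi>top
    show False by (simp add: zero_ereal_def tendsto_PInfty_eq_at_top)
  qed
  then obtain l where l: "L = ereal l" using lt by (cases L) auto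
  have ul: "(u \<longlongrightarrow> l) (ending s)" using L unfolding l by simp
  have U: "sol (\<lambda>x. u x - l)" using qsol_affine[OF u, of 1 "- l"] by simp
  have U0: "0 \<le> u x - l" if x: "x \<noteq> 0" for x
  proof (rule field_le_epsilon)
    fix \<delta> :: real assume \<delta>: "\<delta> > 0"
    have "(\<lambda>_. l) x \<le> u x + \<delta>"
    proof (rule two_ends_comparison[OF qsol_const u x])
      have "eventually (\<lambda>y. l \<le> u y + \<delta>) (ending s)"
        using order_tendstoD(1)[OF ul, of "l - \<delta>"] \<delta> by (auto elim: eventually_mono)
      moreover have "eventually (\<lambda>y. l - \<delta> \<le> u y) (ending (- s))" using utop unfolding filterlim_at_top by blast
      then have "eventually (\<lambda>y. l \<le> u y + \<delta>) (ending (- s))" by eventually_elim simp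
      ultimately show "eventually (\<lambda>y. l \<le> u y + \<delta>) (ending s')" if "s' = 1 \<or> s' = -1" for s' using s(1) that by auto
    qed
    then show "0 \<le> u x - l + \<delta>" by simp
  qed
  have "((\<lambda>x. u x - l) \<longlongrightarrow> 0) (ending s)" using tendsto_diff[OF ul tendsto_const[of l]] by simp
  from ratio_constant[OF s(1) U \<Psi> U0 pos hom this \<Psi>0]
  obtain a where a: "a \<ge> 0" "\<And>x. x \<noteq> 0 \<Longrightarrow> u x - l = a * \<Psi> x" by blast
  have "a \<noteq> 0"
  proof
    assume "a = 0"
    have "eventually (\<lambda>x. l + 1 \<le> u x) (ending (- s))" using utop unfolding filterlim_at_top by blast
    moreover have "eventually (\<lambda>x::real^'n. x \<noteq> 0) (ending (- s))" unfolding eventually_ending by blast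
    ultimately have "eventually (\<lambda>x::real^'n. False) (ending (- s))"
      by eventually_elim (use a(2) \<open>a = 0\<close> in fastforce)
    then show False using ending_nontrivial[OF s(2), where 'n = 'n] by (simp add: eventually_False)
  qed
  then show ?thesis using a by (intro exI[of _ a] conjI exI[of _ l]) (auto simp: algebra_simps)
qed

end

section \<open>Comparison with logarithmic solutions\<close>

context elliptic_operator_ge2
begin

text \<open>The minimum m of u on spheres grows at most linearly in the depth: for large c the
  minima of u - c \<Phi> have dropped once, and quasiconcavity prevents them from rising again.
  Harnack, applied above the level m(depth - 2), turns this into a bound for u itself.\<close>

lemma oscillation_at_end:
  assumes s: "s = 1 \<or> s = -1" and u: "sol u" and top: "filterlim u at_top (ending s)"
    and \<Phi>: "sol \<Phi>" and near: "\<And>x. x \<noteq> 0 \<Longrightarrow> \<bar>\<Phi> x - depth s x\<bar> \<le> c0"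
  shows "\<exists>K T. \<forall>x y. x \<noteq> 0 \<longrightarrow> y \<noteq> 0 \<longrightarrow> T \<le> depth s x \<longrightarrow> T \<le> depth s y \<longrightarrow> \<bar>depth s x - depth s y\<bar> \<le> 1 \<longrightarrow> \<bar>u x - u y\<bar> \<le> K"
proof -
  note cu = sol_cont[OF u] and c\<Phi> = sol_cont[OF \<Phi>]
  define m where "m t = smin s u t" for t
  obtain e :: "real^'n" where e: "norm e = 1" by (metis norm_axis_1)
  have "e \<noteq> 0" using e by auto
  then have c0: "c0 \<ge> 0" using near[of e] by linarith
  \<comment> \<open>\<Phi> is within c0 of the depth, so from depth 0 to depth h it increases by at
    least 1.\<close>
  define h where "h = 2 * c0 + 1"
  obtain xh where xh: "xh \<noteq> 0" "depth s xh = h" "u xh = m h"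
    unfolding m_def by (rule smin_attained[OF s cu])
  define c where "c = \<bar>m h - m 0\<bar> + 1"
  have c: "c > 0" by (simp add: c_def)
  have c\<Phi>s: "sol (\<lambda>x. c * \<Phi> x)" using qsol_affine[OF \<Phi> c, of 0] by simp
  let ?D = "\<lambda>x. u x - c * \<Phi> x"
  define d where "d t = smin s ?D t" for t
  have cD: "continuous_on (- {0}) ?D" by (intro continuous_on_diff continuous_on_mult continuous_on_const cu c\<Phi>)
  have concave: "min (d p) (d r) \<le> d q" if "p \<le> q" "q \<le> r" for p q r
    unfolding d_def by (rule smin_quasiconcave[OF s u c\<Phi>s that])
  have dm: "m p - c * (p + c0) \<le> d p" and md: "d p \<le> m p - c * (p - c0)" for p
  proof -
    obtain x where x: "x \<noteq> 0" "depth s x = p" "?D x = d p" unfolding d_def by (rule smin_attained[OF s cD])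
    have "c * \<Phi> x \<le> c * (p + c0)" using near[OF x(1)] x(2) c by (intro mult_left_mono) auto
    moreover have "m p \<le> u x" using smin_le[OF s cu x(1)] x(2) by (simp add: m_def)
    ultimately show "m p - c * (p + c0) \<le> d p" using x(3) by linarith
    obtain y where y: "y \<noteq> 0" "depth s y = p" "u y = m p" unfolding m_def by (rule smin_attained[OF s cu])
    have "c * (p - c0) \<le> c * \<Phi> y" using near[OF y(1)] y(2) c by (intro mult_left_mono) auto
    moreover have "d p \<le> ?D y" using smin_le[OF s cD y(1)] y(2) by (simp add: d_def)
    ultimately show "d p \<le> m p - c * (p - c0)" using y(3) by linarith
  qed
  have "c * (h - c0) = c * c0 + c" by (simp add: h_def algebra_simps)
  then have dh: "d h < d 0" using md[of h] dm[of 0] by (simp add: c_def)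
  have growth: "m q \<le> m p + c * (q - p) + 2 * c * c0" if pq: "h \<le> p" "p \<le> q" for p q
  proof -
    have "min (d 0) (d p) \<le> d h" using pq c0 by (intro concave) (auto simp: h_def)
    then have 1: "d p < d 0" using dh by linarith
    have "min (d 0) (d q) \<le> d p" using pq c0 by (intro concave) (auto simp: h_def)
    then have "d q \<le> d p" using 1 by linarith
    then have "m q \<le> m p - c * (p - c0) + c * (q + c0)" using dm[of q] md[of p] by linarith
    then show ?thesis by (simp add: algebra_simps)
  qed
  have above: "m p \<le> u x" if x: "x \<noteq> 0" "p \<le> depth s x" for p x
  proof -
    have "(\<lambda>_. m p) x \<le> u x + 0"
    proof (rule end_comparison[OF s qsol_const u x])
      show "m p \<le> u y + 0" if "y \<noteq> 0" "depth s y = p" for y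
        using smin_le[OF s cu that(1)] that(2) by (simp add: m_def)
      show "eventually (\<lambda>y. m p \<le> u y + 0 + \<delta>) (ending s)" if "\<delta> > 0" for \<delta>
      proof -
        have "eventually (\<lambda>y. m p \<le> u y) (ending s)" using top unfolding filterlim_at_top by blast
        then show ?thesis by eventually_elim (use \<open>\<delta> > 0\<close> in simp)
      qed
    qed
    then show ?thesis by simp
  qed
  have mono: "m p \<le> m q" if "p \<le> q" for p q
  proof -
    obtain x where "x \<noteq> 0" "depth s x = q" "u x = m q" unfolding m_def by (rule smin_attained[OF s cu])
    then show ?thesis using above[of x p] that by simp
  qed
  obtain C where C: "C > 0" "\<And>u B s x y. s = 1 \<or> s = -1 \<Longrightarrow> sol u \<Longrightarrow> x \<noteq> 0 \<Longrightarrow> y \<noteq> 0 \<Longrightarrow> depth s x = depth s y \<Longrightarrow>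
      (\<And>z. z \<noteq> 0 \<Longrightarrow> \<bar>depth s z - depth s x\<bar> < 2 \<Longrightarrow> B \<le> u z) \<Longrightarrow> u x - B \<le> C * (u y - B)"
    using Harnack_depth by blast
  \<comment> \<open>The growth of m over two units of depth, the width of the Harnack
    window.\<close>
  define G where "G = 2 * c + 2 * c * c0"
  have "c * c0 \<ge> 0" using c c0 by simp
  then have G: "c + 2 * c * c0 \<le> G" "0 \<le> c + 2 * c * c0" using c by (auto simp: G_def)
  have upper: "u x \<le> m (depth s x - 2) + C * G" if x: "x \<noteq> 0" "h + 2 \<le> depth s x" for x
  proof -
    let ?p = "depth s x"
    obtain y where y: "y \<noteq> 0" "depth s y = ?p" "u y = m ?p" unfolding m_def by (rule smin_attained[OF s cu])
    have "u x - m (?p - 2) \<le> C * (u y - m (?p - 2))"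
      by (rule C(2)[OF s u x(1) y(1) y(2)[symmetric]]) (auto intro!: above)
    also have "\<dots> \<le> C * G" using growth[of "?p - 2" ?p] x(2) y(3) C(1) by (intro mult_left_mono) (auto simp: G_def)
    finally show ?thesis by simp
  qed
  have le: "u y \<le> u x + (C * G + G)"
    if xy: "x \<noteq> 0" "y \<noteq> 0" "h + 2 \<le> depth s x" "h + 2 \<le> depth s y" "\<bar>depth s x - depth s y\<bar> \<le> 1" for x y
  proof -
    have "m (depth s y - 2) \<le> m (depth s x - 2) + G"
    proof (cases "depth s x \<le> depth s y")
      case True
      have "c * (depth s y - depth s x) \<le> c * 1" using xy(5) c by (intro mult_left_mono) auto
      then show ?thesis using growth[of "depth s x - 2" "depth s y - 2"] True xy(3) G by simp
    next
      case False
      then show ?thesis using mono[of "depth s y - 2" "depth s x - 2"] G by simp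
    qed
    moreover have "m (depth s x - 2) \<le> u x" by (rule above) (use xy in auto)
    ultimately show ?thesis using upper[OF xy(2,4)] by linarith
  qed
  show ?thesis
  proof (intro exI allI impI)
    fix x y :: "real^'n" assume "x \<noteq> 0" "y \<noteq> 0" "h + 2 \<le> depth s x" "h + 2 \<le> depth s y" "\<bar>depth s x - depth s y\<bar> \<le> 1"
    then show "\<bar>u x - u y\<bar> \<le> C * G + G" using le[of x y] le[of y x] by (simp add: abs_minus_commute abs_le_iff)
  qed
qed

text \<open>The solutions u(r x / e) and u(r x) + S are compared as r runs through the radii of
  near-extremal points. They have no limits by themselves; after subtraction of u(r e0), with e0 a
  fixed unit vector, the bound K keeps them bounded on compact sets.\<close>

lemma touching_increment:
  assumes u: "sol u" and K: "\<And>x y. x \<noteq> 0 \<Longrightarrow> y \<noteq> 0 \<Longrightarrow> \<bar>ln (norm x) - ln (norm y)\<bar> \<le> 1 \<Longrightarrow> \<bar>u x - u y\<bar> \<le> K"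
    and up: "\<And>x. x \<noteq> 0 \<Longrightarrow> u (exp (-1) *\<^sub>R x) - u x \<le> S"
    and sup: "\<And>\<delta>. \<delta> > 0 \<Longrightarrow> \<exists>x. x \<noteq> 0 \<and> S - \<delta> \<le> u (exp (-1) *\<^sub>R x) - u x" and \<epsilon>: "\<epsilon> > 0"
  shows "\<exists>t. \<forall>x. x \<noteq> 0 \<longrightarrow> ln (norm x) = t \<longrightarrow> S - \<epsilon> \<le> u (exp (-1) *\<^sub>R x) - u x"
proof -
  obtain e :: "real^'n" where e: "norm e = 1" by (metis norm_axis_1)
  have e0: "e \<noteq> 0" using e by auto
  have chain: "\<bar>u x - u y\<bar> \<le> real (Suc n) * K" if "x \<noteq> 0" "y \<noteq> 0" "\<bar>ln (norm x) - ln (norm y)\<bar> \<le> real n" for x y n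
    using that
  proof (induction n arbitrary: x)
    case 0
    then show ?case using K[of x y] by simp
  next
    case (Suc n)
    \<comment> \<open>One step of logarithmic length at most 1 towards |y|; the direction of z is
      arbitrary because K bounds differences over whole spheres.\<close>
    define t where "t = max (ln (norm x) - 1) (min (ln (norm x) + 1) (ln (norm y)))"
    define z where "z = exp t *\<^sub>R e"
    have z: "z \<noteq> 0" "ln (norm z) = t" using e by (auto simp: z_def)
    have "\<bar>ln (norm x) - t\<bar> \<le> 1" "\<bar>t - ln (norm y)\<bar> \<le> real n"
      using Suc.prems(3) by (auto simp: t_def max_def min_def abs_le_iff)
    then have "\<bar>u x - u z\<bar> \<le> K" "\<bar>u z - u y\<bar> \<le> real (Suc n) * K"
      using K[OF Suc.prems(1) z(1)] Suc.IH[OF z(1) Suc.prems(2)] z(2) by auto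
    moreover have "real (Suc (Suc n)) * K = K + real (Suc n) * K" by (simp add: algebra_simps)
    ultimately show ?case by linarith
  qed
  have "\<exists>x. x \<noteq> 0 \<and> S - 1 / real (Suc k) \<le> u (exp (-1) *\<^sub>R x) - u x" for k by (rule sup) simp
  then obtain x where x: "\<And>k. x k \<noteq> 0" "\<And>k. S - 1 / real (Suc k) \<le> u (exp (-1) *\<^sub>R x k) - u (x k)" by metis
  define r where "r k = norm (x k)" for k
  have r: "r k > 0" for k using x(1) by (simp add: r_def)
  define v where "v k z = u (exp (-1) *\<^sub>R r k *\<^sub>R z) - u (r k *\<^sub>R e)" for k z
  define h where "h k z = u (r k *\<^sub>R z) - u (r k *\<^sub>R e) + S" for k z
  have vh: "v k z - h k z = u (exp (-1) *\<^sub>R r k *\<^sub>R z) - u (r k *\<^sub>R z) - S" for k z by (simp add: v_def h_def)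
  have "\<exists>k\<ge>0. \<forall>z. norm z = 1 \<longrightarrow> h k z - \<epsilon> \<le> v k z"
  proof (rule touching_sequences)
    show "sol (v k)" for k
      using qsol_affine[OF sol_rescale[OF u, of "exp (-1) * r k"], of 1 "- u (r k *\<^sub>R e)"] r[of k] by (simp add: v_def[abs_def])
    show "sol (h k)" for k
      using qsol_affine[OF sol_rescale[OF u, of "r k"], of 1 "S - u (r k *\<^sub>R e)"] r[of k] by (simp add: h_def[abs_def] algebra_simps)
  next
    fix C :: "(real^'n) set" assume C: "compact C" "C \<subseteq> - {0}"
    obtain b where b: "\<And>x. x \<in> C \<Longrightarrow> \<bar>ln (norm x)\<bar> \<le> b" by (rule compact_depth_bounded[OF C]) (rule that)
    obtain N :: nat where N: "b + 1 \<le> real N" using real_arch_simple by blast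
    have bd: "\<bar>v k z\<bar> \<le> real (Suc N) * K" "\<bar>h k z\<bar> \<le> real (Suc N) * K + \<bar>S\<bar>" if z: "z \<in> C" for k z
    proof -
      have z0: "z \<noteq> 0" using z C(2) by blast
      have nz: "exp (-1) *\<^sub>R r k *\<^sub>R z \<noteq> 0" "r k *\<^sub>R z \<noteq> 0" "r k *\<^sub>R e \<noteq> 0" using z0 e0 r[of k] by auto
      have ln: "ln (norm (r k *\<^sub>R e)) = ln (r k)" "ln (norm (r k *\<^sub>R z)) = ln (r k) + ln (norm z)"
        "ln (norm (exp (-1) *\<^sub>R r k *\<^sub>R z)) = ln (r k) + ln (norm z) - 1"
        using r[of k] z0 e by (simp_all add: ln_mult)
      have "\<bar>ln (norm (exp (-1) *\<^sub>R r k *\<^sub>R z)) - ln (norm (r k *\<^sub>R e))\<bar> \<le> real N"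
        "\<bar>ln (norm (r k *\<^sub>R z)) - ln (norm (r k *\<^sub>R e))\<bar> \<le> real N"
        unfolding ln using b[OF z] N by linarith+
      note bds = chain[OF nz(1,3) this(1)] chain[OF nz(2,3) this(2)]
      show "\<bar>v k z\<bar> \<le> real (Suc N) * K" unfolding v_def by (rule bds(1))
      show "\<bar>h k z\<bar> \<le> real (Suc N) * K + \<bar>S\<bar>" unfolding h_def using bds(2) by linarith
    qed
    show "\<exists>B. \<forall>\<^sub>F k in sequentially. \<forall>z\<in>C. \<bar>v k z\<bar> \<le> B" "\<exists>B. \<forall>\<^sub>F k in sequentially. \<forall>z\<in>C. \<bar>h k z\<bar> \<le> B"
      by (rule exI, rule always_eventually, use bd in blast)+
  next
    fix z :: "real^'n" and \<delta> :: real assume z: "z \<noteq> 0" and \<delta>: "\<delta> > 0"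
    have "v k z \<le> h k z + \<delta>" for k using up[of "r k *\<^sub>R z"] vh[of k z] z r[of k] \<delta> by simp
    then show "\<forall>\<^sub>F k in sequentially. v k z \<le> h k z + \<delta>" by simp
  next
    show "norm (x k /\<^sub>R r k) = 1" for k using x(1) by (simp add: r_def)
  next
    fix \<delta> :: real assume \<delta>: "\<delta> > 0"
    have "\<forall>\<^sub>F k in sequentially. 1 / real (Suc k) < \<delta>"
      using order_tendstoD(2)[OF LIMSEQ_inverse_real_of_nat \<delta>] by (simp only: inverse_eq_divide)
    then show "\<forall>\<^sub>F k in sequentially. h k (x k /\<^sub>R r k) - \<delta> \<le> v k (x k /\<^sub>R r k)"
    proof eventually_elim
      case (elim k)
      have eq: "r k *\<^sub>R (x k /\<^sub>R r k) = x k" using r[of k] by simp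
      show ?case using vh[of k "x k /\<^sub>R r k"] x(2)[of k] elim unfolding eq by linarith
    qed
  qed (rule \<epsilon>)
  then obtain k where k: "\<And>z. norm z = 1 \<Longrightarrow> h k z - \<epsilon> \<le> v k z" by blast
  have "S - \<epsilon> \<le> u (exp (-1) *\<^sub>R y) - u y" if y: "y \<noteq> 0" "ln (norm y) = ln (r k)" for y
  proof -
    have n: "norm y = r k" using y r[of k] by simp
    then have "r k *\<^sub>R (y /\<^sub>R r k) = y" "norm (y /\<^sub>R r k) = 1" using r[of k] by auto
    then show ?thesis using vh[of k "y /\<^sub>R r k"] k[of "y /\<^sub>R r k"] by simp
  qed
  then show ?thesis by blast
qed

text \<open>The spherical minima of u - v would fall from p - 1 to p and rise from q - 1 to q,
  although both p and q - 1 lie between p - 1 and q. Quasiconcavity excludes such a dip.\<close>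

lemma no_valley:
  assumes u: "sol u" and v: "sol v" and pq: "p \<le> q"
    and dec: "\<And>x. x \<noteq> 0 \<Longrightarrow> ln (norm x) = p \<Longrightarrow> u x - v x < u (exp (-1) *\<^sub>R x) - v (exp (-1) *\<^sub>R x)"
    and inc: "\<And>x. x \<noteq> 0 \<Longrightarrow> ln (norm x) = q \<Longrightarrow> u (exp (-1) *\<^sub>R x) - v (exp (-1) *\<^sub>R x) < u x - v x"
  shows False
proof -
  let ?D = "\<lambda>x. u x - v x"
  define d where "d t = smin 1 ?D t" for t
  have cont: "continuous_on (- {0}) ?D" by (intro continuous_on_diff sol_cont u v)
  have concave: "min (d a) (d c) \<le> d b" if "a \<le> b" "b \<le> c" for a b c
    unfolding d_def by (rule smin_quasiconcave[OF _ u v that]) simp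
  have le: "d (ln (norm x)) \<le> ?D x" if "x \<noteq> 0" for x
    using smin_le[of 1, OF _ cont that] by (simp add: d_def depth_def)
  have att: "\<exists>x. x \<noteq> 0 \<and> ln (norm x) = t \<and> ?D x = d t" for t
    using smin_attained[of 1, OF _ cont, of t] unfolding d_def depth_def by (metis mult_1)
  have "d p < d (p - 1)"
  proof -
    obtain x where x: "x \<noteq> 0" "ln (norm x) = p - 1" "?D x = d (p - 1)" using att by blast
    define y where "y = exp 1 *\<^sub>R x"
    have y: "y \<noteq> 0" "ln (norm y) = p" "exp (-1) *\<^sub>R y = x" using x by (auto simp: y_def ln_mult simp flip: exp_add)
    show ?thesis using dec[OF y(1,2)] le[OF y(1)] x(3) unfolding y(2,3) by linarith
  qed
  moreover have "d (q - 1) < d q"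
  proof -
    obtain y where y: "y \<noteq> 0" "ln (norm y) = q" "?D y = d q" using att by blast
    have "exp (-1) *\<^sub>R y \<noteq> 0" "ln (norm (exp (-1) *\<^sub>R y)) = q - 1" using y by (auto simp: ln_mult)
    then show ?thesis using inc[OF y(1,2)] le[of "exp (-1) *\<^sub>R y"] y(3) by simp
  qed
  moreover have "min (d (p - 1)) (d q) \<le> d p" "min (d (p - 1)) (d q) \<le> d (q - 1)" using pq by (auto intro!: concave)
  ultimately show False by linarith
qed

end

section \<open>The logarithmic case and the assembly of the classification\<close>

lemma logarithm_near_depth:
  fixes \<Phi> :: "real^'n \<Rightarrow> real"
  assumes cont: "continuous_on (- {0}) \<Phi>" and hom: "\<And>r x. r > 0 \<Longrightarrow> x \<noteq> 0 \<Longrightarrow> \<Phi> (r *\<^sub>R x) = \<Phi> x - ln r"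
  obtains c where "\<And>x. x \<noteq> 0 \<Longrightarrow> \<bar>\<Phi> x - depth (-1) x\<bar> \<le> c"
proof -
  let ?S = "sphere 0 1 :: (real^'n) set"
  have "continuous_on ?S \<Phi>" by (rule continuous_on_subset[OF cont]) auto
  from compact_imp_bounded[OF compact_continuous_image[OF this]]
  obtain c where c: "\<forall>x\<in>?S. \<bar>\<Phi> x\<bar> \<le> c" by (auto simp: bounded_iff)
  have "\<bar>\<Phi> x - depth (-1) x\<bar> \<le> c" if x: "x \<noteq> 0" for x
    using hom[of "norm x" "x /\<^sub>R norm x"] c[rule_format, of "x /\<^sub>R norm x"] x by (simp add: depth_def)
  then show ?thesis by (rule that)
qed

lemma homogeneous_classD:
  assumes "\<Phi> \<in> homogeneous_class \<alpha>" "r > 0" "x \<noteq> 0"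
  shows "\<alpha> = 0 \<Longrightarrow> \<Phi> (r *\<^sub>R x) = \<Phi> x - ln r" "\<alpha> \<noteq> 0 \<Longrightarrow> \<Phi> (r *\<^sub>R x) = r powr (- \<alpha>) * \<Phi> x" "\<alpha> \<noteq> 0 \<Longrightarrow> \<alpha> * \<Phi> x > 0"
proof -
  show "\<Phi> (r *\<^sub>R x) = \<Phi> x - ln r" if "\<alpha> = 0"
  proof -
    have "\<Phi> (r *\<^sub>R x) + ln r = \<Phi> x" using assms that by (simp add: homogeneous_class_def)
    then show ?thesis by simp
  qed
  show "\<Phi> (r *\<^sub>R x) = r powr (- \<alpha>) * \<Phi> x" if "\<alpha> \<noteq> 0"
  proof -
    have "r powr \<alpha> * \<Phi> (r *\<^sub>R x) = \<Phi> x" using assms that by (simp add: homogeneous_class_def)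
    then show ?thesis using assms(2) by (auto simp: powr_minus field_simps)
  qed
  show "\<alpha> * \<Phi> x > 0" if "\<alpha> \<noteq> 0" using assms that by (simp add: homogeneous_class_def)
qed

context elliptic_operator_ge2
begin

text \<open>Each end has its own bound, the one at infinity by duality, and the compact shell
  between is widened by one logarithmic unit so that no pair of points falls between the
  cases.\<close>

lemma oscillation:
  assumes u: "sol u" and top: "filterlim u at_top (ending (-1))" and bot: "filterlim u at_bot (ending 1)"
    and \<Phi>: "sol \<Phi>" and hom: "\<And>r x. r > 0 \<Longrightarrow> x \<noteq> 0 \<Longrightarrow> \<Phi> (r *\<^sub>R x) = \<Phi> x - ln r"
  obtains K where "\<And>x y. x \<noteq> 0 \<Longrightarrow> y \<noteq> 0 \<Longrightarrow> \<bar>ln (norm x) - ln (norm y)\<bar> \<le> 1 \<Longrightarrow> \<bar>u x - u y\<bar> \<le> K"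
proof -
  interpret D: elliptic_operator_ge2 "dual_operator F" lam Lam by (rule dual_ge2)
  obtain c where c: "\<And>x. x \<noteq> 0 \<Longrightarrow> \<bar>\<Phi> x - depth (-1) x\<bar> \<le> c"
    by (rule logarithm_near_depth[OF sol_cont[OF \<Phi>] hom]) (assumption | (rule that; assumption))+
  have c': "\<bar>- \<Phi> x - depth 1 x\<bar> \<le> c" if "x \<noteq> 0" for x
    using c[OF that] by (simp add: depth_def abs_minus_commute)
  have "filterlim (\<lambda>x. - u x) at_top (ending 1)" using bot by (simp add: filterlim_uminus_at_top)
  from D.oscillation_at_end[OF _ qsol_dual[OF u] this qsol_dual[OF \<Phi>] c']
  obtain K1 T1 where K1: "\<And>x y. x \<noteq> 0 \<Longrightarrow> y \<noteq> 0 \<Longrightarrow> T1 \<le> depth 1 x \<Longrightarrow> T1 \<le> depth 1 y \<Longrightarrow> \<bar>depth 1 x - depth 1 y\<bar> \<le> 1 \<Longrightarrow> \<bar>- u x - - u y\<bar> \<le> K1"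
    by fast
  from oscillation_at_end[OF _ u top \<Phi> c]
  obtain K2 T2 where K2: "\<And>x y. x \<noteq> 0 \<Longrightarrow> y \<noteq> 0 \<Longrightarrow> T2 \<le> depth (-1) x \<Longrightarrow> T2 \<le> depth (-1) y \<Longrightarrow> \<bar>depth (-1) x - depth (-1) y\<bar> \<le> 1 \<Longrightarrow> \<bar>u x - u y\<bar> \<le> K2"
    by fast
  let ?A = "cball 0 (exp (T1 + 1)) - ball 0 (exp (- T2 - 1)) :: (real^'n) set"
  have "compact ?A" by (intro compact_diff) auto
  moreover have "continuous_on ?A u" by (rule continuous_on_subset[OF sol_cont[OF u]]) auto
  ultimately have "bounded (u ` ?A)" by (rule compact_imp_bounded[OF compact_continuous_image, rotated])
  then obtain B where B: "\<forall>x\<in>?A. \<bar>u x\<bar> \<le> B" by (auto simp: bounded_iff)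
  have B': "\<bar>u x\<bar> \<le> B" if x: "x \<noteq> 0" "- T2 - 1 \<le> ln (norm x)" "ln (norm x) \<le> T1 + 1" for x
  proof -
    have "norm x = exp (ln (norm x))" using x(1) by simp
    then have "exp (- T2 - 1) \<le> norm x" "norm x \<le> exp (T1 + 1)" using x(2,3) by (metis exp_le_cancel_iff)+
    then show ?thesis by (intro B[rule_format]) simp
  qed
  show ?thesis
  proof (rule that[of "max K1 (max K2 (2 * B))"])
    fix x y :: "real^'n" assume xy: "x \<noteq> 0" "y \<noteq> 0" "\<bar>ln (norm x) - ln (norm y)\<bar> \<le> 1"
    consider "T1 \<le> ln (norm x)" "T1 \<le> ln (norm y)" | "ln (norm x) \<le> - T2" "ln (norm y) \<le> - T2"
      | "- T2 - 1 \<le> ln (norm x)" "ln (norm x) \<le> T1 + 1" "- T2 - 1 \<le> ln (norm y)" "ln (norm y) \<le> T1 + 1"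
      using xy(3) unfolding abs_le_iff by linarith
    then show "\<bar>u x - u y\<bar> \<le> max K1 (max K2 (2 * B))"
    proof cases
      case 1
      then show ?thesis using K1[OF xy(1,2)] xy(3) by (simp add: depth_def)
    next
      case 2
      then have "T2 \<le> depth (-1) x" "T2 \<le> depth (-1) y" by (auto simp: depth_def)
      moreover have "\<bar>depth (-1) x - depth (-1) y\<bar> \<le> 1" unfolding depth_def using xy(3) by linarith
      ultimately show ?thesis using K2[OF xy(1,2)] by simp
    next
      case 3
      then show ?thesis using B'[OF xy(1)] B'[OF xy(2)] by linarith
    qed
  qed
qed

text \<open>The constant increment, once it is known to be constant, is the factor a. Then u - a
  \<Phi> is invariant under the dilation by e and attains its maximum on a fundamental shell, so the
  strong maximum principle makes it constant.\<close>

lemma log_classification: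
  assumes u: "sol u" and top: "filterlim u at_top (ending (-1))" and bot: "filterlim u at_bot (ending 1)"
    and \<Phi>: "sol \<Phi>" and hom: "\<And>r x. r > 0 \<Longrightarrow> x \<noteq> 0 \<Longrightarrow> \<Phi> (r *\<^sub>R x) = \<Phi> x - ln r"
  shows "\<exists>a>0. \<exists>b. \<forall>x. x \<noteq> 0 \<longrightarrow> u x = a * \<Phi> x + b"
proof -
  interpret D: elliptic_operator_ge2 "dual_operator F" lam Lam by (rule dual_ge2)
  obtain K where K: "\<And>x y. x \<noteq> 0 \<Longrightarrow> y \<noteq> 0 \<Longrightarrow> \<bar>ln (norm x) - ln (norm y)\<bar> \<le> 1 \<Longrightarrow> \<bar>u x - u y\<bar> \<le> K"
    by (rule oscillation[OF u top bot \<Phi> hom]) (assumption | (rule that; assumption))+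
  obtain e :: "real^'n" where e1: "norm e = 1" by (metis norm_axis_1)
  then have e: "e \<noteq> 0" by auto
  let ?\<sigma> = "exp (-1) :: real"
  define w where "w x = u (?\<sigma> *\<^sub>R x) - u x" for x
  have wK: "\<bar>w x\<bar> \<le> K" if "x \<noteq> 0" for x unfolding w_def using that by (intro K) (auto simp: ln_mult)
  have \<Phi>w: "\<Phi> (?\<sigma> *\<^sub>R x) = \<Phi> x + 1" if "x \<noteq> 0" for x using hom[of ?\<sigma> x] that by simp
  define S where "S = Sup (w ` (- {0}))"
  define I where "I = Inf (w ` (- {0}))"
  have ne: "w ` (- {0}) \<noteq> {}" using e by auto
  have bd: "bdd_above (w ` (- {0}))" "bdd_below (w ` (- {0}))"
    using wK unfolding bdd_above_def bdd_below_def abs_le_iff by (force intro: exI[of _ K] exI[of _ "- K"])+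
  have wS: "w x \<le> S" and Iw: "I \<le> w x" if "x \<noteq> 0" for x
    using that bd by (auto simp: S_def I_def intro: cSup_upper cInf_lower)
  have appS: "\<exists>x. x \<noteq> 0 \<and> S - \<delta> \<le> w x" if "\<delta> > 0" for \<delta>
    using less_cSupD[OF ne, of "S - \<delta>"] that unfolding S_def[symmetric] by force
  have appI: "\<exists>x. x \<noteq> 0 \<and> w x \<le> I + \<delta>" if "\<delta> > 0" for \<delta>
    using cInf_lessD[OF ne, of "I + \<delta>"] that unfolding I_def[symmetric] by force
  have sphS: "\<exists>t. \<forall>x. x \<noteq> 0 \<longrightarrow> ln (norm x) = t \<longrightarrow> S - \<epsilon> \<le> w x" if "\<epsilon> > 0" for \<epsilon>
    unfolding w_def by (rule touching_increment[OF u K _ _ that]) (use wS appS in \<open>auto simp: w_def\<close>)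
  have sphI: "\<exists>t. \<forall>x. x \<noteq> 0 \<longrightarrow> ln (norm x) = t \<longrightarrow> w x \<le> I + \<epsilon>" if \<epsilon>: "\<epsilon> > 0" for \<epsilon>
  proof -
    have "\<exists>t. \<forall>x. x \<noteq> 0 \<longrightarrow> ln (norm x) = t \<longrightarrow> - I - \<epsilon> \<le> - u (?\<sigma> *\<^sub>R x) - - u x"
    proof (rule D.touching_increment[OF qsol_dual[OF u] _ _ _ \<epsilon>])
      show "\<bar>- u x - - u y\<bar> \<le> K" if "x \<noteq> 0" "y \<noteq> 0" "\<bar>ln (norm x) - ln (norm y)\<bar> \<le> 1" for x y
        using K[OF that] by (simp add: abs_minus_commute)
      show "- u (?\<sigma> *\<^sub>R x) - - u x \<le> - I" if "x \<noteq> 0" for x using Iw[OF that] by (simp add: w_def)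
      fix \<delta> :: real assume "\<delta> > 0"
      then obtain x where "x \<noteq> 0" "w x \<le> I + \<delta>" using appI by blast
      then show "\<exists>x. x \<noteq> 0 \<and> - I - \<delta> \<le> - u (?\<sigma> *\<^sub>R x) - - u x" by (intro exI[of _ x]) (simp add: w_def)
    qed
    then obtain t where t: "\<And>x. x \<noteq> 0 \<Longrightarrow> ln (norm x) = t \<Longrightarrow> - I - \<epsilon> \<le> - u (?\<sigma> *\<^sub>R x) - - u x" by blast
    have "w x \<le> I + \<epsilon>" if "x \<noteq> 0" "ln (norm x) = t" for x using t[OF that] by (simp add: w_def)
    then show ?thesis by blast
  qed
  \<comment> \<open>Otherwise u would not increase along the points e, e / exp 1, e / exp 2, ...,
    against its limit at the origin.\<close>
  have S: "S > 0"
  proof (rule ccontr)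
    assume "\<not> S > 0"
    then have dec: "u (?\<sigma> *\<^sub>R x) \<le> u x" if "x \<noteq> 0" for x using wS[OF that] by (simp add: w_def)
    have iter: "u (exp (- real n) *\<^sub>R e) \<le> u e" for n
    proof (induction n)
      case (Suc n)
      have "exp (- real (Suc n)) *\<^sub>R e = ?\<sigma> *\<^sub>R exp (- real n) *\<^sub>R e" by (simp flip: exp_add)
      then show ?case using dec[of "exp (- real n) *\<^sub>R e"] e Suc by simp
    qed simp
    have "eventually (\<lambda>x. u e + 1 \<le> u x) (ending (-1))" using top unfolding filterlim_at_top by blast
    then obtain T where T: "\<And>x. x \<noteq> 0 \<Longrightarrow> T \<le> depth (-1) x \<Longrightarrow> u e + 1 \<le> u x" unfolding eventually_ending by blast
    obtain n :: nat where n: "T \<le> real n" using real_arch_simple by blast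
    have "u e + 1 \<le> u (exp (- real n) *\<^sub>R e)" by (rule T) (use e e1 n in \<open>auto simp: depth_def\<close>)
    then show False using iter[of n] by simp
  qed
  have "S \<le> I"
  proof (rule ccontr)
    assume lt: "\<not> S \<le> I"
    \<comment> \<open>The truncation at 0 makes c positive, so that c \<Phi> is again a
      solution.\<close>
    define c where "c = (max I 0 + S) / 2"
    have c: "0 < c" "I < c" "c < S" using S lt by (auto simp: c_def)
    obtain p where p: "\<And>x. x \<noteq> 0 \<Longrightarrow> ln (norm x) = p \<Longrightarrow> c < w x"
    proof -
      have "(S - c) / 2 > 0" using c by simp
      from sphS[OF this] obtain t where t: "\<And>x. x \<noteq> 0 \<Longrightarrow> ln (norm x) = t \<Longrightarrow> S - (S - c) / 2 \<le> w x" by blast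
      have "c < S - (S - c) / 2" using c by (simp add: field_simps)
      then show ?thesis using that[of t] t by force
    qed
    obtain q where q: "\<And>x. x \<noteq> 0 \<Longrightarrow> ln (norm x) = q \<Longrightarrow> w x < c"
    proof -
      have "(c - I) / 2 > 0" using c by simp
      from sphI[OF this] obtain t where t: "\<And>x. x \<noteq> 0 \<Longrightarrow> ln (norm x) = t \<Longrightarrow> w x \<le> I + (c - I) / 2" by blast
      have "I + (c - I) / 2 < c" using c by (simp add: field_simps)
      then show ?thesis using that[of t] t by force
    qed
    have c\<Phi>: "sol (\<lambda>x. c * \<Phi> x)" using qsol_affine[OF \<Phi> c(1), of 0] by simp
    have \<Phi>c: "c * \<Phi> (?\<sigma> *\<^sub>R x) = c * \<Phi> x + c" if "x \<noteq> 0" for x using \<Phi>w[OF that] by (simp add: distrib_left)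
    show False
    \<comment> \<open>u - c \<Phi> increases inwards across p and decreases inwards across q. If p
      is the inner sphere this is a valley of u - c \<Phi>, otherwise one of c \<Phi> - u.\<close>
    proof (cases "p \<le> q")
      case True
      show False
        by (rule no_valley[OF u c\<Phi> True]) (use p q \<Phi>c in \<open>force simp: w_def\<close>)+
    next
      case False
      then have "q \<le> p" by simp
      show False
        by (rule no_valley[OF c\<Phi> u \<open>q \<le> p\<close>]) (use p q \<Phi>c in \<open>force simp: w_def\<close>)+
    qed
  qed
  then have w: "w x = S" if "x \<noteq> 0" for x using wS[OF that] Iw[OF that] by linarith
  have S\<Phi>: "sol (\<lambda>x. S * \<Phi> x)" using qsol_affine[OF \<Phi> S, of 0] by simp
  define D where "D x = u x - S * \<Phi> x" for x
  have D\<sigma>: "D (?\<sigma> *\<^sub>R x) = D x" if "x \<noteq> 0" for x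
    using w[OF that] \<Phi>w[OF that] by (simp add: D_def w_def distrib_left)
  have Dn: "D (exp (- real n) *\<^sub>R x) = D x" if "x \<noteq> 0" for x n
  proof (induction n)
    case (Suc n)
    have "exp (- real (Suc n)) *\<^sub>R x = ?\<sigma> *\<^sub>R exp (- real n) *\<^sub>R x" by (simp flip: exp_add)
    then show ?case using D\<sigma>[of "exp (- real n) *\<^sub>R x"] that Suc by simp
  qed simp
  have Di: "D (exp (of_int i) *\<^sub>R x) = D x" if x: "x \<noteq> 0" for x i
  proof (cases "i \<le> 0")
    case True
    then have "real_of_int i = - real (nat (- i))" by (simp add: of_nat_nat)
    show ?thesis unfolding \<open>real_of_int i = - real (nat (- i))\<close> by (rule Dn[OF x])
  next
    case False
    then have "real_of_int i = real (nat i)" by simp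
    have "D (exp (- real (nat i)) *\<^sub>R exp (real (nat i)) *\<^sub>R x) = D (exp (real (nat i)) *\<^sub>R x)"
      by (rule Dn) (use x in simp)
    moreover have "exp (- real (nat i)) *\<^sub>R exp (real (nat i)) *\<^sub>R x = x" by (simp add: exp_minus)
    ultimately show ?thesis unfolding \<open>real_of_int i = real (nat i)\<close> by simp
  qed
  let ?A = "cball 0 (exp 1) - ball 0 1 :: (real^'n) set"
  have A: "compact ?A" by (intro compact_diff) auto
  have eA: "e \<in> ?A" using e1 by simp
  have "continuous_on (- {0}) D" unfolding D_def by (intro continuous_on_diff sol_cont u S\<Phi>)
  then have cA: "continuous_on ?A D" by (rule continuous_on_subset) auto
  obtain a where a: "a \<in> ?A" "\<And>x. x \<in> ?A \<Longrightarrow> D x \<le> D a" using continuous_attains_sup[OF A _ cA] eA by blast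
  have le: "D x \<le> D a" if x: "x \<noteq> 0" for x
  proof -
    \<comment> \<open>The dilation that brings x into the shell 1 <= |y| <= e.\<close>
    define i where "i = - floor (ln (norm x))"
    define y where "y = exp (of_int i) *\<^sub>R x"
    have y: "y \<noteq> 0" "D y = D x" using x Di[OF x] by (simp_all add: y_def)
    have "ln (norm y) = ln (norm x) - of_int (floor (ln (norm x)))" using x by (simp add: y_def i_def ln_mult)
    then have "0 \<le> ln (norm y)" "ln (norm y) \<le> 1" by linarith+
    moreover have "norm y = exp (ln (norm y))" using y(1) by simp
    ultimately have "1 \<le> norm y" "norm y \<le> exp 1" by (metis exp_le_cancel_iff exp_zero)+
    then have "y \<in> ?A" by simp
    then show ?thesis using a(2) y(2) by metis
  qed
  have a0: "a \<noteq> 0" using a(1) by auto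
  have "u x = S * \<Phi> x + D a" if "x \<noteq> 0" for x
    by (rule difference_constant[OF u S\<Phi> _ a0 _ that]) (use le in \<open>force simp: D_def\<close>)+
  then show ?thesis using S by blast
qed

text \<open>\<Phi> itself is the witness that fixes the infinite ends of u. A negative exponent is
  reduced to the positive function - \<Phi> and the dual operator, where the vanishing end is the
  origin.\<close>

lemma classification:
  assumes u: "sol u" and \<Phi>: "sol \<Phi>" and cl: "\<Phi> \<in> homogeneous_class \<alpha>"
    and L0: "((\<lambda>x. ereal (u x)) \<longlongrightarrow> L0) (ending (-1))" and L1: "((\<lambda>x. ereal (u x)) \<longlongrightarrow> L1) (ending 1)" and lt: "L1 < L0"
  shows "\<exists>a>0. \<exists>b. \<forall>x. x \<noteq> 0 \<longrightarrow> u x = a * \<Phi> x + b"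
proof -
  note hom = homogeneous_classD[OF cl]
  consider "\<alpha> = 0" | "\<alpha> > 0" | "\<alpha> < 0" by linarith
  then show ?thesis
  proof cases
    case 1
    obtain c where c: "\<And>x. x \<noteq> 0 \<Longrightarrow> \<bar>\<Phi> x - depth (-1) x\<bar> \<le> c"
      by (rule logarithm_near_depth[OF sol_cont[OF \<Phi>] hom(1)[OF _ _ 1]]) (assumption | (rule that; assumption))+
    have top: "filterlim \<Phi> at_top (ending (-1))" unfolding filterlim_at_top eventually_ending
    proof (intro allI exI impI)
      fix Z :: real and x :: "real^'n" assume "x \<noteq> 0" "Z + c \<le> depth (-1) x"
      then show "Z \<le> \<Phi> x" using c[of x] by linarith
    qed
    have bot: "filterlim \<Phi> at_bot (ending 1)" unfolding filterlim_at_bot eventually_ending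
    proof (intro allI exI impI)
      fix Z :: real and x :: "real^'n" assume "x \<noteq> 0" "c - Z \<le> depth 1 x"
      then show "\<Phi> x \<le> Z" using c[of x] depth_minus[of 1 x] by linarith
    qed
    have "L0 = \<infinity>" by (rule end_matching[OF _ \<Phi> u top L0 _ lt]) (use L1 in simp_all)
    then have "filterlim u at_top (ending (-1))" using L0 tendsto_PInfty_eq_at_top by blast
    moreover have "L1 = - \<infinity>" by (rule end_matching_bot[OF _ \<Phi> u bot L1 L0 lt]) simp
    then have "filterlim u at_bot (ending 1)" using L1 by (simp add: tendsto_MInfty_eq_at_bot)
    ultimately show ?thesis by (rule log_classification[OF u _ _ \<Phi> hom(1)[OF _ _ 1]])
  next
    case 2
    have nz: "\<alpha> \<noteq> 0" using 2 by simp
    have pos: "\<Phi> x > 0" if "x \<noteq> 0" for x using hom(3)[OF zero_less_one that nz] 2 by (simp add: zero_less_mult_iff)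
    show ?thesis
      by (rule power_classification[OF u \<Phi> pos nz hom(2)[OF _ _ nz] _ _ lt]) (use 2 L0 L1 in simp_all)
  next
    case 3
    interpret D: elliptic_operator_ge2 "dual_operator F" lam Lam by (rule dual_ge2)
    have nz: "\<alpha> \<noteq> 0" using 3 by simp
    have pos: "- \<Phi> x > 0" if "x \<noteq> 0" for x using hom(3)[OF zero_less_one that nz] 3 by (simp add: zero_less_mult_iff)
    have "\<exists>a>0. \<exists>b. \<forall>x. x \<noteq> 0 \<longrightarrow> - u x = a * - \<Phi> x + b"
    proof (rule D.power_classification[OF qsol_dual[OF u] qsol_dual[OF \<Phi>] pos nz])
      show "- \<Phi> (r *\<^sub>R x) = r powr (- \<alpha>) * - \<Phi> x" if "r > 0" "x \<noteq> 0" for r x using hom(2)[OF that nz] by simp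
      show "((\<lambda>x. ereal (- u x)) \<longlongrightarrow> - L0) (ending (sgn \<alpha>))" "((\<lambda>x. ereal (- u x)) \<longlongrightarrow> - L1) (ending (- sgn \<alpha>))"
        using tendsto_uminus_ereal[OF L0] tendsto_uminus_ereal[OF L1] 3 by simp_all
      show "- L0 < - L1" using lt by simp
    qed
    then obtain a b where ab: "a > 0" "\<And>x. x \<noteq> 0 \<Longrightarrow> - u x = a * - \<Phi> x + b" by blast
    have "u x = a * \<Phi> x + - b" if "x \<noteq> 0" for x using ab(2)[OF that] by simp
    then show ?thesis using ab(1) by blast
  qed
qed

lemma limit_at_end_one_sided:
  assumes s: "s = 1 \<or> s = -1" and u: "sol u"
    and bd: "eventually (\<lambda>x. B \<le> u x) (ending s) \<or> eventually (\<lambda>x. u x \<le> B) (ending s)"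
  shows "\<exists>L :: ereal. ((\<lambda>x. ereal (u x)) \<longlongrightarrow> L) (ending s)"
  using bd
proof
  assume "eventually (\<lambda>x. u x \<le> B) (ending s)"
  then have "eventually (\<lambda>x. - B \<le> - u x) (ending s)" by simp
  from elliptic_operator_ge2.limit_at_end[OF dual_ge2 s qsol_dual[OF u] this]
  obtain L :: ereal where "((\<lambda>x. ereal (- u x)) \<longlongrightarrow> L) (ending s)" by blast
  from tendsto_uminus_ereal[OF this] show ?thesis by auto
qed (rule limit_at_end[OF s u])

text \<open>Numbers above the common limit L bound u from above, numbers below L bound it from
  below. Of two different values of u one would lie strictly on one side of L, contradicting such a
  bound.\<close>

lemma equal_limits_constant:
  assumes u: "sol u" and L: "\<And>s. s = 1 \<or> s = -1 \<Longrightarrow> ((\<lambda>x. ereal (u x)) \<longlongrightarrow> L) (ending s)"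
  shows "\<exists>b. \<forall>x. x \<noteq> 0 \<longrightarrow> u x = b"
proof -
  have up: "u x \<le> r" if r: "L < ereal r" and x: "x \<noteq> 0" for r x
  proof -
    have "u x \<le> (\<lambda>_. 0) x + r"
    proof (rule two_ends_comparison[OF u qsol_const x])
      show "eventually (\<lambda>y. u y \<le> 0 + r) (ending s)" if "s = 1 \<or> s = -1" for s
        using order_tendstoD(2)[OF L[OF that] r] by eventually_elim simp
    qed
    then show ?thesis by simp
  qed
  have low: "r \<le> u x" if r: "ereal r < L" and x: "x \<noteq> 0" for r x
  proof -
    have "(\<lambda>_. r) x \<le> u x + 0"
    proof (rule two_ends_comparison[OF qsol_const u x])
      show "eventually (\<lambda>y. r \<le> u y + 0) (ending s)" if "s = 1 \<or> s = -1" for s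
        using order_tendstoD(1)[OF L[OF that] r] by eventually_elim simp
    qed
    then show ?thesis by simp
  qed
  have le: "u x \<le> u y" if x: "x \<noteq> 0" and y: "y \<noteq> 0" for x y
  proof (rule ccontr)
    assume lt: "\<not> u x \<le> u y"
    show False
    proof (cases "L < ereal (u x)")
      case True
      then obtain r where "L < ereal r" "ereal r < ereal (u x)" using ereal_dense2 by blast
      then show False using up[of r x] x by simp
    next
      case False
      then have "ereal (u y) < L" using lt by (metis ereal_less_eq(3) leI order_less_le_trans)
      then obtain r where "ereal (u y) < ereal r" "ereal r < L" using ereal_dense2 by blast
      then show False using low[of r y] y by simp
    qed
  qed
  obtain e :: "real^'n" where "norm e = 1" by (metis norm_axis_1)
  then have "e \<noteq> 0" by auto
  then have "u x = u e" if "x \<noteq> 0" for x using le[of x e] le[of e x] that by simp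
  then show ?thesis by blast
qed

end

theorem theorem4:
  fixes F :: "real^'n^'n \<Rightarrow> real"
    and \<Phi> \<Phi>' u :: "real^'n \<Rightarrow> real"
    and lam Lam :: real
  assumes "CARD('n) \<ge> 2"
    and "uniformly_elliptic lam Lam F"
    and "positively_homogeneous F"
    and "upward_fundamental_solution F \<Phi>"
    and "upward_fundamental_solution (dual_operator F) \<Phi>'"
    and "continuous_on (- {0}) u"
    and "viscosity_solution F (- {0}) u"
    and "bdd_above (u ` (ball 0 1 - {0})) \<or> bdd_below (u ` (ball 0 1 - {0}))"
    and "bdd_above (u ` (- ball 0 1)) \<or> bdd_below (u ` (- ball 0 1))"
  shows "\<exists>a>0. \<exists>b. (\<forall>x. x \<noteq> 0 \<longrightarrow> u x = b) \<or>
                   (\<forall>x. x \<noteq> 0 \<longrightarrow> u x = a * \<Phi> x + b) \<or>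
                   (\<forall>x. x \<noteq> 0 \<longrightarrow> u x = - a * \<Phi>' x + b)"
proof -
  note bounds = assms(8,9)
  interpret elliptic_operator_ge2 F lam Lam
    using assms(1-3) by unfold_locales
  interpret D: elliptic_operator_ge2 "dual_operator F" lam Lam by (rule dual_ge2)
  have solI: "qsol G (- {0}) f" if "continuous_on (- {0}) f" "viscosity_solution G (- {0}) f" for G :: "real^'n^'n \<Rightarrow> real" and f
    using that by (simp add: qsol_def viscosity_solution_def qsub_viscosity_subsolution qsub_viscosity_supersolution)
  have class_cont: "continuous_on (- {0}) f" if "f \<in> homogeneous_class \<alpha>" for f :: "real^'n \<Rightarrow> real" and \<alpha>
    using that by (auto simp: homogeneous_class_def split: if_splits)
  have u: "sol u" using assms(6,7) by (rule solI)
  obtain \<alpha> where \<Phi>: "\<Phi> \<in> homogeneous_class \<alpha>" "sol \<Phi>"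
    using assms(4) solI class_cont unfolding upward_fundamental_solution_def Let_def by blast
  obtain \<beta> where \<Phi>': "\<Phi>' \<in> homogeneous_class \<beta>" "D.sol \<Phi>'"
    using assms(5) solI class_cont unfolding upward_fundamental_solution_def Let_def by blast
  have one_sided: "\<exists>L :: ereal. ((\<lambda>x. ereal (u x)) \<longlongrightarrow> L) (ending s)"
    if s: "s = 1 \<or> s = -1" and bd: "bdd_above (u ` A) \<or> bdd_below (u ` A)" and A: "eventually (\<lambda>x. x \<in> A) (ending s)" for s A
  proof -
    from bd obtain B where "(\<forall>x\<in>A. B \<le> u x) \<or> (\<forall>x\<in>A. u x \<le> B)"
      unfolding bdd_above_def bdd_below_def by blast
    then have "eventually (\<lambda>x. B \<le> u x) (ending s) \<or> eventually (\<lambda>x. u x \<le> B) (ending s)"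
    proof
      assume "\<forall>x\<in>A. B \<le> u x"
      with A show ?thesis by (intro disjI1) (auto elim: eventually_mono)
    next
      assume "\<forall>x\<in>A. u x \<le> B"
      with A show ?thesis by (intro disjI2) (auto elim: eventually_mono)
    qed
    then show ?thesis by (rule limit_at_end_one_sided[OF s u])
  qed
  have "eventually (\<lambda>x::real^'n. x \<in> ball 0 1 - {0}) (ending (-1))"
    unfolding eventually_ending depth_def
  proof (intro exI allI impI)
    fix x :: "real^'n" assume x: "x \<noteq> 0" "1 \<le> -1 * ln (norm x)"
    then have "ln (norm x) < 0" by linarith
    then show "x \<in> ball 0 1 - {0}" using x(1) by simp
  qed
  from one_sided[OF _ bounds(1) this]
  obtain L0 where L0: "((\<lambda>x. ereal (u x)) \<longlongrightarrow> L0) (ending (-1))" by auto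
  have "eventually (\<lambda>x::real^'n. x \<in> - ball 0 1) (ending 1)"
    unfolding eventually_ending depth_def
  proof (intro exI allI impI)
    fix x :: "real^'n" assume x: "x \<noteq> 0" "0 \<le> 1 * ln (norm x)"
    then show "x \<in> - ball 0 1" by simp
  qed
  from one_sided[OF _ bounds(2) this]
  obtain L1 where L1: "((\<lambda>x. ereal (u x)) \<longlongrightarrow> L1) (ending 1)" by auto
  consider "L0 = L1" | "L1 < L0" | "L0 < L1" using less_linear by blast
  then show ?thesis
  proof cases
    case 1
    obtain b where "\<forall>x. x \<noteq> 0 \<longrightarrow> u x = b"
      using equal_limits_constant[OF u, of L0] L0 L1 1 by auto
    \<comment> \<open>The value 1 only fills the outer quantifier over a.\<close>
    then show ?thesis by (intro exI[of _ 1] conjI exI[of _ b]) auto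
  next
    case 2
    from classification[OF u \<Phi>(2,1) L0 L1 2] show ?thesis by blast
  next
    case 3
    \<comment> \<open>Passing to - u and the dual operator makes the limit at the origin the larger
      one.\<close>
    have "((\<lambda>x. ereal (- u x)) \<longlongrightarrow> - L0) (ending (-1))" "((\<lambda>x. ereal (- u x)) \<longlongrightarrow> - L1) (ending 1)" "- L1 < - L0"
      using tendsto_uminus_ereal[OF L0] tendsto_uminus_ereal[OF L1] 3 by simp_all
    from D.classification[OF qsol_dual[OF u] \<Phi>'(2,1) this]
    obtain a b where ab: "a > 0" "\<And>x. x \<noteq> 0 \<Longrightarrow> - u x = a * \<Phi>' x + b" by blast
    have "u x = - a * \<Phi>' x + - b" if "x \<noteq> 0" for x using ab(2)[OF that] by simp
    then show ?thesis using ab(1) by blast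
  qed
qed

end
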